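(* Let $\Omega\subset\mathbb{R}^N$ be a bounded $C^1$-domain and let $\mathcal{I}(u,x)=\int_{\mathbb{R}^N}[u(x+z)-u(x)]\,\nu_x(dz)$ satisfy assumptions (M0), (M1), (M2), (M3) of the context with the same $\sigma\in(0,1)$. Let $\varphi\in C(\partial\Omega)$ and let $H\in C(\bar\Omega\times\mathbb{R}\times\mathbb{R}^N)$ satisfy (H1) and (H2) of the context with $m>\sigma$. Consider the problem $$-\mathcal{I}(u)+H(x,u,Du)=0\ \text{in }\Omega,\qquad u=\varphi\ \text{on }\partial\Omega,\qquad( * )$$ and assume that one of the following holds: (i) there exists $\lambda_0>0$ such that $\lambda_R\ge\lambda_0$ for all $R>0$ (with $\lambda_R$ the constants in (H1)); (ii) for each $x\in\bar\Omega$ the function $(r,p)\mapsto H(x,r,p)$ is convex, and problem $( * )$ has a bounded strict subsolution. If $u,v$ are bounded and are respectively a viscosity subsolution and a viscosity supersolution to $( * )$, then $u\le v$ in $\Omega$. Moreover, if $\tilde u(x)=u(x)$ for $x\in\Omega$ and $\tilde u(x)=\limsup_{y\to x,\,y\in\Omega}u(y)$ for $x\in\partial\Omega$, then $\tilde u\le v$ in $\bar\Omega$. In this setting there exists a unique viscosity solution $u\in C(\bar\Omega)$ to $( * )$.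
   Context: Notation: $d(x)=\mathrm{dist}(x,\partial\Omega)$, $B_r(x)$ is the open ball, $B_r=B_r(0)$, $B_r^c$ its complement. "$C^1$-domain" means that the boundary is $C^1$, with the convention that there is $\delta_0>0$ such that $d$ is of class $C^1$ in $\{x\in\Omega:d(x)<\delta_0\}$. For each $x\in\bar\Omega$, $\nu_x$ is a nonnegative regular measure on $\mathbb{R}^N$. For $D\subset\mathbb{R}^N$, $\mathcal{I}[D](u,y)=\int_D[u(y+z)-u(y)]\nu_y(dz)$. (M0): (M0-1) $\bigcup_{x\in\bar\Omega}\{x+\mathrm{supp}\,\nu_x\}\subseteq\bar\Omega$. (M0-2) if $x\in\bar\Omega$, $r>0$ and $u\in L^\infty(\bar\Omega)$ is $C^1$ in $B_r(x)$ (i.e. in $B_r(x)\cap\bar\Omega$), then $\mathcal{I}(u,x)$ is well defined, and for any $D\subset\mathbb{R}^N$ the map $y\mapsto\mathcal{I}[D](u,y)$ is continuous in $B_r(x)$ (i.e. in $B_r(x)\cap\bar\Omega$). (M1): there is $C_1>0$ such that for all $\beta\in[0,2]$ and $\delta>0$, $\sup_{x\in\bar\Omega}\int_{B_\delta^c}\min\{1,|z|^\beta\}\nu_x(dz)\le C_1h_{\beta,\sigma}(\delta)$, where $h_{\beta,\sigma}(\delta)=\delta^{\beta-\sigma}$ if $\beta<\sigma$, $=|\ln\delta|+1$ if $\beta=\sigma$, $=1$ if $\beta>\sigma$ (convention $|z|^0=1$). (M2): there is $C_2>0$ such that for all $\beta\in(\sigma,2]$ and $\delta\in(0,1)$, $\sup_{x\in\bar\Omega}\int_{B_\delta}|z|^\beta\nu_x(dz)\le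 C_2\delta^{\beta-\sigma}$. (M3): for each $\beta>0$ there is a modulus of continuity $\omega_{\beta,\sigma}$ such that for all $x,y\in\bar\Omega$, $\delta>0$, $\int_{B_\delta^c}|z|^\beta|\nu_x(dz)-\nu_y(dz)|\le(1+h_{\beta,\sigma}(\delta))\,\omega_{\beta,\sigma}(|x-y|)$, where $|\nu_x-\nu_y|$ is the total variation measure. (H1): for all $R>0$ there is $\lambda_R\ge0$ such that $H(x,u,p)-H(x,v,p)\ge\lambda_R(u-v)$ for all $x\in\bar\Omega$, $p\in\mathbb{R}^N$, $u\ge v$ with $|u|,|v|\le R$. (H2) (with exponent $m$): there is $\underline c>0$ such that for each $R>0$ there is $C_R\ge0$ with $H(x,r,p)\ge\underline c|p|^m-C_R$ for all $x\in\bar\Omega$, $p\in\mathbb{R}^N$, $|r|\le R$. Viscosity solutions: put $\mathcal{E}_\delta(u,\phi,x)=-\mathcal{I}[B_\delta](\phi,x)-\mathcal{I}[B_\delta^c](u,x)+H(x,u(x),D\phi(x))$. An upper semicontinuous $u:\bar\Omega\to\mathbb{R}$ is a viscosity subsolution to $( * )$ if for each $\phi\in C^1(\bar\Omega)$ and each maximum point $x_0$ of $u-\phi$ on $\bar\Omega$, for all $\delta>0$: $\mathcal{E}_\delta(u,\phi,x_0)\le0$ if $x_0\in\Omega$; $\min\{\mathcal{E}_\delta(u,\phi,x_0),u(x_0)-\varphi(x_0)\}\le0$ if $x_0\in\partial\Omega$. Supersolutions are lower semicontinuous and satisfy the analogous conditions with minimum points, reversed inequalities and $\max$ in place of $\min$;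 a solution is both. A strict subsolution to $( * )$ is a viscosity subsolution of the problem obtained from $( * )$ by replacing the right-hand side $0$ of the equation by $-\eta$ for some constant $\eta>0$. *)

theory Defs
  imports "HOL-Analysis.Analysis"
begin

text \<open>
  Functions on a set such as \<open>closure \<Omega>\<close> are total HOL functions; every definition below
  depends only on their values on that set.
\<close>

text \<open>At boundary points of \<open>S\<close> the derivative is the one relative to \<open>S\<close>. For the relatively
  open subsets of the closure of a C1 domain used below, the gradient is thereby unique.\<close>
definition C1_with_gradient :: "'a::euclidean_space set \<Rightarrow> ('a \<Rightarrow> real) \<Rightarrow> ('a \<Rightarrow> 'a) \<Rightarrow> bool" where
  "C1_with_gradient S f Df \<longleftrightarrow>
     (\<forall>x\<in>S. (f has_derivative (\<lambda>h. Df x \<bullet> h)) (at x within S)) \<and> continuous_on S Df"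

definition C1_on :: "'a::euclidean_space set \<Rightarrow> ('a \<Rightarrow> real) \<Rightarrow> bool" where
  "C1_on S f \<longleftrightarrow> (\<exists>Df. C1_with_gradient S f Df)"

text \<open>Locally the set is a strict epigraph over the hyperplane orthogonal to a unit vector \<open>e\<close>;
  \<open>\<gamma>\<close> is only evaluated on that hyperplane.\<close>
definition C1_boundary :: "'a::euclidean_space set \<Rightarrow> bool" where
  "C1_boundary \<Omega> \<longleftrightarrow>
     (\<forall>x0\<in>frontier \<Omega>. \<exists>r>0. \<exists>e \<gamma>. norm e = 1 \<and> C1_on UNIV \<gamma> \<and>
        \<Omega> \<inter> ball x0 r = {x \<in> ball x0 r. x \<bullet> e > \<gamma> (x - (x \<bullet> e) *\<^sub>R e)})"

definition bounded_C1_domain :: "'a::euclidean_space set \<Rightarrow> bool" where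
  "bounded_C1_domain \<Omega> \<longleftrightarrow>
     open \<Omega> \<and> connected \<Omega> \<and> \<Omega> \<noteq> {} \<and> bounded \<Omega> \<and> C1_boundary \<Omega> \<and>
     (\<exists>\<delta>0>0. C1_on {x \<in> \<Omega>. infdist x (frontier \<Omega>) < \<delta>0} (\<lambda>x. infdist x (frontier \<Omega>)))"

definition usc_on :: "'a::topological_space set \<Rightarrow> ('a \<Rightarrow> real) \<Rightarrow> bool" where
  "usc_on S u \<longleftrightarrow> (\<forall>x\<in>S. \<forall>a>u x. \<forall>\<^sub>F y in at x within S. u y < a)"

definition lsc_on :: "'a::topological_space set \<Rightarrow> ('a \<Rightarrow> real) \<Rightarrow> bool" where
  "lsc_on S u \<longleftrightarrow> (\<forall>x\<in>S. \<forall>a<u x. \<forall>\<^sub>F y in at x within S. a < u y)"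

definition modulus_of_continuity :: "(real \<Rightarrow> real) \<Rightarrow> bool" where
  "modulus_of_continuity \<omega> \<longleftrightarrow>
     \<omega> 0 = 0 \<and> mono_on {0..} \<omega> \<and> (\<omega> \<longlongrightarrow> 0) (at_right 0)"

text \<open>The measures may have infinite mass near the origin, as for the density
  \<open>|z| powr (- N - \<sigma>)\<close>. Such a measure is not outer regular at the origin itself, so regularity
  is required away from it.\<close>
definition regular_off_origin :: "'a::euclidean_space measure \<Rightarrow> bool" where
  "regular_off_origin M \<longleftrightarrow> sets M = sets borel \<and>
     (\<forall>A\<in>sets borel. 0 \<notin> A \<longrightarrow>
        emeasure M A = (SUP K\<in>{K. K \<subseteq> A \<and> compact K}. emeasure M K) \<and>
        emeasure M A = (INF U\<in>{U. A \<subseteq> U \<and> open U}. emeasure M U))"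

definition measure_support :: "'a::topological_space measure \<Rightarrow> 'a set" where
  "measure_support M = {z. \<forall>U. open U \<and> z \<in> U \<longrightarrow> emeasure M U > 0}"

definition variation :: "'a measure \<Rightarrow> 'a measure \<Rightarrow> 'a set \<Rightarrow> ennreal" where
  "variation M N A =
     (SUP B\<in>{B :: nat \<Rightarrow> 'a set. range B \<subseteq> sets M \<and> disjoint_family B \<and> (\<Union>i. B i) = A}.
        \<Sum>i. ennreal \<bar>measure M (B i) - measure N (B i)\<bar>)"

text \<open>The total variation measure of \<open>M - N\<close>, for finite measures \<open>M\<close> and \<open>N\<close> on the same
  sigma-algebra.\<close>
definition tv_measure :: "'a measure \<Rightarrow> 'a measure \<Rightarrow> 'a measure" where
  "tv_measure M N = measure_of (space M) (sets M) (variation M N)"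

lemma sets_tv_measure [simp]: "sets (tv_measure M N) = sets M"
  by (simp add: tv_measure_def)

lemma space_tv_measure [simp]: "space (tv_measure M N) = space M"
  by (simp add: tv_measure_def space_measure_of_conv)

lemma variation_Hahn:
  assumes "finite_measure M" "finite_measure N" and sets_eq: "sets N = sets M"
  obtains P where "P \<in> sets M"
    "\<And>A. A \<in> sets M \<Longrightarrow> variation M N A =
      ennreal ((measure M (A \<inter> P) - measure N (A \<inter> P)) + (measure N (A - P) - measure M (A - P)))"
    "\<And>A. A \<in> sets M \<Longrightarrow> A \<subseteq> P \<Longrightarrow> measure N A \<le> measure M A"
    "\<And>A. A \<in> sets M \<Longrightarrow> A \<inter> P = {} \<Longrightarrow> measure M A \<le> measure N A"
proof -
  interpret M: finite_measure M by fact
  interpret N: finite_measure N by fact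
  obtain P where P: "P \<in> sets M"
    and "\<forall>X\<in>sets M. X \<subseteq> P \<longrightarrow> emeasure N X \<le> emeasure M X"
    and "\<forall>X\<in>sets M. X \<subseteq> space M \<longrightarrow> X \<inter> P = {} \<longrightarrow> emeasure M X \<le> emeasure N X"
    using unsigned_Hahn_decomposition[of N M "space M"] sets_eq
    by (metis M.emeasure_finite N.emeasure_finite sets.top)
  then have pos: "measure N A \<le> measure M A" if "A \<in> sets M" "A \<subseteq> P" for A
    using that by (simp add: M.emeasure_eq_measure N.emeasure_eq_measure)
  have neg: "measure M A \<le> measure N A" if "A \<in> sets M" "A \<inter> P = {}" for A
    using that \<open>\<forall>X\<in>sets M. X \<subseteq> space M \<longrightarrow> X \<inter> P = {} \<longrightarrow> emeasure M X \<le> emeasure N X\<close>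
      sets.sets_into_space[OF that(1)]
    by (simp add: M.emeasure_eq_measure N.emeasure_eq_measure)
  define T where "T A = (measure M (A \<inter> P) - measure N (A \<inter> P))
    + (measure N (A - P) - measure M (A - P))" for A
  have T_ge: "\<bar>measure M A - measure N A\<bar> \<le> T A" if A: "A \<in> sets M" for A
  proof -
    have "measure M A = measure M (A \<inter> P) + measure M (A - P)"
      using A P by (metis Diff_disjoint M.finite_measure_Union Int_Diff_Un Int_Diff_disjoint
        sets.Diff sets.Int)
    moreover have "measure N A = measure N (A \<inter> P) + measure N (A - P)"
      using A P sets_eq by (metis N.finite_measure_Union Int_Diff_Un Int_Diff_disjoint
        sets.Diff sets.Int)
    moreover have "measure N (A \<inter> P) \<le> measure M (A \<inter> P)"
      using A P by (intro pos) auto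
    moreover have "measure M (A - P) \<le> measure N (A - P)"
      using A P by (intro neg) auto
    ultimately show ?thesis
      unfolding T_def by linarith
  qed
  have T_sums: "(\<lambda>i. T (B i)) sums T (\<Union>i. B i)"
    if B: "range B \<subseteq> sets M" "disjoint_family B" for B :: "nat \<Rightarrow> _"
  proof -
    have d: "disjoint_family (\<lambda>i. B i \<inter> P)" "disjoint_family (\<lambda>i. B i - P)"
      using B(2) unfolding disjoint_family_on_def by blast+
    have r: "range (\<lambda>i. B i \<inter> P) \<subseteq> sets M" "range (\<lambda>i. B i - P) \<subseteq> sets M"
      using B(1) P by auto
    have eq: "(\<Union>i. B i) \<inter> P = (\<Union>i. B i \<inter> P)" "(\<Union>i. B i) - P = (\<Union>i. B i - P)"
      by auto
    show ?thesis
      unfolding T_def eq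
      by (intro sums_add sums_diff M.finite_measure_UNION N.finite_measure_UNION)
        (use d r sets_eq in auto)
  qed
  have T_nonneg: "0 \<le> T A" if "A \<in> sets M" for A
    using T_ge[OF that] by linarith
  have "variation M N A = ennreal (T A)" if A: "A \<in> sets M" for A
    unfolding variation_def
  proof (rule antisym[OF SUP_least])
    fix B :: "nat \<Rightarrow> 'a set"
    assume "B \<in> {B. range B \<subseteq> sets M \<and> disjoint_family B \<and> (\<Union>i. B i) = A}"
    then have B: "range B \<subseteq> sets M" "disjoint_family B" "(\<Union>i. B i) = A" by auto
    have "(\<Sum>i. ennreal \<bar>measure M (B i) - measure N (B i)\<bar>) \<le> (\<Sum>i. ennreal (T (B i)))"
      using B(1) by (intro suminf_le summableI ennreal_leI T_ge) auto
    also have "\<dots> = ennreal (T A)"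
      using T_sums[OF B(1,2)] B(1,3) T_nonneg
      by (metis rangeI subsetD sums_summable sums_unique suminf_ennreal2)
    finally show "(\<Sum>i. ennreal \<bar>measure M (B i) - measure N (B i)\<bar>) \<le> ennreal (T A)" .
  next
    define B where "B = (\<lambda>i::nat. if i = 0 then A \<inter> P else if i = 1 then A - P else {})"
    have B: "range B \<subseteq> sets M" "disjoint_family B" "(\<Union>i. B i) = A"
      using A P by (auto simp: B_def disjoint_family_on_def split: if_splits)
    have "(\<Sum>i. ennreal \<bar>measure M (B i) - measure N (B i)\<bar>) =
      (\<Sum>i\<in>{0,1}. ennreal \<bar>measure M (B i) - measure N (B i)\<bar>)"
      by (rule suminf_finite) (auto simp: B_def)
    also have "\<dots> = ennreal (T A)"
    proof -
      have "measure N (A \<inter> P) \<le> measure M (A \<inter> P)" "measure M (A - P) \<le> measure N (A - P)"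
        using A P by (auto intro!: pos neg)
      then show ?thesis
        by (simp add: B_def T_def abs_if flip: ennreal_plus)
    qed
    finally show "ennreal (T A) \<le>
      (SUP B\<in>{B. range B \<subseteq> sets M \<and> disjoint_family B \<and> (\<Union>i. B i) = A}.
        \<Sum>i. ennreal \<bar>measure M (B i) - measure N (B i)\<bar>)"
      using B by (intro SUP_upper2[of B]) auto
  qed
  with that[OF P] pos neg show thesis
    unfolding T_def by blast
qed

lemma emeasure_tv_measure:
  assumes "finite_measure M" "finite_measure N" "sets N = sets M" "A \<in> sets M"
  shows "emeasure (tv_measure M N) A = variation M N A"
proof -
  interpret M: finite_measure M by fact
  interpret N: finite_measure N by fact
  obtain P where P: "P \<in> sets M"
    and V: "\<And>A. A \<in> sets M \<Longrightarrow> variation M N A =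
      ennreal ((measure M (A \<inter> P) - measure N (A \<inter> P)) + (measure N (A - P) - measure M (A - P)))"
    and pos: "\<And>A. A \<in> sets M \<Longrightarrow> A \<subseteq> P \<Longrightarrow> measure N A \<le> measure M A"
    and neg: "\<And>A. A \<in> sets M \<Longrightarrow> A \<inter> P = {} \<Longrightarrow> measure M A \<le> measure N A"
    using variation_Hahn[OF assms(1-3)] by blast
  have "countably_additive (sets M) (variation M N)"
  proof (rule countably_additiveI)
    fix B :: "nat \<Rightarrow> 'a set"
    assume B: "range B \<subseteq> sets M" "disjoint_family B" "(\<Union>i. B i) \<in> sets M"
    have d: "disjoint_family (\<lambda>i. B i \<inter> P)" "disjoint_family (\<lambda>i. B i - P)"
      using B(2) unfolding disjoint_family_on_def by blast+
    have r: "range (\<lambda>i. B i \<inter> P) \<subseteq> sets M" "range (\<lambda>i. B i - P) \<subseteq> sets M"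
      using B(1) P by auto
    have eq: "(\<Union>i. B i) \<inter> P = (\<Union>i. B i \<inter> P)" "(\<Union>i. B i) - P = (\<Union>i. B i - P)"
      by auto
    have s: "(\<lambda>i. (measure M (B i \<inter> P) - measure N (B i \<inter> P))
        + (measure N (B i - P) - measure M (B i - P))) sums
      ((measure M ((\<Union>i. B i) \<inter> P) - measure N ((\<Union>i. B i) \<inter> P))
        + (measure N ((\<Union>i. B i) - P) - measure M ((\<Union>i. B i) - P)))"
      unfolding eq
      by (intro sums_add sums_diff M.finite_measure_UNION N.finite_measure_UNION)
        (use d r assms(3) in auto)
    have nn: "0 \<le> (measure M (B i \<inter> P) - measure N (B i \<inter> P))
        + (measure N (B i - P) - measure M (B i - P))" for i
    proof -
      have "measure N (B i \<inter> P) \<le> measure M (B i \<inter> P)"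
        using r by (intro pos) auto
      moreover have "measure M (B i - P) \<le> measure N (B i - P)"
        using r by (intro neg) auto
      ultimately show ?thesis by linarith
    qed
    have "(\<Sum>i. variation M N (B i)) = (\<Sum>i. ennreal ((measure M (B i \<inter> P) - measure N (B i \<inter> P))
        + (measure N (B i - P) - measure M (B i - P))))"
      using B(1) by (intro suminf_cong V) auto
    also have "\<dots> = variation M N (\<Union>i. B i)"
      unfolding V[OF B(3)] suminf_ennreal2[OF nn sums_summable[OF s]]
      using sums_unique[OF s] by simp
    finally show "(\<Sum>i. variation M N (B i)) = variation M N (\<Union>i. B i)" .
  qed
  moreover have "positive (sets M) (variation M N)"
    by (simp add: positive_def V)
  ultimately show ?thesis
    unfolding tv_measure_def
    using assms(4) by (intro emeasure_measure_of_sigma sets.sigma_algebra_axioms) auto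
qed

text \<open>\<open>nonlocal_op \<Omega> \<nu> D u y\<close> is the integral of \<open>u (y + z) - u y\<close> over \<open>z \<in> D\<close> against \<open>\<nu> y\<close>.
  Under \<open>M0_1\<close>, almost every \<open>z\<close> has \<open>y + z \<in> closure \<Omega>\<close>, so the restriction of the integration
  domain does not change the integral; it makes it independent of the values of \<open>u\<close> off
  \<open>closure \<Omega>\<close>.\<close>
definition jump_set :: "'a::euclidean_space set \<Rightarrow> 'a set \<Rightarrow> 'a \<Rightarrow> 'a set" where
  "jump_set \<Omega> D y = {z \<in> D. y + z \<in> closure \<Omega>}"

definition nonlocal_op ::
  "'a::euclidean_space set \<Rightarrow> ('a \<Rightarrow> 'a measure) \<Rightarrow> 'a set \<Rightarrow> ('a \<Rightarrow> real) \<Rightarrow> 'a \<Rightarrow> real" where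
  "nonlocal_op \<Omega> \<nu> D u y = (LINT z:jump_set \<Omega> D y|\<nu> y. u (y + z) - u y)"

definition nonlocal_op_defined ::
  "'a::euclidean_space set \<Rightarrow> ('a \<Rightarrow> 'a measure) \<Rightarrow> 'a set \<Rightarrow> ('a \<Rightarrow> real) \<Rightarrow> 'a \<Rightarrow> bool" where
  "nonlocal_op_defined \<Omega> \<nu> D u y \<longleftrightarrow>
     set_integrable (\<nu> y) (jump_set \<Omega> D y) (\<lambda>z. u (y + z) - u y)"

definition M0_1 :: "'a::euclidean_space set \<Rightarrow> ('a \<Rightarrow> 'a measure) \<Rightarrow> bool" where
  "M0_1 \<Omega> \<nu> \<longleftrightarrow> (\<Union>x\<in>closure \<Omega>. (\<lambda>z. x + z) ` measure_support (\<nu> x)) \<subseteq> closure \<Omega>"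

text \<open>Bounded functions are Borel and defined everywhere on \<open>closure \<Omega>\<close>, since the measures need
  not be absolutely continuous.\<close>
definition M0_2 :: "'a::euclidean_space set \<Rightarrow> ('a \<Rightarrow> 'a measure) \<Rightarrow> bool" where
  "M0_2 \<Omega> \<nu> \<longleftrightarrow>
     (\<forall>x\<in>closure \<Omega>. \<forall>r>0. \<forall>u.
        u \<in> borel_measurable (restrict_space borel (closure \<Omega>)) \<and> bounded (u ` closure \<Omega>) \<and>
        C1_on (ball x r \<inter> closure \<Omega>) u \<longrightarrow>
        nonlocal_op_defined \<Omega> \<nu> UNIV u x \<and>
        (\<forall>D\<in>sets borel. continuous_on (ball x r \<inter> closure \<Omega>) (\<lambda>y. nonlocal_op \<Omega> \<nu> D u y)))"

definition M0 :: "'a::euclidean_space set \<Rightarrow> ('a \<Rightarrow> 'a measure) \<Rightarrow> bool" where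
  "M0 \<Omega> \<nu> \<longleftrightarrow> M0_1 \<Omega> \<nu> \<and> M0_2 \<Omega> \<nu>"

definition h_growth :: "real \<Rightarrow> real \<Rightarrow> real \<Rightarrow> real" where
  "h_growth \<beta> \<sigma> \<delta> =
     (if \<beta> < \<sigma> then \<delta> powr (\<beta> - \<sigma>) else if \<beta> = \<sigma> then \<bar>ln \<delta>\<bar> + 1 else 1)"

text \<open>The origin is outside the integration domain, so \<open>norm z powr 0 = 1\<close> there.\<close>
definition M1 :: "'a::euclidean_space set \<Rightarrow> ('a \<Rightarrow> 'a measure) \<Rightarrow> real \<Rightarrow> bool" where
  "M1 \<Omega> \<nu> \<sigma> \<longleftrightarrow>
     (\<exists>C1>0. \<forall>\<beta>\<in>{0..2}. \<forall>\<delta>>0.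
        (SUP x\<in>closure \<Omega>. \<integral>\<^sup>+z\<in>- ball 0 \<delta>. ennreal (min 1 (norm z powr \<beta>)) \<partial>\<nu> x)
          \<le> ennreal (C1 * h_growth \<beta> \<sigma> \<delta>))"

definition M2 :: "'a::euclidean_space set \<Rightarrow> ('a \<Rightarrow> 'a measure) \<Rightarrow> real \<Rightarrow> bool" where
  "M2 \<Omega> \<nu> \<sigma> \<longleftrightarrow>
     (\<exists>C2>0. \<forall>\<beta>\<in>{\<sigma><..2}. \<forall>\<delta>\<in>{0<..<1}.
        (SUP x\<in>closure \<Omega>. \<integral>\<^sup>+z\<in>ball 0 \<delta>. ennreal (norm z powr \<beta>) \<partial>\<nu> x)
          \<le> ennreal (C2 * \<delta> powr (\<beta> - \<sigma>)))"

text \<open>Only the restrictions of \<open>\<nu> x\<close> and \<open>\<nu> y\<close> to the complement of a ball are finite, so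
  the total variation is taken after restricting.\<close>
definition M3 :: "'a::euclidean_space set \<Rightarrow> ('a \<Rightarrow> 'a measure) \<Rightarrow> real \<Rightarrow> bool" where
  "M3 \<Omega> \<nu> \<sigma> \<longleftrightarrow>
     (\<forall>\<beta>>0. \<exists>\<omega>. modulus_of_continuity \<omega> \<and>
        (\<forall>x\<in>closure \<Omega>. \<forall>y\<in>closure \<Omega>. \<forall>\<delta>>0.
           (\<integral>\<^sup>+z. ennreal (norm z powr \<beta>)
              \<partial>tv_measure (restrict_space (\<nu> x) (- ball 0 \<delta>)) (restrict_space (\<nu> y) (- ball 0 \<delta>)))
             \<le> ennreal ((1 + h_growth \<beta> \<sigma> \<delta>) * \<omega> (dist x y))))"

text \<open>The constants \<open>lam R\<close> are a parameter because further conditions are imposed on them.\<close>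
definition H1 ::
  "'a::euclidean_space set \<Rightarrow> ('a \<Rightarrow> real \<Rightarrow> 'a \<Rightarrow> real) \<Rightarrow> (real \<Rightarrow> real) \<Rightarrow> bool" where
  "H1 \<Omega> H lam \<longleftrightarrow>
     (\<forall>R>0. lam R \<ge> 0 \<and>
        (\<forall>x\<in>closure \<Omega>. \<forall>p u v. u \<ge> v \<and> \<bar>u\<bar> \<le> R \<and> \<bar>v\<bar> \<le> R \<longrightarrow>
           H x u p - H x v p \<ge> lam R * (u - v)))"

definition H2 ::
  "'a::euclidean_space set \<Rightarrow> ('a \<Rightarrow> real \<Rightarrow> 'a \<Rightarrow> real) \<Rightarrow> real \<Rightarrow> bool" where
  "H2 \<Omega> H m \<longleftrightarrow>
     (\<exists>c>0. \<forall>R>0. \<exists>C\<ge>0. \<forall>x\<in>closure \<Omega>. \<forall>p r. \<bar>r\<bar> \<le> R \<longrightarrow>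
        H x r p \<ge> c * norm p powr m - C)"

definition visc_E ::
  "'a::euclidean_space set \<Rightarrow> ('a \<Rightarrow> 'a measure) \<Rightarrow> ('a \<Rightarrow> real \<Rightarrow> 'a \<Rightarrow> real) \<Rightarrow>
   real \<Rightarrow> ('a \<Rightarrow> real) \<Rightarrow> ('a \<Rightarrow> real) \<Rightarrow> ('a \<Rightarrow> 'a) \<Rightarrow> 'a \<Rightarrow> real" where
  "visc_E \<Omega> \<nu> H \<delta> u \<phi> D\<phi> x =
     - nonlocal_op \<Omega> \<nu> (ball 0 \<delta>) \<phi> x - nonlocal_op \<Omega> \<nu> (- ball 0 \<delta>) u x + H x (u x) (D\<phi> x)"

text \<open>Viscosity sub- and supersolutions of \<open>- I(u) + H(x, u, Du) = c\<close> in \<open>\<Omega>\<close>, \<open>u = g\<close> on the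
  boundary. They are meant for functions bounded on \<open>closure \<Omega>\<close>, for which the integrals in
  \<open>visc_E\<close> exist under \<open>M1\<close> and \<open>M2\<close>.\<close>
definition visc_subsolution ::
  "'a::euclidean_space set \<Rightarrow> ('a \<Rightarrow> 'a measure) \<Rightarrow> ('a \<Rightarrow> real \<Rightarrow> 'a \<Rightarrow> real) \<Rightarrow>
   ('a \<Rightarrow> real) \<Rightarrow> real \<Rightarrow> ('a \<Rightarrow> real) \<Rightarrow> bool" where
  "visc_subsolution \<Omega> \<nu> H g c u \<longleftrightarrow>
     usc_on (closure \<Omega>) u \<and>
     (\<forall>\<phi> D\<phi>. C1_with_gradient (closure \<Omega>) \<phi> D\<phi> \<longrightarrow>
        (\<forall>x0\<in>closure \<Omega>. (\<forall>y\<in>closure \<Omega>. u y - \<phi> y \<le> u x0 - \<phi> x0) \<longrightarrow>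
           (\<forall>\<delta>>0.
              (x0 \<in> \<Omega> \<longrightarrow> visc_E \<Omega> \<nu> H \<delta> u \<phi> D\<phi> x0 - c \<le> 0) \<and>
              (x0 \<in> frontier \<Omega> \<longrightarrow> min (visc_E \<Omega> \<nu> H \<delta> u \<phi> D\<phi> x0 - c) (u x0 - g x0) \<le> 0))))"

definition visc_supersolution ::
  "'a::euclidean_space set \<Rightarrow> ('a \<Rightarrow> 'a measure) \<Rightarrow> ('a \<Rightarrow> real \<Rightarrow> 'a \<Rightarrow> real) \<Rightarrow>
   ('a \<Rightarrow> real) \<Rightarrow> real \<Rightarrow> ('a \<Rightarrow> real) \<Rightarrow> bool" where
  "visc_supersolution \<Omega> \<nu> H g c u \<longleftrightarrow>
     lsc_on (closure \<Omega>) u \<and>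
     (\<forall>\<phi> D\<phi>. C1_with_gradient (closure \<Omega>) \<phi> D\<phi> \<longrightarrow>
        (\<forall>x0\<in>closure \<Omega>. (\<forall>y\<in>closure \<Omega>. u y - \<phi> y \<ge> u x0 - \<phi> x0) \<longrightarrow>
           (\<forall>\<delta>>0.
              (x0 \<in> \<Omega> \<longrightarrow> visc_E \<Omega> \<nu> H \<delta> u \<phi> D\<phi> x0 - c \<ge> 0) \<and>
              (x0 \<in> frontier \<Omega> \<longrightarrow> max (visc_E \<Omega> \<nu> H \<delta> u \<phi> D\<phi> x0 - c) (u x0 - g x0) \<ge> 0))))"

definition visc_solution ::
  "'a::euclidean_space set \<Rightarrow> ('a \<Rightarrow> 'a measure) \<Rightarrow> ('a \<Rightarrow> real \<Rightarrow> 'a \<Rightarrow> real) \<Rightarrow>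
   ('a \<Rightarrow> real) \<Rightarrow> real \<Rightarrow> ('a \<Rightarrow> real) \<Rightarrow> bool" where
  "visc_solution \<Omega> \<nu> H g c u \<longleftrightarrow>
     visc_subsolution \<Omega> \<nu> H g c u \<and> visc_supersolution \<Omega> \<nu> H g c u"

definition strict_visc_subsolution ::
  "'a::euclidean_space set \<Rightarrow> ('a \<Rightarrow> 'a measure) \<Rightarrow> ('a \<Rightarrow> real \<Rightarrow> 'a \<Rightarrow> real) \<Rightarrow>
   ('a \<Rightarrow> real) \<Rightarrow> ('a \<Rightarrow> real) \<Rightarrow> bool" where
  "strict_visc_subsolution \<Omega> \<nu> H g u \<longleftrightarrow> (\<exists>\<eta>>0. visc_subsolution \<Omega> \<nu> H g (- \<eta>) u)"

definition interior_limsup_ext :: "'a::euclidean_space set \<Rightarrow> ('a \<Rightarrow> real) \<Rightarrow> 'a \<Rightarrow> ereal" where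
  "interior_limsup_ext \<Omega> u x =
     (if x \<in> \<Omega> then ereal (u x) else Limsup (at x within \<Omega>) (\<lambda>y. ereal (u y)))"

end

theory Submission
  imports Defs
begin

text \<open>
  Since \<open>m > \<sigma>\<close>, a subsolution cannot be touched from above by steep functions: at slope \<open>L\<close> the
  Hamiltonian is of order \<open>L powr m\<close>, while the nonlocal term is at most of order \<open>L powr \<sigma>\<close>. At
  boundary points this gives \<open>u \<le> g\<close>. In the interior it gives a Lipschitz bound on small balls
  that blows up at the boundary; integrated along paths it is a Hoelder bound, which improves the
  estimate of the nonlocal term, and finitely many rounds make \<open>u\<close> Lipschitz on \<open>\<Omega>\<close> with a constant
  depending only on the bound of \<open>\<bar>u\<bar>\<close>.

  Continuity of the nonlocal terms of indicator functions (\<open>M0_2\<close>) and of \<open>\<nu>\<close> in total variation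
  (\<open>M3\<close>) force \<open>\<nu> x\<close> not to charge the boundary, which is a Lebesgue null set. Hence \<open>u\<close> may be
  replaced by the Lipschitz extension of its restriction to \<open>\<Omega>\<close>.

  Comparison doubles variables with the penalty \<open>L * sqrt (\<mu>\<^sup>2 + norm (x - y - \<xi>) ^ 2)\<close>, where \<open>\<xi>\<close>
  points into \<open>\<Omega>\<close>. Its slope stays bounded, so mere continuity of \<open>H\<close> suffices, and as \<open>L\<close> exceeds
  the Lipschitz constant of the subsolution, \<open>x - y\<close> stays close to \<open>\<xi>\<close> and \<open>x\<close> stays in \<open>\<Omega>\<close>.
  Strictness comes from subtracting a constant in case (i), and from a convex combination with the
  strict subsolution in case (ii). Existence is Perron's method among continuous subsolutions, which
  are equi-Lipschitz.
\<close>

section \<open>Total variation of finite measures\<close>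


text \<open>The rounds gain by the following balance. If subsolutions are Hoelder with exponent
  \<open>\<gamma>\<close>, long jumps contribute order \<open>t powr (\<gamma> - \<sigma>)\<close>
  on a ball of radius \<open>t\<close>, so coercivity leaves slopes of order
  \<open>t powr ((\<gamma> - \<sigma>) / m)\<close>. Integrated up to the boundary, this gives the
  exponent \<open>1 - (\<sigma> - \<gamma>) / m\<close>. It exceeds \<open>\<gamma>\<close> at
  \<open>\<gamma> = 0\<close> because \<open>m > \<sigma>\<close>, at
  \<open>\<gamma> = \<sigma>\<close> because \<open>\<sigma> < 1\<close>, and hence in between. The
  value \<open>\<gamma> = \<sigma>\<close>, where \<open>h_growth\<close> is logarithmic, has to be
  stepped over.

  Comparison is shaped by an asymmetry: subsolutions lie below \<open>g\<close> on the boundary,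
  while supersolutions may be below \<open>g\<close> there too. A maximum of \<open>U - v\<close>
  can thus sit on the boundary, where \<open>v < U \<le> g\<close> gives the equation for
  \<open>v\<close> but nothing gives it for \<open>U\<close>. The shift \<open>\<xi>\<close>
  therefore has to bring the point of \<open>U\<close> inside even when the point of
  \<open>v\<close> stays on the boundary.

  Perron's method starts between barriers: constants in case (i); in case (ii) the strict
  subsolution from below and an exponential from above. The latter needs linear growth of
  \<open>H\<close> in the gradient, which convexity supplies even if \<open>m < 1\<close>.\<close>

lemma nn_integral_le_add_measure:
  assumes sets: "sets N = sets M" "sets V = sets M"
    and le: "\<And>A. A \<in> sets M \<Longrightarrow> emeasure M A \<le> emeasure N A + emeasure V A"
  shows "(\<integral>\<^sup>+z. f z \<partial>M) \<le> (\<integral>\<^sup>+z. f z \<partial>N) + (\<integral>\<^sup>+z. f z \<partial>V)"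
  unfolding nn_integral_def[of M]
proof (rule SUP_least)
  fix s assume "s \<in> {s. simple_function M s \<and> s \<le> f}"
  then have s: "simple_function M s" "\<And>z. s z \<le> f z" by (auto simp: le_fun_def)
  have sp: "space N = space M" "space V = space M"
    using sets sets_eq_imp_space_eq by blast+
  have sN: "simple_function N s" and sV: "simple_function V s"
    using s(1) sp sets by (auto simp: simple_function_def)
  have "integral\<^sup>S M s \<le> (\<Sum>x\<in>s ` space M.
      x * (emeasure N (s -` {x} \<inter> space M) + emeasure V (s -` {x} \<inter> space M)))"
    unfolding simple_integral_def
    by (intro sum_mono mult_left_mono le simple_functionD(2)[OF s(1)]) auto
  also have "\<dots> = integral\<^sup>S N s + integral\<^sup>S V s"
    by (simp add: simple_integral_def sp distrib_left sum.distrib)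
  also have "\<dots> = (\<integral>\<^sup>+z. s z \<partial>N) + (\<integral>\<^sup>+z. s z \<partial>V)"
    by (simp add: nn_integral_eq_simple_integral sN sV)
  also have "\<dots> \<le> (\<integral>\<^sup>+z. f z \<partial>N) + (\<integral>\<^sup>+z. f z \<partial>V)"
    by (intro add_mono nn_integral_mono s)
  finally show "integral\<^sup>S M s \<le> (\<integral>\<^sup>+z. f z \<partial>N) + (\<integral>\<^sup>+z. f z \<partial>V)" .
qed

lemma emeasure_le_add_tv_measure:
  assumes fin: "finite_measure M" "finite_measure N" and sets: "sets N = sets M" and A: "A \<in> sets M"
  shows "emeasure M A \<le> emeasure N A + emeasure (tv_measure M N) A"
    and "emeasure N A \<le> emeasure M A + emeasure (tv_measure M N) A"
proof -
  interpret M: finite_measure M by fact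
  interpret N: finite_measure N by fact
  \<comment> \<open>The trivial partition of \<open>A\<close> is one competitor in the supremum that
    defines the variation.\<close>
  let ?B = "\<lambda>i::nat. if i = 0 then A else {}"
  have "ennreal \<bar>measure M A - measure N A\<bar> = (\<Sum>i. ennreal \<bar>measure M (?B i) - measure N (?B i)\<bar>)"
    by (subst suminf_finite[of "{0}"]) auto
  also have "\<dots> \<le> variation M N A"
    unfolding variation_def using A
    by (intro SUP_upper) (auto simp: disjoint_family_on_def split: if_splits)
  also have "\<dots> = emeasure (tv_measure M N) A"
    using emeasure_tv_measure[OF fin sets A] by simp
  finally have V: "ennreal \<bar>measure M A - measure N A\<bar> \<le> emeasure (tv_measure M N) A" .
  have "ennreal (measure M A) \<le> ennreal (measure N A) + ennreal \<bar>measure M A - measure N A\<bar>"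
    "ennreal (measure N A) \<le> ennreal (measure M A) + ennreal \<bar>measure M A - measure N A\<bar>"
    by (auto simp flip: ennreal_plus intro!: ennreal_leI)
  with V show "emeasure M A \<le> emeasure N A + emeasure (tv_measure M N) A"
    "emeasure N A \<le> emeasure M A + emeasure (tv_measure M N) A"
    unfolding M.emeasure_eq_measure N.emeasure_eq_measure
    by (meson add_left_mono order_trans)+
qed

text \<open>Adding \<open>B\<close> makes \<open>f\<close> nonnegative with values at most
  \<open>2 * B\<close>, which costs \<open>2 * B * v\<close>; removing \<open>B\<close> again
  compares the total masses and costs another \<open>B * v\<close>. Hence the factor 3.\<close>

lemma integral_diff_le_tv_measure:
  fixes f :: "'a \<Rightarrow> real"
  assumes fin: "finite_measure M" "finite_measure N" and sets: "sets N = sets M"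
    and f: "f \<in> borel_measurable M" "\<And>z. z \<in> space M \<Longrightarrow> \<bar>f z\<bar> \<le> B"
    and v: "emeasure (tv_measure M N) (space M) \<le> ennreal v" "0 \<le> v" and B: "0 \<le> B"
  shows "\<bar>integral\<^sup>L M f - integral\<^sup>L N f\<bar> \<le> 3 * B * v"
proof -
  interpret M: finite_measure M by fact
  interpret N: finite_measure N by fact
  let ?V = "tv_measure M N"
  have sp: "space N = space M" using sets sets_eq_imp_space_eq by blast
  have fN: "f \<in> borel_measurable N" using f(1) sets measurable_cong_sets by blast
  have iM: "integrable M f" and iN: "integrable N f"
    using f fN sp by (auto intro!: M.integrable_const_bound[of _ B] N.integrable_const_bound[of _ B])
  have nnV: "(\<integral>\<^sup>+z. ennreal (f z + B) \<partial>?V) \<le> ennreal (2 * B * v)"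
  proof -
    have "(\<integral>\<^sup>+z. ennreal (f z + B) \<partial>?V) \<le> (\<integral>\<^sup>+z. ennreal (2 * B) \<partial>?V)"
      using f(2) by (intro nn_integral_mono ennreal_leI) (force simp: abs_le_iff)
    also have "\<dots> \<le> ennreal (2 * B) * ennreal v"
      using v(1) by (simp add: mult_left_mono)
    finally show ?thesis using B v by (simp add: ennreal_mult)
  qed
  have nn: "0 \<le> f z + B" if "z \<in> space M" for z
    using f(2)[OF that] by linarith
  have ae: "AE z in M. 0 \<le> f z + B" "AE z in N. 0 \<le> f z + B"
    using nn sp by (auto intro!: AE_I2)
  have eq: "(\<integral>\<^sup>+z. ennreal (f z + B) \<partial>M) = ennreal (integral\<^sup>L M f + B * measure M (space M))"
    "(\<integral>\<^sup>+z. ennreal (f z + B) \<partial>N) = ennreal (integral\<^sup>L N f + B * measure N (space M))"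
    using ae iM iN sp by (simp_all add: nn_integral_eq_integral mult.commute)
  have pos: "0 \<le> integral\<^sup>L M f + B * measure M (space M)" "0 \<le> integral\<^sup>L N f + B * measure N (space M)"
  proof -
    have "0 \<le> integral\<^sup>L M (\<lambda>z. f z + B)" "0 \<le> integral\<^sup>L N (\<lambda>z. f z + B)"
      using nn sp by (auto intro!: integral_nonneg_AE AE_I2)
    then show "0 \<le> integral\<^sup>L M f + B * measure M (space M)" "0 \<le> integral\<^sup>L N f + B * measure N (space M)"
      using iM iN sp by (simp_all add: mult.commute)
  qed
  have "ennreal (integral\<^sup>L M f + B * measure M (space M)) \<le>
      ennreal (integral\<^sup>L N f + B * measure N (space M)) + ennreal (2 * B * v)"
    unfolding eq[symmetric]
    by (rule order_trans[OF nn_integral_le_add_measure[OF sets, of ?V]])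
      (auto intro: emeasure_le_add_tv_measure[OF fin sets] add_left_mono nnV)
  then have 1: "integral\<^sup>L M f + B * measure M (space M) \<le> integral\<^sup>L N f + B * measure N (space M) + 2 * B * v"
    using pos B v by (simp flip: ennreal_plus)
  have "ennreal (integral\<^sup>L N f + B * measure N (space M)) \<le>
      ennreal (integral\<^sup>L M f + B * measure M (space M)) + ennreal (2 * B * v)"
    unfolding eq[symmetric]
    by (rule order_trans[OF nn_integral_le_add_measure[of M N ?V]])
      (auto simp: sets intro: emeasure_le_add_tv_measure[OF fin sets] add_left_mono nnV)
  then have 2: "integral\<^sup>L N f + B * measure N (space M) \<le> integral\<^sup>L M f + B * measure M (space M) + 2 * B * v"
    using pos B v by (simp flip: ennreal_plus)
  have "ennreal (measure M (space M)) \<le> ennreal (measure N (space M)) + ennreal v"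
    "ennreal (measure N (space M)) \<le> ennreal (measure M (space M)) + ennreal v"
    using emeasure_le_add_tv_measure[OF fin sets, of "space M"] v(1)
    unfolding M.emeasure_eq_measure N.emeasure_eq_measure
    by (meson add_left_mono order_trans sets.top)+
  then have "\<bar>measure M (space M) - measure N (space M)\<bar> \<le> v"
    using v(2) by (simp add: abs_le_iff flip: ennreal_plus)
  then have "B * \<bar>measure M (space M) - measure N (space M)\<bar> \<le> B * v"
    using B by (rule mult_left_mono)
  then have "\<bar>B * measure M (space M) - B * measure N (space M)\<bar> \<le> B * v"
    using B by (metis abs_mult abs_of_nonneg right_diff_distrib')
  with 1 2 show ?thesis by linarith
qed

section \<open>The domain and its boundary charts\<close>


lemma C1_with_gradient_subset:
  "C1_with_gradient S f Df \<Longrightarrow> T \<subseteq> S \<Longrightarrow> C1_with_gradient T f Df"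
  unfolding C1_with_gradient_def
  by (meson continuous_on_subset has_derivative_subset subsetD)

lemma C1_with_gradient_continuous_on: "C1_with_gradient S f Df \<Longrightarrow> continuous_on S f"
  unfolding C1_with_gradient_def continuous_on_eq_continuous_within
  using has_derivative_continuous by blast

text \<open>\<open>\<rho>\<close> is the height above the boundary graph in direction
  \<open>e\<close>. It grows at unit rate along \<open>e\<close>, so its gradient has norm at least
  1 everywhere: \<open>k * \<rho>\<close> is a test function of slope at least \<open>k\<close> that
  vanishes on the boundary near \<open>x0\<close>.\<close>

lemma boundary_chart:
  fixes \<Omega> :: "'a::euclidean_space set"
  assumes "C1_boundary \<Omega>" and opn: "open \<Omega>" and x0: "x0 \<in> frontier \<Omega>"
  obtains r e \<rho> D\<rho> where "r > 0" "norm e = 1" "C1_with_gradient UNIV \<rho> D\<rho>"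
    "\<And>x. D\<rho> x \<bullet> e = 1" "\<And>x t. \<rho> (x + t *\<^sub>R e) = \<rho> x + t"
    "\<And>x. x \<in> ball x0 r \<Longrightarrow> x \<in> \<Omega> \<longleftrightarrow> \<rho> x > 0"
    "\<And>x. x \<in> ball x0 r \<Longrightarrow> x \<in> frontier \<Omega> \<longleftrightarrow> \<rho> x = 0"
proof -
  obtain r e \<gamma> where r: "r > 0" and e: "norm e = 1" and "C1_on UNIV \<gamma>"
    and epi: "\<Omega> \<inter> ball x0 r = {x \<in> ball x0 r. x \<bullet> e > \<gamma> (x - (x \<bullet> e) *\<^sub>R e)}"
    using assms(1) x0 unfolding C1_boundary_def by blast
  then obtain D\<gamma> where D\<gamma>: "C1_with_gradient UNIV \<gamma> D\<gamma>" unfolding C1_on_def by blast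
  have ee: "e \<bullet> e = 1" using e by (simp add: norm_eq_1)
  define \<pi> where "\<pi> = (\<lambda>x::'a. x - (x \<bullet> e) *\<^sub>R e)"
  define \<rho> where "\<rho> = (\<lambda>x. x \<bullet> e - \<gamma> (\<pi> x))"
  define D\<rho> where "D\<rho> = (\<lambda>x. e - (D\<gamma> (\<pi> x) - (D\<gamma> (\<pi> x) \<bullet> e) *\<^sub>R e))"
  have blpi: "bounded_linear \<pi>"
    unfolding \<pi>_def by (intro bounded_linear_intros)
  have dg: "(\<gamma> has_derivative (\<lambda>h. D\<gamma> y \<bullet> h)) (at y)" for y
    using D\<gamma> unfolding C1_with_gradient_def by simp
  have d\<rho>: "(\<rho> has_derivative (\<lambda>h. D\<rho> x \<bullet> h)) (at x)" for x
  proof -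
    have "(\<rho> has_derivative (\<lambda>h. h \<bullet> e - D\<gamma> (\<pi> x) \<bullet> \<pi> h)) (at x)"
      unfolding \<rho>_def
      by (intro has_derivative_diff has_derivative_inner_left has_derivative_ident
          has_derivative_compose[OF bounded_linear_imp_has_derivative[OF blpi] dg])
    moreover have "h \<bullet> e - D\<gamma> (\<pi> x) \<bullet> \<pi> h = D\<rho> x \<bullet> h" for h
      by (simp add: D\<rho>_def \<pi>_def algebra_simps inner_commute)
    ultimately show ?thesis by simp
  qed
  have c\<pi>: "continuous_on UNIV \<pi>" using blpi linear_continuous_on by blast
  have cD: "continuous_on UNIV (\<lambda>x. D\<gamma> (\<pi> x))"
    using D\<gamma> c\<pi> continuous_on_compose2 unfolding C1_with_gradient_def by blast
  have C1: "C1_with_gradient UNIV \<rho> D\<rho>"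
    unfolding C1_with_gradient_def using d\<rho> cD by (auto simp: D\<rho>_def intro!: continuous_intros)
  have sh: "\<rho> (x + t *\<^sub>R e) = \<rho> x + t" for x t
    by (simp add: \<rho>_def \<pi>_def algebra_simps ee)
  have in\<Omega>: "x \<in> \<Omega> \<longleftrightarrow> \<rho> x > 0" if "x \<in> ball x0 r" for x
  proof -
    have "x \<in> \<Omega> \<inter> ball x0 r \<longleftrightarrow> x \<in> {x \<in> ball x0 r. x \<bullet> e > \<gamma> (x - (x \<bullet> e) *\<^sub>R e)}"
      by (simp only: epi)
    then show ?thesis using that by (simp add: \<rho>_def \<pi>_def)
  qed
  have fr: "x \<in> frontier \<Omega> \<longleftrightarrow> \<rho> x = 0" if x: "x \<in> ball x0 r" for x
  proof
    assume xf: "x \<in> frontier \<Omega>"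
    then have "x \<notin> \<Omega>" using opn by (simp add: frontier_def interior_open)
    then have "\<rho> x \<le> 0" using in\<Omega>[OF x] by simp
    moreover have "\<not> \<rho> x < 0"
    proof
      assume neg: "\<rho> x < 0"
      have "open (ball x0 r \<inter> {x. \<rho> x < 0})"
        by (intro open_Int open_ball open_Collect_less C1_with_gradient_continuous_on[OF C1] continuous_on_const)
      moreover have "x \<in> closure \<Omega>" using xf by (simp add: frontier_def)
      ultimately obtain y where "y \<in> \<Omega>" "y \<in> ball x0 r \<inter> {x. \<rho> x < 0}"
        using x neg open_Int_closure_eq_empty[of "ball x0 r \<inter> {x. \<rho> x < 0}" \<Omega>] by blast
      then show False using in\<Omega> by force
    qed
    ultimately show "\<rho> x = 0" by simp
  next
    assume z: "\<rho> x = 0"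
    have "x \<in> closure \<Omega>"
      unfolding closure_approachable
    proof (intro allI impI)
      fix d :: real assume d: "d > 0"
      define t where "t = min d (r - dist x0 x) / 2"
      have t: "t > 0" "t < d" "t < r - dist x0 x" using d x by (auto simp: t_def min_def field_simps)
      have dx: "dist (x + t *\<^sub>R e) x = t" using t e by (simp add: dist_norm)
      then have "dist x0 (x + t *\<^sub>R e) < r" using t dist_triangle[of x0 "x + t *\<^sub>R e" x]
        by (simp add: dist_commute)
      then have "x + t *\<^sub>R e \<in> \<Omega>" using in\<Omega> sh z t by simp
      then show "\<exists>y\<in>\<Omega>. dist y x < d" using dx t by metis
    qed
    moreover have "x \<notin> \<Omega>" using in\<Omega>[OF x] z by simp
    ultimately show "x \<in> frontier \<Omega>" using opn by (simp add: frontier_def interior_open)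
  qed
  have De: "D\<rho> x \<bullet> e = 1" for x
    by (simp add: D\<rho>_def inner_diff_left ee)
  show ?thesis
    using that[OF r e C1 De sh in\<Omega> fr] .
qed

text \<open>Near a boundary point the boundary is a graph, hence contained in the image of a
  hyperplane under the differentiable map that slides points along \<open>e\<close> to the zero set
  of \<open>\<rho>\<close>. Differentiable maps send null sets to null sets.\<close>

lemma negligible_C1_frontier:
  fixes \<Omega> :: "'a::euclidean_space set"
  assumes "C1_boundary \<Omega>" "open \<Omega>"
  shows "negligible (frontier \<Omega>)"
proof (rule iffD2[OF locally_negligible_alt], rule ballI)
  fix x0 assume x0: "x0 \<in> frontier \<Omega>"
  obtain r e \<rho> D\<rho> where r: "r > 0" and e: "norm e = 1" and C1: "C1_with_gradient UNIV \<rho> D\<rho>"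
    and "\<And>x. D\<rho> x \<bullet> e = 1" and sh: "\<And>x t. \<rho> (x + t *\<^sub>R e) = \<rho> x + t"
    and "\<And>x. x \<in> ball x0 r \<Longrightarrow> x \<in> \<Omega> \<longleftrightarrow> \<rho> x > 0"
    and fr: "\<And>x. x \<in> ball x0 r \<Longrightarrow> x \<in> frontier \<Omega> \<longleftrightarrow> \<rho> x = 0"
    using boundary_chart[OF assms x0] by blast
  have ee: "e \<bullet> e = 1" using e by (simp add: norm_eq_1)
  let ?P = "{y. e \<bullet> y = 0}"
  let ?h = "\<lambda>y. y - \<rho> y *\<^sub>R e"
  have "negligible ?P" using e by (intro negligible_hyperplane) auto
  moreover have "?h differentiable_on ?P"
    unfolding differentiable_on_def
  proof
    fix y assume "y \<in> ?P"
    have "(\<rho> has_derivative (\<lambda>h. D\<rho> y \<bullet> h)) (at y within ?P)"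
      using C1 unfolding C1_with_gradient_def by (meson UNIV_I has_derivative_subset subset_UNIV)
    then have "\<rho> differentiable (at y within ?P)" unfolding differentiable_def by blast
    then show "?h differentiable at y within ?P" by (intro derivative_intros) auto
  qed
  ultimately have "negligible (?h ` ?P)"
    by (rule negligible_differentiable_image_negligible[OF order_refl])
  moreover have "frontier \<Omega> \<inter> ball x0 r \<subseteq> ?h ` ?P"
  proof
    fix x assume x: "x \<in> frontier \<Omega> \<inter> ball x0 r"
    let ?y = "x - (x \<bullet> e) *\<^sub>R e"
    have "\<rho> ?y = \<rho> x - x \<bullet> e" using sh[of x "- (x \<bullet> e)"] by simp
    moreover have "\<rho> x = 0" using fr x by blast
    ultimately have "x = ?h ?y" by simp
    moreover have "?y \<in> ?P" by (simp add: inner_diff_right ee inner_commute)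
    ultimately show "x \<in> ?h ` ?P" by blast
  qed
  ultimately have "negligible (frontier \<Omega> \<inter> ball x0 r)" using negligible_subset by blast
  moreover have "openin (top_of_set (frontier \<Omega>)) (frontier \<Omega> \<inter> ball x0 r)"
    by (simp add: openin_open_Int)
  moreover have "x0 \<in> frontier \<Omega> \<inter> ball x0 r" using x0 r by simp
  ultimately show "\<exists>U. openin (top_of_set (frontier \<Omega>)) U \<and> x0 \<in> U \<and> negligible U" by blast
qed

section \<open>The standing assumptions and the moments of the jump measures\<close>

locale nonlocal_dirichlet =
  fixes \<Omega> :: "'a::euclidean_space set"
    and \<nu> :: "'a \<Rightarrow> 'a measure"
    and \<sigma> m :: real
    and g :: "'a \<Rightarrow> real"
    and H :: "'a \<Rightarrow> real \<Rightarrow> 'a \<Rightarrow> real"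
    and lam :: "real \<Rightarrow> real"
  assumes domain: "bounded_C1_domain \<Omega>"
    and regular: "\<And>x. x \<in> closure \<Omega> \<Longrightarrow> regular_off_origin (\<nu> x)"
    and \<sigma>: "0 < \<sigma>" "\<sigma> < 1"
    and M0: "M0 \<Omega> \<nu>" and M1: "M1 \<Omega> \<nu> \<sigma>" and M2: "M2 \<Omega> \<nu> \<sigma>" and M3: "M3 \<Omega> \<nu> \<sigma>"
    and g: "continuous_on (frontier \<Omega>) g"
    and H: "continuous_on (closure \<Omega> \<times> UNIV \<times> UNIV) (\<lambda>(x, r, p). H x r p)"
    and H1: "H1 \<Omega> H lam"
    and m: "m > \<sigma>" and H2: "H2 \<Omega> H m"
begin

abbreviation "cl \<equiv> closure \<Omega>"

lemma open_\<Omega>: "open \<Omega>" and \<Omega>_nonempty: "\<Omega> \<noteq> {}" and bounded_\<Omega>: "bounded \<Omega>"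
  and C1_boundary: "C1_boundary \<Omega>"
  using domain unfolding bounded_C1_domain_def by auto

lemma compact_cl: "compact cl"
  using bounded_\<Omega> by (simp add: compact_closure)

lemma \<Omega>_cl: "\<Omega> \<subseteq> cl" by (rule closure_subset)

lemma frontier_cl: "frontier \<Omega> = cl - \<Omega>"
  using open_\<Omega> by (simp add: frontier_def interior_open)

lemma sets_\<nu> [simp]: "x \<in> cl \<Longrightarrow> sets (\<nu> x) = sets borel"
  using regular unfolding regular_off_origin_def by blast

lemma space_\<nu> [simp]: "x \<in> cl \<Longrightarrow> space (\<nu> x) = UNIV"
  using sets_eq_imp_space_eq[OF sets_\<nu>] by simp

lemma borel_measurable_\<nu> [simp]:
  "x \<in> cl \<Longrightarrow> borel_measurable (\<nu> x) = (borel_measurable borel :: ('a \<Rightarrow> 'b::topological_space) set)"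
  by (rule measurable_cong_sets) auto

lemma far_moment:
  assumes "\<beta> \<in> {0..2}"
  shows "\<exists>C>0. \<forall>x\<in>cl. \<forall>\<delta>>0.
    (\<integral>\<^sup>+z\<in>- ball 0 \<delta>. ennreal (min 1 (norm z powr \<beta>)) \<partial>\<nu> x) \<le> ennreal (C * h_growth \<beta> \<sigma> \<delta>)"
  using M1 assms unfolding M1_def by (meson SUP_le_iff)

text \<open>\<open>M2\<close> with exponent 1, admissible because \<open>\<sigma> < 1\<close>.
  Increments of Lipschitz functions are thus integrable near the origin, with a bound that vanishes
  with \<delta>.\<close>

lemma near_moment:
  "\<exists>C>0. \<forall>x\<in>cl. \<forall>\<delta>. 0 < \<delta> \<and> \<delta> < 1 \<longrightarrow>
    (\<integral>\<^sup>+z\<in>ball 0 \<delta>. ennreal (norm z) \<partial>\<nu> x) \<le> ennreal (C * \<delta> powr (1 - \<sigma>))"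
proof -
  obtain C where C: "C > 0" "\<And>\<beta> \<delta>. \<beta> \<in> {\<sigma><..2} \<Longrightarrow> \<delta> \<in> {0<..<1} \<Longrightarrow>
        (SUP x\<in>cl. \<integral>\<^sup>+z\<in>ball 0 \<delta>. ennreal (norm z powr \<beta>) \<partial>\<nu> x) \<le> ennreal (C * \<delta> powr (\<beta> - \<sigma>))"
    using M2 unfolding M2_def by blast
  have "(\<integral>\<^sup>+z\<in>ball 0 \<delta>. ennreal (norm z) \<partial>\<nu> x) \<le> ennreal (C * \<delta> powr (1 - \<sigma>))"
    if "x \<in> cl" "0 < \<delta>" "\<delta> < 1" for x \<delta>
    using C(2)[of 1 \<delta>] that \<sigma> by (simp add: SUP_le_iff)
  with C(1) show ?thesis by blast
qed

lemma far_mass: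
  "\<exists>C>0. \<forall>x\<in>cl. \<forall>\<delta>>0. emeasure (\<nu> x) (- ball 0 \<delta>) \<le> ennreal (C * \<delta> powr (- \<sigma>))"
proof -
  obtain C where C: "C > 0" "\<And>x \<delta>. x \<in> cl \<Longrightarrow> \<delta> > 0 \<Longrightarrow>
    (\<integral>\<^sup>+z\<in>- ball 0 \<delta>. ennreal (min 1 (norm z powr 0)) \<partial>\<nu> x) \<le> ennreal (C * h_growth 0 \<sigma> \<delta>)"
    using far_moment[of 0] by auto
  have "emeasure (\<nu> x) (- ball 0 \<delta>) \<le> ennreal (C * \<delta> powr (- \<sigma>))" if "x \<in> cl" "\<delta> > 0" for x \<delta>
  proof -
    have "emeasure (\<nu> x) (- ball 0 \<delta>) = (\<integral>\<^sup>+z. indicator (- ball 0 \<delta>) z \<partial>\<nu> x)"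
      using that by simp
    also have "\<dots> = (\<integral>\<^sup>+z\<in>- ball 0 \<delta>. ennreal (min 1 (norm z powr 0)) \<partial>\<nu> x)"
      using that by (intro nn_integral_cong) (auto simp: indicator_def)
    finally show ?thesis using C(2)[OF that] \<sigma> by (simp add: h_growth_def)
  qed
  with C(1) show ?thesis by blast
qed

lemma far_finite:
  assumes "x \<in> cl" "\<delta> > 0"
  shows "emeasure (\<nu> x) (- ball 0 \<delta>) < \<infinity>"
  using far_mass assms by (metis ennreal_less_top infinity_ennreal_def order_le_less_trans)

lemma finite_measure_restrict_far:
  assumes "x \<in> cl" "\<delta> > 0"
  shows "finite_measure (restrict_space (\<nu> x) (- ball 0 \<delta>))"
  using far_finite[OF assms] assms
  by (intro finite_measureI) (simp add: emeasure_restrict_space space_restrict_space)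

lemma far_integrable:
  fixes f :: "'a \<Rightarrow> real"
  assumes "x \<in> cl" "\<delta> > 0" "f \<in> borel_measurable borel" "\<And>z. \<bar>f z\<bar> \<le> B"
  shows "set_integrable (\<nu> x) (- ball 0 \<delta>) f"
proof -
  interpret finite_measure "restrict_space (\<nu> x) (- ball 0 \<delta>)"
    by (rule finite_measure_restrict_far[OF assms(1,2)])
  have "f \<in> borel_measurable (restrict_space (\<nu> x) (- ball 0 \<delta>))"
    using assms by (intro measurable_restrict_space1) simp
  then have "integrable (restrict_space (\<nu> x) (- ball 0 \<delta>)) f"
    using assms(4) by (intro integrable_const_bound[of _ B]) auto
  then show ?thesis
    using assms(1) by (subst (asm) integrable_restrict_space) (auto simp: set_integrable_def)
qed

text \<open>The integrand may change with \<open>n\<close>, because only its uniform bound enters.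
  Later limits can therefore treat the motion of the measure and that of the integrand
  separately.\<close>

lemma tv_seq:
  assumes x: "\<And>n. x n \<in> cl" "x0 \<in> cl" "x \<longlonglongrightarrow> x0" and \<delta>: "\<delta> > 0"
    and f: "\<And>n. f n \<in> borel_measurable borel" "\<And>n z. \<bar>f n z\<bar> \<le> (B::real)"
  shows "(\<lambda>n. (LINT z:- ball 0 \<delta>|\<nu> (x n). f n z) - (LINT z:- ball 0 \<delta>|\<nu> x0. f n z)) \<longlonglongrightarrow> 0"
proof -
  obtain \<omega> where \<omega>: "modulus_of_continuity \<omega>"
    and TV: "\<And>x y. x \<in> cl \<Longrightarrow> y \<in> cl \<Longrightarrow> (\<integral>\<^sup>+z. ennreal (norm z powr 1)
              \<partial>tv_measure (restrict_space (\<nu> x) (- ball 0 \<delta>)) (restrict_space (\<nu> y) (- ball 0 \<delta>)))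
             \<le> ennreal ((1 + h_growth 1 \<sigma> \<delta>) * \<omega> (dist x y))"
    using M3 \<delta> unfolding M3_def by (metis zero_less_one)
  have h: "h_growth 1 \<sigma> \<delta> = 1" using \<sigma> by (simp add: h_growth_def)
  have \<omega>0: "0 \<le> \<omega> s" if "0 \<le> s" for s
    using \<omega> that unfolding modulus_of_continuity_def mono_on_def by (metis atLeast_iff order_refl)
  have B: "0 \<le> B" using f(2)[of 0 0] by linarith
  have "(\<lambda>n. \<omega> (dist (x n) x0)) \<longlonglongrightarrow> 0"
  proof (rule LIMSEQ_I)
    fix r :: real assume r: "r > 0"
    have "(\<omega> \<longlongrightarrow> 0) (at_right 0)" using \<omega> unfolding modulus_of_continuity_def by blast
    then have "\<forall>\<^sub>F s in at_right 0. dist (\<omega> s) 0 < r" using r tendstoD by blast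
    then obtain d where d: "d > 0" "\<And>s. 0 < s \<Longrightarrow> s < d \<Longrightarrow> \<bar>\<omega> s\<bar> < r"
      unfolding eventually_at_right_field by (auto simp: dist_real_def)
    have d': "\<bar>\<omega> s\<bar> < r" if "0 \<le> s" "s < d" for s
      using d(2)[of s] that r \<omega> unfolding modulus_of_continuity_def by (cases "s = 0") auto
    obtain N where "\<And>n. n \<ge> N \<Longrightarrow> dist (x n) x0 < d"
      using x(3) d(1) unfolding lim_sequentially by blast
    then show "\<exists>no. \<forall>n\<ge>no. norm (\<omega> (dist (x n) x0) - 0) < r"
      using d' by (intro exI[of _ N]) auto
  qed
  then have lim: "(\<lambda>n. 3 * B * (2 * \<omega> (dist (x n) x0) / \<delta>)) \<longlonglongrightarrow> 3 * B * (2 * 0 / \<delta>)"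
    using \<delta> by (intro tendsto_intros) auto
  have bd: "\<bar>(LINT z:- ball 0 \<delta>|\<nu> (x n). f n z) - (LINT z:- ball 0 \<delta>|\<nu> x0. f n z)\<bar>
    \<le> 3 * B * (2 * \<omega> (dist (x n) x0) / \<delta>)" for n
  proof -
    let ?M = "restrict_space (\<nu> (x n)) (- ball 0 \<delta>)" and ?N = "restrict_space (\<nu> x0) (- ball 0 \<delta>)"
    let ?V = "tv_measure ?M ?N"
    have sp: "space ?M = - ball 0 \<delta>" using x by (simp add: space_restrict_space)
    have nn: "0 \<le> 2 * \<omega> (dist (x n) x0)" using \<omega>0 by simp
    \<comment> \<open>\<open>M3\<close> controls a first moment; off the ball \<open>norm z\<close>
      is at least \<delta>, so dividing by \<delta> bounds the mass of the variation.\<close>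
    have "ennreal \<delta> * emeasure ?V (space ?M) = (\<integral>\<^sup>+z. ennreal \<delta> \<partial>?V)" by simp
    also have "\<dots> \<le> (\<integral>\<^sup>+z. ennreal (norm z powr 1) \<partial>?V)"
      using sp by (intro nn_integral_mono ennreal_leI) auto
    also have "\<dots> \<le> ennreal (2 * \<omega> (dist (x n) x0))"
      using TV[OF x(1,2)] h by simp
    finally have "ennreal \<delta> * emeasure ?V (space ?M) \<le> ennreal (2 * \<omega> (dist (x n) x0))" .
    then have v: "emeasure ?V (space ?M) \<le> ennreal (2 * \<omega> (dist (x n) x0) / \<delta>)"
      using \<delta> nn
      by (cases "emeasure ?V (space ?M)")
        (auto simp: ennreal_mult_top ennreal_mult[symmetric] top_unique field_simps)
    have "\<bar>integral\<^sup>L ?M (f n) - integral\<^sup>L ?N (f n)\<bar> \<le> 3 * B * (2 * \<omega> (dist (x n) x0) / \<delta>)"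
    proof (rule integral_diff_le_tv_measure)
      show "finite_measure ?M" "finite_measure ?N"
        using x \<delta> by (auto intro: finite_measure_restrict_far)
      show "sets ?N = sets ?M" using x by (intro sets_restrict_space_cong) simp
      show "f n \<in> borel_measurable ?M" using f x by (intro measurable_restrict_space1) simp
      show "0 \<le> 2 * \<omega> (dist (x n) x0) / \<delta>" using nn \<delta> by simp
    qed (use v B f in auto)
    then show ?thesis
      using x by (simp add: integral_restrict_space set_lebesgue_integral_def)
  qed
  show ?thesis
    by (rule tendsto_rabs_zero_cancel, rule tendsto_sandwich[OF _ _ tendsto_const, where h="\<lambda>n. 3 * B * (2 * \<omega> (dist (x n) x0) / \<delta>)"])
      (use bd lim in auto)
qed

end

section \<open>The boundary is not charged\<close>


text \<open>A non-integrable \<open>f\<close> has integral 0 by convention, so the bound covers it.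
  This lets \<open>near_bound\<close> and \<open>far_bound\<close> speak of arbitrary
  functions.\<close>

lemma abs_integral_le:
  fixes f :: "'a \<Rightarrow> real"
  assumes "AE z in M. \<bar>f z\<bar> \<le> h z" "(\<integral>\<^sup>+z. ennreal (h z) \<partial>M) \<le> ennreal c" "0 \<le> c"
  shows "\<bar>integral\<^sup>L M f\<bar> \<le> c"
proof (cases "integrable M f")
  case True
  have "ennreal \<bar>integral\<^sup>L M f\<bar> \<le> (\<integral>\<^sup>+z. ennreal (norm (f z)) \<partial>M)"
    using integral_norm_bound_ennreal[OF True] by simp
  also have "\<dots> \<le> (\<integral>\<^sup>+z. ennreal (h z) \<partial>M)"
    using assms(1) by (intro nn_integral_mono_AE) (auto intro: ennreal_leI)
  finally show ?thesis using assms(2,3) by (metis ennreal_le_iff order_trans)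
qed (use assms in \<open>simp add: not_integrable_integral_eq\<close>)

context nonlocal_dirichlet
begin

text \<open>Let \<open>A\<close> be the boundary outside a ball around \<open>x\<close>. Its
  indicator vanishes near \<open>x\<close>, so \<open>M0_2\<close> makes \<open>F\<close> continuous
  there, and by \<open>tv_seq\<close> so is the variant \<open>G\<close> with the measure frozen at
  \<open>x\<close>. Fubini and the translation invariance of Lebesgue measure give
  \<open>G y = 0\<close> for almost every \<open>y\<close>, hence on a sequence in \<Omega> tending
  to \<open>x\<close>, and \<open>G x = 0\<close> follows. The jump \<open>z = 0\<close> is excepted
  since no assumption limits an atom at the origin.\<close>

lemma frontier_null:
  assumes x: "x \<in> cl"
  shows "AE z in \<nu> x. x + z \<in> frontier \<Omega> \<longrightarrow> z = 0"
proof -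
  have neg: "frontier \<Omega> \<in> null_sets lborel"
    using negligible_C1_frontier[OF C1_boundary open_\<Omega>] negligible_iff_null_sets
      null_sets_completion_iff[of "frontier \<Omega>" lborel] by auto
  have "measure (\<nu> x) {z. x + z \<in> frontier \<Omega> - ball x r} = 0" if r: "r > 0" for r
  proof -
    define A where "A = frontier \<Omega> - ball x r"
    have A [measurable]: "A \<in> sets borel"
      unfolding A_def by (intro borel_closed closed_Diff) auto
    have A_null: "A \<in> null_sets lborel"
      using neg A unfolding A_def by (intro null_sets_subset[OF neg]) auto
    define F where "F = (\<lambda>y. nonlocal_op \<Omega> \<nu> UNIV (indicator A) y)"
    define G where "G = (\<lambda>y. LINT z:- ball 0 (r/2)|\<nu> x. (indicator A (y + z) :: real))"
    have iA: "(\<lambda>z. indicator A (y + z) :: real) \<in> borel_measurable borel" for y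
      by measurable
    have "(indicat_real A has_derivative (\<lambda>h. 0 \<bullet> h)) (at y within ball x r \<inter> cl)"
      if "y \<in> ball x r \<inter> cl" for y
      by (rule has_derivative_transform[where f="\<lambda>_. 0"]) (use that in \<open>auto simp: A_def\<close>)
    then have "C1_with_gradient (ball x r \<inter> cl) (indicator A) (\<lambda>_. 0)"
      unfolding C1_with_gradient_def by (metis continuous_on_const)
    then have 1: "C1_on (ball x r \<inter> cl) (indicator A)" unfolding C1_on_def by blast
    have 2: "indicat_real A \<in> borel_measurable (restrict_space borel cl)"
      by (intro measurable_restrict_space1) simp
    have 3: "bounded (indicat_real A ` cl)"
      by (rule boundedI[of _ 1]) (auto simp: indicator_def)
    have "UNIV \<in> sets (borel :: 'a measure)" by simp
    with M0 x r 1 2 3 have c: "continuous_on (ball x r \<inter> cl) F"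
      unfolding M0_def M0_2_def F_def by blast
    \<comment> \<open>For \<open>y\<close> within \<open>r/2\<close> of \<open>x\<close> the
      indicator vanishes at \<open>y\<close>, and every jump from \<open>y\<close> into
      \<open>A\<close> has length at least \<open>r/2\<close>.\<close>
    have F: "F y = (LINT z:- ball 0 (r/2)|\<nu> y. (indicator A (y + z) :: real))"
      if y: "y \<in> ball x (r/2) \<inter> cl" for y
      unfolding F_def nonlocal_op_def set_lebesgue_integral_def
    proof (rule Bochner_Integration.integral_cong[OF refl])
      fix z
      have "y \<notin> A" using y r by (auto simp: A_def dist_commute)
      moreover have "z \<notin> ball 0 (r/2)" if "y + z \<in> A"
      proof
        assume "z \<in> ball 0 (r/2)"
        then have "dist x (y + z) < r"
          using y norm_triangle_ineq[of "y - x" z] by (auto simp: dist_norm norm_minus_commute algebra_simps)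
        with that show False by (auto simp: A_def)
      qed
      moreover have "y + z \<in> cl" if "y + z \<in> A" using that by (auto simp: A_def frontier_cl)
      ultimately show "indicat_real (jump_set \<Omega> UNIV y) z *\<^sub>R (indicat_real A (y + z) - indicat_real A y)
         = indicat_real (- ball 0 (r/2)) z *\<^sub>R indicat_real A (y + z)"
        unfolding jump_set_def by (auto simp: indicator_def)
    qed
    have Fc: "(\<lambda>n. F (y n)) \<longlonglongrightarrow> F x" if "\<And>n. y n \<in> cl" "y \<longlonglongrightarrow> x" for y
    proof -
      have "\<forall>\<^sub>F n in sequentially. y n \<in> ball x r \<inter> cl"
        using topological_tendstoD[OF that(2) open_ball, of x r] r that(1) by (auto elim: eventually_mono)
      then show ?thesis
        using c x r that(2) by (intro continuous_on_tendsto_compose[of "ball x r \<inter> cl" F]) auto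
    qed
    \<comment> \<open>Freezing the measure changes \<open>F (y n)\<close> by a null sequence, so
      \<open>G\<close> inherits the limit of \<open>F\<close>.\<close>
    have Gc: "(\<lambda>n. G (y n)) \<longlonglongrightarrow> G x" if y: "\<And>n. y n \<in> cl" "y \<longlonglongrightarrow> x" for y
    proof -
      have "(\<lambda>n. (LINT z:- ball 0 (r/2)|\<nu> (y n). indicator A (y n + z))
          - (LINT z:- ball 0 (r/2)|\<nu> x. (indicator A (y n + z) :: real))) \<longlonglongrightarrow> 0"
        using y x r by (intro tv_seq[where B=1]) (auto simp: indicator_def)
      moreover have ev: "\<forall>\<^sub>F n in sequentially. y n \<in> ball x (r/2) \<inter> cl"
        using topological_tendstoD[OF y(2) open_ball, of x "r/2"] r y(1) by (auto elim: eventually_mono)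
      ultimately have "(\<lambda>n. F (y n) - G (y n)) \<longlonglongrightarrow> 0"
        by (elim Lim_transform_eventually) (use ev in \<open>eventually_elim, simp add: F G_def\<close>)
      then have "(\<lambda>n. F (y n) - (F (y n) - G (y n))) \<longlonglongrightarrow> F x - 0"
        by (intro tendsto_diff Fc y)
      then show ?thesis using F[of x] x r by (simp add: G_def)
    qed
    have "AE y in lborel. G y = 0"
    proof -
      \<comment> \<open>Cutting off the ball makes the measure finite, as Fubini requires. The
        swapped inner integral is the Lebesgue measure of a translate of the null set
        \<open>A\<close>.\<close>
      define M where "M = density (\<nu> x) (\<lambda>z. ennreal (indicator (- ball 0 (r/2)) z))"
      have sM [measurable_cong]: "sets M = sets borel" unfolding M_def using x by simp
      interpret M: finite_measure M
        using far_finite[OF x, of "r/2"] x r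
        by (intro finite_measureI) (auto simp: M_def emeasure_density ennreal_indicator)
      interpret pair_sigma_finite lborel M ..
      have "(\<integral>\<^sup>+y. \<integral>\<^sup>+z. indicator A (y + z) \<partial>M \<partial>lborel) = (\<integral>\<^sup>+z. \<integral>\<^sup>+y. indicator A (y + z) \<partial>lborel \<partial>M)"
        by (rule Fubini'[symmetric]) measurable
      also have "\<dots> = (\<integral>\<^sup>+z. 0 \<partial>M)"
      proof (rule nn_integral_cong)
        fix z
        have "(\<integral>\<^sup>+y. indicator A (y + z) \<partial>lborel) = (\<integral>\<^sup>+y. indicator A y \<partial>distr lborel borel ((+) z))"
          by (subst nn_integral_distr) (auto simp: add.commute)
        also have "\<dots> = emeasure lborel A" by (simp add: lborel_distr_plus)
        finally show "(\<integral>\<^sup>+y. indicator A (y + z) \<partial>lborel) = 0" using A_null by auto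
      qed
      finally have "(\<integral>\<^sup>+y. \<integral>\<^sup>+z. indicator A (y + z) \<partial>M \<partial>lborel) = 0" by simp
      then have "AE y in lborel. (\<integral>\<^sup>+z. indicator A (y + z) \<partial>M) = 0"
        by (subst (asm) nn_integral_0_iff_AE) auto
      then show ?thesis
      proof eventually_elim
        case (elim y)
        then have "(\<integral>\<^sup>+z. indicator (- ball 0 (r/2)) z * indicator A (y + z) \<partial>\<nu> x) = (0::ennreal)"
          unfolding M_def using x by (subst (asm) nn_integral_density) (auto simp: ennreal_indicator)
        then have "AE z in \<nu> x. indicator (- ball 0 (r/2)) z * indicator A (y + z) = (0::ennreal)"
          using x iA by (subst (asm) nn_integral_0_iff_AE) auto
        then have "AE z in \<nu> x. indicator (- ball 0 (r/2)) z *\<^sub>R indicator A (y + z) = (0::real)"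
          by eventually_elim (auto simp: indicator_def split: if_splits)
        then show "G y = 0" unfolding G_def set_lebesgue_integral_def
          by (intro integral_eq_zero_AE)
      qed
    qed
    have "G x = 0"
    proof (rule ccontr)
      assume Gx: "G x \<noteq> 0"
      \<comment> \<open>The part of \<Omega> near \<open>x\<close> is open and nonempty, so it is
        not a null set and contains a zero of \<open>G\<close>.\<close>
      have "\<exists>y. y \<in> \<Omega> \<and> dist y x < inverse (Suc n) \<and> G y = 0" for n
      proof (rule ccontr)
        assume *: "\<nexists>y. y \<in> \<Omega> \<and> dist y x < inverse (Suc n) \<and> G y = 0"
        let ?U = "\<Omega> \<inter> ball x (inverse (Suc n))"
        have oU: "open ?U" using open_\<Omega> by auto
        have "AE y in lborel. y \<notin> ?U"
          using \<open>AE y in lborel. G y = 0\<close> by eventually_elim (use * in \<open>auto simp: dist_commute\<close>)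
        then have "?U \<in> null_sets lborel" using oU by (subst AE_iff_null_sets) auto
        then have "negligible ?U" using negligible_iff_null_sets null_sets_completionI by blast
        moreover have "?U \<noteq> {}" using x closure_approachable[of x \<Omega>]
          by (metis (no_types, lifting) disjoint_iff dist_commute inverse_positive_iff_positive mem_ball of_nat_0_less_iff zero_less_Suc)
        ultimately show False using oU open_not_negligible by blast
      qed
      then obtain y where y: "\<And>n. y n \<in> \<Omega> \<and> dist (y n) x < inverse (Suc n) \<and> G (y n) = 0" by metis
      have "y \<longlonglongrightarrow> x"
        unfolding tendsto_dist_iff[of y]
        by (rule tendsto_sandwich[OF _ _ tendsto_const LIMSEQ_inverse_real_of_nat])
          (use y in \<open>auto intro!: always_eventually less_imp_le\<close>)
      then have "(\<lambda>n. G (y n)) \<longlonglongrightarrow> G x" using y \<Omega>_cl by (intro Gc) auto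
      then show False using y Gx by (simp add: LIMSEQ_const_iff)
    qed
    moreover have "G x = measure (\<nu> x) {z. x + z \<in> A}"
    proof -
      have "{z. x + z \<in> A} \<in> sets borel" by measurable
      then have "measure (\<nu> x) {z. x + z \<in> A} = (LINT z|\<nu> x. indicator {z. x + z \<in> A} z)"
        using x by simp
      also have "\<dots> = G x" unfolding G_def set_lebesgue_integral_def
        using r by (intro Bochner_Integration.integral_cong) (auto simp: A_def indicator_def dist_norm)
      finally show ?thesis by simp
    qed
    ultimately show ?thesis unfolding A_def by simp
  qed
  note meas = this
  have "AE z in \<nu> x. z \<notin> {z. x + z \<in> frontier \<Omega> - ball x (inverse (Suc n))}" for n
  proof -
    let ?r = "inverse (real (Suc n))"
    let ?A = "{z. x + z \<in> frontier \<Omega> - ball x ?r}"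
    have r: "?r > 0" by simp
    have "?A = (\<lambda>z. x + z) -` (frontier \<Omega> - ball x ?r) \<inter> space borel" by auto
    also have "\<dots> \<in> sets borel"
      by (rule measurable_sets[of _ borel borel])
        (auto intro!: borel_closed closed_Diff borel_measurable_continuous_onI continuous_intros)
    finally have [measurable]: "?A \<in> sets borel" .
    \<comment> \<open>\<open>measure\<close> is also 0 on sets of infinite mass, so finiteness has
      to be secured before passing to \<open>emeasure\<close>.\<close>
    have "emeasure (\<nu> x) ?A \<le> emeasure (\<nu> x) (- ball 0 ?r)"
      using x by (intro emeasure_mono) (auto simp: dist_norm)
    then have "emeasure (\<nu> x) ?A < \<infinity>" using far_finite[OF x r] by auto
    then have "emeasure (\<nu> x) ?A = 0" using meas[OF r]
      unfolding measure_def enn2real_eq_0_iff by auto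
    then have "?A \<in> null_sets (\<nu> x)" using \<open>?A \<in> sets borel\<close> x unfolding null_sets_def by simp
    then show ?thesis by (rule AE_not_in)
  qed
  then have "AE z in \<nu> x. \<forall>n. z \<notin> {z. x + z \<in> frontier \<Omega> - ball x (inverse (Suc n))}"
    by (simp only: AE_all_countable) blast
  then show ?thesis
  proof eventually_elim
    case (elim z)
    show ?case
    proof (intro impI, rule ccontr)
      assume "x + z \<in> frontier \<Omega>" "z \<noteq> 0"
      then obtain n where "inverse (real (Suc n)) < norm z"
        using reals_Archimedean[of "norm z"] by auto
      then show False using elim \<open>x + z \<in> frontier \<Omega>\<close> by (auto simp: dist_norm dest: spec[of _ n])
    qed
  qed
qed

text \<open>\<open>tv_seq\<close> moves the measure to the limit point; under the then fixed
  measure, dominated convergence applies with the constant \<open>B\<close>, which is integrable off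
  the ball. Convergence is asked only almost everywhere, so jumps onto the boundary can be
  ignored.\<close>

lemma far_limit:
  assumes x: "\<And>n. x n \<in> cl" "x0 \<in> cl" "x \<longlonglongrightarrow> x0" and \<delta>: "\<delta> > 0"
    and f: "\<And>n. f n \<in> borel_measurable borel" "\<And>n z. \<bar>f n z\<bar> \<le> (B::real)" "f0 \<in> borel_measurable borel"
    and lim: "AE z in \<nu> x0. norm z \<ge> \<delta> \<longrightarrow> (\<lambda>n. f n z) \<longlonglongrightarrow> f0 z"
  shows "(\<lambda>n. LINT z:- ball 0 \<delta>|\<nu> (x n). f n z) \<longlonglongrightarrow> (LINT z:- ball 0 \<delta>|\<nu> x0. f0 z)"
proof -
  have B: "0 \<le> B" using f(2)[of 0 0] by linarith
  have "(\<lambda>n. LINT z:- ball 0 \<delta>|\<nu> x0. f n z) \<longlonglongrightarrow> (LINT z:- ball 0 \<delta>|\<nu> x0. f0 z)"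
    unfolding set_lebesgue_integral_def
  proof (rule integral_dominated_convergence)
    show "(\<lambda>z. indicator (- ball 0 \<delta>) z *\<^sub>R f0 z) \<in> borel_measurable (\<nu> x0)"
      using f(3) x by simp
    show "(\<lambda>z. indicator (- ball 0 \<delta>) z *\<^sub>R f n z) \<in> borel_measurable (\<nu> x0)" for n
      using f(1) x by simp
    show "integrable (\<nu> x0) (\<lambda>z. indicator (- ball 0 \<delta>) z *\<^sub>R B)"
      using far_integrable[OF x(2) \<delta>, of "\<lambda>_. B" B] B by (simp add: set_integrable_def)
    show "AE z in \<nu> x0. (\<lambda>n. indicator (- ball 0 \<delta>) z *\<^sub>R f n z) \<longlonglongrightarrow> indicator (- ball 0 \<delta>) z *\<^sub>R f0 z"
      using lim by eventually_elim (auto simp: indicator_def)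
    show "AE z in \<nu> x0. norm (indicator (- ball 0 \<delta>) z *\<^sub>R f n z) \<le> indicator (- ball 0 \<delta>) z *\<^sub>R B" for n
      using f(2)[of n] by (auto simp: indicator_def)
  qed
  with tv_seq[OF x \<delta> f(1,2)] have "(\<lambda>n. ((LINT z:- ball 0 \<delta>|\<nu> (x n). f n z) - (LINT z:- ball 0 \<delta>|\<nu> x0. f n z))
     + (LINT z:- ball 0 \<delta>|\<nu> x0. f n z)) \<longlonglongrightarrow> 0 + (LINT z:- ball 0 \<delta>|\<nu> x0. f0 z)"
    by (rule tendsto_add)
  then show ?thesis by simp
qed

end

section \<open>Semicontinuity and limits of nonlocal terms\<close>


lemma usc_on_iff:
  "usc_on S u \<longleftrightarrow> (\<forall>x\<in>S. \<forall>a>u x. \<exists>U. open U \<and> x \<in> U \<and> (\<forall>y\<in>U \<inter> S. u y < a))"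
  unfolding usc_on_def eventually_at_topological by (intro ball_cong refl) (metis IntE IntI)

lemma lsc_on_iff_usc_on: "lsc_on S v \<longleftrightarrow> usc_on S (\<lambda>x. - v x)"
proof -
  have "(\<forall>a<v x. \<forall>\<^sub>F y in F. a < v y) \<longleftrightarrow> (\<forall>a>- v x. \<forall>\<^sub>F y in F. - v y < a)" for x F
  proof safe
    fix a assume "\<forall>a<v x. \<forall>\<^sub>F y in F. a < v y" "- v x < a"
    then have "\<forall>\<^sub>F y in F. - a < v y" by simp
    then show "\<forall>\<^sub>F y in F. - v y < a" by eventually_elim simp
  next
    fix a assume "\<forall>a>- v x. \<forall>\<^sub>F y in F. - v y < a" "a < v x"
    then have "\<forall>\<^sub>F y in F. - v y < - a" by (elim allE[of _ "- a"]) simp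
    then show "\<forall>\<^sub>F y in F. a < v y" by eventually_elim simp
  qed
  then show ?thesis unfolding lsc_on_def usc_on_def by simp
qed

lemma continuous_on_imp_usc_on: "continuous_on S u \<Longrightarrow> usc_on S u"
  unfolding usc_on_def continuous_on_def by (simp add: order_tendsto_iff)

lemma continuous_on_imp_lsc_on: "continuous_on S u \<Longrightarrow> lsc_on S u"
  unfolding lsc_on_def continuous_on_def by (simp add: order_tendsto_iff)

lemma usc_on_add:
  assumes "usc_on S u" "usc_on S w"
  shows "usc_on S (\<lambda>x. u x + w x)"
  unfolding usc_on_def
proof (intro ballI allI impI)
  fix x a assume x: "x \<in> S" and a: "a > u x + w x"
  define e where "e = (a - (u x + w x)) / 2"
  have e: "e > 0" using a by (simp add: e_def)
  have "\<forall>\<^sub>F y in at x within S. u y < u x + e" "\<forall>\<^sub>F y in at x within S. w y < w x + e"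
    using assms x e unfolding usc_on_def by simp_all
  then show "\<forall>\<^sub>F y in at x within S. u y + w y < a"
    by eventually_elim (simp add: e_def field_simps)
qed

lemma usc_on_compose:
  assumes u: "usc_on T u" and f: "continuous_on S f" "f ` S \<subseteq> T"
  shows "usc_on S (\<lambda>x. u (f x))"
  unfolding usc_on_iff
proof (intro ballI allI impI)
  fix x a assume x: "x \<in> S" and a: "a > u (f x)"
  then obtain U where U: "open U" "f x \<in> U" "\<forall>y\<in>U \<inter> T. u y < a"
    using u f(2) unfolding usc_on_iff by (metis image_subset_iff)
  obtain V where V: "open V" "V \<inter> S = f -` U \<inter> S"
    using f(1) U(1) unfolding continuous_on_open_invariant by metis
  have "x \<in> V" using V(2) U(2) x by blast
  moreover have "u (f y) < a" if "y \<in> V \<inter> S" for y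
  proof -
    have "f y \<in> U" "f y \<in> T" using that V(2) f(2) by blast+
    then show ?thesis using U(3) by blast
  qed
  ultimately show "\<exists>U. open U \<and> x \<in> U \<and> (\<forall>y\<in>U \<inter> S. u (f y) < a)" using V(1) by blast
qed

lemma usc_on_subset: "usc_on T u \<Longrightarrow> S \<subseteq> T \<Longrightarrow> usc_on S u"
  unfolding usc_on_def by (meson at_le filter_leD subsetD)

text \<open>If no maximum existed, each point \<open>x\<close> would be beaten by some
  \<open>b x\<close>, even on a neighbourhood of \<open>x\<close>. Of finitely many such competitors
  the best one lies in one of the covering neighbourhoods and would be beaten by another
  competitor.\<close>

lemma usc_on_attains_sup:
  assumes "compact S" "S \<noteq> {}" "usc_on S u"
  obtains x where "x \<in> S" "\<And>y. y \<in> S \<Longrightarrow> u y \<le> u x"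
proof -
  have "\<exists>x\<in>S. \<forall>y\<in>S. u y \<le> u x"
  proof (rule ccontr)
    assume "\<not> ?thesis"
    then obtain b where b: "\<And>x. x \<in> S \<Longrightarrow> b x \<in> S \<and> u x < u (b x)" by (metis not_le)
    have "\<exists>U. open U \<and> x \<in> U \<and> (\<forall>y\<in>U \<inter> S. u y < u (b x))" if x: "x \<in> S" for x
      using assms(3)[unfolded usc_on_iff, rule_format, OF x] b[OF x] by blast
    then obtain U where U: "\<And>x. x \<in> S \<Longrightarrow> open (U x) \<and> x \<in> U x \<and> (\<forall>y\<in>U x \<inter> S. u y < u (b x))"
      by metis
    have "S \<subseteq> (\<Union>x\<in>S. U x)" using U by blast
    then obtain C where C: "C \<subseteq> S" "finite C" "S \<subseteq> (\<Union>c\<in>C. U c)"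
      using compactE_image[OF assms(1), of S U] U by metis
    have "C \<noteq> {}" using C(3) assms(2) by (metis UN_empty subset_empty)
    then obtain t where t: "t \<in> (\<lambda>c. u (b c)) ` C" "\<And>s. s \<in> (\<lambda>c. u (b c)) ` C \<Longrightarrow> s \<le> t"
      using Max_in[of "(\<lambda>c. u (b c)) ` C"] Max_ge[of "(\<lambda>c. u (b c)) ` C"] C(2)
      by (metis finite_imageI image_is_empty)
    then obtain c where c: "c \<in> C" "t = u (b c)" by blast
    obtain c' where "c' \<in> C" "b c \<in> U c'" using C b c by blast
    then have "u (b c) < u (b c')" using U b C c by blast
    with t(2)[OF imageI[OF \<open>c' \<in> C\<close>]] c(2) show False by simp
  qed
  with that show ?thesis by blast
qed

lemma usc_on_seq:
  assumes "usc_on S u" "\<And>n. x n \<in> S" "x0 \<in> S" "x \<longlonglongrightarrow> x0" "u x0 < a"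
  shows "\<forall>\<^sub>F n in sequentially. u (x n) < a"
proof -
  obtain U where U: "open U" "x0 \<in> U" "\<forall>y\<in>U \<inter> S. u y < a"
    using assms(1)[unfolded usc_on_iff, rule_format, OF assms(3,5)] by blast
  have "\<forall>\<^sub>F n in sequentially. x n \<in> U" using assms(4) U topological_tendstoD by blast
  then show ?thesis by eventually_elim (use U assms in blast)
qed

lemma lsc_on_seq:
  assumes "lsc_on S v" "\<And>n. x n \<in> S" "x0 \<in> S" "x \<longlonglongrightarrow> x0" "a < v x0"
  shows "\<forall>\<^sub>F n in sequentially. a < v (x n)"
  using usc_on_seq[of S "\<lambda>x. - v x" x x0 "- a"] assms by (simp add: lsc_on_iff_usc_on)

lemma borel_measurable_usc_on:
  assumes "usc_on S (u :: 'a::topological_space \<Rightarrow> real)" "S \<in> sets borel"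
  shows "u \<in> borel_measurable (restrict_space borel S)"
  unfolding borel_measurable_iff_less
proof
  fix a
  have "openin (top_of_set S) {x \<in> S. u x < a}"
  proof (subst openin_subopen, intro ballI)
    fix x assume x: "x \<in> {x \<in> S. u x < a}"
    then obtain U where "open U" "x \<in> U" "\<forall>y\<in>U \<inter> S. u y < a"
      using assms(1)[unfolded usc_on_iff, rule_format, of x a] by blast
    then show "\<exists>T. openin (top_of_set S) T \<and> x \<in> T \<and> T \<subseteq> {x \<in> S. u x < a}"
      using x by (intro exI[of _ "S \<inter> U"]) (auto simp: openin_open)
  qed
  then obtain U where "open U" "{x \<in> S. u x < a} = S \<inter> U" by (auto simp: openin_open)
  then show "{w \<in> space (restrict_space borel S). u w < a} \<in> sets (restrict_space borel S)"
    using assms(2) by (auto simp: space_restrict_space sets_restrict_space_iff)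
qed

lemma borel_measurable_lsc_on:
  assumes "lsc_on S (v :: 'a::topological_space \<Rightarrow> real)" "S \<in> sets borel"
  shows "v \<in> borel_measurable (restrict_space borel S)"
  using borel_measurable_usc_on[of S "\<lambda>x. - v x"] assms
    borel_measurable_uminus[of "\<lambda>x. - v x" "restrict_space borel S"]
  by (simp add: lsc_on_iff_usc_on)

section \<open>Bounds and limits of the near and far parts of the nonlocal operator\<close>

context nonlocal_dirichlet
begin

text \<open>Chosen once and for all, so that later constants can be given explicitly in terms of it;
  likewise \<open>far_const\<close>.\<close>

definition "near_const = (SOME C. C > 0 \<and> (\<forall>x\<in>cl. \<forall>\<delta>. 0 < \<delta> \<and> \<delta> < 1 \<longrightarrow>
    (\<integral>\<^sup>+z\<in>ball 0 \<delta>. ennreal (norm z) \<partial>\<nu> x) \<le> ennreal (C * \<delta> powr (1 - \<sigma>))))"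

definition "far_const = (SOME C. C > 0 \<and> (\<forall>x\<in>cl. \<forall>\<delta>>0.
    emeasure (\<nu> x) (- ball 0 \<delta>) \<le> ennreal (C * \<delta> powr (- \<sigma>))))"

lemma near_const: "near_const > 0"
  "\<And>x \<delta>. x \<in> cl \<Longrightarrow> 0 < \<delta> \<Longrightarrow> \<delta> < 1 \<Longrightarrow>
    (\<integral>\<^sup>+z\<in>ball 0 \<delta>. ennreal (norm z) \<partial>\<nu> x) \<le> ennreal (near_const * \<delta> powr (1 - \<sigma>))"
  using someI_ex[OF near_moment] unfolding near_const_def[symmetric] by auto

lemma far_const: "far_const > 0"
  "\<And>x \<delta>. x \<in> cl \<Longrightarrow> \<delta> > 0 \<Longrightarrow> emeasure (\<nu> x) (- ball 0 \<delta>) \<le> ennreal (far_const * \<delta> powr (- \<sigma>))"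
  using someI_ex[OF far_mass] unfolding far_const_def[symmetric] by auto

lemma near_bound:
  assumes x: "x \<in> cl" and \<delta>: "0 < \<delta>" "\<delta> < 1" and A: "0 \<le> A"
    and f: "\<And>z. norm z < \<delta> \<Longrightarrow> x + z \<in> cl \<Longrightarrow> \<bar>f (x + z) - f x\<bar> \<le> A * norm z"
  shows "\<bar>nonlocal_op \<Omega> \<nu> (ball 0 \<delta>) f x\<bar> \<le> A * (near_const * \<delta> powr (1 - \<sigma>))"
  unfolding nonlocal_op_def set_lebesgue_integral_def
proof (rule abs_integral_le[where h="\<lambda>z. A * (norm z * indicator (ball 0 \<delta>) z)"])
  show "AE z in \<nu> x. \<bar>indicat_real (jump_set \<Omega> (ball 0 \<delta>) x) z *\<^sub>R (f (x + z) - f x)\<bar>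
      \<le> A * (norm z * indicator (ball 0 \<delta>) z)"
    using f A by (auto simp: jump_set_def indicator_def)
  have [measurable]: "ball 0 \<delta> \<in> sets (borel :: 'a measure)" by simp
  have "(\<integral>\<^sup>+z. ennreal (A * (norm z * indicator (ball 0 \<delta>) z)) \<partial>\<nu> x)
    = (\<integral>\<^sup>+z. ennreal A * (ennreal (norm z) * indicator (ball 0 \<delta>) z) \<partial>\<nu> x)"
    using A by (intro nn_integral_cong) (auto simp: ennreal_mult indicator_def)
  also have "\<dots> = ennreal A * (\<integral>\<^sup>+z\<in>ball 0 \<delta>. ennreal (norm z) \<partial>\<nu> x)"
    using x by (intro nn_integral_cmult) (simp; measurable)
  also have "\<dots> \<le> ennreal A * ennreal (near_const * \<delta> powr (1 - \<sigma>))"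
    by (intro mult_left_mono near_const x \<delta>) simp
  finally show "(\<integral>\<^sup>+z. ennreal (A * (norm z * indicator (ball 0 \<delta>) z)) \<partial>\<nu> x)
    \<le> ennreal (A * (near_const * \<delta> powr (1 - \<sigma>)))"
    using A near_const(1) by (simp add: ennreal_mult)
qed (use A near_const(1) in simp)

lemma far_bound:
  assumes x: "x \<in> cl" and \<delta>: "0 < \<delta>" and B: "0 \<le> B"
    and f: "\<And>z. norm z \<ge> \<delta> \<Longrightarrow> x + z \<in> cl \<Longrightarrow> \<bar>f (x + z) - f x\<bar> \<le> B"
  shows "\<bar>nonlocal_op \<Omega> \<nu> (- ball 0 \<delta>) f x\<bar> \<le> B * (far_const * \<delta> powr (- \<sigma>))"
  unfolding nonlocal_op_def set_lebesgue_integral_def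
proof (rule abs_integral_le[where h="\<lambda>z. B * indicator (- ball 0 \<delta>) z"])
  show "AE z in \<nu> x. \<bar>indicat_real (jump_set \<Omega> (- ball 0 \<delta>) x) z *\<^sub>R (f (x + z) - f x)\<bar>
      \<le> B * indicator (- ball 0 \<delta>) z"
    using f B by (auto simp: jump_set_def indicator_def)
  have "(\<integral>\<^sup>+z. ennreal (B * indicator (- ball 0 \<delta>) z) \<partial>\<nu> x)
    = (\<integral>\<^sup>+z. ennreal B * indicator (- ball 0 \<delta>) z \<partial>\<nu> x)"
    by (intro nn_integral_cong) (auto simp: indicator_def)
  also have "\<dots> = ennreal B * emeasure (\<nu> x) (- ball 0 \<delta>)"
    using x by (intro nn_integral_cmult_indicator) simp
  also have "\<dots> \<le> ennreal B * ennreal (far_const * \<delta> powr (- \<sigma>))"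
    by (intro mult_left_mono far_const x \<delta>) simp
  finally show "(\<integral>\<^sup>+z. ennreal (B * indicator (- ball 0 \<delta>) z) \<partial>\<nu> x)
    \<le> ennreal (B * (far_const * \<delta> powr (- \<sigma>)))"
    using B far_const(1) by (simp add: ennreal_mult)
qed (use B far_const(1) in simp)

text \<open>A Hoelder bound improves the far term from order
  \<open>\<delta> powr (- \<sigma>)\<close> to \<open>h_growth \<gamma> \<sigma> \<delta>\<close>;
  this drives the regularity rounds. By \<open>frontier_null\<close> the increments need control
  only for jumps that land in \<Omega>.\<close>

lemma far_bound_holder:
  assumes \<gamma>: "0 \<le> \<gamma>" "\<gamma> \<le> 1"
  shows "\<exists>C>0. \<forall>x\<in>cl. \<forall>\<delta>>0. \<forall>f. \<forall>A\<ge>0.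
    (\<forall>z. norm z \<ge> \<delta> \<longrightarrow> x + z \<in> \<Omega> \<longrightarrow> \<bar>f (x + z) - f x\<bar> \<le> A * norm z powr \<gamma>) \<longrightarrow>
    \<bar>nonlocal_op \<Omega> \<nu> (- ball 0 \<delta>) f x\<bar> \<le> A * (C * h_growth \<gamma> \<sigma> \<delta>)"
proof -
  obtain C where C: "C > 0" "\<And>x \<delta>. x \<in> cl \<Longrightarrow> \<delta> > 0 \<Longrightarrow>
    (\<integral>\<^sup>+z\<in>- ball 0 \<delta>. ennreal (min 1 (norm z powr \<gamma>)) \<partial>\<nu> x) \<le> ennreal (C * h_growth \<gamma> \<sigma> \<delta>)"
    using far_moment[of \<gamma>] \<gamma> by auto
  \<comment> \<open>Jumps inside the closure are no longer than its diameter, so for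
    \<open>\<gamma> \<le> 1\<close> the factor \<open>D\<close> turns
    \<open>min 1 (norm z powr \<gamma>)\<close> of \<open>M1\<close> into
    \<open>norm z powr \<gamma>\<close>.\<close>
  define D where "D = max 1 (diameter cl)"
  have D: "D \<ge> 1" by (simp add: D_def)
  have "\<bar>nonlocal_op \<Omega> \<nu> (- ball 0 \<delta>) f x\<bar> \<le> A * ((D * C) * h_growth \<gamma> \<sigma> \<delta>)"
    if x: "x \<in> cl" and \<delta>: "\<delta> > 0" and A: "A \<ge> 0"
      and f: "\<And>z. norm z \<ge> \<delta> \<Longrightarrow> x + z \<in> \<Omega> \<Longrightarrow> \<bar>f (x + z) - f x\<bar> \<le> A * norm z powr \<gamma>" for x \<delta> f A
  proof -
    let ?h = "\<lambda>z. A * D * (min 1 (norm z powr \<gamma>) * indicator (- ball 0 \<delta>) z)"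
    have h0: "0 \<le> h_growth \<gamma> \<sigma> \<delta>" by (simp add: h_growth_def)
    have pw: "\<bar>indicat_real (jump_set \<Omega> (- ball 0 \<delta>) x) z *\<^sub>R (f (x + z) - f x)\<bar> \<le> ?h z"
      if z: "x + z \<in> frontier \<Omega> \<longrightarrow> z = 0" for z
    proof (cases "norm z \<ge> \<delta> \<and> x + z \<in> cl")
      case True
      then have "x + z \<in> \<Omega>" using z \<delta> by (auto simp: frontier_cl)
      moreover have "norm z powr \<gamma> \<le> D * min 1 (norm z powr \<gamma>)"
      proof (cases "norm z \<le> 1")
        case True
        then have "norm z powr \<gamma> \<le> 1" using \<gamma> by (simp add: powr_le1)
        then show ?thesis using D mult_right_mono[of 1 D "norm z powr \<gamma>"] by (simp add: min_def)
      next
        case False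
        have "norm z = dist x (x + z)" by (simp add: dist_norm)
        also have "\<dots> \<le> diameter cl"
          using x True bounded_\<Omega> by (intro diameter_bounded_bound) auto
        finally have zD: "norm z \<le> D" by (simp add: D_def)
        have "norm z powr \<gamma> \<le> norm z powr 1" using False \<gamma> by (intro powr_mono) auto
        moreover have "1 \<le> norm z powr \<gamma>" using False \<gamma> by (simp add: ge_one_powr_ge_zero)
        ultimately show ?thesis using zD by (simp add: min_def)
      qed
      ultimately have "\<bar>f (x + z) - f x\<bar> \<le> A * (D * min 1 (norm z powr \<gamma>))"
        using f[of z] True A by (meson mult_left_mono order_trans)
      then show ?thesis using True by (simp add: jump_set_def indicator_def mult.assoc)
    qed (use A D in \<open>auto simp: jump_set_def indicator_def\<close>)
    show ?thesis
      unfolding nonlocal_op_def set_lebesgue_integral_def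
    proof (rule abs_integral_le[where h="?h"])
      show "AE z in \<nu> x. \<bar>indicat_real (jump_set \<Omega> (- ball 0 \<delta>) x) z *\<^sub>R (f (x + z) - f x)\<bar> \<le> ?h z"
        using frontier_null[OF x] by eventually_elim (rule pw)
      have "(\<integral>\<^sup>+z. ennreal (?h z) \<partial>\<nu> x)
        = (\<integral>\<^sup>+z. ennreal (A * D) * (ennreal (min 1 (norm z powr \<gamma>)) * indicator (- ball 0 \<delta>) z) \<partial>\<nu> x)"
        using A D by (intro nn_integral_cong) (auto simp: ennreal_mult indicator_def)
      also have "\<dots> = ennreal (A * D) * (\<integral>\<^sup>+z\<in>- ball 0 \<delta>. ennreal (min 1 (norm z powr \<gamma>)) \<partial>\<nu> x)"
        using x by (intro nn_integral_cmult) simp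
      also have "\<dots> \<le> ennreal (A * D) * ennreal (C * h_growth \<gamma> \<sigma> \<delta>)"
        by (intro mult_left_mono C x \<delta>) simp
      finally show "(\<integral>\<^sup>+z. ennreal (?h z) \<partial>\<nu> x) \<le> ennreal (A * ((D * C) * h_growth \<gamma> \<sigma> \<delta>))"
        using A C(1) D h0 by (simp add: ennreal_mult[symmetric] mult.assoc)
    qed (use A C(1) D h0 in simp)
  qed
  moreover have "D * C > 0" using D C(1) by simp
  ultimately show ?thesis by blast
qed

lemma nonlocal_far_eq:
  "nonlocal_op \<Omega> \<nu> (- ball 0 \<delta>) u x = (LINT z:- ball 0 \<delta>|\<nu> x. indicat_real cl (x + z) * (u (x + z) - u x))"
  unfolding nonlocal_op_def set_lebesgue_integral_def
  by (rule Bochner_Integration.integral_cong) (auto simp: jump_set_def indicator_def)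

lemma jump_measurable [measurable]:
  assumes "u \<in> borel_measurable (restrict_space borel cl)"
  shows "(\<lambda>z. indicat_real cl (x + z) * (u (x + z) - c)) \<in> borel_measurable borel"
proof -
  have u: "(\<lambda>y. indicat_real cl y * u y) \<in> borel_measurable borel"
    using assms by (subst (asm) borel_measurable_restrict_space_iff) auto
  have "(\<lambda>z. indicat_real cl (x + z) * u (x + z)) \<in> borel_measurable borel"
    by (rule measurable_compose[OF _ u]) simp
  moreover have "(\<lambda>z. indicat_real cl (x + z)) \<in> borel_measurable borel"
    by (rule measurable_compose[of _ _ borel]) auto
  ultimately have "(\<lambda>z. indicat_real cl (x + z) * u (x + z) - indicat_real cl (x + z) * c) \<in> borel_measurable borel"
    by (rule borel_measurable_diff[OF _ borel_measurable_times[OF _ borel_measurable_const]])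
  then show ?thesis by (simp only: right_diff_distrib)
qed

lemma jump_bounded:
  assumes "\<And>y. y \<in> cl \<Longrightarrow> \<bar>u y\<bar> \<le> R" "\<bar>c\<bar> \<le> A" "0 \<le> R"
  shows "\<bar>indicat_real cl (x + z) * (u (x + z) - c)\<bar> \<le> R + A"
  using assms(1)[of "x + z"] assms(2,3) by (auto simp: indicator_def)

lemma far_jump_integrable:
  assumes x: "x \<in> cl" and "0 < \<delta>" and u: "u \<in> borel_measurable (restrict_space borel cl)"
    and R: "\<And>y. y \<in> cl \<Longrightarrow> \<bar>u y\<bar> \<le> R"
  shows "set_integrable (\<nu> x) (- ball 0 \<delta>) (\<lambda>z. indicat_real cl (x + z) * (u (x + z) - c))"
  using jump_bounded[of u R c "\<bar>c\<bar>", OF R] R[OF x]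
  by (intro far_integrable[where B="R + \<bar>c\<bar>"] assms jump_measurable) auto

lemma C1_jump_integrable:
  assumes x: "x \<in> cl" and \<phi>: "C1_with_gradient cl \<phi> D\<phi>"
  shows "integrable (\<nu> x) (\<lambda>z. indicat_real cl (x + z) * (\<phi> (x + z) - \<phi> x))"
proof -
  have c: "continuous_on cl \<phi>" using C1_with_gradient_continuous_on[OF \<phi>] .
  have "\<phi> \<in> borel_measurable (restrict_space borel cl)"
    using borel_measurable_usc_on[OF continuous_on_imp_usc_on[OF c]] by simp
  moreover have "bounded (\<phi> ` cl)" using compact_continuous_image[OF c compact_cl] compact_imp_bounded by blast
  moreover have "C1_on (ball x 1 \<inter> cl) \<phi>"
    using C1_with_gradient_subset[OF \<phi>] unfolding C1_on_def by (meson inf_le2)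
  ultimately have "nonlocal_op_defined \<Omega> \<nu> UNIV \<phi> x"
    using M0 x unfolding M0_def M0_2_def by (meson zero_less_one)
  moreover have "indicat_real (jump_set \<Omega> UNIV x) z *\<^sub>R (\<phi> (x + z) - \<phi> x)
      = indicat_real cl (x + z) * (\<phi> (x + z) - \<phi> x)" for z
    by (auto simp: jump_set_def indicator_def)
  ultimately show ?thesis unfolding nonlocal_op_defined_def set_integrable_def by (simp only:)
qed

text \<open>Pointwise convergence can fail only where \<open>x0 + z\<close> is on the boundary,
  which \<open>frontier_null\<close> excludes. The base value is a separate sequence
  \<open>a\<close> because Perron's method subtracts the value of an approximating function there,
  and not that of \<open>u\<close>.\<close>

lemma far_limit_jump:
  assumes x: "\<And>n. x n \<in> cl" "x0 \<in> cl" "x \<longlonglongrightarrow> x0" and \<delta>: "\<delta> > 0"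
    and u: "u \<in> borel_measurable (restrict_space borel cl)" "\<And>y. y \<in> cl \<Longrightarrow> \<bar>u y\<bar> \<le> R" "continuous_on \<Omega> u"
    and a: "a \<longlonglongrightarrow> a0"
  shows "(\<lambda>n. LINT z:- ball 0 \<delta>|\<nu> (x n). indicat_real cl (x n + z) * (u (x n + z) - a n))
    \<longlonglongrightarrow> (LINT z:- ball 0 \<delta>|\<nu> x0. indicat_real cl (x0 + z) * (u (x0 + z) - a0))"
proof -
  obtain A where A: "\<And>n. \<bar>a n\<bar> \<le> A"
    using convergent_imp_Bseq[of a] a unfolding convergent_def Bseq_def by auto
  have R: "0 \<le> R" using u(2)[OF x(2)] by linarith
  show ?thesis
  proof (rule far_limit[OF x \<delta>, where B="R + A"])
    show "\<bar>indicat_real cl (x n + z) * (u (x n + z) - a n)\<bar> \<le> R + A" for n z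
      by (rule jump_bounded[OF u(2) A R])
    show "AE z in \<nu> x0. \<delta> \<le> norm z \<longrightarrow> (\<lambda>n. indicat_real cl (x n + z) * (u (x n + z) - a n))
        \<longlonglongrightarrow> indicat_real cl (x0 + z) * (u (x0 + z) - a0)"
      using frontier_null[OF x(2)]
    proof eventually_elim
      case (elim z)
      have xz: "(\<lambda>n. x n + z) \<longlonglongrightarrow> x0 + z" by (intro tendsto_intros x)
      show ?case
      proof (intro impI)
        assume z: "\<delta> \<le> norm z"
        show "(\<lambda>n. indicat_real cl (x n + z) * (u (x n + z) - a n))
          \<longlonglongrightarrow> indicat_real cl (x0 + z) * (u (x0 + z) - a0)"
        proof (cases "x0 + z \<in> cl")
          case True
          then have in\<Omega>: "x0 + z \<in> \<Omega>" using elim z \<delta> by (auto simp: frontier_cl)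
          have ev: "\<forall>\<^sub>F n in sequentially. x n + z \<in> \<Omega>"
            using xz in\<Omega> open_\<Omega> topological_tendstoD by blast
          have "(\<lambda>n. u (x n + z)) \<longlonglongrightarrow> u (x0 + z)"
            using continuous_on_tendsto_compose[OF u(3) xz in\<Omega> ev] .
          then have "(\<lambda>n. u (x n + z) - a n) \<longlonglongrightarrow> u (x0 + z) - a0" by (intro tendsto_intros a)
          then have "(\<lambda>n. indicat_real cl (x n + z) * (u (x n + z) - a n)) \<longlonglongrightarrow> u (x0 + z) - a0"
            by (rule Lim_transform_eventually) (use ev \<Omega>_cl in \<open>auto elim!: eventually_mono\<close>)
          then show ?thesis using True by simp
        next
          case False
          have "\<forall>\<^sub>F n in sequentially. x n + z \<in> - cl"
            using xz False topological_tendstoD[OF xz, of "- cl"] by auto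
          then have "\<forall>\<^sub>F n in sequentially. indicat_real cl (x n + z) * (u (x n + z) - a n) = 0"
            by eventually_elim simp
          then show ?thesis using False by (simp add: tendsto_eventually)
        qed
      qed
    qed
  qed (intro jump_measurable u)+
qed

lemma nonlocal_far_tendsto:
  assumes x: "\<And>n. x n \<in> cl" "x0 \<in> cl" "x \<longlonglongrightarrow> x0" and \<delta>: "\<delta> > 0" and u: "continuous_on cl u"
  shows "(\<lambda>n. nonlocal_op \<Omega> \<nu> (- ball 0 \<delta>) u (x n)) \<longlonglongrightarrow> nonlocal_op \<Omega> \<nu> (- ball 0 \<delta>) u x0"
proof -
  have "bounded (u ` cl)" using compact_continuous_image[OF u compact_cl] compact_imp_bounded by blast
  then obtain R where "\<And>y. y \<in> cl \<Longrightarrow> \<bar>u y\<bar> \<le> R" unfolding bounded_iff by auto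
  moreover have "u \<in> borel_measurable (restrict_space borel cl)"
    using borel_measurable_usc_on[OF continuous_on_imp_usc_on[OF u]] by simp
  moreover have "(\<lambda>n. u (x n)) \<longlonglongrightarrow> u x0"
    using continuous_on_tendsto_compose[OF u x(3,2)] x(1) by simp
  ultimately show ?thesis
    unfolding nonlocal_far_eq
    by (intro far_limit_jump[OF x \<delta>]) (use u \<Omega>_cl continuous_on_subset in auto)
qed

text \<open>A Fatou-type statement in which the measure moves as well. For a lower semicontinuous
  \<open>v\<close> the integrands \<open>f n\<close> have only a lower limit, so
  \<open>far_limit\<close> is applied to their truncation from above by \<open>f0\<close>, which
  does converge.\<close>

lemma nonlocal_far_liminf:
  assumes x: "\<And>n. x n \<in> cl" "x0 \<in> cl" "x \<longlonglongrightarrow> x0" and \<delta>: "\<delta> > 0"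
    and v: "lsc_on cl v" "\<And>y. y \<in> cl \<Longrightarrow> \<bar>v y\<bar> \<le> R" and lim: "(\<lambda>n. v (x n)) \<longlonglongrightarrow> v x0" and e: "e > 0"
  shows "\<forall>\<^sub>F n in sequentially. nonlocal_op \<Omega> \<nu> (- ball 0 \<delta>) v (x n) \<ge> nonlocal_op \<Omega> \<nu> (- ball 0 \<delta>) v x0 - e"
proof -
  have vb: "v \<in> borel_measurable (restrict_space borel cl)" using borel_measurable_lsc_on[OF v(1)] by simp
  have R: "0 \<le> R" using v(2)[OF x(2)] by linarith
  define f where "f = (\<lambda>n z. indicat_real cl (x n + z) * (v (x n + z) - v (x n)))"
  define f0 where "f0 = (\<lambda>z. indicat_real cl (x0 + z) * (v (x0 + z) - v x0))"
  have fb: "\<bar>f n z\<bar> \<le> R + R" "\<bar>f0 z\<bar> \<le> R + R" for n z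
    unfolding f_def f0_def by (rule jump_bounded; use v(2) R x in blast)+
  have fm [measurable]: "f n \<in> borel_measurable borel" "f0 \<in> borel_measurable borel" for n
    unfolding f_def f0_def by (intro jump_measurable vb)+
  have "(\<lambda>n. LINT z:- ball 0 \<delta>|\<nu> (x n). min (f n z) (f0 z)) \<longlonglongrightarrow> (LINT z:- ball 0 \<delta>|\<nu> x0. f0 z)"
  proof (rule far_limit[OF x \<delta>, where B="R + R"])
    show "\<bar>min (f n z) (f0 z)\<bar> \<le> R + R" for n z using fb(1)[of n z] fb(2)[of z] by (simp add: min_def)
    show "AE z in \<nu> x0. \<delta> \<le> norm z \<longrightarrow> (\<lambda>n. min (f n z) (f0 z)) \<longlonglongrightarrow> f0 z"
      using frontier_null[OF x(2)]
    proof eventually_elim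
      case (elim z)
      have xz: "(\<lambda>n. x n + z) \<longlonglongrightarrow> x0 + z" by (intro tendsto_intros x)
      show ?case
      proof (intro impI, rule order_tendstoI)
        fix a assume z: "\<delta> \<le> norm z" and a: "a < f0 z"
        have "\<forall>\<^sub>F n in sequentially. a < f n z"
        proof (cases "x0 + z \<in> cl")
          case True
          then have in\<Omega>: "x0 + z \<in> \<Omega>" using elim z \<delta> by (auto simp: frontier_cl)
          have ev: "\<forall>\<^sub>F n in sequentially. x n + z \<in> \<Omega>"
            using xz in\<Omega> open_\<Omega> topological_tendstoD by blast
          define d where "d = (f0 z - a) / 2"
          have d: "d > 0" using a by (simp add: d_def)
          obtain U where U: "open U" "x0 + z \<in> U" "\<forall>y\<in>U \<inter> cl. - v y < - v (x0 + z) + d"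
            using v(1) True d unfolding lsc_on_iff_usc_on usc_on_iff by (metis less_add_same_cancel1)
          have "\<forall>\<^sub>F n in sequentially. x n + z \<in> U" using xz U topological_tendstoD by blast
          moreover have "\<forall>\<^sub>F n in sequentially. v (x n) < v x0 + d" using lim d by (simp add: order_tendsto_iff)
          ultimately show ?thesis using ev
          proof eventually_elim
            case (elim n)
            then have "x n + z \<in> U \<inter> cl" using \<Omega>_cl by blast
            then have "- v (x n + z) < - v (x0 + z) + d" using U(3) by blast
            then have "v (x n + z) > v (x0 + z) - d" by linarith
            then show ?case using elim True \<Omega>_cl a unfolding f_def f0_def d_def
              by (auto simp: indicator_def field_simps)
          qed
        next
          case False
          have "\<forall>\<^sub>F n in sequentially. x n + z \<in> - cl"
            using xz False topological_tendstoD[OF xz, of "- cl"] by auto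
          then show ?thesis by eventually_elim (use a False in \<open>simp add: f_def f0_def\<close>)
        qed
        then show "\<forall>\<^sub>F n in sequentially. a < min (f n z) (f0 z)" by eventually_elim (use a in simp)
      next
        fix a assume "f0 z < a"
        then show "\<forall>\<^sub>F n in sequentially. min (f n z) (f0 z) < a" by (simp add: min_less_iff_disj)
      qed
    qed
  qed auto
  then have "\<forall>\<^sub>F n in sequentially. (LINT z:- ball 0 \<delta>|\<nu> (x n). min (f n z) (f0 z)) > (LINT z:- ball 0 \<delta>|\<nu> x0. f0 z) - e"
    using e by (simp add: order_tendsto_iff)
  then show ?thesis
  proof eventually_elim
    case (elim n)
    have "\<bar>min (f n z) (f0 z)\<bar> \<le> R + R" for z using fb(1)[of n z] fb(2)[of z] by (simp add: min_def)
    then have "(LINT z:- ball 0 \<delta>|\<nu> (x n). min (f n z) (f0 z)) \<le> (LINT z:- ball 0 \<delta>|\<nu> (x n). f n z)"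
      using x \<delta> fb by (intro set_integral_mono far_integrable[where B="R + R"]) auto
    with elim show ?case unfolding nonlocal_far_eq f_def f0_def by linarith
  qed
qed

end

section \<open>Test functions and contact inequalities\<close>


lemma C1_with_gradient_add:
  assumes "C1_with_gradient S f Df" "C1_with_gradient S h Dh"
  shows "C1_with_gradient S (\<lambda>x. f x + h x) (\<lambda>x. Df x + Dh x)"
  using assms unfolding C1_with_gradient_def
  by (auto intro!: continuous_on_add has_derivative_eq_rhs[OF has_derivative_add] simp: inner_add_left)

lemma C1_with_gradient_cmult:
  assumes "C1_with_gradient S f Df"
  shows "C1_with_gradient S (\<lambda>x. c * f x) (\<lambda>x. c *\<^sub>R Df x)"
  using assms unfolding C1_with_gradient_def
  by (auto intro!: continuous_intros has_derivative_eq_rhs[OF has_derivative_mult_right])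

lemma C1_with_gradient_const: "C1_with_gradient S (\<lambda>x. c) (\<lambda>x. 0)"
  unfolding C1_with_gradient_def by (auto intro!: derivative_eq_intros)

text \<open>Radial functions are written in the squared norm, which is smooth also at the
  centre.\<close>

lemma C1_with_gradient_radial:
  assumes f: "\<And>t. t \<ge> 0 \<Longrightarrow> (f has_real_derivative f' t) (at t)" and f': "continuous_on {0..} f'"
  shows "C1_with_gradient S (\<lambda>x. f (norm (x - y) ^ 2)) (\<lambda>x. (2 * f' (norm (x - y) ^ 2)) *\<^sub>R (x - y))"
  unfolding C1_with_gradient_def
proof (intro conjI ballI)
  fix x
  have "((\<lambda>x. (x - y) \<bullet> (x - y)) has_derivative (\<lambda>h. 2 * ((x - y) \<bullet> h))) (at x within S)"
    by (auto intro!: derivative_eq_intros simp: inner_commute)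
  then have d: "((\<lambda>x. norm (x - y) ^ 2) has_derivative (\<lambda>h. 2 * ((x - y) \<bullet> h))) (at x within S)"
    by (simp add: power2_norm_eq_inner)
  have "(f has_derivative (\<lambda>h. f' (norm (x - y) ^ 2) * h)) (at (norm (x - y) ^ 2))"
    using f[of "norm (x - y) ^ 2"] by (simp add: has_field_derivative_def)
  from has_derivative_compose[OF d this]
  show "((\<lambda>x. f (norm (x - y) ^ 2)) has_derivative (\<lambda>h. (2 * f' (norm (x - y) ^ 2)) *\<^sub>R (x - y) \<bullet> h)) (at x within S)"
    by (simp add: algebra_simps)
next
  have "continuous_on S (\<lambda>x. f' (norm (x - y) ^ 2))"
    by (rule continuous_on_compose2[OF f']) (auto intro!: continuous_intros)
  then show "continuous_on S (\<lambda>x. (2 * f' (norm (x - y) ^ 2)) *\<^sub>R (x - y))"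
    by (intro continuous_intros)
qed

lemma C1_with_gradient_dist_sq:
  "C1_with_gradient S (\<lambda>x. norm (x - y) ^ 2) (\<lambda>x. 2 *\<^sub>R (x - y))"
  using C1_with_gradient_radial[of "\<lambda>t. t" "\<lambda>_. 1" S y] by (simp add: continuous_on_const)

lemma C1_with_gradient_sqrt:
  assumes "\<mu> > 0"
  shows "C1_with_gradient S (\<lambda>x. sqrt (\<mu>\<^sup>2 + norm (x - y) ^ 2)) (\<lambda>x. (1 / sqrt (\<mu>\<^sup>2 + norm (x - y) ^ 2)) *\<^sub>R (x - y))"
proof -
  have pos: "\<mu>\<^sup>2 + t > 0" if "t \<ge> 0" for t using assms that by (simp add: add_pos_nonneg)
  have "C1_with_gradient S (\<lambda>x. sqrt (\<mu>\<^sup>2 + norm (x - y) ^ 2))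
      (\<lambda>x. (2 * (1 / (2 * sqrt (\<mu>\<^sup>2 + norm (x - y) ^ 2)))) *\<^sub>R (x - y))"
  proof (rule C1_with_gradient_radial)
    show "((\<lambda>t. sqrt (\<mu>\<^sup>2 + t)) has_real_derivative 1 / (2 * sqrt (\<mu>\<^sup>2 + t))) (at t)" if "t \<ge> 0" for t
      using pos[OF that] by (auto intro!: derivative_eq_intros simp: field_simps)
    show "continuous_on {0..} (\<lambda>t. 1 / (2 * sqrt (\<mu>\<^sup>2 + t)))"
    proof (intro continuous_intros ballI)
      fix t :: real assume "t \<in> {0..}"
      then show "2 * sqrt (\<mu>\<^sup>2 + t) \<noteq> 0" using pos[of t] by simp
    qed
  qed
  then show ?thesis by simp
qed

text \<open>Wherever \<open>y\<close> and \<open>t\<close> lie relative to \<open>s\<close>, the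
  remainder of the first-order expansion is at most \<open>(y - t)\<^sup>2\<close>.\<close>

lemma has_real_derivative_pos_part_sq:
  fixes t :: real
  shows "((\<lambda>t. (max 0 (t - s))\<^sup>2) has_real_derivative 2 * max 0 (t - s)) (at t)"
proof -
  have q: "\<bar>(max 0 (y - s))\<^sup>2 - (max 0 (t - s))\<^sup>2 - 2 * max 0 (t - s) * (y - t)\<bar> \<le> (y - t)\<^sup>2" for y
  proof -
    consider "y \<ge> s" "t \<ge> s" | "y < s" "t \<ge> s" | "y \<ge> s" "t < s" | "y < s" "t < s" by linarith
    then show ?thesis
    proof cases
      case 1
      have "(y - s)\<^sup>2 - (t - s)\<^sup>2 - 2 * (t - s) * (y - t) = (y - t)\<^sup>2"
        by (simp add: power2_eq_square algebra_simps)
      then show ?thesis using 1 by simp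
    next
      case 2
      have "- (t - s)\<^sup>2 - 2 * (t - s) * (y - t) = (y - t)\<^sup>2 - (s - y)\<^sup>2"
        by (simp add: power2_eq_square algebra_simps)
      moreover have "(s - y)\<^sup>2 \<le> (t - y)\<^sup>2" using 2 by (intro power_mono) auto
      ultimately show ?thesis using 2 by (simp add: power2_commute[of y t])
    next
      case 3
      have "(y - s)\<^sup>2 \<le> (y - t)\<^sup>2" using 3 by (intro power_mono) auto
      then show ?thesis using 3 by simp
    next
      case 4
      then show ?thesis by simp
    qed
  qed
  show ?thesis
    unfolding has_field_derivative_def has_derivative_at_within
  proof (intro conjI bounded_linear_mult_right)
    show "((\<lambda>y. ((max 0 (y - s))\<^sup>2 - (max 0 (t - s))\<^sup>2 - 2 * max 0 (t - s) * (y - t)) /\<^sub>R norm (y - t)) \<longlongrightarrow> 0) (at t)"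
    proof (rule tendsto_rabs_zero_cancel, rule tendsto_sandwich[OF _ _ tendsto_const])
      show "((\<lambda>y. \<bar>y - t\<bar>) \<longlongrightarrow> 0) (at t)"
        by (auto intro!: tendsto_eq_intros)
      show "\<forall>\<^sub>F y in at t. \<bar>((max 0 (y - s))\<^sup>2 - (max 0 (t - s))\<^sup>2 - 2 * max 0 (t - s) * (y - t)) /\<^sub>R norm (y - t)\<bar> \<le> \<bar>y - t\<bar>"
        unfolding eventually_at_filter
      proof (intro always_eventually allI impI)
        fix y assume "y \<noteq> t"
        then show "\<bar>((max 0 (y - s))\<^sup>2 - (max 0 (t - s))\<^sup>2 - 2 * max 0 (t - s) * (y - t)) /\<^sub>R norm (y - t)\<bar> \<le> \<bar>y - t\<bar>"
          using q[of y] by (simp add: abs_mult divide_inverse[symmetric] field_simps power2_eq_square flip: abs_mult)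
      qed
    qed auto
  qed
qed

text \<open>For \<open>s \<ge> 0\<close> this function vanishes with its gradient on the ball of
  radius \<open>sqrt s\<close> about \<open>y\<close> and is positive outside. Adding a large
  multiple turns local contact into global contact without disturbing the contact point.\<close>

lemma C1_with_gradient_cutoff:
  "C1_with_gradient S (\<lambda>x. (max 0 (norm (x - y) ^ 2 - s))\<^sup>2) (\<lambda>x. (4 * max 0 (norm (x - y) ^ 2 - s)) *\<^sub>R (x - y))"
  using C1_with_gradient_radial[OF has_real_derivative_pos_part_sq, of s S y]
  by (simp add: continuous_intros)

section \<open>Monotonicity and localisation of the contact inequality\<close>

context nonlocal_dirichlet
begin

text \<open>The equation part of \<open>visc_subsolution\<close> at one point, without the boundary
  alternative. It is used in \<Omega> and also at boundary points where the function exceeds the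
  data.\<close>

definition sub_at :: "real \<Rightarrow> ('a \<Rightarrow> real) \<Rightarrow> 'a \<Rightarrow> bool" where
  "sub_at c u x0 \<longleftrightarrow> (\<forall>\<phi> D\<phi>. C1_with_gradient cl \<phi> D\<phi> \<longrightarrow> (\<forall>y\<in>cl. u y - \<phi> y \<le> u x0 - \<phi> x0) \<longrightarrow>
     (\<forall>\<delta>>0. visc_E \<Omega> \<nu> H \<delta> u \<phi> D\<phi> x0 \<le> c))"

lemma visc_subsolution_sub_at:
  assumes "visc_subsolution \<Omega> \<nu> H g c u"
  shows "x0 \<in> \<Omega> \<Longrightarrow> sub_at c u x0" "x0 \<in> frontier \<Omega> \<Longrightarrow> u x0 > g x0 \<Longrightarrow> sub_at c u x0"
proof -
  have *: "(x0 \<in> \<Omega> \<longrightarrow> visc_E \<Omega> \<nu> H \<delta> u \<phi> D\<phi> x0 - c \<le> 0) \<and>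
      (x0 \<in> frontier \<Omega> \<longrightarrow> min (visc_E \<Omega> \<nu> H \<delta> u \<phi> D\<phi> x0 - c) (u x0 - g x0) \<le> 0)"
    if "C1_with_gradient cl \<phi> D\<phi>" "x0 \<in> cl" "\<forall>y\<in>cl. u y - \<phi> y \<le> u x0 - \<phi> x0" "\<delta> > 0" for \<phi> D\<phi> \<delta>
    using assms that unfolding visc_subsolution_def by blast
  show "x0 \<in> \<Omega> \<Longrightarrow> sub_at c u x0" unfolding sub_at_def using * \<Omega>_cl by fastforce
  show "x0 \<in> frontier \<Omega> \<Longrightarrow> u x0 > g x0 \<Longrightarrow> sub_at c u x0"
    unfolding sub_at_def using * by (force simp: frontier_cl min_le_iff_disj)
qed

lemma sub_at_mono: "sub_at c u x0 \<Longrightarrow> c \<le> c' \<Longrightarrow> sub_at c' u x0"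
  unfolding sub_at_def by (meson order_trans)

abbreviation jump :: "('a \<Rightarrow> real) \<Rightarrow> 'a \<Rightarrow> 'a \<Rightarrow> real" where
  "jump f x z \<equiv> indicat_real cl (x + z) * (f (x + z) - f x)"

text \<open>The two nonlocal terms of \<open>visc_E\<close> form a single integral, which makes them monotone in the
  pair of the test function and the solution.\<close>

lemma nonlocal_split:
  assumes x: "x \<in> cl" and \<phi>: "C1_with_gradient cl \<phi> D\<phi>" and \<delta>: "\<delta> > 0"
    and u: "u \<in> borel_measurable (restrict_space borel cl)" "\<And>y. y \<in> cl \<Longrightarrow> \<bar>u y\<bar> \<le> R"
  shows "integrable (\<nu> x) (\<lambda>z. if norm z < \<delta> then jump \<phi> x z else jump u x z)"
    and "nonlocal_op \<Omega> \<nu> (ball 0 \<delta>) \<phi> x + nonlocal_op \<Omega> \<nu> (- ball 0 \<delta>) u x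
      = (LINT z|\<nu> x. (if norm z < \<delta> then jump \<phi> x z else jump u x z))"
proof -
  have 1: "integrable (\<nu> x) (\<lambda>z. indicator (ball 0 \<delta>) z *\<^sub>R jump \<phi> x z)"
    using C1_jump_integrable[OF x \<phi>] x by (intro integrable_mult_indicator) auto
  have 2: "integrable (\<nu> x) (\<lambda>z. indicator (- ball 0 \<delta>) z *\<^sub>R jump u x z)"
    using far_jump_integrable[OF x \<delta> u] by (simp add: set_integrable_def)
  have eq: "(\<lambda>z. if norm z < \<delta> then jump \<phi> x z else jump u x z)
    = (\<lambda>z. indicator (ball 0 \<delta>) z *\<^sub>R jump \<phi> x z + indicator (- ball 0 \<delta>) z *\<^sub>R jump u x z)"
    by (auto simp: fun_eq_iff indicator_def)
  show "integrable (\<nu> x) (\<lambda>z. if norm z < \<delta> then jump \<phi> x z else jump u x z)"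
    unfolding eq by (intro Bochner_Integration.integrable_add 1 2)
  have "nonlocal_op \<Omega> \<nu> (ball 0 \<delta>) \<phi> x = (LINT z|\<nu> x. indicator (ball 0 \<delta>) z *\<^sub>R jump \<phi> x z)"
    unfolding nonlocal_op_def set_lebesgue_integral_def
    by (rule Bochner_Integration.integral_cong) (auto simp: jump_set_def indicator_def)
  then show "nonlocal_op \<Omega> \<nu> (ball 0 \<delta>) \<phi> x + nonlocal_op \<Omega> \<nu> (- ball 0 \<delta>) u x
      = (LINT z|\<nu> x. (if norm z < \<delta> then jump \<phi> x z else jump u x z))"
    unfolding eq nonlocal_far_eq set_lebesgue_integral_def
    using Bochner_Integration.integral_add[OF 1 2] by simp
qed

text \<open>The two sides may be split at different radii, and jumps longer than \<delta> may
  violate the order by \<open>K\<close>, which costs \<open>K\<close> times their mass. The defect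
  serves Perron's bump, where the raised function exceeds \<open>u\<close> slightly, and the
  exponential barrier, where long jumps are estimated crudely.\<close>

lemma nonlocal_split_mono:
  assumes x: "x \<in> cl" and \<phi>: "C1_with_gradient cl \<phi> D\<phi>" and \<psi>: "C1_with_gradient cl \<psi> D\<psi>"
    and \<delta>: "\<delta> > 0" "\<delta>' > 0"
    and u: "u \<in> borel_measurable (restrict_space borel cl)" "\<And>y. y \<in> cl \<Longrightarrow> \<bar>u y\<bar> \<le> R"
    and w: "w \<in> borel_measurable (restrict_space borel cl)" "\<And>y. y \<in> cl \<Longrightarrow> \<bar>w y\<bar> \<le> R'"
    and K: "0 \<le> K"
    and le: "\<And>z. x + z \<in> cl \<Longrightarrow> (if norm z < \<delta> then \<phi> (x + z) - \<phi> x else u (x + z) - u x)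
      \<le> (if norm z < \<delta>' then \<psi> (x + z) - \<psi> x else w (x + z) - w x) + (if norm z < \<delta> then 0 else K)"
  shows "nonlocal_op \<Omega> \<nu> (ball 0 \<delta>) \<phi> x + nonlocal_op \<Omega> \<nu> (- ball 0 \<delta>) u x
    \<le> nonlocal_op \<Omega> \<nu> (ball 0 \<delta>') \<psi> x + nonlocal_op \<Omega> \<nu> (- ball 0 \<delta>') w x + K * (far_const * \<delta> powr (- \<sigma>))"
proof -
  have iK: "integrable (\<nu> x) (\<lambda>z. indicator (- ball 0 \<delta>) z *\<^sub>R K)"
    using far_integrable[OF x \<delta>(1), of "\<lambda>_. K" K] K by (simp add: set_integrable_def)
  have "\<bar>LINT z|\<nu> x. indicator (- ball 0 \<delta>) z *\<^sub>R K\<bar> \<le> K * (far_const * \<delta> powr (- \<sigma>))"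
  proof (rule abs_integral_le[where h="\<lambda>z. indicator (- ball 0 \<delta>) z *\<^sub>R K"])
    have "(\<integral>\<^sup>+z. ennreal (indicator (- ball 0 \<delta>) z *\<^sub>R K) \<partial>\<nu> x) = (\<integral>\<^sup>+z. ennreal K * indicator (- ball 0 \<delta>) z \<partial>\<nu> x)"
      by (intro nn_integral_cong) (auto simp: indicator_def)
    also have "\<dots> = ennreal K * emeasure (\<nu> x) (- ball 0 \<delta>)"
      using x by (intro nn_integral_cmult_indicator) simp
    also have "\<dots> \<le> ennreal K * ennreal (far_const * \<delta> powr (- \<sigma>))"
      by (intro mult_left_mono far_const x \<delta>) simp
    finally show "(\<integral>\<^sup>+z. ennreal (indicator (- ball 0 \<delta>) z *\<^sub>R K) \<partial>\<nu> x) \<le> ennreal (K * (far_const * \<delta> powr (- \<sigma>)))"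
      using K far_const(1) by (simp add: ennreal_mult)
  qed (use K far_const(1) in \<open>auto simp: indicator_def\<close>)
  moreover have "(LINT z|\<nu> x. (if norm z < \<delta> then jump \<phi> x z else jump u x z))
    \<le> (LINT z|\<nu> x. (if norm z < \<delta>' then jump \<psi> x z else jump w x z) + indicator (- ball 0 \<delta>) z *\<^sub>R K)"
  proof (rule integral_mono)
    show "(if norm z < \<delta> then jump \<phi> x z else jump u x z)
      \<le> (if norm z < \<delta>' then jump \<psi> x z else jump w x z) + indicator (- ball 0 \<delta>) z *\<^sub>R K" for z
      using le[of z] K by (cases "x + z \<in> cl") (auto split: if_splits)
    show "integrable (\<nu> x) (\<lambda>z. if norm z < \<delta> then jump \<phi> x z else jump u x z)"
      by (rule nonlocal_split(1)[OF x \<phi> \<delta>(1) u])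
    show "integrable (\<nu> x) (\<lambda>z. (if norm z < \<delta>' then jump \<psi> x z else jump w x z) + indicator (- ball 0 \<delta>) z *\<^sub>R K)"
      by (rule Bochner_Integration.integrable_add[OF nonlocal_split(1)[OF x \<psi> \<delta>(2) w] iK])
  qed
  moreover have "(LINT z|\<nu> x. (if norm z < \<delta>' then jump \<psi> x z else jump w x z) + indicator (- ball 0 \<delta>) z *\<^sub>R K)
    = (LINT z|\<nu> x. (if norm z < \<delta>' then jump \<psi> x z else jump w x z)) + (LINT z|\<nu> x. indicator (- ball 0 \<delta>) z *\<^sub>R K)"
    by (rule Bochner_Integration.integral_add[OF nonlocal_split(1)[OF x \<psi> \<delta>(2) w] iK])
  moreover note nonlocal_split(2)[OF x \<phi> \<delta>(1) u] nonlocal_split(2)[OF x \<psi> \<delta>(2) w]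
  ultimately show ?thesis by linarith
qed

text \<open>At a contact point from above, the increments of \<open>u\<close> lie below those of
  \<phi>. A larger radius replaces the former by the latter and so raises the nonlocal terms. Small
  radii thus give the strongest inequality.\<close>

lemma visc_E_antimono:
  assumes x: "x \<in> cl" and \<phi>: "C1_with_gradient cl \<phi> D\<phi>" and \<delta>: "0 < \<delta>" "\<delta> \<le> \<delta>'"
    and u: "u \<in> borel_measurable (restrict_space borel cl)" "\<And>y. y \<in> cl \<Longrightarrow> \<bar>u y\<bar> \<le> R"
    and max: "\<forall>y\<in>cl. u y - \<phi> y \<le> u x - \<phi> x"
  shows "visc_E \<Omega> \<nu> H \<delta>' u \<phi> D\<phi> x \<le> visc_E \<Omega> \<nu> H \<delta> u \<phi> D\<phi> x"
proof -
  have "u (x + z) - u x \<le> \<phi> (x + z) - \<phi> x" if "x + z \<in> cl" for z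
    using max that by fastforce
  then have "nonlocal_op \<Omega> \<nu> (ball 0 \<delta>) \<phi> x + nonlocal_op \<Omega> \<nu> (- ball 0 \<delta>) u x
    \<le> nonlocal_op \<Omega> \<nu> (ball 0 \<delta>') \<phi> x + nonlocal_op \<Omega> \<nu> (- ball 0 \<delta>') u x + 0 * (far_const * \<delta> powr (- \<sigma>))"
    using \<delta> by (intro nonlocal_split_mono[OF x \<phi> \<phi> _ _ u u]) auto
  then show ?thesis unfolding visc_E_def by simp
qed

text \<open>The cutoff vanishes on the ball of radius \<delta>, so adding it to \<phi> changes
  neither the gradient at \<open>x0\<close> nor the near term, while outside the ball of radius
  \<open>r\<close> it forces the contact to be global.\<close>

lemma sub_at_local:
  assumes sub: "sub_at c u x0" and x0: "x0 \<in> cl" and \<phi>: "C1_with_gradient cl \<phi> D\<phi>"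
    and max: "\<And>y. y \<in> cl \<Longrightarrow> dist y x0 < r \<Longrightarrow> u y - \<phi> y \<le> u x0 - \<phi> x0"
    and R: "\<And>y. y \<in> cl \<Longrightarrow> u y \<le> R" and \<delta>: "0 < \<delta>" "\<delta> < r"
  shows "visc_E \<Omega> \<nu> H \<delta> u \<phi> D\<phi> x0 \<le> c"
proof -
  have "bounded (\<phi> ` cl)"
    using compact_continuous_image[OF C1_with_gradient_continuous_on[OF \<phi>] compact_cl] compact_imp_bounded by blast
  then obtain B where B: "\<And>y. y \<in> cl \<Longrightarrow> \<bar>\<phi> y\<bar> \<le> B" unfolding bounded_iff by auto
  have dr: "r\<^sup>2 - \<delta>\<^sup>2 > 0" using \<delta> by (simp add: power_strict_mono)
  \<comment> \<open>Outside radius \<open>r\<close> the cutoff is at least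
    \<open>(r\<^sup>2 - \<delta>\<^sup>2)\<^sup>2\<close>; with this \<open>k\<close> it makes up
    for the largest possible excess of \<open>u - \<phi>\<close> over its value at
    \<open>x0\<close>.\<close>
  define k where "k = (\<bar>R\<bar> + B + \<bar>u x0 - \<phi> x0\<bar>) / (r\<^sup>2 - \<delta>\<^sup>2)\<^sup>2"
  have B0: "B \<ge> 0" using B[OF x0] by linarith
  have k: "k \<ge> 0" using B0 by (simp add: k_def)
  define \<eta> where "\<eta> = (\<lambda>y. (max 0 (norm (y - x0) ^ 2 - \<delta>\<^sup>2))\<^sup>2)"
  define \<psi> where "\<psi> = (\<lambda>y. \<phi> y + k * \<eta> y)"
  define D\<psi> where "D\<psi> = (\<lambda>y. D\<phi> y + k *\<^sub>R ((4 * max 0 (norm (y - x0) ^ 2 - \<delta>\<^sup>2)) *\<^sub>R (y - x0)))"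
  have \<psi>: "C1_with_gradient cl \<psi> D\<psi>"
    unfolding \<psi>_def D\<psi>_def \<eta>_def
    by (intro C1_with_gradient_add \<phi> C1_with_gradient_cmult C1_with_gradient_cutoff)
  have \<eta>0: "\<eta> y = 0" if "dist y x0 < \<delta>" for y
  proof -
    have "norm (y - x0) ^ 2 \<le> \<delta>\<^sup>2" using that by (intro power_mono) (auto simp: dist_norm)
    then show ?thesis by (simp add: \<eta>_def)
  qed
  have \<psi>x0: "\<psi> x0 = \<phi> x0" using \<eta>0[of x0] \<delta> by (simp add: \<psi>_def)
  have "u y - \<psi> y \<le> u x0 - \<psi> x0" if y: "y \<in> cl" for y
  proof (cases "dist y x0 < r")
    case True
    have "0 \<le> k * \<eta> y" using k by (simp add: \<eta>_def)
    then show ?thesis using max[OF y True] \<psi>x0 unfolding \<psi>_def by linarith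
  next
    case False
    have "norm (y - x0) ^ 2 \<ge> r\<^sup>2" using False \<delta> by (intro power_mono) (auto simp: dist_norm)
    then have "\<eta> y \<ge> (r\<^sup>2 - \<delta>\<^sup>2)\<^sup>2" unfolding \<eta>_def using dr by (intro power_mono) auto
    then have "k * \<eta> y \<ge> k * (r\<^sup>2 - \<delta>\<^sup>2)\<^sup>2" using k by (intro mult_left_mono)
    also have "k * (r\<^sup>2 - \<delta>\<^sup>2)\<^sup>2 = \<bar>R\<bar> + B + \<bar>u x0 - \<phi> x0\<bar>" using dr by (simp add: k_def)
    finally show ?thesis using R[OF y] B[OF y] \<psi>x0 unfolding \<psi>_def by linarith
  qed
  then have "visc_E \<Omega> \<nu> H \<delta> u \<psi> D\<psi> x0 \<le> c"
    using sub \<psi> \<delta> unfolding sub_at_def by blast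
  moreover have "nonlocal_op \<Omega> \<nu> (ball 0 \<delta>) \<psi> x0 = nonlocal_op \<Omega> \<nu> (ball 0 \<delta>) \<phi> x0"
    unfolding nonlocal_op_def set_lebesgue_integral_def
  proof (rule Bochner_Integration.integral_cong[OF refl])
    fix z
    have "\<psi> (x0 + z) = \<phi> (x0 + z)" if "norm z < \<delta>" using \<eta>0[of "x0 + z"] that by (simp add: \<psi>_def dist_norm)
    then show "indicat_real (jump_set \<Omega> (ball 0 \<delta>) x0) z *\<^sub>R (\<psi> (x0 + z) - \<psi> x0)
      = indicat_real (jump_set \<Omega> (ball 0 \<delta>) x0) z *\<^sub>R (\<phi> (x0 + z) - \<phi> x0)"
      using \<psi>x0 by (auto simp: jump_set_def indicator_def)
  qed
  moreover have "D\<psi> x0 = D\<phi> x0" by (simp add: D\<psi>_def)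
  ultimately show ?thesis by (simp add: visc_E_def)
qed

lemma nonlocal_far_cong:
  assumes x: "x \<in> \<Omega>" and \<delta>: "\<delta> > 0" and eq: "\<And>y. y \<in> \<Omega> \<Longrightarrow> u y = w y"
    and u: "u \<in> borel_measurable (restrict_space borel cl)"
    and w: "w \<in> borel_measurable (restrict_space borel cl)"
  shows "nonlocal_op \<Omega> \<nu> (- ball 0 \<delta>) u x = nonlocal_op \<Omega> \<nu> (- ball 0 \<delta>) w x"
proof -
  have x': "x \<in> cl" using x \<Omega>_cl by blast
  show ?thesis
    unfolding nonlocal_far_eq set_lebesgue_integral_def
  proof (rule integral_cong_AE)
    show "AE z in \<nu> x. indicator (- ball 0 \<delta>) z *\<^sub>R jump u x z = indicator (- ball 0 \<delta>) z *\<^sub>R jump w x z"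
      using frontier_null[OF x']
    proof eventually_elim
      case (elim z)
      show ?case
      proof (cases "x + z \<in> cl \<and> norm z \<ge> \<delta>")
        case True
        then have "x + z \<in> \<Omega>" using elim \<delta> by (auto simp: frontier_cl)
        then show ?thesis using eq x by simp
      qed (auto simp: indicator_def)
    qed
    show "(\<lambda>z. indicator (- ball 0 \<delta>) z *\<^sub>R jump u x z) \<in> borel_measurable (\<nu> x)"
      "(\<lambda>z. indicator (- ball 0 \<delta>) z *\<^sub>R jump w x z) \<in> borel_measurable (\<nu> x)"
      using jump_measurable[OF u] jump_measurable[OF w] x'
      by (auto intro!: borel_measurable_scaleR borel_measurable_indicator)
  qed
qed

text \<open>Changing boundary values may destroy a global contact but not the contact on a ball
  inside \<Omega>. \<open>sub_at_local\<close> gives the inequality for a small radius, where the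
  far terms agree by \<open>frontier_null\<close>, and \<open>visc_E_antimono\<close> carries it to
  every larger radius.\<close>

lemma sub_at_interior_cong:
  assumes x0: "x0 \<in> \<Omega>" and sub: "sub_at c u x0" and eq: "\<And>y. y \<in> \<Omega> \<Longrightarrow> w y = u y"
    and u: "u \<in> borel_measurable (restrict_space borel cl)" "\<And>y. y \<in> cl \<Longrightarrow> \<bar>u y\<bar> \<le> R"
    and w: "w \<in> borel_measurable (restrict_space borel cl)" "\<And>y. y \<in> cl \<Longrightarrow> \<bar>w y\<bar> \<le> R'"
  shows "sub_at c w x0"
  unfolding sub_at_def
proof (intro allI impI)
  fix \<phi> D\<phi> and \<delta> :: real
  assume \<phi>: "C1_with_gradient cl \<phi> D\<phi>" and max: "\<forall>y\<in>cl. w y - \<phi> y \<le> w x0 - \<phi> x0" and \<delta>: "\<delta> > 0"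
  have x0': "x0 \<in> cl" using x0 \<Omega>_cl by blast
  obtain r where r: "r > 0" "ball x0 r \<subseteq> \<Omega>" using open_\<Omega> x0 openE by blast
  define d where "d = min \<delta> (r / 2)"
  have d: "0 < d" "d \<le> \<delta>" "d < r" using \<delta> r by (auto simp: d_def min_def)
  have "visc_E \<Omega> \<nu> H d u \<phi> D\<phi> x0 \<le> c"
  proof (rule sub_at_local[OF sub x0' \<phi>])
    show "u y - \<phi> y \<le> u x0 - \<phi> x0" if "y \<in> cl" "dist y x0 < r" for y
      using max that r eq[of y] eq[OF x0] by (auto simp: dist_commute subset_iff)
    show "u y \<le> R" if "y \<in> cl" for y using u(2)[OF that] by linarith
  qed (use d in auto)
  moreover have "visc_E \<Omega> \<nu> H d w \<phi> D\<phi> x0 = visc_E \<Omega> \<nu> H d u \<phi> D\<phi> x0"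
    unfolding visc_E_def using nonlocal_far_cong[OF x0 d(1) eq w(1) u(1)] eq[OF x0] by simp
  ultimately show "visc_E \<Omega> \<nu> H \<delta> w \<phi> D\<phi> x0 \<le> c"
    using visc_E_antimono[OF x0' \<phi> d(1,2) w max] by linarith
qed

end

section \<open>Interior cones and boundary values of subsolutions\<close>


lemma C1_with_gradient_lipschitz:
  assumes f: "C1_with_gradient S f Df" and S: "convex S" and B: "\<And>x. x \<in> S \<Longrightarrow> norm (Df x) \<le> B"
    and ab: "a \<in> S" "b \<in> S"
  shows "\<bar>f a - f b\<bar> \<le> B * norm (a - b)"
proof -
  have "norm (f a - f b) \<le> B * norm (a - b)"
  proof (rule differentiable_bound[OF S _ _ ab(1) ab(2)])
    show "(f has_derivative (\<lambda>h. Df x \<bullet> h)) (at x within S)" if "x \<in> S" for x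
      using f that unfolding C1_with_gradient_def by blast
    show "onorm (\<lambda>h. Df x \<bullet> h) \<le> B" if "x \<in> S" for x
    proof (rule onorm_le)
      fix h
      show "norm (Df x \<bullet> h) \<le> B * norm h"
        using Cauchy_Schwarz_ineq2[of "Df x" h] mult_right_mono[OF B[OF that] norm_ge_zero, of h] by simp
    qed
  qed
  then show ?thesis by simp
qed

lemma C1_with_gradient_lipschitz_compact:
  assumes f: "C1_with_gradient S f Df" and S: "convex S" "compact S"
  obtains B where "B \<ge> 1" "\<And>a b. a \<in> S \<Longrightarrow> b \<in> S \<Longrightarrow> \<bar>f a - f b\<bar> \<le> B * norm (a - b)"
proof -
  have "bounded (Df ` S)"
    using f S(2) compact_continuous_image compact_imp_bounded unfolding C1_with_gradient_def by blast
  then obtain B where B: "\<And>x. x \<in> S \<Longrightarrow> norm (Df x) \<le> B" unfolding bounded_iff by auto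
  show ?thesis
  proof (rule that[of "max 1 B"])
    show "\<bar>f a - f b\<bar> \<le> max 1 B * norm (a - b)" if "a \<in> S" "b \<in> S" for a b
      by (rule C1_with_gradient_lipschitz[OF f S(1) _ that]) (use B in fastforce)
  qed simp
qed

lemma powr_dominates:
  fixes c :: real
  assumes "0 \<le> \<sigma>" "\<sigma> < m" "c > 0"
  shows "\<forall>\<^sub>F k in at_top. C1 + C2 * k powr \<sigma> < c * k powr m"
proof -
  have "filterlim (\<lambda>k::real. k powr (m - \<sigma>)) at_top at_top"
    using assms by (intro real_powr_at_top) simp
  then have "\<forall>\<^sub>F k in at_top. k powr (m - \<sigma>) > (\<bar>C1\<bar> + \<bar>C2\<bar>) / c"
    by (simp add: filterlim_at_top_dense)
  then show ?thesis using eventually_ge_at_top[of 1]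
  proof eventually_elim
    case (elim k)
    have k1: "1 \<le> k powr \<sigma>" using elim(2) assms(1) by (rule ge_one_powr_ge_zero)
    have "C1 + C2 * k powr \<sigma> \<le> \<bar>C1\<bar> * k powr \<sigma> + \<bar>C2\<bar> * k powr \<sigma>"
      using k1 mult_left_mono[of 1 "k powr \<sigma>" "\<bar>C1\<bar>"] mult_right_mono[OF abs_ge_self, of "k powr \<sigma>" C2] by simp
    also have "\<dots> = (\<bar>C1\<bar> + \<bar>C2\<bar>) * k powr \<sigma>" by (simp add: algebra_simps)
    also have "\<dots> < (c * k powr (m - \<sigma>)) * k powr \<sigma>"
      using elim(1) assms(3) k1 by (intro mult_strict_right_mono) (auto simp: field_simps)
    also have "\<dots> = c * k powr m" using elim(2) by (simp add: powr_add[symmetric])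
    finally show ?case .
  qed
qed

context nonlocal_dirichlet
begin

text \<open>At a boundary point, moving by \<open>t\<close> along \<open>e\<close> raises the
  defining function by \<open>t\<close>, while a ball of radius \<open>t / (2 * l)\<close>, with
  \<open>l\<close> its Lipschitz constant, lowers it by less than \<open>t / 2\<close>.\<close>

lemma interior_cone_local:
  assumes x: "x \<in> cl"
  shows "\<exists>r c e. 0 < r \<and> 0 < c \<and> c < 1 \<and> norm e = 1 \<and>
    (\<forall>y\<in>cl. dist x y < r \<longrightarrow> (\<forall>t. 0 < t \<and> t \<le> r \<longrightarrow> ball (y + t *\<^sub>R e) (c * t) \<subseteq> \<Omega>))"
proof (cases "x \<in> \<Omega>")
  case True
  then obtain R where R: "R > 0" "ball x R \<subseteq> \<Omega>" using open_\<Omega> openE by blast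
  obtain e :: 'a where e: "norm e = 1" using vector_choose_size[of 1] by auto
  have "ball (y + t *\<^sub>R e) (1/2 * t) \<subseteq> \<Omega>" if "dist x y < R / 3" "0 < t" "t \<le> R / 3" for y t
  proof
    fix w assume "w \<in> ball (y + t *\<^sub>R e) (1/2 * t)"
    then have w: "dist (y + t *\<^sub>R e) w < 1/2 * t" by simp
    have "dist y (y + t *\<^sub>R e) = t" using e that by (simp add: dist_norm)
    then have "dist x w < R"
      using w that dist_triangle[of x w y] dist_triangle[of y w "y + t *\<^sub>R e"] by linarith
    then show "w \<in> \<Omega>" using R by auto
  qed
  then show ?thesis using R e by (intro exI[of _ "R/3"] exI[of _ "1/2"] exI[of _ e]) auto
next
  case False
  then have xf: "x \<in> frontier \<Omega>" using x by (simp add: frontier_cl)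
  obtain r e \<rho> D\<rho> where r: "r > 0" and e: "norm e = 1" and C1: "C1_with_gradient UNIV \<rho> D\<rho>"
    and "\<And>x. D\<rho> x \<bullet> e = 1" and sh: "\<And>x t. \<rho> (x + t *\<^sub>R e) = \<rho> x + t"
    and in\<Omega>: "\<And>y. y \<in> ball x r \<Longrightarrow> y \<in> \<Omega> \<longleftrightarrow> \<rho> y > 0"
    and fr: "\<And>y. y \<in> ball x r \<Longrightarrow> y \<in> frontier \<Omega> \<longleftrightarrow> \<rho> y = 0"
    using boundary_chart[OF C1_boundary open_\<Omega> xf] by blast
  obtain l where l: "l \<ge> 1" "\<And>a b. a \<in> cball x r \<Longrightarrow> b \<in> cball x r \<Longrightarrow> \<bar>\<rho> a - \<rho> b\<bar> \<le> l * norm (a - b)"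
    using C1_with_gradient_lipschitz_compact[OF C1_with_gradient_subset[OF C1], of "cball x r"] by auto
  have "ball (y + t *\<^sub>R e) (1 / (2 * l) * t) \<subseteq> \<Omega>" if y: "y \<in> cl" "dist x y < r / 3" and t: "0 < t" "t \<le> r / 3" for y t
  proof
    fix w assume "w \<in> ball (y + t *\<^sub>R e) (1 / (2 * l) * t)"
    then have w: "dist (y + t *\<^sub>R e) w < 1 / (2 * l) * t" by simp
    have "1 / (2 * l) * t \<le> t" using l t by (simp add: field_simps)
    then have w': "dist (y + t *\<^sub>R e) w < t" using w by linarith
    have yt: "dist y (y + t *\<^sub>R e) = t" using e t by (simp add: dist_norm)
    have xw: "dist x w < r"
      using w' yt y t dist_triangle[of x w y] dist_triangle[of y w "y + t *\<^sub>R e"] by linarith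
    have xyt: "dist x (y + t *\<^sub>R e) < r" using yt y t dist_triangle[of x "y + t *\<^sub>R e" y] by linarith
    have "0 \<le> \<rho> y" using in\<Omega>[of y] fr[of y] y r by (cases "y \<in> \<Omega>") (auto simp: frontier_cl)
    moreover have "\<bar>\<rho> (y + t *\<^sub>R e) - \<rho> w\<bar> \<le> l * norm (y + t *\<^sub>R e - w)"
      using xw xyt by (intro l) auto
    moreover have "l * norm (y + t *\<^sub>R e - w) < l * (1 / (2 * l) * t)"
      using w l by (intro mult_strict_left_mono) (auto simp: dist_norm)
    moreover have "l * (1 / (2 * l) * t) = t / 2" using l by simp
    ultimately have "\<rho> w > 0" using sh[of y t] t by linarith
    then show "w \<in> \<Omega>" using in\<Omega>[of w] xw by simp
  qed
  then show ?thesis using r e l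
    by (intro exI[of _ "r/3"] exI[of _ "1 / (2 * l)"] exI[of _ e]) (auto simp: field_simps)
qed

text \<open>Compactness makes the size and the aperture uniform. The direction still depends on
  \<open>x\<close>, but it is common to all points near \<open>x\<close>; this allows two close
  points to be moved inwards in parallel.\<close>

lemma interior_cone:
  obtains r c where "0 < r" "0 < c" "c < 1"
    "\<And>x. x \<in> cl \<Longrightarrow> \<exists>e. norm e = 1 \<and>
      (\<forall>y\<in>cl. dist x y < r \<longrightarrow> (\<forall>t. 0 < t \<and> t \<le> r \<longrightarrow> ball (y + t *\<^sub>R e) (c * t) \<subseteq> \<Omega>))"
proof -
  obtain r c e where P: "\<And>x. x \<in> cl \<Longrightarrow> 0 < r x \<and> 0 < c x \<and> c x < (1::real) \<and> norm (e x) = 1 \<and>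
    (\<forall>y\<in>cl. dist x y < r x \<longrightarrow> (\<forall>t. 0 < t \<and> t \<le> r x \<longrightarrow> ball (y + t *\<^sub>R e x) (c x * t) \<subseteq> \<Omega>))"
    using interior_cone_local by metis
  have "cl \<subseteq> (\<Union>x\<in>cl. ball x (r x / 2))"
  proof
    fix x assume "x \<in> cl"
    then show "x \<in> (\<Union>x\<in>cl. ball x (r x / 2))" using P[of x] by (intro UN_I[of x]) auto
  qed
  then obtain F where F: "F \<subseteq> cl" "finite F" "cl \<subseteq> (\<Union>x\<in>F. ball x (r x / 2))"
    using compactE_image[OF compact_cl, of cl "\<lambda>x. ball x (r x / 2)"] by (metis open_ball)
  have Fne: "F \<noteq> {}" using F(3) \<Omega>_nonempty by (metis UN_empty closure_eq_empty subset_empty)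
  \<comment> \<open>Half radii: if \<open>x\<close> lies in the half ball about \<open>p\<close>,
    then points within \<open>r0\<close> of \<open>x\<close> lie in the full ball about
    \<open>p\<close>.\<close>
  define r0 where "r0 = Min ((\<lambda>x. r x / 2) ` F)"
  define c0 where "c0 = Min (c ` F)"
  have Frc: "0 < r x" "0 < c x" if "x \<in> F" for x using P[of x] F(1) that by auto
  have r0: "r0 > 0" using F(2) Fne Frc by (simp add: r0_def)
  have r0_le: "r0 \<le> r x / 2" if "x \<in> F" for x
    unfolding r0_def using F(2) that by (intro Min_le) auto
  have c0: "c0 > 0" using F(2) Fne Frc by (simp add: c0_def)
  have c0_le: "c0 \<le> c x" if "x \<in> F" for x
    unfolding c0_def using F(2) that by (intro Min_le) auto
  obtain p0 where "p0 \<in> F" using Fne by blast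
  then have c01: "c0 < 1" using c0_le[of p0] P[of p0] F(1) by fastforce
  show ?thesis
  proof (rule that[OF r0 c0 c01])
    fix x assume "x \<in> cl"
    then obtain p where p: "p \<in> F" "dist p x < r p / 2" using F(3) by auto
    have pc: "p \<in> cl" using p F by blast
    have "ball (y + t *\<^sub>R e p) (c0 * t) \<subseteq> \<Omega>" if y: "y \<in> cl" "dist x y < r0" and t: "0 < t" "t \<le> r0" for y t
    proof -
      have rp: "r0 \<le> r p / 2" using r0_le[OF p(1)] .
      have "dist p y < r p" using dist_triangle[of p y x] p y rp by linarith
      moreover have "t \<le> r p" using t rp P[OF pc] by linarith
      ultimately have "ball (y + t *\<^sub>R e p) (c p * t) \<subseteq> \<Omega>" using P[OF pc] y t by blast
      moreover have "c0 * t \<le> c p * t" using c0_le[OF p(1)] t by (intro mult_right_mono) auto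
      ultimately show ?thesis by (meson subset_ball subset_trans)
    qed
    then show "\<exists>e. norm e = 1 \<and> (\<forall>y\<in>cl. dist x y < r0 \<longrightarrow> (\<forall>t. 0 < t \<and> t \<le> r0 \<longrightarrow> ball (y + t *\<^sub>R e) (c0 * t) \<subseteq> \<Omega>))"
      using P[OF pc] by (intro exI[of _ "e p"]) auto
  qed
qed

lemma coercive:
  obtains c where "c > 0" "\<And>R. R > 0 \<Longrightarrow> \<exists>C\<ge>0. \<forall>x\<in>cl. \<forall>p r. \<bar>r\<bar> \<le> R \<longrightarrow> H x r p \<ge> c * norm p powr m - C"
  using H2 unfolding H2_def by blast

text \<open>Adding a large multiple of a defining function of \<open>\<Omega>\<close> to a test function keeps contact from
  above at a boundary point; since \<open>m > \<sigma>\<close>, the gradient term then beats the nonlocal ones.\<close>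

lemma subsolution_le_boundary_data:
  assumes usc: "usc_on cl u" and R: "\<And>y. y \<in> cl \<Longrightarrow> \<bar>u y\<bar> \<le> R"
    and sub: "\<And>x. x \<in> \<Omega> \<Longrightarrow> sub_at c u x" "\<And>x. x \<in> frontier \<Omega> \<Longrightarrow> u x > g x \<Longrightarrow> sub_at c u x"
    and x0: "x0 \<in> frontier \<Omega>"
  shows "u x0 \<le> g x0"
proof (rule ccontr)
  assume "\<not> u x0 \<le> g x0"
  then have gt: "g x0 < u x0" by simp
  have x0c: "x0 \<in> cl" using x0 by (simp add: frontier_cl)
  define R1 where "R1 = R + 1"
  have R1: "R1 > 0" "\<And>y. y \<in> cl \<Longrightarrow> \<bar>u y\<bar> \<le> R1"
    using R[OF x0c] R unfolding R1_def by (linarith, fastforce)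
  obtain ch where ch: "ch > 0" "\<And>R. R > 0 \<Longrightarrow> \<exists>C\<ge>0. \<forall>x\<in>cl. \<forall>p r. \<bar>r\<bar> \<le> R \<longrightarrow> H x r p \<ge> ch * norm p powr m - C"
    using coercive by blast
  obtain C where C: "C \<ge> 0" "\<And>x p r. x \<in> cl \<Longrightarrow> \<bar>r\<bar> \<le> R1 \<Longrightarrow> H x r p \<ge> ch * norm p powr m - C"
    using ch(2)[OF R1(1)] by blast
  obtain r e \<rho> D\<rho> where r: "r > 0" and e: "norm e = 1" and C1: "C1_with_gradient UNIV \<rho> D\<rho>"
    and De: "\<And>x. D\<rho> x \<bullet> e = 1" and sh: "\<And>x t. \<rho> (x + t *\<^sub>R e) = \<rho> x + t"
    and in\<Omega>: "\<And>y. y \<in> ball x0 r \<Longrightarrow> y \<in> \<Omega> \<longleftrightarrow> \<rho> y > 0"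
    and fr: "\<And>y. y \<in> ball x0 r \<Longrightarrow> y \<in> frontier \<Omega> \<longleftrightarrow> \<rho> y = 0"
    using boundary_chart[OF C1_boundary open_\<Omega> x0] by blast
  have "\<forall>\<^sub>F y in at x0 within frontier \<Omega>. g y < u x0"
    using g x0 gt unfolding continuous_on_def by (auto simp: order_tendsto_iff)
  then obtain s1 where s1: "s1 > 0" "\<And>y. y \<in> frontier \<Omega> \<Longrightarrow> dist y x0 < s1 \<Longrightarrow> g y < u x0"
    using gt unfolding eventually_at by (metis)
  define s where "s = min (s1 / 2) (min (r / 2) (1/2))"
  have s: "s > 0" "s < s1" "s < r" "s < 1" using s1 r by (auto simp: s_def min_def)
  obtain l where l: "l \<ge> 1" "\<And>a b. a \<in> cball x0 s \<Longrightarrow> b \<in> cball x0 s \<Longrightarrow> \<bar>\<rho> a - \<rho> b\<bar> \<le> l * norm (a - b)"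
    using C1_with_gradient_lipschitz_compact[OF C1_with_gradient_subset[OF C1], of "cball x0 s"] by auto
  \<comment> \<open>Comparing values at \<open>x\<close> and \<open>x0\<close> will give
    \<open>norm (x - x0) ^ 2 \<le> 2 * R1 / M = 2 * s\<^sup>2 / 9\<close>, which is below
    \<open>(s / 2)\<^sup>2\<close>.\<close>
  define M where "M = 9 * R1 / s\<^sup>2"
  have M: "M > 0" using R1 s by (simp add: M_def)
  \<comment> \<open>The coefficient of \<open>k powr \<sigma>\<close> in the sum of the near and the
    far term at radius \<open>1 / k\<close>.\<close>
  define L0 where "L0 = (2 * M * s + l) * near_const + 2 * R1 * far_const"
  have "\<forall>\<^sub>F k in at_top. (c + C) + L0 * k powr \<sigma> < (ch / 2 powr m) * k powr m"
    using \<sigma> m ch(1) by (intro powr_dominates) auto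
  \<comment> \<open>\<open>k > 4 * M * s\<close> keeps the gradient of the quadratic term below
    \<open>k / 2\<close>; the other two bounds put the radius \<open>1 / k\<close> below
    \<open>s / 2\<close> and 1.\<close>
  then have "\<forall>\<^sub>F k in at_top. (c + C) + L0 * k powr \<sigma> < (ch / 2 powr m) * k powr m \<and> k > max (4 * M * s) (max 1 (2 / s))"
    using eventually_gt_at_top eventually_conj by blast
  from eventually_happens'[OF _ this] obtain k where k: "(c + C) + L0 * k powr \<sigma> < (ch / 2 powr m) * k powr m"
    "k > 4 * M * s" "k > 1" "k > 2 / s"
    by auto
  define \<phi> where "\<phi> = (\<lambda>x. M * norm (x - x0) ^ 2 + k * \<rho> x)"
  define D\<phi> where "D\<phi> = (\<lambda>x. M *\<^sub>R (2 *\<^sub>R (x - x0)) + k *\<^sub>R D\<rho> x)"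
  have \<phi>: "C1_with_gradient cl \<phi> D\<phi>"
    unfolding \<phi>_def D\<phi>_def
    by (intro C1_with_gradient_add C1_with_gradient_cmult C1_with_gradient_dist_sq C1_with_gradient_subset[OF C1]) auto
  have "compact (cl \<inter> cball x0 s)" using compact_cl by (intro compact_Int_closed) auto
  moreover have "cl \<inter> cball x0 s \<noteq> {}" using x0c s by auto
  moreover have "usc_on (cl \<inter> cball x0 s) (\<lambda>x. u x + - \<phi> x)"
    by (intro usc_on_add usc_on_subset[OF usc] continuous_on_imp_usc_on continuous_on_minus
        continuous_on_subset[OF C1_with_gradient_continuous_on[OF \<phi>]]) auto
  ultimately obtain x where x: "x \<in> cl \<inter> cball x0 s"
    and xmax: "\<And>y. y \<in> cl \<inter> cball x0 s \<Longrightarrow> u y + - \<phi> y \<le> u x + - \<phi> x"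
    using usc_on_attains_sup[of "cl \<inter> cball x0 s" "\<lambda>x. u x + - \<phi> x"] by metis
  have xb: "x \<in> ball x0 r" using x s by auto
  have \<rho>0: "\<rho> x0 = 0" using fr[of x0] x0 r by simp
  have \<rho>x: "0 \<le> \<rho> x" using in\<Omega>[OF xb] fr[OF xb] x by (cases "x \<in> \<Omega>") (auto simp: frontier_cl)
  have "u x0 \<le> u x - \<phi> x" using xmax[of x0] x0c s \<rho>0 by (simp add: \<phi>_def)
  moreover have "0 \<le> k * \<rho> x" using \<rho>x k by simp
  ultimately have ux: "u x0 + M * norm (x - x0) ^ 2 \<le> u x" by (simp add: \<phi>_def)
  have uxx: "u x0 \<le> u x" using ux M by (smt (verit) mult_nonneg_nonneg zero_le_power2)
  \<comment> \<open>A maximum point on the boundary still satisfies the equation: there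
    \<open>g x < u x0 \<le> u x\<close>, as \<open>x\<close> is close to \<open>x0\<close>.\<close>
  have subx: "sub_at c u x"
  proof (cases "x \<in> \<Omega>")
    case False
    then have "x \<in> frontier \<Omega>" using x by (simp add: frontier_cl)
    moreover have "g x < u x" using s1(2)[OF \<open>x \<in> frontier \<Omega>\<close>] x s uxx by (simp add: dist_commute)
    ultimately show ?thesis by (rule sub(2))
  qed (rule sub(1))
  have "M * norm (x - x0) ^ 2 \<le> 2 * R1" using ux R1(2)[of x] R1(2)[OF x0c] x by force
  then have "norm (x - x0) ^ 2 \<le> 2 * s\<^sup>2 / 9" using R1(1) s by (simp add: M_def field_simps)
  also have "\<dots> < (s / 2)\<^sup>2" using s by (simp add: power2_eq_square)
  finally have "norm (x - x0) ^ 2 < (s / 2)\<^sup>2" .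
  then have xs: "norm (x - x0) < s / 2" using s by (intro power2_less_imp_less[of _ "s / 2"]) auto
  \<comment> \<open>This radius balances both terms: the near one, of slope \<open>k\<close>, gives
    \<open>k * \<delta> powr (1 - \<sigma>) = k powr \<sigma>\<close>, and the far one gives
    \<open>\<delta> powr (- \<sigma>) = k powr \<sigma>\<close>.\<close>
  define \<delta> where "\<delta> = 1 / k"
  have \<delta>: "0 < \<delta>" "\<delta> < s / 2" "\<delta> < 1" using k s by (auto simp: \<delta>_def field_simps)
  have xc: "x \<in> cl" using x by simp
  have E: "visc_E \<Omega> \<nu> H \<delta> u \<phi> D\<phi> x \<le> c"
  proof (rule sub_at_local[OF subx xc \<phi>])
    show "u y - \<phi> y \<le> u x - \<phi> x" if "y \<in> cl" "dist y x < s / 2" for y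
    proof -
      have "dist x0 y \<le> s" using that xs dist_triangle[of x0 y x] by (simp add: dist_norm norm_minus_commute)
      then show ?thesis using xmax[of y] that by simp
    qed
    show "u y \<le> R" if "y \<in> cl" for y using R[OF that] by linarith
  qed (use \<delta> in auto)
  have "\<bar>nonlocal_op \<Omega> \<nu> (ball 0 \<delta>) \<phi> x\<bar> \<le> (2 * M * s + k * l) * (near_const * \<delta> powr (1 - \<sigma>))"
  proof (rule near_bound[OF xc \<delta>(1,3)])
    show "0 \<le> 2 * M * s + k * l" using M s k l by simp
    fix z :: 'a assume z: "norm z < \<delta>"
    have a: "x \<in> cball x0 s" "x + z \<in> cball x0 s"
      using x xs z \<delta> norm_triangle_ineq[of "x - x0" z] by (auto simp: dist_norm norm_minus_commute algebra_simps)
    have "norm (x + z - x0) ^ 2 - norm (x - x0) ^ 2 = z \<bullet> (2 *\<^sub>R (x - x0) + z)"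
      by (simp add: power2_norm_eq_inner algebra_simps inner_commute)
    then have "\<bar>norm (x + z - x0) ^ 2 - norm (x - x0) ^ 2\<bar> \<le> norm z * norm (2 *\<^sub>R (x - x0) + z)"
      by (simp add: Cauchy_Schwarz_ineq2)
    also have "norm (2 *\<^sub>R (x - x0) + z) \<le> 2 * s"
      using norm_triangle_ineq[of "2 *\<^sub>R (x - x0)" z] xs z \<delta> by simp
    finally have q: "\<bar>norm (x + z - x0) ^ 2 - norm (x - x0) ^ 2\<bar> \<le> norm z * (2 * s)"
      by (simp add: mult_left_mono)
    have "\<bar>\<phi> (x + z) - \<phi> x\<bar> \<le> M * \<bar>norm (x + z - x0) ^ 2 - norm (x - x0) ^ 2\<bar> + k * \<bar>\<rho> (x + z) - \<rho> x\<bar>"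
    proof -
      have "\<phi> (x + z) - \<phi> x = M * (norm (x + z - x0) ^ 2 - norm (x - x0) ^ 2) + k * (\<rho> (x + z) - \<rho> x)"
        by (simp add: \<phi>_def algebra_simps)
      then show ?thesis using M k abs_triangle_ineq[of "M * (norm (x + z - x0) ^ 2 - norm (x - x0) ^ 2)" "k * (\<rho> (x + z) - \<rho> x)"]
        by (simp add: abs_mult)
    qed
    also have "\<dots> \<le> M * (norm z * (2 * s)) + k * (l * norm z)"
      using q l(2)[OF a(2,1)] M k by (intro add_mono mult_left_mono) auto
    finally show "\<bar>\<phi> (x + z) - \<phi> x\<bar> \<le> (2 * M * s + k * l) * norm z" by (simp add: algebra_simps)
  qed
  also have "\<dots> \<le> (2 * M * s + l) * near_const * k powr \<sigma>"
  proof -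
    have a: "\<delta> powr (1 - \<sigma>) = k powr (\<sigma> - 1)" using k by (simp add: \<delta>_def powr_divide powr_minus_divide[symmetric])
    have b: "k * k powr (\<sigma> - 1) = k powr \<sigma>" using k by (simp add: powr_mult_base)
    have "k powr (\<sigma> - 1) \<le> k powr \<sigma>" using k by (intro powr_mono) auto
    then have d: "2 * M * s * k powr (\<sigma> - 1) \<le> 2 * M * s * k powr \<sigma>"
      using M s by (intro mult_left_mono) auto
    have "(2 * M * s + k * l) * \<delta> powr (1 - \<sigma>) = 2 * M * s * k powr (\<sigma> - 1) + l * (k * k powr (\<sigma> - 1))"
      unfolding a by (simp add: algebra_simps)
    also have "\<dots> \<le> 2 * M * s * k powr \<sigma> + l * k powr \<sigma>" unfolding b using d by linarith
    also have "\<dots> = (2 * M * s + l) * k powr \<sigma>" by (simp add: algebra_simps)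
    finally have "(2 * M * s + k * l) * \<delta> powr (1 - \<sigma>) \<le> (2 * M * s + l) * k powr \<sigma>" .
    then have "near_const * ((2 * M * s + k * l) * \<delta> powr (1 - \<sigma>)) \<le> near_const * ((2 * M * s + l) * k powr \<sigma>)"
      using near_const(1) by (intro mult_left_mono) auto
    then show ?thesis by (simp add: mult_ac)
  qed
  finally have I1: "\<bar>nonlocal_op \<Omega> \<nu> (ball 0 \<delta>) \<phi> x\<bar> \<le> (2 * M * s + l) * near_const * k powr \<sigma>" .
  have "\<bar>nonlocal_op \<Omega> \<nu> (- ball 0 \<delta>) u x\<bar> \<le> (2 * R1) * (far_const * \<delta> powr (- \<sigma>))"
  proof (rule far_bound[OF xc \<delta>(1)])
    show "\<bar>u (x + z) - u x\<bar> \<le> 2 * R1" if "x + z \<in> cl" for z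
      using R1(2)[OF that] R1(2)[OF xc] by linarith
  qed (use R1 in simp)
  also have "\<delta> powr (- \<sigma>) = k powr \<sigma>" using k by (simp add: \<delta>_def powr_divide powr_minus_divide)
  finally have I2: "\<bar>nonlocal_op \<Omega> \<nu> (- ball 0 \<delta>) u x\<bar> \<le> 2 * R1 * far_const * k powr \<sigma>" by (simp add: mult_ac)
  have "norm (D\<phi> x) \<ge> k / 2"
  proof -
    have "1 \<le> norm (D\<rho> x)" using De[of x] Cauchy_Schwarz_ineq2[of "D\<rho> x" e] e by simp
    then have "k \<le> norm (k *\<^sub>R D\<rho> x)" using k by simp
    moreover have "norm (M *\<^sub>R (2 *\<^sub>R (x - x0))) \<le> k / 2"
    proof -
      have "M * norm (x - x0) \<le> M * (s / 2)" using xs M by (intro mult_left_mono) auto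
      moreover have "M * (s / 2) = (M * s) / 2" "4 * M * s = 4 * (M * s)" "0 \<le> M * s" using M s by simp_all
      moreover have "norm (M *\<^sub>R (2 *\<^sub>R (x - x0))) = 2 * (M * norm (x - x0))" using M by simp
      ultimately show ?thesis using k(2) by linarith
    qed
    moreover have "norm (k *\<^sub>R D\<rho> x) - norm (M *\<^sub>R (2 *\<^sub>R (x - x0))) \<le> norm (D\<phi> x)"
      unfolding D\<phi>_def using norm_diff_ineq[of "k *\<^sub>R D\<rho> x" "M *\<^sub>R (2 *\<^sub>R (x - x0))"] by (simp add: add.commute)
    ultimately show ?thesis by linarith
  qed
  then have "(k / 2) powr m \<le> norm (D\<phi> x) powr m" using k \<sigma> m by (intro powr_mono2) auto
  then have "ch * (k / 2) powr m \<le> ch * norm (D\<phi> x) powr m" using ch by simp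
  then have "ch / 2 powr m * k powr m - C \<le> H x (u x) (D\<phi> x)"
    using C(2)[OF xc R1(2)[OF xc], of "D\<phi> x"] k by (simp add: powr_divide)
  then have "ch / 2 powr m * k powr m - C \<le> c + (2 * M * s + l) * near_const * k powr \<sigma> + 2 * R1 * far_const * k powr \<sigma>"
    using E I1 I2 unfolding visc_E_def by linarith
  also have "\<dots> = c + L0 * k powr \<sigma>" by (simp add: L0_def algebra_simps)
  finally show False using k(1) by linarith
qed

end

section \<open>Lipschitz regularity of subsolutions\<close>


context nonlocal_dirichlet
begin

definition subs :: "real \<Rightarrow> ('a \<Rightarrow> real) set" where
  "subs R = {u. usc_on cl u \<and> (\<forall>y\<in>cl. \<bar>u y\<bar> \<le> R) \<and> (\<forall>x\<in>\<Omega>. sub_at 0 u x)}"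

text \<open>\<open>A\<close> is uniform over all subsolutions bounded by \<open>R\<close>. Perron's
  method relies on this, since the supremum of a family keeps a common Lipschitz constant.\<close>

definition equi_holder :: "real \<Rightarrow> real \<Rightarrow> bool" where
  "equi_holder R \<gamma> \<longleftrightarrow> (\<exists>A\<ge>0. \<forall>u\<in>subs R. \<forall>x\<in>\<Omega>. \<forall>y\<in>\<Omega>. \<bar>u x - u y\<bar> \<le> A * norm (x - y) powr \<gamma>)"

text \<open>Maximise \<open>u\<close> minus a regularised cone of slope \<open>L\<close> with vertex
  \<open>y\<close>. The cutoff, whose height is fitted to the known Hoelder bound, keeps the maximum
  point \<open>x\<close> inside the ball. If \<open>x\<close> were at distance \<mu> or more from
  \<open>y\<close>, the test function would have slope at least \<open>L / 2\<close> there, against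
  \<open>big\<close>. Hence \<open>x\<close> is close to \<open>y\<close>, and the maximum property
  is a one-sided Lipschitz bound that becomes sharp as \<mu> tends to 0.\<close>

lemma subs_contact_near:
  assumes u: "u \<in> subs R" and R: "R > 0"
    and ch: "ch > 0" "C \<ge> 0" "\<And>x p r. x \<in> cl \<Longrightarrow> \<bar>r\<bar> \<le> R \<Longrightarrow> H x r p \<ge> ch * norm p powr m - C"
    and \<gamma>: "0 \<le> \<gamma>" and A: "A \<ge> 0" "\<And>x y. x \<in> \<Omega> \<Longrightarrow> y \<in> \<Omega> \<Longrightarrow> \<bar>u x - u y\<bar> \<le> A * norm (x - y) powr \<gamma>"
    and t: "0 < t" "t \<le> 1" "ball y t \<subseteq> \<Omega>" and L: "L > 0" and \<mu>: "\<mu> > 0" and B: "0 \<le> B"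
    and far: "\<And>x. x \<in> \<Omega> \<Longrightarrow> \<bar>nonlocal_op \<Omega> \<nu> (- ball 0 (t/4)) u x\<bar> \<le> B"
    and big: "ch * (L / 2) powr m > C + (L + 128 * (A + 1) * t powr (\<gamma> - 1)) * (near_const * t powr (1 - \<sigma>)) + B"
  shows "\<exists>x\<in>\<Omega>. norm (x - y) < \<mu> \<and> (\<forall>w. norm (w - y) < t / 4 \<longrightarrow> u w - L * (\<mu> + norm (w - y)) \<le> u x)"
proof -
  have usc: "usc_on cl u" and Rb: "\<And>y. y \<in> cl \<Longrightarrow> \<bar>u y\<bar> \<le> R" and sub: "\<And>x. x \<in> \<Omega> \<Longrightarrow> sub_at 0 u x"
    using u unfolding subs_def by auto
  have ball_cl: "x \<in> cl" "x \<in> \<Omega>" if "norm (x - y) < t" for x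
  proof -
    have "x \<in> ball y t" using that by (metis dist_commute dist_norm mem_ball)
    then show "x \<in> \<Omega>" by (rule subsetD[OF t(3)])
    then show "x \<in> cl" by (rule subsetD[OF \<Omega>_cl])
  qed
  \<comment> \<open>At distance at least \<open>t / 2\<close> from \<open>y\<close> the cutoff is at
    least \<open>9 / 256 * t ^ 4\<close>, so \<open>k\<close> times it is at least
    \<open>9 / 8 * (A + 1) * t powr \<gamma>\<close>, more than \<open>u\<close> can gain there. Its
    gradient is at most \<open>4 * k * t ^ 3\<close>, the origin of the factor 128.\<close>
  define k where "k = 32 * (A + 1) * t powr (\<gamma> - 4)"
  have k: "k > 0" using A t by (simp add: k_def)
  have kt: "k * t ^ 4 = 32 * (A + 1) * t powr \<gamma>" "k * t ^ 3 = 32 * (A + 1) * t powr (\<gamma> - 1)"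
  proof -
    have "t ^ 4 = t powr 4" "t ^ 3 = t powr 3"
      using t(1) powr_realpow[of t 4] powr_realpow[of t 3] by simp_all
    then show "k * t ^ 4 = 32 * (A + 1) * t powr \<gamma>" "k * t ^ 3 = 32 * (A + 1) * t powr (\<gamma> - 1)"
      by (simp_all add: k_def mult.assoc flip: powr_add)
  qed
  define \<eta> where "\<eta> = (\<lambda>x. (max 0 (norm (x - y) ^ 2 - (t/4)\<^sup>2))\<^sup>2)"
  define \<phi> where "\<phi> = (\<lambda>x. L * sqrt (\<mu>\<^sup>2 + norm (x - y) ^ 2) + k * \<eta> x)"
  define \<phi>' where "\<phi>' = (\<lambda>x. L / sqrt (\<mu>\<^sup>2 + norm (x - y) ^ 2) + k * (4 * max 0 (norm (x - y) ^ 2 - (t/4)\<^sup>2)))"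
  define D\<phi> where "D\<phi> = (\<lambda>x. \<phi>' x *\<^sub>R (x - y))"
  have \<phi>U: "C1_with_gradient S \<phi> D\<phi>" for S
  proof -
    have "C1_with_gradient S \<phi> (\<lambda>x. L *\<^sub>R ((1 / sqrt (\<mu>\<^sup>2 + norm (x - y) ^ 2)) *\<^sub>R (x - y)) +
      k *\<^sub>R ((4 * max 0 (norm (x - y) ^ 2 - (t/4)\<^sup>2)) *\<^sub>R (x - y)))"
      unfolding \<phi>_def \<eta>_def
      by (intro C1_with_gradient_add C1_with_gradient_cmult C1_with_gradient_sqrt C1_with_gradient_cutoff \<mu>)
    then show ?thesis by (simp add: D\<phi>_def \<phi>'_def scaleR_add_left)
  qed
  have sq: "norm (x - y) \<le> sqrt (\<mu>\<^sup>2 + norm (x - y) ^ 2)" "\<mu> \<le> sqrt (\<mu>\<^sup>2 + norm (x - y) ^ 2)"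
    "0 < sqrt (\<mu>\<^sup>2 + norm (x - y) ^ 2)" "sqrt (\<mu>\<^sup>2 + norm (x - y) ^ 2) \<le> \<mu> + norm (x - y)" for x
    using \<mu> real_sqrt_sum_squares_triangle_ineq[of \<mu> 0 0 "norm (x - y)"]
    by (auto intro!: real_le_rsqrt add_pos_nonneg)
  have \<eta>0: "0 \<le> \<eta> x" for x by (simp add: \<eta>_def)
  have \<eta>_small: "\<eta> x = 0" if "norm (x - y) < t / 4" for x
  proof -
    have "norm (x - y) ^ 2 \<le> (t/4)\<^sup>2" using that by (intro power_mono) auto
    then show ?thesis by (simp add: \<eta>_def)
  qed
  have \<phi>y: "\<phi> y = L * \<mu>" using \<eta>_small[of y] t \<mu> by (simp add: \<phi>_def)
  have \<phi>lo: "L * \<mu> \<le> \<phi> x" for x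
    using sq(2)[of x] \<eta>0[of x] k L by (simp add: \<phi>_def add_increasing2)
  have outer: "u x - \<phi> x < u y - \<phi> y" if x: "t / 2 \<le> norm (x - y)" "norm (x - y) < t" for x
  proof -
    have "norm (x - y) ^ 2 \<ge> (t/2)\<^sup>2" using x t by (intro power_mono) auto
    then have "3 * t\<^sup>2 / 16 \<le> norm (x - y) ^ 2 - (t/4)\<^sup>2" by (simp add: power2_eq_square field_simps)
    then have "3 * t\<^sup>2 / 16 \<le> max 0 (norm (x - y) ^ 2 - (t/4)\<^sup>2)" by (rule order_trans) simp
    then have "(3 * t\<^sup>2 / 16)\<^sup>2 \<le> \<eta> x" unfolding \<eta>_def by (intro power_mono) auto
    then have "k * (3 * t\<^sup>2 / 16)\<^sup>2 \<le> k * \<eta> x" using k by (intro mult_left_mono) auto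
    moreover have "k * (3 * t\<^sup>2 / 16)\<^sup>2 = 9 / 256 * (k * t ^ 4)" by (simp add: power2_eq_square power4_eq_xxxx)
    moreover have "k * t ^ 4 = 32 * ((A + 1) * t powr \<gamma>)" using kt(1) by (simp add: mult.assoc)
    ultimately have kk: "9 / 8 * ((A + 1) * t powr \<gamma>) \<le> k * \<eta> x" by linarith
    have "norm (x - y) powr \<gamma> \<le> t powr \<gamma>" using x \<gamma> by (intro powr_mono2) auto
    then have "A * norm (x - y) powr \<gamma> \<le> A * t powr \<gamma>" using A(1) by (rule mult_left_mono)
    moreover have "\<bar>u x - u y\<bar> \<le> A * norm (x - y) powr \<gamma>"
      using x t by (intro A(2) ball_cl) auto
    moreover have "t powr \<gamma> > 0" using t by simp
    moreover have "(A + 1) * t powr \<gamma> = A * t powr \<gamma> + t powr \<gamma>" "0 \<le> A * t powr \<gamma>"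
      using A(1) by (simp_all add: algebra_simps)
    ultimately have "u x - u y < k * \<eta> x" using kk by linarith
    moreover have "L * \<mu> \<le> L * sqrt (\<mu>\<^sup>2 + norm (x - y) ^ 2)" using sq(2) L by simp
    ultimately show ?thesis unfolding \<phi>y by (simp add: \<phi>_def)
  qed
  have "cball y (t/2) \<subseteq> cl"
  proof
    fix w assume "w \<in> cball y (t/2)"
    then have "norm (w - y) < t" using t(1) by (simp add: dist_norm norm_minus_commute)
    then show "w \<in> cl" by (rule ball_cl)
  qed
  then have "usc_on (cball y (t/2)) (\<lambda>x. u x + - \<phi> x)"
    by (intro usc_on_add usc_on_subset[OF usc] continuous_on_imp_usc_on continuous_on_minus
        C1_with_gradient_continuous_on[OF \<phi>U])
  from usc_on_attains_sup[OF compact_cball _ this]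
  obtain x where x: "x \<in> cball y (t/2)" and xmax: "\<And>w. w \<in> cball y (t/2) \<Longrightarrow> u w + - \<phi> w \<le> u x + - \<phi> x"
    using t(1) by auto
  have xy: "u y - \<phi> y \<le> u x - \<phi> x" using xmax[of y] t by simp
  have xt: "norm (x - y) < t / 2" using outer[of x] xy x t by (force simp: dist_norm norm_minus_commute)
  have xmax': "u w - \<phi> w \<le> u x - \<phi> x" if "norm (w - y) < t" for w
    using xmax[of w] outer[of w] xy that by (cases "norm (w - y) \<le> t / 2") (auto simp: dist_norm norm_minus_commute)
  have x\<Omega>: "x \<in> \<Omega>" "x \<in> cl" using ball_cl[of x] xt t by auto
  have E: "visc_E \<Omega> \<nu> H (t/4) u \<phi> D\<phi> x \<le> 0"
  proof (rule sub_at_local[OF sub[OF x\<Omega>(1)] x\<Omega>(2) \<phi>U])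
    show "u w - \<phi> w \<le> u x - \<phi> x" if "dist w x < t / 2" for w
      using that xt norm_triangle_ineq[of "w - x" "x - y"] by (intro xmax') (simp add: dist_norm)
    show "u w \<le> R" if "w \<in> cl" for w using Rb[OF that] by linarith
  qed (use t in auto)
  let ?K = "L + 128 * (A + 1) * t powr (\<gamma> - 1)"
  have Dbd: "norm (D\<phi> w) \<le> ?K" if w: "w \<in> ball y t" for w
  proof -
    have wt: "norm (w - y) < t" using w by (simp add: dist_norm norm_minus_commute)
    have "norm (w - y) ^ 2 \<le> t\<^sup>2" using wt by (intro power_mono) auto
    then have m1: "max 0 (norm (w - y) ^ 2 - (t/4)\<^sup>2) \<le> t\<^sup>2" by (smt (verit) zero_le_power2)
    have "L / sqrt (\<mu>\<^sup>2 + norm (w - y) ^ 2) * norm (w - y) \<le> L"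
      using sq(1,3)[of w] L by (simp add: divide_le_eq mult_left_mono)
    moreover have "k * (4 * max 0 (norm (w - y) ^ 2 - (t/4)\<^sup>2)) * norm (w - y) \<le> k * (4 * t\<^sup>2) * t"
      using m1 wt k by (intro mult_mono) auto
    moreover have "k * (4 * t\<^sup>2) * t = 4 * (k * t ^ 3)" by (simp add: power2_eq_square power3_eq_cube)
    moreover have "0 \<le> \<phi>' w" using L k sq(3)[of w] by (simp add: \<phi>'_def)
    ultimately show ?thesis unfolding D\<phi>_def kt by (simp add: \<phi>'_def distrib_right)
  qed
  have K0: "0 \<le> ?K" using L A(1) by simp
  have "\<bar>nonlocal_op \<Omega> \<nu> (ball 0 (t/4)) \<phi> x\<bar> \<le> ?K * (near_const * (t/4) powr (1 - \<sigma>))"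
  proof (rule near_bound[OF x\<Omega>(2) _ _ K0])
    fix z :: 'a assume z: "norm z < t/4"
    have "norm (x + z - y) \<le> norm (x - y) + norm z"
      using norm_triangle_ineq[of "x - y" z] by (simp add: algebra_simps)
    then have "norm (x + z - y) < t" using xt z t(1) by linarith
    then have "\<bar>\<phi> (x + z) - \<phi> x\<bar> \<le> ?K * norm (x + z - x)"
      using xt t by (intro C1_with_gradient_lipschitz[OF \<phi>U convex_ball Dbd]) (auto simp: dist_norm norm_minus_commute)
    then show "\<bar>\<phi> (x + z) - \<phi> x\<bar> \<le> ?K * norm z" by simp
  qed (use t in auto)
  also have "\<dots> \<le> ?K * (near_const * t powr (1 - \<sigma>))"
    using K0 near_const(1) t \<sigma> by (intro mult_left_mono powr_mono2) auto
  finally have I1: "\<bar>nonlocal_op \<Omega> \<nu> (ball 0 (t/4)) \<phi> x\<bar> \<le> ?K * (near_const * t powr (1 - \<sigma>))" .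
  have x\<mu>: "norm (x - y) < \<mu>"
  proof (rule ccontr)
    assume "\<not> norm (x - y) < \<mu>"
    then have ge: "\<mu> \<le> norm (x - y)" by simp
    \<comment> \<open>At distance at least \<mu> from the vertex the regularisation reduces the
      slope of the cone by no more than a factor 2.\<close>
    have "sqrt (\<mu>\<^sup>2 + norm (x - y) ^ 2) \<le> 2 * norm (x - y)" using sq(4)[of x] ge by simp
    then have "L / 2 \<le> L / sqrt (\<mu>\<^sup>2 + norm (x - y) ^ 2) * norm (x - y)"
      using sq(3)[of x] L by (simp add: field_simps)
    also have "\<dots> \<le> \<phi>' x * norm (x - y)" using k by (intro mult_right_mono) (auto simp: \<phi>'_def)
    also have "\<dots> = norm (D\<phi> x)" using L k sq(3)[of x] by (simp add: D\<phi>_def \<phi>'_def)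
    finally have "(L / 2) powr m \<le> norm (D\<phi> x) powr m" using L \<sigma> m by (intro powr_mono2) auto
    then have "ch * (L / 2) powr m \<le> ch * norm (D\<phi> x) powr m" using ch(1) by simp
    then have "ch * (L / 2) powr m - C \<le> H x (u x) (D\<phi> x)"
      using ch(3)[OF x\<Omega>(2) Rb[OF x\<Omega>(2)], of "D\<phi> x"] by linarith
    then show False using E I1 far[OF x\<Omega>(1)] big unfolding visc_E_def by linarith
  qed
  have "u w - L * (\<mu> + norm (w - y)) \<le> u x" if w: "norm (w - y) < t / 4" for w
  proof -
    have "\<phi> w \<le> L * (\<mu> + norm (w - y))" using \<eta>_small[OF w] sq(4)[of w] L by (simp add: \<phi>_def)
    moreover have "u w - \<phi> w \<le> u x - \<phi> x" using w t by (intro xmax') auto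
    moreover have "0 \<le> \<phi> x" using \<phi>lo[of x] L \<mu> mult_pos_pos[of L \<mu>] by linarith
    ultimately show ?thesis by linarith
  qed
  then show ?thesis using x\<Omega>(1) x\<mu> by blast
qed

text \<open>With slope \<open>L = \<Lambda> * t powr (- a)\<close> and \<open>q = a * m\<close>,
  coercivity yields order \<open>t powr (- q)\<close>. The far term is no larger because
  \<open>\<sigma> - \<gamma> \<le> q\<close>, and the near term carries the extra factor
  \<open>t powr \<kappa>\<close>. Excluding \<open>\<gamma> = \<sigma>\<close> avoids the logarithm
  in \<open>h_growth\<close>.\<close>

lemma equi_holder_local_lipschitz:
  assumes R: "R > 0" and hold: "equi_holder R \<gamma>" and \<gamma>: "0 \<le> \<gamma>" "\<gamma> \<le> 1" "\<gamma> \<noteq> \<sigma>"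
    and a: "0 \<le> a" "a \<le> 1" "\<sigma> - \<gamma> \<le> a * m"
  shows "\<exists>\<Lambda>>0. \<exists>t0>0. t0 \<le> 1 \<and> (\<forall>u\<in>subs R. \<forall>y t. 0 < t \<and> t \<le> t0 \<and> ball y t \<subseteq> \<Omega> \<longrightarrow>
    (\<forall>x. norm (x - y) < t / 4 \<longrightarrow> u x - u y \<le> \<Lambda> * t powr (- a) * norm (x - y)))"
proof -
  obtain A where A: "A \<ge> 0" "\<And>u x y. u \<in> subs R \<Longrightarrow> x \<in> \<Omega> \<Longrightarrow> y \<in> \<Omega> \<Longrightarrow> \<bar>u x - u y\<bar> \<le> A * norm (x - y) powr \<gamma>"
    using hold unfolding equi_holder_def by blast
  obtain ch where ch: "ch > 0" "\<And>R. R > 0 \<Longrightarrow> \<exists>C\<ge>0. \<forall>x\<in>cl. \<forall>p r. \<bar>r\<bar> \<le> R \<longrightarrow> H x r p \<ge> ch * norm p powr m - C"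
    using coercive by blast
  obtain C where C: "C \<ge> 0" "\<And>x p r. x \<in> cl \<Longrightarrow> \<bar>r\<bar> \<le> R \<Longrightarrow> H x r p \<ge> ch * norm p powr m - C"
    using ch(2)[OF R] by blast
  obtain Ch where Ch: "Ch > 0" "\<And>x \<delta> f A. x \<in> cl \<Longrightarrow> \<delta> > 0 \<Longrightarrow> A \<ge> 0 \<Longrightarrow>
    (\<And>z. norm z \<ge> \<delta> \<Longrightarrow> x + z \<in> \<Omega> \<Longrightarrow> \<bar>f (x + z) - f x\<bar> \<le> A * norm z powr \<gamma>) \<Longrightarrow>
    \<bar>nonlocal_op \<Omega> \<nu> (- ball 0 \<delta>) f x\<bar> \<le> A * (Ch * h_growth \<gamma> \<sigma> \<delta>)"
    using far_bound_holder[OF \<gamma>(1,2)] by blast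
  define q where "q = a * m"
  have mpos: "m > 0" using \<sigma> m by simp
  have q: "0 \<le> q" "\<sigma> - \<gamma> \<le> q" using a mpos by (auto simp: q_def)
  \<comment> \<open>The near term is \<open>L * t powr (1 - \<sigma>) = \<Lambda> * t powr \<kappa>
    * t powr (- q)\<close>. Positivity of \<kappa> means \<open>a * (1 - m) < 1 - \<sigma>\<close>,
    which follows from \<open>m > \<sigma>\<close> and \<open>a \<le> 1\<close>.\<close>
  define \<kappa> where "\<kappa> = 1 - \<sigma> - a + q"
  have "a * (1 - m) < 1 - \<sigma>"
  proof (cases "m \<le> 1")
    case True
    then have "a * (1 - m) \<le> 1 * (1 - m)" using a by (intro mult_right_mono) auto
    then show ?thesis using m by simp
  next
    case False
    then have "a * (1 - m) \<le> 0" using a by (intro mult_nonneg_nonpos) auto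
    then show ?thesis using \<sigma> by linarith
  qed
  then have \<kappa>: "\<kappa> > 0" by (simp add: \<kappa>_def q_def algebra_simps)
  \<comment> \<open>The coefficients of \<open>t powr (- q)\<close> in the bound to be beaten. The
    summand 1 is reserved for the near term of slope \<open>L\<close>: once \<Lambda> is fixed from
    \<open>Q\<close>, the choice of \<open>t0\<close> makes that term small enough, so the choices
    are not circular.\<close>
  define Q where "Q = C + 128 * (A + 1) * near_const + 4 * A * Ch + 1"
  have "\<forall>\<^sub>F k in at_top. Q + 0 * k powr 0 < ch / 2 powr m * k powr m"
    using mpos ch by (intro powr_dominates) auto
  then have "\<forall>\<^sub>F k in at_top. Q + 0 * k powr 0 < ch / 2 powr m * k powr m \<and> k > 0"
    using eventually_gt_at_top eventually_conj by blast
  from eventually_happens'[OF _ this] obtain \<Lambda> where \<Lambda>: "Q < ch / 2 powr m * \<Lambda> powr m" "\<Lambda> > 0" by auto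
  define t0 where "t0 = min 1 ((1 / (near_const * \<Lambda>)) powr (1 / \<kappa>))"
  have nL: "near_const * \<Lambda> > 0" using near_const(1) \<Lambda> by simp
  have t0: "0 < t0" "t0 \<le> 1" using nL by (auto simp: t0_def)
  have "t0 powr \<kappa> \<le> ((1 / (near_const * \<Lambda>)) powr (1 / \<kappa>)) powr \<kappa>"
    using t0 \<kappa> by (intro powr_mono2) (auto simp: t0_def)
  also have "\<dots> = 1 / (near_const * \<Lambda>)" using nL \<kappa> by (simp add: powr_powr)
  finally have t0\<kappa>: "near_const * \<Lambda> * t0 powr \<kappa> \<le> 1" using nL by (simp add: field_simps)
  have main: "u x - u y \<le> \<Lambda> * t powr (- a) * norm (x - y)"
    if u: "u \<in> subs R" and t: "0 < t" "t \<le> t0" "ball y t \<subseteq> \<Omega>" and x: "norm (x - y) < t / 4" for u y t x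
  proof -
    have usc: "usc_on cl u" using u unfolding subs_def by auto
    define L where "L = \<Lambda> * t powr (- a)"
    have L: "L > 0" using \<Lambda> t by (simp add: L_def)
    have t1: "t \<le> 1" using t t0 by simp
    have tq1: "1 \<le> t powr (- q)"
      using powr_mono'[of "- q" 0 t] t t1 q by simp
    have tq2: "t powr (\<gamma> - \<sigma>) \<le> t powr (- q)" using t t1 q by (intro powr_mono') auto
    have h: "h_growth \<gamma> \<sigma> (t/4) \<le> 4 * t powr (- q)" "0 \<le> h_growth \<gamma> \<sigma> (t/4)"
    proof -
      show "h_growth \<gamma> \<sigma> (t/4) \<le> 4 * t powr (- q)"
      proof (cases "\<gamma> < \<sigma>")
        case True
        have "(t/4) powr (\<gamma> - \<sigma>) = 4 powr (\<sigma> - \<gamma>) * t powr (\<gamma> - \<sigma>)"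
          using t by (simp add: powr_divide powr_minus_divide[symmetric] field_simps powr_diff)
        also have "\<dots> \<le> 4 powr 1 * t powr (- q)"
        proof (intro mult_mono tq2)
          show "4 powr (\<sigma> - \<gamma>) \<le> (4::real) powr 1" using \<sigma> \<gamma> by (intro powr_mono) auto
        qed auto
        finally show ?thesis using True by (simp add: h_growth_def)
      next
        case False
        then show ?thesis using \<gamma> tq1 by (simp add: h_growth_def)
      qed
    qed (simp add: h_growth_def)
    define B where "B = A * (Ch * (4 * t powr (- q)))"
    have B0: "0 \<le> B" using A Ch by (simp add: B_def)
    have far: "\<bar>nonlocal_op \<Omega> \<nu> (- ball 0 (t/4)) u w\<bar> \<le> B" if w: "w \<in> \<Omega>" for w
    proof -
      have "\<bar>nonlocal_op \<Omega> \<nu> (- ball 0 (t/4)) u w\<bar> \<le> A * (Ch * h_growth \<gamma> \<sigma> (t/4))"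
      proof (rule Ch(2))
        show "w \<in> cl" using w \<Omega>_cl by blast
        show "\<bar>u (w + z) - u w\<bar> \<le> A * norm z powr \<gamma>" if "w + z \<in> \<Omega>" for z
          using A(2)[OF u that w] by simp
      qed (use t A in auto)
      also have "\<dots> \<le> B" unfolding B_def using A Ch h by (intro mult_left_mono) auto
      finally show ?thesis .
    qed
    have big: "ch * (L / 2) powr m > C + (L + 128 * (A + 1) * t powr (\<gamma> - 1)) * (near_const * t powr (1 - \<sigma>)) + B"
    proof -
      have e1: "L * t powr (1 - \<sigma>) = \<Lambda> * t powr \<kappa> * t powr (- q)"
        by (simp add: L_def \<kappa>_def mult.assoc powr_add[symmetric])
      have e2: "t powr (\<gamma> - 1) * t powr (1 - \<sigma>) = t powr (\<gamma> - \<sigma>)"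
        by (simp add: powr_add[symmetric])
      have "t powr \<kappa> \<le> t0 powr \<kappa>" using t \<kappa> by (intro powr_mono2) auto
      then have "near_const * \<Lambda> * t powr \<kappa> \<le> 1"
        using t0\<kappa> mult_left_mono[of "t powr \<kappa>" "t0 powr \<kappa>" "near_const * \<Lambda>"] nL by linarith
      then have "near_const * \<Lambda> * t powr \<kappa> * t powr (- q) \<le> 1 * t powr (- q)"
        by (intro mult_right_mono) auto
      then have f1: "near_const * (L * t powr (1 - \<sigma>)) \<le> t powr (- q)" unfolding e1 by (simp add: mult_ac)
      have f2: "128 * (A + 1) * near_const * t powr (\<gamma> - \<sigma>) \<le> 128 * (A + 1) * near_const * t powr (- q)"
        using tq2 A(1) near_const(1) by (intro mult_left_mono) auto
      have f3: "C \<le> C * t powr (- q)" using tq1 C(1) mult_left_mono[of 1 "t powr (- q)" C] by simp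
      have "(L + 128 * (A + 1) * t powr (\<gamma> - 1)) * (near_const * t powr (1 - \<sigma>))
        = near_const * (L * t powr (1 - \<sigma>)) + 128 * (A + 1) * near_const * (t powr (\<gamma> - 1) * t powr (1 - \<sigma>))"
        by (simp add: algebra_simps)
      also have "\<dots> \<le> t powr (- q) + 128 * (A + 1) * near_const * t powr (- q)"
        unfolding e2 using f1 f2 by linarith
      finally have "C + (L + 128 * (A + 1) * t powr (\<gamma> - 1)) * (near_const * t powr (1 - \<sigma>)) + B
        \<le> C * t powr (- q) + (t powr (- q) + 128 * (A + 1) * near_const * t powr (- q)) + B"
        using f3 by linarith
      also have "\<dots> = Q * t powr (- q)" by (simp add: Q_def B_def algebra_simps)
      also have "\<dots> < ch / 2 powr m * \<Lambda> powr m * t powr (- q)"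
        using \<Lambda> t by (intro mult_strict_right_mono) auto
      also have "\<dots> = ch * (L / 2) powr m"
        using \<Lambda> t by (simp add: L_def q_def powr_divide powr_mult powr_powr)
      finally show ?thesis .
    qed
    have yc: "y \<in> cl" using t \<Omega>_cl by (meson centre_in_ball subsetD)
    \<comment> \<open>As \<mu> shrinks, the contact point \<open>w\<close> tends to
      \<open>y\<close>, and upper semicontinuity at \<open>y\<close> replaces \<open>u w\<close> by
      \<open>u y\<close>.\<close>
    have "u x \<le> u y + L * norm (x - y) + e" if e: "e > 0" for e
    proof -
      obtain U where U: "open U" "y \<in> U" "\<forall>w\<in>U \<inter> cl. u w < u y + e / 2"
        using usc[unfolded usc_on_iff, rule_format, OF yc, of "u y + e / 2"] e by auto
      obtain d where d: "d > 0" "ball y d \<subseteq> U" using U openE by blast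
      define \<mu> where "\<mu> = min d (e / (2 * L))"
      have \<mu>: "\<mu> > 0" "\<mu> \<le> d" "\<mu> \<le> e / (2 * L)" using d e L by (auto simp: \<mu>_def)
      obtain w where w: "w \<in> \<Omega>" "norm (w - y) < \<mu>" "u x - L * (\<mu> + norm (x - y)) \<le> u w"
        using subs_contact_near[OF u R ch(1) C \<gamma>(1) A(1) A(2)[OF u] t(1) t1 t(3) L \<mu>(1) B0 far big] x by blast
      have "w \<in> U \<inter> cl" using w \<mu> d \<Omega>_cl by (auto simp: subset_iff dist_norm norm_minus_commute)
      then have "u w < u y + e / 2" using U by blast
      moreover have "L * \<mu> \<le> e / 2" using \<mu>(3) L by (simp add: field_simps)
      ultimately show ?thesis using w(3) by (simp add: distrib_left)
    qed
    then show ?thesis unfolding L_def[symmetric] by (metis add.commute add.right_neutral diff_le_eq field_le_epsilon)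
  qed
  then show ?thesis using \<Lambda>(2) t0 by blast
qed

end


section \<open>From local slopes to global Hoelder and Lipschitz bounds\<close>

context nonlocal_dirichlet
begin

text \<open>Points of \<open>\<Omega>\<close> are joined by moving up along a common interior direction, across, and down
  again. The upward paths are cut geometrically, so that every piece stays in a ball on which the
  local estimate applies.\<close>

lemma holder_from_local_lipschitz:
  assumes R: "R \<ge> 0" and \<Lambda>: "\<Lambda> > 0" and t0: "0 < t0" "t0 \<le> 1" and a: "0 \<le> a" "a < 1"
  shows "\<exists>A\<ge>0. \<forall>u. (\<forall>x\<in>\<Omega>. \<bar>u x\<bar> \<le> R) \<longrightarrow>
    (\<forall>y t. 0 < t \<and> t \<le> t0 \<and> ball y t \<subseteq> \<Omega> \<longrightarrow>
      (\<forall>x. norm (x - y) < t / 4 \<longrightarrow> u x - u y \<le> \<Lambda> * t powr (- a) * norm (x - y))) \<longrightarrow>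
    (\<forall>x\<in>\<Omega>. \<forall>y\<in>\<Omega>. \<bar>u x - u y\<bar> \<le> A * norm (x - y) powr (1 - a))"
proof -
  obtain r c where rc: "0 < r" "0 < c" "c < 1"
    and cone: "\<And>x. x \<in> cl \<Longrightarrow> \<exists>e. norm e = 1 \<and>
      (\<forall>y\<in>cl. dist x y < r \<longrightarrow> (\<forall>t. 0 < t \<and> t \<le> r \<longrightarrow> ball (y + t *\<^sub>R e) (c * t) \<subseteq> \<Omega>))"
    using interior_cone by blast
  define r1 where "r1 = min r t0"
  have r1: "0 < r1" "r1 \<le> r" "r1 \<le> t0" using rc t0 by (auto simp: r1_def)
  \<comment> \<open>The hypothesis bounds only \<open>u x - u y\<close> with \<open>y\<close> the
    centre. Exchanging the two points halves the radius of the admissible ball and costs the factor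
    \<open>2 powr a\<close>.\<close>
  define K where "K = \<Lambda> * 2 powr a"
  have K: "K > 0" "\<Lambda> \<le> K" using \<Lambda> a by (auto simp: K_def ge_one_powr_ge_zero)
  \<comment> \<open>Consecutive points at heights \<open>\<tau> n\<close> and
    \<open>q * \<tau> n\<close> are \<open>c * \<tau> n / 16\<close> apart, within the eighth of the
    radius \<open>c * \<tau> n\<close> in which the two-sided estimate holds. The increments are
    then geometric with ratio \<theta>, and \<open>\<theta> < 1\<close> because
    \<open>a < 1\<close>.\<close>
  define q where "q = 1 - c / 16"
  have q: "0 < q" "q < 1" using rc by (auto simp: q_def)
  define \<theta> where "\<theta> = q powr (1 - a)"
  have \<theta>: "0 < \<theta>" "\<theta> < 1" using q a powr_less_mono2[of "1 - a" q 1] by (auto simp: \<theta>_def)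
  define K1 where "K1 = K / (1 - \<theta>)"
  have K1: "K1 > 0" using K \<theta> by (simp add: K1_def)
  \<comment> \<open>Two points at distance \<open>d\<close> are raised by \<open>s = D * d\<close>;
    there the cone contains a ball of radius \<open>c * s = 16 * d\<close>, large enough for the
    horizontal step of length \<open>d\<close>.\<close>
  define D where "D = 16 / c"
  have D: "D > 0" using rc by (simp add: D_def)
  define d0 where "d0 = r1 / D"
  have d0: "d0 > 0" using r1 D by (simp add: d0_def)
  \<comment> \<open>Two vertical paths, one horizontal step, and the trivial bound
    \<open>2 * R\<close> for points at distance at least \<open>d0\<close>.\<close>
  define A where "A = 2 * K1 * D powr (1 - a) + K + 2 * R / d0 powr (1 - a)"
  have A: "A \<ge> 0" using K1 K R by (simp add: A_def)
  have "\<bar>u x - u y\<bar> \<le> A * norm (x - y) powr (1 - a)"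
    if bd: "\<And>x. x \<in> \<Omega> \<Longrightarrow> \<bar>u x\<bar> \<le> R"
      and loc: "\<And>y t x. 0 < t \<Longrightarrow> t \<le> t0 \<Longrightarrow> ball y t \<subseteq> \<Omega> \<Longrightarrow> norm (x - y) < t / 4 \<Longrightarrow>
        u x - u y \<le> \<Lambda> * t powr (- a) * norm (x - y)"
      and xy: "x \<in> \<Omega>" "y \<in> \<Omega>" for u x y
  proof -
    have loc2: "\<bar>u w - u y\<bar> \<le> K * t powr (- a) * norm (w - y)"
      if t: "0 < t" "t \<le> t0" "ball y t \<subseteq> \<Omega>" and w: "norm (w - y) < t / 8" for w y t
    proof -
      have 1: "u w - u y \<le> \<Lambda> * t powr (- a) * norm (w - y)" using w t by (intro loc) auto
      have "ball w (t / 2) \<subseteq> ball y t"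
      proof
        fix v assume "v \<in> ball w (t / 2)"
        then show "v \<in> ball y t" using w dist_triangle[of y v w] t(1) by (simp add: dist_norm norm_minus_commute)
      qed
      then have "u y - u w \<le> \<Lambda> * (t / 2) powr (- a) * norm (y - w)"
        using w t by (intro loc) (auto simp: norm_minus_commute)
      also have "\<Lambda> * (t / 2) powr (- a) = K * t powr (- a)"
        using t by (simp add: K_def powr_divide powr_minus_divide)
      finally have 2: "u y - u w \<le> K * t powr (- a) * norm (w - y)" by (simp add: norm_minus_commute)
      have "\<Lambda> * t powr (- a) * norm (w - y) \<le> K * t powr (- a) * norm (w - y)"
        using K by (intro mult_right_mono) auto
      with 1 2 show ?thesis by linarith
    qed
    have up: "\<bar>u (y + s *\<^sub>R e) - u y\<bar> \<le> K1 * s powr (1 - a)"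
      if y: "y \<in> \<Omega>" and e: "norm e = 1" and s: "0 < s" "s \<le> r1"
        and ce: "\<And>t. 0 < t \<Longrightarrow> t \<le> r1 \<Longrightarrow> ball (y + t *\<^sub>R e) (c * t) \<subseteq> \<Omega>" for y e s
    proof -
      define \<tau> where "\<tau> n = s * q ^ n" for n
      have \<tau>: "0 < \<tau> n" "\<tau> n \<le> r1" for n
      proof -
        show "0 < \<tau> n" using s q by (simp add: \<tau>_def)
        have "q ^ n \<le> 1" using q by (intro power_le_one) auto
        then have "\<tau> n \<le> s" using s by (simp add: \<tau>_def mult_left_le)
        then show "\<tau> n \<le> r1" using s by simp
      qed
      define p where "p n = y + \<tau> n *\<^sub>R e" for n
      have step: "\<bar>u (p n) - u (p (Suc n))\<bar> \<le> K * s powr (1 - a) * \<theta> ^ n" for n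
      proof -
        have pn: "norm (p (Suc n) - p n) = \<tau> n * (c / 16)"
        proof -
          have "p (Suc n) - p n = - (\<tau> n * (c / 16)) *\<^sub>R e"
            by (simp add: p_def \<tau>_def q_def algebra_simps)
          then show ?thesis using e \<tau>(1)[of n] rc by (simp add: abs_mult)
        qed
        have ct: "0 < c * \<tau> n" "c * \<tau> n \<le> t0"
        proof -
          show "0 < c * \<tau> n" using rc \<tau>(1) by simp
          have "c * \<tau> n \<le> 1 * \<tau> n" using rc \<tau>(1)[of n] by (intro mult_right_mono) auto
          then show "c * \<tau> n \<le> t0" using \<tau>(2)[of n] r1 by linarith
        qed
        have "norm (p (Suc n) - p n) < c * \<tau> n / 8" unfolding pn using ct(1) by (simp add: mult.commute)
        then have "\<bar>u (p (Suc n)) - u (p n)\<bar> \<le> K * (c * \<tau> n) powr (- a) * norm (p (Suc n) - p n)"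
          using ce[OF \<tau>(1,2)] ct by (intro loc2) (auto simp: p_def)
        also have "\<dots> = K * ((c * \<tau> n) powr (- a) * (c * \<tau> n)) / 16" unfolding pn by simp
        also have "(c * \<tau> n) powr (- a) * (c * \<tau> n) = (c * \<tau> n) powr (1 - a)"
          using ct(1) powr_mult_base[of "c * \<tau> n" "- a"] by (simp add: mult.commute)
        also have "\<dots> = c powr (1 - a) * (s powr (1 - a) * \<theta> ^ n)"
        proof -
          have "(q ^ n) powr (1 - a) = \<theta> ^ n"
            using q by (induction n) (simp_all add: \<theta>_def powr_mult)
          then show ?thesis using rc s q by (simp add: \<tau>_def powr_mult)
        qed
        finally have "\<bar>u (p (Suc n)) - u (p n)\<bar> \<le> K * (c powr (1 - a) * (s powr (1 - a) * \<theta> ^ n)) / 16" .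
        also have "\<dots> \<le> K * (1 * (s powr (1 - a) * \<theta> ^ n)) / 1"
          using K \<theta> rc a by (intro frac_le mult_left_mono mult_right_mono powr_le1) auto
        finally show ?thesis by (simp add: abs_minus_commute mult.assoc)
      qed
      have tel: "\<bar>u (p 0) - u (p N)\<bar> \<le> K1 * s powr (1 - a)" for N
      proof -
        have "u (p 0) - u (p N) = (\<Sum>n<N. u (p n) - u (p (Suc n)))"
          using sum_lessThan_telescope'[of "\<lambda>n. u (p n)" N] by simp
        then have "\<bar>u (p 0) - u (p N)\<bar> \<le> (\<Sum>n<N. \<bar>u (p n) - u (p (Suc n))\<bar>)" by (metis sum_abs)
        also have "\<dots> \<le> (\<Sum>n<N. K * s powr (1 - a) * \<theta> ^ n)" by (intro sum_mono step)
        also have "\<dots> = K * s powr (1 - a) * (\<Sum>n<N. \<theta> ^ n)" by (simp add: sum_distrib_left)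
        also have "(\<Sum>n<N. \<theta> ^ n) = (1 - \<theta> ^ N) / (1 - \<theta>)" using \<theta> by (simp add: sum_gp_strict)
        also have "K * s powr (1 - a) * ((1 - \<theta> ^ N) / (1 - \<theta>)) \<le> K * s powr (1 - a) * (1 / (1 - \<theta>))"
          using K \<theta> by (intro mult_left_mono divide_right_mono) auto
        finally show ?thesis by (simp add: K1_def)
      qed
      \<comment> \<open>The path approaches \<open>y\<close> without reaching it. The last gap is
        closed by the local estimate on a fixed ball around \<open>y\<close>, whose radius
        disappears in the limit.\<close>
      obtain d where d: "d > 0" "ball y d \<subseteq> \<Omega>" using open_\<Omega> y openE by blast
      define t where "t = min d t0"
      have t: "0 < t" "t \<le> t0" "ball y t \<subseteq> \<Omega>" using d t0 by (auto simp: t_def)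
      have "(\<lambda>n. q ^ n) \<longlonglongrightarrow> 0" using q by (intro LIMSEQ_power_zero) simp
      then have \<tau>0: "\<tau> \<longlonglongrightarrow> 0" unfolding \<tau>_def[abs_def] using tendsto_mult_right_zero by blast
      have py: "norm (p n - y) = \<tau> n" for n using e \<tau>(1)[of n] by (simp add: p_def)
      have "\<forall>\<^sub>F n in sequentially. \<tau> n < t / 8" using order_tendstoD(2)[OF \<tau>0, of "t / 8"] t(1) by simp
      then have "\<forall>\<^sub>F n in sequentially. \<bar>u (p 0) - u y\<bar> \<le> K1 * s powr (1 - a) + K * t powr (- a) * \<tau> n"
      proof eventually_elim
        case (elim n)
        then have "\<bar>u (p n) - u y\<bar> \<le> K * t powr (- a) * norm (p n - y)" by (intro loc2 t) (simp add: py)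
        then show ?case using tel[of n] unfolding py by linarith
      qed
      moreover have "(\<lambda>n. K1 * s powr (1 - a) + K * t powr (- a) * \<tau> n) \<longlonglongrightarrow> K1 * s powr (1 - a) + K * t powr (- a) * 0"
        by (intro tendsto_intros \<tau>0)
      ultimately have "\<bar>u (p 0) - u y\<bar> \<le> K1 * s powr (1 - a) + K * t powr (- a) * 0"
        by (intro tendsto_lowerbound) auto
      then show ?thesis by (simp add: p_def \<tau>_def)
    qed
    define d where "d = norm (x - y)"
    show ?thesis
    proof (cases "x = y")
      case False
      then have d: "d > 0" by (simp add: d_def)
      show ?thesis
      proof (cases "d < d0")
        case True
        define s where "s = D * d"
        have s: "0 < s" "s \<le> r1" using d D True by (auto simp: s_def d0_def field_simps)
        have ds: "c * s = 16 * d" using rc by (simp add: s_def D_def)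
        have "d < r"
        proof -
          have "16 * d \<le> 1 * s" unfolding ds[symmetric] using rc s by (intro mult_right_mono) auto
          then show ?thesis using s r1 d by linarith
        qed
        have x': "x \<in> cl" "y \<in> cl" using xy \<Omega>_cl by auto
        obtain e where e: "norm e = 1"
          "\<And>y t. y \<in> cl \<Longrightarrow> dist x y < r \<Longrightarrow> 0 < t \<Longrightarrow> t \<le> r \<Longrightarrow> ball (y + t *\<^sub>R e) (c * t) \<subseteq> \<Omega>"
          using cone[OF x'(1)] by blast
        have cx: "ball (x + t *\<^sub>R e) (c * t) \<subseteq> \<Omega>" if "0 < t" "t \<le> r1" for t
          using e(2)[OF x'(1)] that r1 rc by simp
        have cy: "ball (y + t *\<^sub>R e) (c * t) \<subseteq> \<Omega>" if "0 < t" "t \<le> r1" for t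
          using e(2)[OF x'(2)] that r1 \<open>d < r\<close> by (simp add: d_def dist_norm)
        have ux: "\<bar>u (x + s *\<^sub>R e) - u x\<bar> \<le> K1 * s powr (1 - a)" using up[OF xy(1) e(1) s cx] .
        have uy: "\<bar>u (y + s *\<^sub>R e) - u y\<bar> \<le> K1 * s powr (1 - a)" using up[OF xy(2) e(1) s cy] .
        have "\<bar>u (y + s *\<^sub>R e) - u (x + s *\<^sub>R e)\<bar> \<le> K * (16 * d) powr (- a) * norm ((y + s *\<^sub>R e) - (x + s *\<^sub>R e))"
        proof (rule loc2)
          show "16 * d \<le> t0"
            using ds rc s r1 mult_right_mono[of c 1 s] by linarith
          show "ball (x + s *\<^sub>R e) (16 * d) \<subseteq> \<Omega>" using cx[OF s] ds by simp
        qed (use d in \<open>auto simp: d_def norm_minus_commute\<close>)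
        also have "norm ((y + s *\<^sub>R e) - (x + s *\<^sub>R e)) = d" by (simp add: d_def norm_minus_commute)
        also have "K * (16 * d) powr (- a) * d \<le> K * d powr (- a) * d"
          using K d a by (intro mult_right_mono mult_left_mono powr_mono2') auto
        also have "\<dots> = K * d powr (1 - a)" using d powr_mult_base[of d "- a"] by (simp add: mult.commute mult.assoc)
        finally have "\<bar>u (y + s *\<^sub>R e) - u (x + s *\<^sub>R e)\<bar> \<le> K * d powr (1 - a)" .
        then have "\<bar>u x - u y\<bar> \<le> 2 * (K1 * s powr (1 - a)) + K * d powr (1 - a)" using ux uy by linarith
        also have "\<dots> = (2 * K1 * D powr (1 - a) + K) * d powr (1 - a)"
          using D d by (simp add: s_def powr_mult algebra_simps)
        also have "\<dots> \<le> A * d powr (1 - a)" using R by (intro mult_right_mono) (auto simp: A_def)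
        finally show ?thesis by (simp add: d_def)
      next
        case False
        then have "d0 powr (1 - a) \<le> d powr (1 - a)" using d0 a by (intro powr_mono2) auto
        then have "2 * R \<le> 2 * R / d0 powr (1 - a) * d powr (1 - a)"
          using R d0 mult_left_mono[of "d0 powr (1 - a)" "d powr (1 - a)" "2 * R / d0 powr (1 - a)"] by simp
        also have "\<dots> \<le> A * d powr (1 - a)" using K1 K by (intro mult_right_mono) (auto simp: A_def)
        finally show ?thesis using bd[OF xy(1)] bd[OF xy(2)] by (simp add: d_def)
      qed
    qed simp
  qed
  note main = this
  show ?thesis
  proof (intro exI[of _ A] conjI allI impI ballI A)
    fix u x y
    assume "\<forall>x\<in>\<Omega>. \<bar>u x\<bar> \<le> R"
      and "\<forall>y t. 0 < t \<and> t \<le> t0 \<and> ball y t \<subseteq> \<Omega> \<longrightarrow>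
        (\<forall>x. norm (x - y) < t / 4 \<longrightarrow> u x - u y \<le> \<Lambda> * t powr (- a) * norm (x - y))"
      and "x \<in> \<Omega>" "y \<in> \<Omega>"
    then show "\<bar>u x - u y\<bar> \<le> A * norm (x - y) powr (1 - a)" by (intro main) simp_all
  qed
qed

text \<open>One round: \<open>a\<close> is the rate at which the local slopes may blow up at the
  boundary, and \<open>\<gamma>' = 1 - a\<close> is the exponent left after integrating
  them.\<close>

lemma equi_holder_step:
  assumes R: "R > 0" and hold: "equi_holder R \<gamma>" and \<gamma>: "0 \<le> \<gamma>" "\<gamma> \<le> 1" "\<gamma> \<noteq> \<sigma>"
    and \<gamma>': "0 < \<gamma>'" "\<gamma>' \<le> 1" "\<sigma> - \<gamma> \<le> (1 - \<gamma>') * m"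
  shows "equi_holder R \<gamma>'"
proof -
  define a where "a = 1 - \<gamma>'"
  have a: "0 \<le> a" "a < 1" "\<sigma> - \<gamma> \<le> a * m" using \<gamma>' by (auto simp: a_def)
  obtain \<Lambda> t0 where \<Lambda>: "\<Lambda> > 0" "t0 > 0" "t0 \<le> 1"
    and loc: "\<And>u y t x. u \<in> subs R \<Longrightarrow> 0 < t \<and> t \<le> t0 \<and> ball y t \<subseteq> \<Omega> \<Longrightarrow> norm (x - y) < t / 4 \<Longrightarrow>
      u x - u y \<le> \<Lambda> * t powr (- a) * norm (x - y)"
    using equi_holder_local_lipschitz[OF R hold \<gamma>, of a] a by auto
  obtain A where A: "A \<ge> 0" "\<And>u. (\<forall>x\<in>\<Omega>. \<bar>u x\<bar> \<le> R) \<Longrightarrow>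
    (\<forall>y t. 0 < t \<and> t \<le> t0 \<and> ball y t \<subseteq> \<Omega> \<longrightarrow>
      (\<forall>x. norm (x - y) < t / 4 \<longrightarrow> u x - u y \<le> \<Lambda> * t powr (- a) * norm (x - y))) \<Longrightarrow>
    (\<forall>x\<in>\<Omega>. \<forall>y\<in>\<Omega>. \<bar>u x - u y\<bar> \<le> A * norm (x - y) powr (1 - a))"
    using holder_from_local_lipschitz[OF less_imp_le[OF R] \<Lambda>(1-3) a(1,2)] by blast
  have "\<forall>x\<in>\<Omega>. \<forall>y\<in>\<Omega>. \<bar>u x - u y\<bar> \<le> A * norm (x - y) powr (1 - a)" if u: "u \<in> subs R" for u
  proof (rule A(2))
    show "\<forall>x\<in>\<Omega>. \<bar>u x\<bar> \<le> R" using u \<Omega>_cl unfolding subs_def by auto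
  qed (use loc[OF u] in blast)
  then show ?thesis unfolding equi_holder_def using A(1) by (auto simp: a_def)
qed

lemma equi_lipschitz:
  assumes R: "R > 0"
  shows "\<exists>A\<ge>0. \<forall>u\<in>subs R. \<forall>x\<in>\<Omega>. \<forall>y\<in>\<Omega>. \<bar>u x - u y\<bar> \<le> A * norm (x - y)"
proof -
  have mpos: "m > 0" using \<sigma> m by simp
  \<comment> \<open>A round may raise any exponent in \<open>[0, \<sigma>]\<close> by
    \<open>2 * \<kappa>\<close>; the two terms of the minimum serve \<open>m \<le> 1\<close> and
    \<open>m > 1\<close>. Regular rounds use only \<kappa>; the other half is kept for the jump
    across \<sigma>.\<close>
  define \<kappa> where "\<kappa> = min ((m - \<sigma>) / m) (1 - \<sigma>) / 2"
  have \<kappa>: "\<kappa> > 0" "2 * \<kappa> \<le> (m - \<sigma>) / m" "2 * \<kappa> \<le> 1 - \<sigma>" using \<sigma> m mpos by (auto simp: \<kappa>_def)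
  have gain: "\<sigma> - \<gamma> \<le> (1 - (\<gamma> + 2 * \<kappa>)) * m" if g: "0 \<le> \<gamma>" "\<gamma> \<le> \<sigma>" for \<gamma>
  proof (cases "m \<le> 1")
    case True
    have "2 * \<kappa> * m \<le> m - \<sigma>" using \<kappa>(2) mpos by (simp add: field_simps)
    moreover have "\<gamma> * m \<le> \<gamma> * 1" using True g by (intro mult_left_mono) auto
    moreover have "(1 - (\<gamma> + 2 * \<kappa>)) * m = m - \<gamma> * m - 2 * \<kappa> * m" by (simp add: algebra_simps)
    ultimately show ?thesis by linarith
  next
    case False
    have "0 \<le> 1 - (\<gamma> + 2 * \<kappa>)" using \<kappa>(3) g by linarith
    then have "(1 - (\<gamma> + 2 * \<kappa>)) * 1 \<le> (1 - (\<gamma> + 2 * \<kappa>)) * m" using False by (intro mult_left_mono) auto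
    moreover have "\<sigma> - \<gamma> \<le> (1 - (\<gamma> + 2 * \<kappa>)) * 1" using \<kappa>(3) by simp
    ultimately show ?thesis by (rule order_trans[rotated])
  qed
  have "equi_holder R 0"
    unfolding equi_holder_def
  proof (intro exI[of _ "2 * R"] conjI ballI)
    fix u x y assume "u \<in> subs R" "x \<in> \<Omega>" "y \<in> \<Omega>"
    then have "\<bar>u x\<bar> \<le> R" "\<bar>u y\<bar> \<le> R" using \<Omega>_cl unfolding subs_def by auto
    \<comment> \<open>For \<open>x = y\<close> the right-hand side is 0, because
      \<open>0 powr 0 = 0\<close>; otherwise it is \<open>2 * R\<close>.\<close>
    then show "\<bar>u x - u y\<bar> \<le> 2 * R * norm (x - y) powr 0" by (cases "x = y") auto
  qed (use R in simp)
  note base = this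
  have P: "real n * \<kappa> < \<sigma> \<Longrightarrow> equi_holder R (real n * \<kappa>)" for n
  proof (induction n)
    case 0
    show ?case using base by simp
  next
    case (Suc n)
    have n: "0 \<le> real n * \<kappa>" "real n * \<kappa> < \<sigma>" using Suc.prems \<kappa>(1) by (auto simp: algebra_simps)
    have "(1 - (real n * \<kappa> + 2 * \<kappa>)) * m \<le> (1 - real (Suc n) * \<kappa>) * m"
      using \<kappa>(1) mpos by (intro mult_right_mono) (auto simp: algebra_simps)
    then have "\<sigma> - real n * \<kappa> \<le> (1 - real (Suc n) * \<kappa>) * m" using gain[OF n(1)] n(2) by linarith
    then show ?case
      using n Suc.prems \<sigma> \<kappa>(1) by (intro equi_holder_step[OF R Suc.IH[OF n(2)] n(1)]) auto
  qed
  define n where "n = nat \<lfloor>\<sigma> / \<kappa>\<rfloor>"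
  have nn: "real n \<le> \<sigma> / \<kappa>" "\<sigma> / \<kappa> < real n + 1" using \<sigma> \<kappa>(1) by (auto simp: n_def)
  \<comment> \<open>The last multiple of \<kappa> strictly below \<sigma>. From it a step of
    \<open>2 * \<kappa>\<close> lands strictly above \<sigma>, also when \<sigma> is itself a
    multiple of \<kappa>.\<close>
  obtain k where k: "real k * \<kappa> < \<sigma>" "\<sigma> \<le> real k * \<kappa> + \<kappa>"
  proof (cases "real n * \<kappa> < \<sigma>")
    case True
    have "\<sigma> \<le> real n * \<kappa> + \<kappa>" using nn(2) \<kappa>(1) by (simp add: field_simps)
    then show ?thesis using that True by blast
  next
    case False
    then have eq: "real n * \<kappa> = \<sigma>" using nn(1) \<kappa>(1) by (simp add: field_simps)
    then have "n \<noteq> 0" using \<sigma>(1) by (metis mult_zero_left of_nat_0 less_irrefl)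
    then obtain j where "n = Suc j" using not0_implies_Suc by blast
    with eq have "real j * \<kappa> + \<kappa> = \<sigma>" by (simp add: algebra_simps)
    then show ?thesis using that[of j] \<kappa>(1) by linarith
  qed
  define \<gamma> where "\<gamma> = real k * \<kappa> + 2 * \<kappa>"
  have k0: "0 \<le> real k * \<kappa>" using \<kappa>(1) by simp
  have \<gamma>: "\<sigma> < \<gamma>" "\<gamma> \<le> 1" using k \<kappa> by (auto simp: \<gamma>_def)
  have "equi_holder R \<gamma>"
    by (rule equi_holder_step[OF R P[OF k(1)] k0]) (use gain[OF k0] k k0 \<gamma> \<sigma> in \<open>auto simp: \<gamma>_def\<close>)
  \<comment> \<open>Above \<sigma> the far term is bounded, so \<open>a = 0\<close> is admissible
    and a single round gives exponent 1.\<close>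
  then have "equi_holder R 1"
    by (rule equi_holder_step[OF R]) (use \<gamma> \<sigma> in auto)
  then show ?thesis unfolding equi_holder_def by simp
qed

end

section \<open>Comparison for strict subsolutions\<close>


lemma sqrt_sum_sq_lipschitz:
  fixes a b :: "'a::euclidean_space"
  assumes "\<mu> > 0"
  shows "\<bar>sqrt (\<mu>\<^sup>2 + norm a ^ 2) - sqrt (\<mu>\<^sup>2 + norm b ^ 2)\<bar> \<le> norm (a - b)"
proof -
  have "\<bar>sqrt (\<mu>\<^sup>2 + norm (a - 0) ^ 2) - sqrt (\<mu>\<^sup>2 + norm (b - 0) ^ 2)\<bar> \<le> 1 * norm (a - b)"
  proof (rule C1_with_gradient_lipschitz[OF C1_with_gradient_sqrt[OF assms] convex_UNIV])
    fix x :: 'a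
    have "norm x \<le> sqrt (\<mu>\<^sup>2 + norm x ^ 2)" "0 < sqrt (\<mu>\<^sup>2 + norm x ^ 2)"
      using assms by (auto intro!: real_le_rsqrt add_pos_nonneg)
    then show "norm ((1 / sqrt (\<mu>\<^sup>2 + norm (x - 0) ^ 2)) *\<^sub>R (x - 0)) \<le> 1" by simp
  qed auto
  then show ?thesis by simp
qed

text \<open>Squaring leaves \<open>3 / 4 * s\<^sup>2 \<le> \<mu> * s\<close>.\<close>

lemma sqrt_penalty_estimate:
  fixes s \<mu> :: real
  assumes "0 \<le> s" "0 < \<mu>" "sqrt (\<mu>\<^sup>2 + s\<^sup>2) \<le> \<mu> + s / 2"
  shows "s \<le> 4 / 3 * \<mu>"
proof (cases "s = 0")
  case False
  have "\<mu>\<^sup>2 + s\<^sup>2 \<le> (\<mu> + s / 2)\<^sup>2"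
    using assms by (metis real_sqrt_le_iff real_sqrt_unique add_nonneg_nonneg divide_nonneg_pos less_imp_le sqrt_le_D zero_less_numeral)
  then have "s * s \<le> (4 / 3 * \<mu>) * s" by (simp add: power2_eq_square algebra_simps)
  then show ?thesis using False assms(1) by simp
qed (use assms in simp)

context nonlocal_dirichlet
begin

lemma H_tendsto:
  assumes "\<And>n. x n \<in> cl" "x0 \<in> cl" "x \<longlonglongrightarrow> x0" "r \<longlonglongrightarrow> r0" "p \<longlonglongrightarrow> p0"
  shows "(\<lambda>n. H (x n) (r n) (p n)) \<longlonglongrightarrow> H x0 r0 p0"
proof -
  have "(\<lambda>n. (x n, r n, p n)) \<longlonglongrightarrow> (x0, r0, p0)" by (intro tendsto_Pair assms)
  from continuous_on_tendsto_compose[OF H this] show ?thesis using assms by simp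
qed

lemma H_mono: "x \<in> cl \<Longrightarrow> r \<le> s \<Longrightarrow> H x r p \<le> H x s p"
proof -
  assume x: "x \<in> cl" and rs: "r \<le> s"
  define R where "R = \<bar>r\<bar> + \<bar>s\<bar> + 1"
  have "R > 0" "\<bar>r\<bar> \<le> R" "\<bar>s\<bar> \<le> R" by (auto simp: R_def)
  then have "lam R \<ge> 0" "H x s p - H x r p \<ge> lam R * (s - r)"
    using H1 x rs unfolding H1_def by blast+
  moreover have "lam R * (s - r) \<ge> 0" using calculation(1) rs by simp
  ultimately show ?thesis by linarith
qed

text \<open>On the boundary \<open>u\<close> may lie above its limits from inside; \<open>U\<close>
  lowers those values. The interior inequality survives by \<open>sub_at_interior_cong\<close>, and
  the data are respected since \<open>U \<le> u \<le> g\<close> on the boundary.\<close>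

lemma subsolution_extension:
  assumes u: "visc_subsolution \<Omega> \<nu> H g c u" and c: "c \<le> 0" and bd: "bounded (u ` cl)"
  obtains U L where "L > 0" "L-lipschitz_on cl U" "\<And>x. x \<in> \<Omega> \<Longrightarrow> U x = u x"
    "\<And>x. x \<in> \<Omega> \<Longrightarrow> sub_at c U x" "\<And>x. x \<in> frontier \<Omega> \<Longrightarrow> U x \<le> g x"
proof -
  obtain R0 where R0: "\<And>y. y \<in> cl \<Longrightarrow> \<bar>u y\<bar> \<le> R0" using bd unfolding bounded_iff by auto
  define R where "R = \<bar>R0\<bar> + 1"
  have R: "R > 0" "\<And>y. y \<in> cl \<Longrightarrow> \<bar>u y\<bar> \<le> R" using R0 by (auto simp: R_def) (smt (verit) R0)
  have usc: "usc_on cl u" using u unfolding visc_subsolution_def by blast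
  have "u \<in> subs R"
    unfolding subs_def using usc R(2) visc_subsolution_sub_at(1)[OF u] sub_at_mono[OF _ c] by auto
  then obtain A where A: "A \<ge> 0" "\<And>x y. x \<in> \<Omega> \<Longrightarrow> y \<in> \<Omega> \<Longrightarrow> \<bar>u x - u y\<bar> \<le> A * norm (x - y)"
    using equi_lipschitz[OF R(1)] by blast
  then have "(A + 1)-lipschitz_on \<Omega> u"
  proof (intro lipschitz_onI)
    fix x y assume "x \<in> \<Omega>" "y \<in> \<Omega>"
    then have "\<bar>u x - u y\<bar> \<le> A * norm (x - y)" by (rule A(2))
    also have "\<dots> \<le> (A + 1) * norm (x - y)" by (intro mult_right_mono) auto
    finally show "dist (u x) (u y) \<le> (A + 1) * dist x y" by (simp add: dist_norm)
  qed simp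
  then obtain U where U: "(A + 1)-lipschitz_on cl U" "\<And>x. x \<in> \<Omega> \<Longrightarrow> U x = u x"
    using lipschitz_extend_closure by blast
  have Uc: "continuous_on cl U" using lipschitz_on_continuous_on[OF U(1)] .
  have "bounded (U ` cl)" using compact_continuous_image[OF Uc compact_cl] compact_imp_bounded by blast
  then obtain R' where R': "\<And>y. y \<in> cl \<Longrightarrow> \<bar>U y\<bar> \<le> R'" unfolding bounded_iff by auto
  have Ub: "U \<in> borel_measurable (restrict_space borel cl)"
    using borel_measurable_usc_on[OF continuous_on_imp_usc_on[OF Uc]] by simp
  have ub: "u \<in> borel_measurable (restrict_space borel cl)"
    using borel_measurable_usc_on[OF usc] by simp
  show ?thesis
  proof (rule that[OF _ U])
    show "sub_at c U x" if "x \<in> \<Omega>" for x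
      by (rule sub_at_interior_cong[OF that visc_subsolution_sub_at(1)[OF u that] U(2) ub R(2) Ub R'])
    show "U x \<le> g x" if x: "x \<in> frontier \<Omega>" for x
    proof -
      have xc: "x \<in> cl" using x by (simp add: frontier_cl)
      then obtain s where s: "\<And>n. s n \<in> \<Omega>" "s \<longlonglongrightarrow> x" unfolding closure_sequential by blast
      have sc: "s n \<in> cl" for n using s(1) \<Omega>_cl by blast
      have "(\<lambda>n. U (s n)) \<longlonglongrightarrow> U x"
        using continuous_on_tendsto_compose[OF Uc s(2) xc] sc by simp
      then have lim: "(\<lambda>n. u (s n)) \<longlonglongrightarrow> U x" using U(2) s(1) by simp
      \<comment> \<open>\<open>U x\<close> is a limit of values of \<open>u\<close> from inside, and
        \<open>u\<close> is upper semicontinuous.\<close>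
      have "U x \<le> u x"
      proof (rule ccontr)
        assume "\<not> U x \<le> u x"
        then have "u x < U x" by simp
        then obtain a where a: "u x < a" "a < U x" using dense by blast
        have "\<forall>\<^sub>F n in sequentially. u (s n) < a" by (rule usc_on_seq[OF usc sc xc s(2) a(1)])
        moreover have "\<forall>\<^sub>F n in sequentially. a < u (s n)" by (rule order_tendstoD(1)[OF lim a(2)])
        ultimately have "\<forall>\<^sub>F n in sequentially. False" by eventually_elim simp
        then show False by simp
      qed
      also have "u x \<le> g x"
        by (rule subsolution_le_boundary_data[OF usc R(2) visc_subsolution_sub_at[OF u] x])
      finally show ?thesis .
    qed
  qed (use A in simp)
qed

text \<open>Doubling with the penalty centred at \<open>x - y = \<xi>\<close>. Its minimum lies at
  shifted pairs, and \<open>x\<close> is so close to \<open>y + \<xi>\<close> that the interior cone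
  puts it in \<Omega>, wherever \<open>y\<close> lies. At \<open>y\<close> the supersolution
  inequality holds even on the boundary, since \<open>v y < U y \<le> g y\<close>. The slopes
  \<open>p\<close> and \<open>q\<close> are bounded by a multiple of the Lipschitz constant and by
  \<epsilon>, whatever the size of \<mu>.\<close>

lemma comparison_approx:
  assumes U: "L1-lipschitz_on cl U" and L1: "L1 > 0" and sub: "\<And>x. x \<in> \<Omega> \<Longrightarrow> sub_at (- \<eta>) U x"
    and Ug: "\<And>x. x \<in> frontier \<Omega> \<Longrightarrow> U x \<le> g x"
    and v: "visc_supersolution \<Omega> \<nu> H g 0 v"
    and x0: "x0 \<in> cl" and max: "\<And>y. y \<in> cl \<Longrightarrow> U y - v y \<le> U x0 - v x0" and pos: "U x0 - v x0 > 0"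
    and \<epsilon>: "\<epsilon> > 0"
  shows "\<exists>x y p q. x \<in> \<Omega> \<and> y \<in> cl \<and> dist x x0 < \<epsilon> \<and> dist y x0 < \<epsilon> \<and> v y \<le> v x0 + (L1 + 1) * \<epsilon> \<and>
    norm p \<le> 2 * L1 \<and> norm (q - p) < \<epsilon> \<and>
    (\<forall>\<delta>. 0 < \<delta> \<and> \<delta> < 1 \<longrightarrow>
      H x (U x) p \<le> - \<eta> + 2 * L1 * (near_const * \<delta> powr (1 - \<sigma>)) + nonlocal_op \<Omega> \<nu> (- ball 0 \<delta>) U x \<and>
      H y (v y) q \<ge> - (2 * L1 + 2 * diameter cl) * (near_const * \<delta> powr (1 - \<sigma>)) + nonlocal_op \<Omega> \<nu> (- ball 0 \<delta>) v y)"
proof -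
  obtain r c where rc: "0 < r" "0 < c" "c < 1"
    and cone: "\<And>x. x \<in> cl \<Longrightarrow> \<exists>e. norm e = 1 \<and>
      (\<forall>y\<in>cl. dist x y < r \<longrightarrow> (\<forall>t. 0 < t \<and> t \<le> r \<longrightarrow> ball (y + t *\<^sub>R e) (c * t) \<subseteq> \<Omega>))"
    using interior_cone by blast
  obtain e where e: "norm e = 1"
    "\<And>y t. y \<in> cl \<Longrightarrow> dist x0 y < r \<Longrightarrow> 0 < t \<Longrightarrow> t \<le> r \<Longrightarrow> ball (y + t *\<^sub>R e) (c * t) \<subseteq> \<Omega>"
    using cone[OF x0] by blast
  define M where "M = U x0 - v x0"
  \<comment> \<open>One half of the slope pays for the variation of \<open>U\<close>; the other half
    is left to control the distance of \<open>x - y\<close> from \<xi>.\<close>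
  define L where "L = 2 * L1"
  define B where "B = min r (min (r\<^sup>2) (min ((\<epsilon> / 4)\<^sup>2) (min \<epsilon> M)))"
  have B: "0 < B" "B \<le> r" "B \<le> r\<^sup>2" "B \<le> (\<epsilon> / 4)\<^sup>2" "B \<le> \<epsilon>" "B \<le> M"
    using rc \<epsilon> pos by (auto simp: B_def M_def)
  \<comment> \<open>Makes \<open>6 * L1 * t\<close> smaller than \<open>M\<close>, which yields
    \<open>v y < U y\<close>, and smaller than \<open>r\<^sup>2\<close> and
    \<open>(\<epsilon> / 4)\<^sup>2\<close>, which keeps \<open>y\<close> near \<open>x0\<close>;
    the 17 makes \<open>4 * t\<close> small against \<epsilon>.\<close>
  define t where "t = B / (6 * L1 + 17)"
  have "(6 * L1 + 17) * t = B" using L1 by (simp add: t_def)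
  then have t_eq: "6 * (L1 * t) + 17 * t = B" by (simp add: algebra_simps)
  have t: "0 < t" using B L1 by (simp add: t_def)
  have L1t: "0 < L1 * t" using L1 t by simp
  have tr: "t \<le> r" using t_eq t L1t B by linarith
  \<comment> \<open>The final estimate \<open>s \<le> 4 / 3 * \<mu>\<close> then falls below the
    cone radius \<open>c * t\<close>.\<close>
  define \<mu> where "\<mu> = c * t / 2"
  have \<mu>: "0 < \<mu>" using rc t by (simp add: \<mu>_def)
  have \<mu>t: "\<mu> \<le> t / 2" using rc t mult_right_mono[of c 1 t] by (simp add: \<mu>_def)
  have L\<mu>: "L * \<mu> \<le> L1 * t" using mult_left_mono[OF \<mu>t, of "2 * L1"] L1 by (simp add: L_def)
  define \<xi> where "\<xi> = t *\<^sub>R e"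
  have \<xi>: "norm \<xi> = t" using e t by (simp add: \<xi>_def)
  define \<Phi> where "\<Phi> = (\<lambda>(x, y). U x - v y - L * sqrt (\<mu>\<^sup>2 + norm (x - y - \<xi>) ^ 2) - norm (y - x0) ^ 2)"
  have Uc: "continuous_on cl U" using lipschitz_on_continuous_on[OF U] .
  have Ulip: "\<bar>U x - U y\<bar> \<le> L1 * norm (x - y)" if "x \<in> cl" "y \<in> cl" for x y
    using lipschitz_onD[OF U that] by (simp add: dist_norm)
  have lsc: "usc_on cl (\<lambda>y. - v y)"
    using v unfolding visc_supersolution_def by (simp add: lsc_on_iff_usc_on)
  have c1: "continuous_on (cl \<times> cl) (\<lambda>p. U (fst p) + (- (L * sqrt (\<mu>\<^sup>2 + norm (fst p - snd p - \<xi>) ^ 2)) - norm (snd p - x0) ^ 2))"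
    by (intro continuous_intros continuous_on_compose2[OF Uc]) auto
  have "usc_on (cl \<times> cl) (\<lambda>p. - v (snd p))"
    by (rule usc_on_compose[OF lsc]) (auto intro!: continuous_intros)
  then have "usc_on (cl \<times> cl) (\<lambda>p. (U (fst p) + (- (L * sqrt (\<mu>\<^sup>2 + norm (fst p - snd p - \<xi>) ^ 2)) - norm (snd p - x0) ^ 2)) + - v (snd p))"
    by (intro usc_on_add continuous_on_imp_usc_on[OF c1])
  also have "(\<lambda>p. (U (fst p) + (- (L * sqrt (\<mu>\<^sup>2 + norm (fst p - snd p - \<xi>) ^ 2)) - norm (snd p - x0) ^ 2)) + - v (snd p)) = \<Phi>"
    by (auto simp: \<Phi>_def fun_eq_iff)
  finally have "usc_on (cl \<times> cl) \<Phi>" .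
  from usc_on_attains_sup[OF compact_Times[OF compact_cl compact_cl] _ this]
  obtain xy where xy: "xy \<in> cl \<times> cl" "\<And>z. z \<in> cl \<times> cl \<Longrightarrow> \<Phi> z \<le> \<Phi> xy" using x0 by blast
  obtain x y where "xy = (x, y)" by (cases xy)
  with xy have x: "x \<in> cl" and y: "y \<in> cl" and \<Phi>max: "\<And>a b. a \<in> cl \<Longrightarrow> b \<in> cl \<Longrightarrow> \<Phi> (a, b) \<le> \<Phi> (x, y)" by auto
  define s where "s = norm (x - y - \<xi>)"
  have s0: "0 \<le> s" by (simp add: s_def)
  have in\<Omega>: "ball (b + \<xi>) (c * t) \<subseteq> \<Omega>" if "b \<in> cl" "dist x0 b < r" for b
    using e(2)[OF that t tr] by (simp add: \<xi>_def)
  have x0\<xi>: "x0 + \<xi> \<in> cl" using in\<Omega>[OF x0] rc t \<Omega>_cl by (auto simp: subset_iff)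
  have sqs: "s \<le> sqrt (\<mu>\<^sup>2 + s\<^sup>2)" by (intro real_le_rsqrt) auto
  have val: "\<Phi> (x, y) = U x - v y - L * sqrt (\<mu>\<^sup>2 + s\<^sup>2) - norm (y - x0) ^ 2" by (simp add: \<Phi>_def s_def)
  \<comment> \<open>A competitor with minimal penalty \<open>L * \<mu>\<close>: it bounds the
    maximum from below by nearly \<open>M\<close> and so localises \<open>y\<close> near
    \<open>x0\<close>.\<close>
  have "\<Phi> (x0 + \<xi>, x0) \<le> \<Phi> (x, y)" by (rule \<Phi>max[OF x0\<xi> x0])
  then have low: "U (x0 + \<xi>) - v x0 - L * \<mu> \<le> \<Phi> (x, y)" using \<mu> by (simp add: \<Phi>_def)
  have "\<bar>U (x0 + \<xi>) - U x0\<bar> \<le> L1 * t" using Ulip[OF x0\<xi> x0] \<xi> by simp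
  then have low2: "M - 2 * (L1 * t) \<le> \<Phi> (x, y)" using low L\<mu> unfolding M_def by linarith
  have "norm (x - y) \<le> s + t" using norm_triangle_ineq[of "x - y - \<xi>" \<xi>] \<xi> by (simp add: s_def)
  then have "L1 * norm (x - y) \<le> L1 * (s + t)" using L1 by (intro mult_left_mono) auto
  then have Uxy: "\<bar>U x - U y\<bar> \<le> L1 * s + L1 * t" using Ulip[OF x y] by (simp add: distrib_left)
  have Ls: "L * s \<le> L * sqrt (\<mu>\<^sup>2 + s\<^sup>2)" using sqs L1 by (simp add: L_def)
  have LL: "L * s = 2 * (L1 * s)" by (simp add: L_def)
  have L1s: "0 \<le> L1 * s" using L1 s0 by simp
  have "norm (y - x0) ^ 2 + L1 * s \<le> 3 * (L1 * t)"
    using low2 Uxy Ls LL max[OF y] unfolding val M_def by linarith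
  then have ysq: "norm (y - x0) ^ 2 \<le> 3 * (L1 * t)" and "L1 * s \<le> 3 * (L1 * t)"
    using L1s zero_le_power2[of "norm (y - x0)"] by linarith+
  then have "L1 * s \<le> L1 * (3 * t)" by simp
  then have s3: "s \<le> 3 * t" using L1 by simp
  have "norm (y - x0) ^ 2 < r\<^sup>2" "norm (y - x0) ^ 2 < (\<epsilon> / 4)\<^sup>2" using ysq t_eq t L1t B by linarith+
  then have yr: "norm (y - x0) < r" and y\<epsilon>: "norm (y - x0) < \<epsilon> / 4"
    using rc \<epsilon> power2_less_imp_less[of "norm (y - x0)" r] power2_less_imp_less[of "norm (y - x0)" "\<epsilon> / 4"] by auto
  have sub\<Omega>: "ball (y + \<xi>) (c * t) \<subseteq> \<Omega>" using in\<Omega>[OF y] yr by (simp add: dist_norm norm_minus_commute)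
  then have y\<xi>: "y + \<xi> \<in> cl" using rc t \<Omega>_cl by (auto simp: subset_iff)
  \<comment> \<open>Only the first point is moved here, so the merely semicontinuous
    \<open>v\<close> and the quadratic term cancel, and the Lipschitz bound of \<open>U\<close>
    alone decides.\<close>
  have "\<Phi> (y + \<xi>, y) \<le> \<Phi> (x, y)" by (rule \<Phi>max[OF y\<xi> y])
  then have "U (y + \<xi>) - L * \<mu> \<le> U x - L * sqrt (\<mu>\<^sup>2 + s\<^sup>2)" using \<mu> unfolding val by (simp add: \<Phi>_def)
  moreover have "\<bar>U x - U (y + \<xi>)\<bar> \<le> L1 * s" using Ulip[OF x y\<xi>] by (simp add: s_def diff_diff_add)
  ultimately have "L * sqrt (\<mu>\<^sup>2 + s\<^sup>2) \<le> L * \<mu> + L1 * s" by linarith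
  also have "\<dots> = L * (\<mu> + s / 2)" by (simp add: L_def algebra_simps)
  finally have "sqrt (\<mu>\<^sup>2 + s\<^sup>2) \<le> \<mu> + s / 2" using L1 by (simp add: L_def)
  then have "s \<le> 4 / 3 * \<mu>" by (rule sqrt_penalty_estimate[OF s0 \<mu>])
  then have "s < c * t" using \<mu> unfolding \<mu>_def by linarith
  then have "x \<in> ball (y + \<xi>) (c * t)" by (simp add: s_def dist_norm norm_minus_commute diff_diff_add)
  then have x\<Omega>: "x \<in> \<Omega>" using sub\<Omega> by blast
  have xx0: "norm (x - x0) < \<epsilon>"
  proof -
    have "norm (x - x0) \<le> norm (x - y) + norm (y - x0)" using norm_triangle_ineq[of "x - y" "y - x0"] by simp
    then show ?thesis using \<open>norm (x - y) \<le> s + t\<close> s3 y\<epsilon> t_eq t L1t B \<epsilon> by linarith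
  qed
  have vy: "v y \<le> U x - M + 2 * (L1 * t)"
    using low2 Ls LL L1s zero_le_power2[of "norm (y - x0)"] unfolding val by linarith
  have vyb: "v y < U y" using vy Uxy s3 L1 t_eq t L1t B mult_left_mono[OF s3, of L1] by linarith
  have vx0: "v y \<le> v x0 + (L1 + 1) * \<epsilon>"
  proof -
    have "\<bar>U x - U x0\<bar> \<le> L1 * \<epsilon>" using Ulip[OF x x0] mult_left_mono[OF less_imp_le[OF xx0], of L1] L1 by linarith
    then show ?thesis using vy t_eq t L1t B unfolding M_def by (simp add: algebra_simps)
  qed
  define z where "z = sqrt (\<mu>\<^sup>2 + s\<^sup>2)"
  have z: "0 < z" using \<mu> by (simp add: z_def add_pos_nonneg)
  define p where "p = L *\<^sub>R ((1 / z) *\<^sub>R (x - (y + \<xi>)))"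
  define q where "q = p - 2 *\<^sub>R (y - x0)"
  have sz: "norm (x - (y + \<xi>)) = s" by (simp add: s_def diff_diff_add)
  have p: "norm p \<le> 2 * L1"
  proof -
    have "norm p = L * (s / z)" using L1 z sz by (simp add: p_def L_def)
    also have "\<dots> \<le> L * 1" using sqs z L1 by (intro mult_left_mono) (auto simp: z_def L_def)
    finally show ?thesis by (simp add: L_def)
  qed
  have qp: "norm (q - p) < \<epsilon>" using y\<epsilon> \<epsilon> by (simp add: q_def)
  define \<phi> where "\<phi> = (\<lambda>a. L * sqrt (\<mu>\<^sup>2 + norm (a - (y + \<xi>)) ^ 2))"
  define D\<phi> where "D\<phi> = (\<lambda>a. L *\<^sub>R ((1 / sqrt (\<mu>\<^sup>2 + norm (a - (y + \<xi>)) ^ 2)) *\<^sub>R (a - (y + \<xi>))))"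
  have \<phi>: "C1_with_gradient cl \<phi> D\<phi>"
    unfolding \<phi>_def D\<phi>_def by (intro C1_with_gradient_cmult C1_with_gradient_sqrt \<mu>)
  have D\<phi>x: "D\<phi> x = p" by (simp add: D\<phi>_def p_def z_def sz)
  have \<phi>max: "\<forall>a\<in>cl. U a - \<phi> a \<le> U x - \<phi> x"
    using \<Phi>max[OF _ y] by (fastforce simp: \<Phi>_def \<phi>_def diff_diff_add)
  have E1: "visc_E \<Omega> \<nu> H \<delta> U \<phi> D\<phi> x \<le> - \<eta>" if "\<delta> > 0" for \<delta>
    using sub[OF x\<Omega>] \<phi> \<phi>max that unfolding sub_at_def by blast
  define \<psi> where "\<psi> = (\<lambda>b. (- L) * sqrt (\<mu>\<^sup>2 + norm (b - (x - \<xi>)) ^ 2) + (- 1) * norm (b - x0) ^ 2)"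
  define D\<psi> where "D\<psi> = (\<lambda>b. (- L) *\<^sub>R ((1 / sqrt (\<mu>\<^sup>2 + norm (b - (x - \<xi>)) ^ 2)) *\<^sub>R (b - (x - \<xi>))) + (- 1) *\<^sub>R (2 *\<^sub>R (b - x0)))"
  have \<psi>: "C1_with_gradient cl \<psi> D\<psi>"
    unfolding \<psi>_def D\<psi>_def
    by (intro C1_with_gradient_add C1_with_gradient_cmult C1_with_gradient_sqrt C1_with_gradient_dist_sq \<mu>)
  have nb: "norm (b - (x - \<xi>)) = norm (x - b - \<xi>)" for b
  proof -
    have "b - (x - \<xi>) = - (x - b - \<xi>)" by simp
    then show ?thesis by (metis norm_minus_cancel)
  qed
  have yx: "y - (x - \<xi>) = - (x - (y + \<xi>))" by simp
  have D\<psi>y: "D\<psi> y = q"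
  proof -
    have a: "D\<psi> y = (- L) *\<^sub>R ((1 / z) *\<^sub>R - (x - (y + \<xi>))) + (- 1) *\<^sub>R (2 *\<^sub>R (y - x0))"
      unfolding D\<psi>_def nb z_def s_def yx by (rule refl)
    have b: "(- L) *\<^sub>R ((1 / z) *\<^sub>R - w) + (- 1) *\<^sub>R (2 *\<^sub>R d) = L *\<^sub>R ((1 / z) *\<^sub>R w) - 2 *\<^sub>R d" for w d :: 'a
      by simp
    show ?thesis unfolding a q_def p_def by (rule b)
  qed
  have \<psi>min: "\<forall>b\<in>cl. v b - \<psi> b \<ge> v y - \<psi> y"
    using \<Phi>max[OF x] by (fastforce simp: \<Phi>_def \<psi>_def nb)
  have E2: "visc_E \<Omega> \<nu> H \<delta> v \<psi> D\<psi> y \<ge> 0" if \<delta>: "\<delta> > 0" for \<delta>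
  proof -
    have *: "(y \<in> \<Omega> \<longrightarrow> visc_E \<Omega> \<nu> H \<delta> v \<psi> D\<psi> y - 0 \<ge> 0) \<and>
      (y \<in> frontier \<Omega> \<longrightarrow> max (visc_E \<Omega> \<nu> H \<delta> v \<psi> D\<psi> y - 0) (v y - g y) \<ge> 0)"
      using v \<psi> y \<psi>min \<delta> unfolding visc_supersolution_def by blast
    show ?thesis
    proof (cases "y \<in> \<Omega>")
      case False
      then have yf: "y \<in> frontier \<Omega>" using y by (simp add: frontier_cl)
      then have "v y - g y < 0" using vyb Ug[OF yf] by linarith
      then show ?thesis using * yf by (auto simp: le_max_iff_disj)
    qed (use * in simp)
  qed
  have ineqs: "H x (U x) p \<le> - \<eta> + 2 * L1 * (near_const * \<delta> powr (1 - \<sigma>)) + nonlocal_op \<Omega> \<nu> (- ball 0 \<delta>) U x \<and>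
      H y (v y) q \<ge> - (2 * L1 + 2 * diameter cl) * (near_const * \<delta> powr (1 - \<sigma>)) + nonlocal_op \<Omega> \<nu> (- ball 0 \<delta>) v y"
    if \<delta>: "0 < \<delta>" "\<delta> < 1" for \<delta>
  proof -
    have dia: "norm (a - x0) \<le> diameter cl" if "a \<in> cl" for a
      using diameter_bounded_bound[OF compact_imp_bounded[OF compact_cl] that x0] by (simp add: dist_norm)
    have dia0: "0 \<le> diameter cl" by (rule diameter_ge_0[OF compact_imp_bounded[OF compact_cl]])
    have i1: "\<bar>nonlocal_op \<Omega> \<nu> (ball 0 \<delta>) \<phi> x\<bar> \<le> (2 * L1) * (near_const * \<delta> powr (1 - \<sigma>))"
    proof (rule near_bound[OF x \<delta>])
      fix w :: 'a
      have "\<bar>\<phi> (x + w) - \<phi> x\<bar> = L * \<bar>sqrt (\<mu>\<^sup>2 + norm (x + w - (y + \<xi>)) ^ 2) - sqrt (\<mu>\<^sup>2 + norm (x - (y + \<xi>)) ^ 2)\<bar>"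
        using L1 by (simp add: \<phi>_def L_def abs_mult flip: right_diff_distrib)
      also have "\<dots> \<le> L * norm ((x + w - (y + \<xi>)) - (x - (y + \<xi>)))"
        using L1 by (intro mult_left_mono sqrt_sum_sq_lipschitz \<mu>) (simp add: L_def)
      finally show "\<bar>\<phi> (x + w) - \<phi> x\<bar> \<le> 2 * L1 * norm w" by (simp add: L_def)
    qed (use L1 in simp)
    have i2: "\<bar>nonlocal_op \<Omega> \<nu> (ball 0 \<delta>) \<psi> y\<bar> \<le> (2 * L1 + 2 * diameter cl) * (near_const * \<delta> powr (1 - \<sigma>))"
    proof (rule near_bound[OF y \<delta>])
      show "0 \<le> 2 * L1 + 2 * diameter cl" using L1 dia0 by simp
      fix w :: 'a assume w: "y + w \<in> cl"
      have "\<bar>sqrt (\<mu>\<^sup>2 + norm (y + w - (x - \<xi>)) ^ 2) - sqrt (\<mu>\<^sup>2 + norm (y - (x - \<xi>)) ^ 2)\<bar> \<le> norm w"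
        using sqrt_sum_sq_lipschitz[OF \<mu>, of "y + w - (x - \<xi>)" "y - (x - \<xi>)"] by simp
      then have k1: "L * \<bar>sqrt (\<mu>\<^sup>2 + norm (y + w - (x - \<xi>)) ^ 2) - sqrt (\<mu>\<^sup>2 + norm (y - (x - \<xi>)) ^ 2)\<bar> \<le> L * norm w"
        using L1 by (simp add: L_def)
      have "norm (y + w - x0) ^ 2 - norm (y - x0) ^ 2 = w \<bullet> ((y + w - x0) + (y - x0))"
        by (simp add: power2_norm_eq_inner algebra_simps inner_commute)
      then have "\<bar>norm (y + w - x0) ^ 2 - norm (y - x0) ^ 2\<bar> \<le> norm w * norm ((y + w - x0) + (y - x0))"
        by (simp add: Cauchy_Schwarz_ineq2)
      also have "\<dots> \<le> norm w * (2 * diameter cl)"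
        using dia[OF w] dia[OF y] norm_triangle_ineq[of "y + w - x0" "y - x0"] by (intro mult_left_mono) auto
      finally have k2: "\<bar>norm (y + w - x0) ^ 2 - norm (y - x0) ^ 2\<bar> \<le> norm w * (2 * diameter cl)" .
      have "\<psi> (y + w) - \<psi> y = - (L * (sqrt (\<mu>\<^sup>2 + norm (y + w - (x - \<xi>)) ^ 2) - sqrt (\<mu>\<^sup>2 + norm (y - (x - \<xi>)) ^ 2)))
        - (norm (y + w - x0) ^ 2 - norm (y - x0) ^ 2)" by (simp add: \<psi>_def algebra_simps)
      then have "\<bar>\<psi> (y + w) - \<psi> y\<bar> \<le> L * \<bar>sqrt (\<mu>\<^sup>2 + norm (y + w - (x - \<xi>)) ^ 2) - sqrt (\<mu>\<^sup>2 + norm (y - (x - \<xi>)) ^ 2)\<bar>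
        + \<bar>norm (y + w - x0) ^ 2 - norm (y - x0) ^ 2\<bar>"
        using L1 by (metis (no_types, opaque_lifting) L_def abs_minus_cancel abs_mult abs_of_pos abs_triangle_ineq4 mult_pos_pos zero_less_numeral)
      also have "\<dots> \<le> (2 * L1 + 2 * diameter cl) * norm w" using k1 k2 by (simp add: L_def algebra_simps)
      finally show "\<bar>\<psi> (y + w) - \<psi> y\<bar> \<le> (2 * L1 + 2 * diameter cl) * norm w" .
    qed
    show ?thesis
      using E1[OF \<delta>(1)] E2[OF \<delta>(1)] i1 i2 unfolding visc_E_def D\<phi>x D\<psi>y mult_minus_left by linarith
  qed
  show ?thesis
    using x\<Omega> y xx0 y\<epsilon> \<epsilon> vx0 p qp ineqs by (intro exI[of _ x] exI[of _ y] exI[of _ p] exI[of _ q]) (auto simp: dist_norm)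
qed

lemma tendsto_zero_inverse_Suc:
  fixes f :: "nat \<Rightarrow> 'b::metric_space"
  assumes "\<And>n. dist (f n) a < inverse (real (Suc n))"
  shows "f \<longlonglongrightarrow> a"
proof (subst tendsto_dist_iff, rule tendsto_sandwich[OF _ _ tendsto_const LIMSEQ_inverse_real_of_nat])
  show "\<forall>\<^sub>F n in sequentially. dist (f n) a \<le> inverse (real (Suc n))"
    by (intro always_eventually allI less_imp_le assms)
qed simp

lemma near_const_tendsto: "(\<lambda>n. near_const * inverse (real (Suc n)) powr (1 - \<sigma>)) \<longlonglongrightarrow> 0"
proof -
  have "(\<lambda>n. inverse (real (Suc n)) powr (1 - \<sigma>)) \<longlonglongrightarrow> 0 powr (1 - \<sigma>)"
    using \<sigma> by (intro tendsto_powr' LIMSEQ_inverse_real_of_nat tendsto_const) auto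
  then show ?thesis using tendsto_mult_right_zero[of "\<lambda>n. inverse (real (Suc n)) powr (1 - \<sigma>)"] by simp
qed

text \<open>Two limits in this order: first the doubled points merge at \<open>x0\<close> with
  \<delta> fixed, the bounded slopes converging along a subsequence to one common slope; then
  \<delta> tends to 0 and removes the near terms, which leaves
  \<open>\<eta> \<le> 0\<close>.\<close>

lemma strict_comparison:
  assumes U: "L1-lipschitz_on cl U" and L1: "L1 > 0" and sub: "\<And>x. x \<in> \<Omega> \<Longrightarrow> sub_at (- \<eta>) U x"
    and \<eta>: "\<eta> > 0" and Ug: "\<And>x. x \<in> frontier \<Omega> \<Longrightarrow> U x \<le> g x"
    and v: "visc_supersolution \<Omega> \<nu> H g 0 v" and bd: "bounded (v ` cl)"
    and w: "w \<in> cl"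
  shows "U w \<le> v w"
proof (rule ccontr)
  assume neg: "\<not> U w \<le> v w"
  obtain R where R: "\<And>y. y \<in> cl \<Longrightarrow> \<bar>v y\<bar> \<le> R" using bd unfolding bounded_iff by auto
  have Uc: "continuous_on cl U" using lipschitz_on_continuous_on[OF U] .
  have lsc: "lsc_on cl v" using v unfolding visc_supersolution_def by blast
  have "usc_on cl (\<lambda>y. U y + - v y)"
    using lsc by (intro usc_on_add continuous_on_imp_usc_on[OF Uc]) (simp add: lsc_on_iff_usc_on)
  moreover have "cl \<noteq> {}" using \<Omega>_nonempty by simp
  ultimately obtain x0 where x0: "x0 \<in> cl" "\<And>y. y \<in> cl \<Longrightarrow> U y + - v y \<le> U x0 + - v x0"
    using usc_on_attains_sup[OF compact_cl] by blast
  have max: "U y - v y \<le> U x0 - v x0" if "y \<in> cl" for y using x0(2)[OF that] by simp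
  have pos: "U x0 - v x0 > 0" using max[OF w] neg by simp
  define Rel where "Rel = (\<lambda>\<epsilon> x y p q. x \<in> \<Omega> \<and> y \<in> cl \<and> dist x x0 < \<epsilon> \<and> dist y x0 < \<epsilon> \<and>
    v y \<le> v x0 + (L1 + 1) * \<epsilon> \<and> norm p \<le> 2 * L1 \<and> norm (q - p) < \<epsilon> \<and>
    (\<forall>\<delta>. 0 < \<delta> \<and> \<delta> < 1 \<longrightarrow>
      H x (U x) p \<le> - \<eta> + 2 * L1 * (near_const * \<delta> powr (1 - \<sigma>)) + nonlocal_op \<Omega> \<nu> (- ball 0 \<delta>) U x \<and>
      H y (v y) q \<ge> - (2 * L1 + 2 * diameter cl) * (near_const * \<delta> powr (1 - \<sigma>)) + nonlocal_op \<Omega> \<nu> (- ball 0 \<delta>) v y))"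
  have ex: "\<exists>x y p q. Rel (inverse (real (Suc n))) x y p q" for n
    unfolding Rel_def by (rule comparison_approx[OF U L1 sub Ug v x0(1) max pos]) simp_all
  have "\<forall>n. \<exists>z. Rel (inverse (real (Suc n))) (fst z) (fst (snd z)) (fst (snd (snd z))) (snd (snd (snd z)))"
  proof
    fix n
    obtain x y p q where "Rel (inverse (real (Suc n))) x y p q" using ex by blast
    then show "\<exists>z. Rel (inverse (real (Suc n))) (fst z) (fst (snd z)) (fst (snd (snd z))) (snd (snd (snd z)))"
      by (intro exI[of _ "(x, y, p, q)"]) simp
  qed
  from choice[OF this] obtain Z where Z: "\<And>n. Rel (inverse (real (Suc n))) (fst (Z n)) (fst (snd (Z n))) (fst (snd (snd (Z n)))) (snd (snd (snd (Z n))))"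
    by blast
  define X Y P Q where "X = (\<lambda>n. fst (Z n))" and "Y = (\<lambda>n. fst (snd (Z n)))"
    and "P = (\<lambda>n. fst (snd (snd (Z n))))" and "Q = (\<lambda>n. snd (snd (snd (Z n))))"
  have XY: "Rel (inverse (real (Suc n))) (X n) (Y n) (P n) (Q n)" for n
    using Z by (simp add: X_def Y_def P_def Q_def)
  have S: "\<And>n. X n \<in> \<Omega>" "\<And>n. Y n \<in> cl"
    "\<And>n. dist (X n) x0 < inverse (real (Suc n))" "\<And>n. dist (Y n) x0 < inverse (real (Suc n))"
    "\<And>n. v (Y n) \<le> v x0 + (L1 + 1) * inverse (real (Suc n))"
    "\<And>n. norm (P n) \<le> 2 * L1" "\<And>n. norm (Q n - P n) < inverse (real (Suc n))"
    "\<And>n \<delta>. 0 < \<delta> \<Longrightarrow> \<delta> < 1 \<Longrightarrow>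
      H (X n) (U (X n)) (P n) \<le> - \<eta> + 2 * L1 * (near_const * \<delta> powr (1 - \<sigma>)) + nonlocal_op \<Omega> \<nu> (- ball 0 \<delta>) U (X n)"
    "\<And>n \<delta>. 0 < \<delta> \<Longrightarrow> \<delta> < 1 \<Longrightarrow>
      H (Y n) (v (Y n)) (Q n) \<ge> - (2 * L1 + 2 * diameter cl) * (near_const * \<delta> powr (1 - \<sigma>)) + nonlocal_op \<Omega> \<nu> (- ball 0 \<delta>) v (Y n)"
    using XY unfolding Rel_def by simp_all
  have Xc: "X n \<in> cl" for n using S(1) \<Omega>_cl by blast
  have X: "X \<longlonglongrightarrow> x0" and Y: "Y \<longlonglongrightarrow> x0" using tendsto_zero_inverse_Suc S(3,4) by blast+
  have QP: "(\<lambda>n. Q n - P n) \<longlonglongrightarrow> 0" using S(7) by (intro tendsto_zero_inverse_Suc) (simp add: dist_norm)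
  \<comment> \<open>Lower semicontinuity gives one half; the bound on \<open>v y\<close> from
    \<open>comparison_approx\<close> gives the other. Convergence of these values is needed for the
    continuity of \<open>H\<close> and for the base value in the far integral.\<close>
  have vY: "(\<lambda>n. v (Y n)) \<longlonglongrightarrow> v x0"
  proof (rule order_tendstoI)
    fix a assume "a < v x0"
    then show "\<forall>\<^sub>F n in sequentially. a < v (Y n)" by (rule lsc_on_seq[OF lsc S(2) x0(1) Y])
  next
    fix a assume a: "v x0 < a"
    have "(\<lambda>n. v x0 + (L1 + 1) * inverse (real (Suc n))) \<longlonglongrightarrow> v x0 + (L1 + 1) * 0"
      by (intro tendsto_intros LIMSEQ_inverse_real_of_nat)
    then have "\<forall>\<^sub>F n in sequentially. v x0 + (L1 + 1) * inverse (real (Suc n)) < a"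
      using a order_tendstoD(2) by fastforce
    then show "\<forall>\<^sub>F n in sequentially. v (Y n) < a" by eventually_elim (use S(5) le_less_trans in blast)
  qed
  have UX: "(\<lambda>n. U (X n)) \<longlonglongrightarrow> U x0" using continuous_on_tendsto_compose[OF Uc X x0(1)] Xc by simp
  have "\<forall>n. P n \<in> cball 0 (2 * L1)" using S(6) by simp
  then have "\<exists>l\<in>cball 0 (2 * L1). \<exists>r. strict_mono r \<and> (P \<circ> r) \<longlonglongrightarrow> l"
    using compact_cball[of "0::'a" "2 * L1"] unfolding compact_def by simp
  then obtain p \<tau> where \<tau>: "strict_mono \<tau>" "(P \<circ> \<tau>) \<longlonglongrightarrow> p" by blast
  have sub': "(\<lambda>n. f (\<tau> n)) \<longlonglongrightarrow> l" if "f \<longlonglongrightarrow> l" for f :: "nat \<Rightarrow> 'b::topological_space" and l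
    using LIMSEQ_subseq_LIMSEQ[OF that \<tau>(1)] by (simp add: o_def)
  have P: "(\<lambda>n. P (\<tau> n)) \<longlonglongrightarrow> p" using \<tau>(2) by (simp add: o_def)
  have Q: "(\<lambda>n. Q (\<tau> n)) \<longlonglongrightarrow> p"
    using tendsto_add[OF P sub'[OF QP]] by simp
  have HX: "(\<lambda>n. H (X (\<tau> n)) (U (X (\<tau> n))) (P (\<tau> n))) \<longlonglongrightarrow> H x0 (U x0) p"
    by (rule H_tendsto[OF Xc x0(1) sub'[OF X] sub'[OF UX] P])
  have HY: "(\<lambda>n. H (Y (\<tau> n)) (v (Y (\<tau> n))) (Q (\<tau> n))) \<longlonglongrightarrow> H x0 (v x0) p"
    by (rule H_tendsto[OF S(2) x0(1) sub'[OF Y] sub'[OF vY] Q])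
  define G where "G = 4 * L1 + 2 * diameter cl"
  have key: "\<eta> \<le> G * (near_const * \<delta> powr (1 - \<sigma>))" if \<delta>: "0 < \<delta>" "\<delta> < 1" for \<delta>
  proof -
    let ?k = "near_const * \<delta> powr (1 - \<sigma>)"
    let ?I = "nonlocal_op \<Omega> \<nu> (- ball 0 \<delta>)"
    have a: "H x0 (U x0) p \<le> - \<eta> + 2 * L1 * ?k + ?I U x0"
    proof (rule LIMSEQ_le[OF HX])
      show "(\<lambda>n. - \<eta> + 2 * L1 * ?k + ?I U (X (\<tau> n))) \<longlonglongrightarrow> - \<eta> + 2 * L1 * ?k + ?I U x0"
        by (intro tendsto_intros nonlocal_far_tendsto[OF Xc x0(1) sub'[OF X] \<delta>(1) Uc])
      show "\<exists>N. \<forall>n\<ge>N. H (X (\<tau> n)) (U (X (\<tau> n))) (P (\<tau> n)) \<le> - \<eta> + 2 * L1 * ?k + ?I U (X (\<tau> n))"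
        using S(8)[OF \<delta>] by blast
    qed
    have b: "- (2 * L1 + 2 * diameter cl) * ?k + ?I v x0 \<le> H x0 (v x0) p"
    proof (rule field_le_epsilon)
      fix e :: real assume e: "e > 0"
      have "\<forall>\<^sub>F n in sequentially. ?I v (Y (\<tau> n)) \<ge> ?I v x0 - e"
        by (rule nonlocal_far_liminf[OF S(2) x0(1) sub'[OF Y] \<delta>(1) lsc _ sub'[OF vY] e]) (rule R)
      then have "\<forall>\<^sub>F n in sequentially. - (2 * L1 + 2 * diameter cl) * ?k + (?I v x0 - e) \<le> H (Y (\<tau> n)) (v (Y (\<tau> n))) (Q (\<tau> n))"
      proof eventually_elim
        case (elim n)
        then show ?case using S(9)[OF \<delta>, of "\<tau> n"] by linarith
      qed
      then have "- (2 * L1 + 2 * diameter cl) * ?k + (?I v x0 - e) \<le> H x0 (v x0) p"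
        by (rule tendsto_lowerbound[OF HY]) simp
      then show "- (2 * L1 + 2 * diameter cl) * ?k + ?I v x0 \<le> H x0 (v x0) p + e" by linarith
    qed
    \<comment> \<open>Maximality of \<open>U - v\<close> at \<open>x0\<close> makes each increment
      of \<open>U\<close> at most that of \<open>v\<close>.\<close>
    have "?I U x0 \<le> ?I v x0"
      unfolding nonlocal_far_eq
    proof (rule set_integral_mono)
      obtain R' where R': "\<And>y. y \<in> cl \<Longrightarrow> \<bar>U y\<bar> \<le> R'"
        using compact_imp_bounded[OF compact_continuous_image[OF Uc compact_cl]] unfolding bounded_iff by auto
      show "set_integrable (\<nu> x0) (- ball 0 \<delta>) (\<lambda>z. jump U x0 z)"
        by (rule far_jump_integrable[OF x0(1) \<delta>(1) borel_measurable_usc_on[OF continuous_on_imp_usc_on[OF Uc]]]) (use R' in simp_all)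
      show "set_integrable (\<nu> x0) (- ball 0 \<delta>) (\<lambda>z. jump v x0 z)"
        by (rule far_jump_integrable[OF x0(1) \<delta>(1) borel_measurable_lsc_on[OF lsc]]) (use R in simp_all)
      show "jump U x0 z \<le> jump v x0 z" for z
        using max[of "x0 + z"] by (auto simp: indicator_def)
    qed
    moreover have "H x0 (v x0) p \<le> H x0 (U x0) p" using pos by (intro H_mono x0) simp
    moreover have "G * ?k = 2 * L1 * ?k - - (2 * L1 + 2 * diameter cl) * ?k" by (simp add: G_def algebra_simps)
    ultimately show ?thesis using a b by linarith
  qed
  have "(\<lambda>n. G * (near_const * inverse (real (Suc n)) powr (1 - \<sigma>))) \<longlonglongrightarrow> 0"
    using tendsto_mult_right_zero[OF near_const_tendsto] .
  then have "\<forall>\<^sub>F n in sequentially. G * (near_const * inverse (real (Suc n)) powr (1 - \<sigma>)) < \<eta>"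
    using \<eta> by (simp add: order_tendsto_iff)
  moreover have "\<forall>\<^sub>F n in sequentially. n \<ge> (1::nat)" by (rule eventually_ge_at_top)
  ultimately have "\<forall>\<^sub>F n::nat in sequentially. False"
  proof eventually_elim
    case (elim n)
    have "inverse (real (Suc n)) < 1" using elim(2) by (simp add: inverse_eq_divide field_simps)
    then show ?case using key[of "inverse (real (Suc n))"] elim(1) by simp
  qed
  then show False by simp
qed

end

section \<open>Convex combinations of subsolutions\<close>


context nonlocal_dirichlet
begin

lemma continuous_on_cl_bounded:
  fixes u :: "'a \<Rightarrow> real"
  assumes "continuous_on cl u"
  obtains R where "R > 0" "\<And>y. y \<in> cl \<Longrightarrow> \<bar>u y\<bar> \<le> R"
proof -
  obtain R where "\<And>y. y \<in> cl \<Longrightarrow> \<bar>u y\<bar> \<le> R"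
    using compact_imp_bounded[OF compact_continuous_image[OF assms compact_cl]] unfolding bounded_iff by auto
  then have "\<And>y. y \<in> cl \<Longrightarrow> \<bar>u y\<bar> \<le> \<bar>R\<bar> + 1" by fastforce
  then show ?thesis using that[of "\<bar>R\<bar> + 1"] by simp
qed

lemma continuous_on_cl_measurable:
  fixes u :: "'a \<Rightarrow> real"
  shows "continuous_on cl u \<Longrightarrow> u \<in> borel_measurable (restrict_space borel cl)"
  by (rule borel_measurable_usc_on[OF continuous_on_imp_usc_on]) simp_all

text \<open>Since \<open>\<sigma> < 1\<close>, the part of the integral near the origin vanishes in the limit, so the test
  function only matters through its gradient at the contact point.\<close>

lemma sub_at_limitI:
  assumes x0: "x0 \<in> \<Omega>" and u: "continuous_on cl u"
    and *: "\<And>\<phi> D\<phi>. C1_with_gradient cl \<phi> D\<phi> \<Longrightarrow> \<forall>y\<in>cl. u y - \<phi> y \<le> u x0 - \<phi> x0 \<Longrightarrow>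
      \<exists>K. \<exists>r>0. \<forall>\<delta>. 0 < \<delta> \<and> \<delta> < r \<longrightarrow> H x0 (u x0) (D\<phi> x0) \<le>
        c + K * (near_const * \<delta> powr (1 - \<sigma>)) + nonlocal_op \<Omega> \<nu> (- ball 0 \<delta>) u x0"
  shows "sub_at c u x0"
  unfolding sub_at_def
proof (intro allI impI)
  fix \<phi> D\<phi> and d :: real
  assume \<phi>: "C1_with_gradient cl \<phi> D\<phi>" and max: "\<forall>y\<in>cl. u y - \<phi> y \<le> u x0 - \<phi> x0" and d: "d > 0"
  have x0c: "x0 \<in> cl" using x0 \<Omega>_cl by blast
  obtain R where R: "R > 0" "\<And>y. y \<in> cl \<Longrightarrow> \<bar>u y\<bar> \<le> R" using continuous_on_cl_bounded[OF u] by blast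
  obtain K r where K: "r > 0" "\<And>\<delta>. 0 < \<delta> \<Longrightarrow> \<delta> < r \<Longrightarrow> H x0 (u x0) (D\<phi> x0) \<le>
        c + K * (near_const * \<delta> powr (1 - \<sigma>)) + nonlocal_op \<Omega> \<nu> (- ball 0 \<delta>) u x0"
    using *[OF \<phi> max] by blast
  obtain s where s: "s > 0" "cball x0 s \<subseteq> \<Omega>" using open_\<Omega> x0 open_contains_cball by blast
  obtain B where B: "B \<ge> 1" "\<And>a b. a \<in> cball x0 s \<Longrightarrow> b \<in> cball x0 s \<Longrightarrow> \<bar>\<phi> a - \<phi> b\<bar> \<le> B * norm (a - b)"
    using C1_with_gradient_lipschitz_compact[OF C1_with_gradient_subset[OF \<phi>], of "cball x0 s"] s(2) \<Omega>_cl by auto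
  have key: "visc_E \<Omega> \<nu> H d u \<phi> D\<phi> x0 \<le> c + (K + B) * (near_const * \<delta> powr (1 - \<sigma>))"
    if \<delta>: "0 < \<delta>" "\<delta> < 1" "\<delta> < r" "\<delta> < s" "\<delta> \<le> d" for \<delta>
  proof -
    have "\<bar>nonlocal_op \<Omega> \<nu> (ball 0 \<delta>) \<phi> x0\<bar> \<le> B * (near_const * \<delta> powr (1 - \<sigma>))"
    proof (rule near_bound[OF x0c \<delta>(1,2)])
      fix z :: 'a assume "norm z < \<delta>"
      then have "x0 + z \<in> cball x0 s" "x0 \<in> cball x0 s" using \<delta> s by (auto simp: dist_norm)
      then show "\<bar>\<phi> (x0 + z) - \<phi> x0\<bar> \<le> B * norm z" using B(2)[of "x0 + z" x0] by simp
    qed (use B in simp)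
    moreover have "visc_E \<Omega> \<nu> H d u \<phi> D\<phi> x0 \<le> visc_E \<Omega> \<nu> H \<delta> u \<phi> D\<phi> x0"
      by (rule visc_E_antimono[OF x0c \<phi> \<delta>(1,5) continuous_on_cl_measurable[OF u] R(2) max])
    ultimately show ?thesis using K(2)[OF \<delta>(1,3)] unfolding visc_E_def by (simp add: distrib_right abs_le_iff)
  qed
  have "(\<lambda>n. c + (K + B) * (near_const * inverse (real (Suc n)) powr (1 - \<sigma>))) \<longlonglongrightarrow> c + (K + B) * 0"
    by (intro tendsto_intros near_const_tendsto)
  moreover have "\<forall>\<^sub>F n in sequentially. inverse (real (Suc n)) < min (min 1 r) (min s d)"
    using order_tendstoD(2)[OF LIMSEQ_inverse_real_of_nat, of "min (min 1 r) (min s d)"] K(1) s(1) d by simp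
  then have "\<forall>\<^sub>F n in sequentially. visc_E \<Omega> \<nu> H d u \<phi> D\<phi> x0 \<le> c + (K + B) * (near_const * inverse (real (Suc n)) powr (1 - \<sigma>))"
    by eventually_elim (rule key, auto)
  ultimately have "visc_E \<Omega> \<nu> H d u \<phi> D\<phi> x0 \<le> c + (K + B) * 0"
    by (intro tendsto_lowerbound) auto
  then show "visc_E \<Omega> \<nu> H d u \<phi> D\<phi> x0 \<le> c" by simp
qed

lemma near_bound_lipschitz_ball:
  assumes x: "x \<in> cl" and \<delta>: "0 < \<delta>" "\<delta> < 1" "\<delta> < s / 2" and xs: "norm (x - x0) < s / 2"
    and B: "0 \<le> B" "\<And>a b. a \<in> cball x0 s \<Longrightarrow> b \<in> cball x0 s \<Longrightarrow> \<bar>\<phi> a - \<phi> b\<bar> \<le> B * norm (a - b)"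
  shows "\<bar>nonlocal_op \<Omega> \<nu> (ball 0 \<delta>) \<phi> x\<bar> \<le> B * (near_const * \<delta> powr (1 - \<sigma>))"
proof (rule near_bound[OF x \<delta>(1,2) B(1)])
  fix z :: 'a assume z: "norm z < \<delta>"
  have "norm (x + z - x0) \<le> norm (x - x0) + norm z" using norm_triangle_ineq[of "x - x0" z] by (simp add: algebra_simps)
  then have "norm (x + z - x0) \<le> s" "norm (x - x0) \<le> s" using z \<delta> xs by linarith+
  then have "x + z \<in> cball x0 s" "x \<in> cball x0 s" by (metis dist_commute dist_norm mem_cball)+
  then show "\<bar>\<phi> (x + z) - \<phi> x\<bar> \<le> B * norm z" using B(2)[of "x + z" x] by simp
qed

lemma dist_sq_lipschitz:
  fixes a b x0 :: 'a
  assumes "a \<in> cball x0 s" "b \<in> cball x0 s"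
  shows "\<bar>norm (a - x0) ^ 2 - norm (b - x0) ^ 2\<bar> \<le> 2 * s * norm (a - b)"
proof -
  have "norm (a - x0) ^ 2 - norm (b - x0) ^ 2 = (a - b) \<bullet> ((a - x0) + (b - x0))"
    by (simp add: power2_norm_eq_inner algebra_simps inner_commute)
  then have "\<bar>norm (a - x0) ^ 2 - norm (b - x0) ^ 2\<bar> \<le> norm (a - b) * norm ((a - x0) + (b - x0))"
    by (simp add: Cauchy_Schwarz_ineq2)
  also have "\<dots> \<le> norm (a - b) * (s + s)"
  proof (rule mult_left_mono)
    have "norm (a - x0) \<le> s" "norm (b - x0) \<le> s" using assms by (metis dist_commute dist_norm mem_cball)+
    then show "norm ((a - x0) + (b - x0)) \<le> s + s" using norm_triangle_ineq[of "a - x0" "b - x0"] by linarith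
  qed simp
  finally show ?thesis by (simp add: mult.commute)
qed

text \<open>A contact of the combination gives no contact of \<open>U1\<close> or \<open>U2\<close>
  alone, so the variables are doubled. The gradients seen by \<open>U1\<close> and \<open>U2\<close>
  carry the opposite terms \<open>q / (1 - \<theta>)\<close> and \<open>- q / \<theta>\<close>,
  which cancel in the combination. Half of \<open>L\<close> exceeds the Lipschitz constants of
  \<open>U1 - \<phi>\<close> and of the quadratic term together, so the two points stay close and
  \<open>q\<close> stays bounded.\<close>

lemma convex_combination_approx:
  assumes L1: "L1 > 0" "L1-lipschitz_on cl U1" "L1-lipschitz_on cl U2"
    and sub: "\<And>x. x \<in> \<Omega> \<Longrightarrow> sub_at c1 U1 x" "\<And>x. x \<in> \<Omega> \<Longrightarrow> sub_at c2 U2 x"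
    and \<theta>: "0 < \<theta>" "\<theta> < 1" and s: "0 < s" "s \<le> 1" "cball x0 s \<subseteq> \<Omega>"
    and \<phi>: "C1_with_gradient cl \<phi> D\<phi>"
    and max: "\<forall>y\<in>cl. ((1 - \<theta>) * U1 y + \<theta> * U2 y) - \<phi> y \<le> ((1 - \<theta>) * U1 x0 + \<theta> * U2 x0) - \<phi> x0"
    and B: "B \<ge> 1" "\<And>a b. a \<in> cball x0 s \<Longrightarrow> b \<in> cball x0 s \<Longrightarrow> \<bar>\<phi> a - \<phi> b\<bar> \<le> B * norm (a - b)"
    and L: "L = 2 * (L1 + B + 2)" and \<epsilon>: "\<epsilon> > 0"
  shows "\<exists>x y q. x \<in> cl \<and> y \<in> cl \<and> norm (x - x0) < \<epsilon> \<and> norm (y - x0) < \<epsilon> \<and> norm q \<le> L \<and>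
    (\<forall>\<delta>. 0 < \<delta> \<and> \<delta> < s / 2 \<longrightarrow>
      H x (U1 x) (D\<phi> x + (1 / (1 - \<theta>)) *\<^sub>R (2 *\<^sub>R (x - x0) + q)) \<le>
        c1 + (B + (1 / (1 - \<theta>)) * (2 * s + L)) * (near_const * \<delta> powr (1 - \<sigma>)) + nonlocal_op \<Omega> \<nu> (- ball 0 \<delta>) U1 x \<and>
      H y (U2 y) (D\<phi> y + (1 / \<theta>) *\<^sub>R (- q)) \<le>
        c2 + (B + (1 / \<theta>) * L) * (near_const * \<delta> powr (1 - \<sigma>)) + nonlocal_op \<Omega> \<nu> (- ball 0 \<delta>) U2 y)"
proof -
  let ?C = "cball x0 s"
  have Ccl: "?C \<subseteq> cl" using s(3) \<Omega>_cl by blast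
  have x0C: "x0 \<in> ?C" using s by simp
  have U1c: "continuous_on cl U1" and U2c: "continuous_on cl U2"
    using L1 lipschitz_on_continuous_on by blast+
  have Ulip: "\<bar>U1 a - U1 b\<bar> \<le> L1 * norm (a - b)" "\<bar>U2 a - U2 b\<bar> \<le> L1 * norm (a - b)" if "a \<in> cl" "b \<in> cl" for a b
    using lipschitz_onD[OF L1(2) that] lipschitz_onD[OF L1(3) that] by (simp_all add: dist_norm)
  define b where "b = min (s / 4) (\<epsilon> / 2)"
  have b: "0 < b" "b \<le> s / 4" "b \<le> \<epsilon> / 2" using s \<epsilon> by (auto simp: b_def)
  \<comment> \<open>Small enough that the distance of \<open>x\<close> and \<open>y\<close>, at most
    \<open>4 / 3 * \<mu>\<close>, is below \<open>b / 4\<close>, and that the error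
    \<open>(L1 + B) * (4 * \<mu>)\<close> from separating the points is at most
    \<open>b\<^sup>2 / 4\<close>.\<close>
  define \<mu> where "\<mu> = min (b\<^sup>2 / (4 * (L1 + B))) (b / 4) / 4"
  have LB: "L1 + B > 0" using L1 B by simp
  have \<mu>: "0 < \<mu>" using b LB by (simp add: \<mu>_def)
  have "\<mu> \<le> (b / 4) / 4" unfolding \<mu>_def by (intro divide_right_mono min.cobounded2) simp
  then have \<mu>b: "4 / 3 * \<mu> < b / 4" using b by linarith
  have "4 * \<mu> \<le> b\<^sup>2 / (4 * (L1 + B))" unfolding \<mu>_def by simp
  then have "(L1 + B) * (4 * \<mu>) \<le> (L1 + B) * (b\<^sup>2 / (4 * (L1 + B)))" using LB by (intro mult_left_mono) auto
  also have "(L1 + B) * (b\<^sup>2 / (4 * (L1 + B))) = b\<^sup>2 / 4" using LB by (simp add: field_simps)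
  finally have \<mu>b2: "(L1 + B) * (4 * \<mu>) \<le> b\<^sup>2 / 4" .
  define \<Phi> where "\<Phi> = (\<lambda>p. (1 - \<theta>) * (U1 (fst p) - \<phi> (fst p)) + \<theta> * (U2 (snd p) - \<phi> (snd p)) - norm (fst p - x0) ^ 2
    - L * sqrt (\<mu>\<^sup>2 + norm (fst p - snd p) ^ 2))"
  have c\<phi>: "continuous_on cl \<phi>" by (rule C1_with_gradient_continuous_on[OF \<phi>])
  have \<Phi>c: "continuous_on (?C \<times> ?C) \<Phi>"
    unfolding \<Phi>_def
    by (intro continuous_intros continuous_on_compose2[OF U1c] continuous_on_compose2[OF U2c] continuous_on_compose2[OF c\<phi>])
      (use Ccl in auto)
  have "?C \<times> ?C \<noteq> {}" using x0C by blast
  from continuous_attains_sup[OF compact_Times[OF compact_cball compact_cball] this \<Phi>c]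
  obtain p where p: "p \<in> ?C \<times> ?C" "\<forall>z\<in>?C \<times> ?C. \<Phi> z \<le> \<Phi> p" by blast
  define x y where "x = fst p" and "y = snd p"
  have x: "x \<in> ?C" and y: "y \<in> ?C" using p(1) by (auto simp: x_def y_def)
  have \<Phi>max: "\<Phi> (a, b) \<le> \<Phi> (x, y)" if "a \<in> ?C" "b \<in> ?C" for a b
    using p(2) that by (simp add: x_def y_def)
  have xc: "x \<in> cl" and yc: "y \<in> cl" and x0c: "x0 \<in> cl" using x y x0C Ccl by auto
  define d where "d = norm (x - y)"
  define z where "z = sqrt (\<mu>\<^sup>2 + d\<^sup>2)"
  have z0: "0 < z" using \<mu> by (simp add: z_def add_pos_nonneg)
  have zd: "d \<le> z" "\<mu> \<le> z" using \<mu> by (auto simp: z_def d_def intro!: real_le_rsqrt)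
  have L0: "L > 0" using L L1 B by simp
  have val: "\<Phi> (x, y) = (1 - \<theta>) * (U1 x - \<phi> x) + \<theta> * (U2 y - \<phi> y) - norm (x - x0) ^ 2 - L * z"
    by (simp add: \<Phi>_def z_def d_def)
  have d3: "d \<le> 4 / 3 * \<mu>"
  proof (rule sqrt_penalty_estimate[OF _ \<mu>])
    \<comment> \<open>Moving the first point onto the second leaves the \<open>U2\<close> part
      unchanged and bounds the penalty.\<close>
    have "\<Phi> (y, y) \<le> \<Phi> (x, y)" by (rule \<Phi>max[OF y y])
    then have "L * z \<le> L * \<mu> + (1 - \<theta>) * ((U1 x - U1 y) - (\<phi> x - \<phi> y)) + (norm (y - x0) ^ 2 - norm (x - x0) ^ 2)"
      using \<mu> unfolding val by (simp add: \<Phi>_def algebra_simps)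
    also have "\<dots> \<le> L * \<mu> + (L1 + B) * d + 2 * d"
    proof -
      have "\<bar>(U1 x - U1 y) - (\<phi> x - \<phi> y)\<bar> \<le> (L1 + B) * d"
        using Ulip(1)[OF xc yc] B(2)[OF x y] by (simp add: d_def distrib_right abs_le_iff)
      moreover have "0 \<le> (L1 + B) * d" using LB by (simp add: d_def)
      ultimately have "(1 - \<theta>) * ((U1 x - U1 y) - (\<phi> x - \<phi> y)) \<le> 1 * ((L1 + B) * d)"
        using \<theta> by (intro order_trans[OF mult_left_mono mult_right_mono]) (auto simp: abs_le_iff)
      moreover have "norm (y - x0) ^ 2 - norm (x - x0) ^ 2 \<le> 2 * s * d"
        using dist_sq_lipschitz[OF y x] by (simp add: d_def norm_minus_commute abs_le_iff)
      moreover have "2 * s * d \<le> 2 * d" using s mult_right_mono[of s 1 d] by (simp add: d_def)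
      ultimately show ?thesis by linarith
    qed
    also have "\<dots> = L * (\<mu> + d / 2)" by (simp add: L algebra_simps)
    finally show "sqrt (\<mu>\<^sup>2 + d\<^sup>2) \<le> \<mu> + d / 2" using L0 by (simp add: z_def)
  qed (simp add: d_def)
  have xb: "norm (x - x0) < b"
  proof -
    \<comment> \<open>Up to the variation of \<open>U2 - \<phi>\<close> between \<open>x\<close> and
      \<open>y\<close>, the combination is evaluated at one point, where contact at
      \<open>x0\<close> leaves no room but for the quadratic term.\<close>
    have "\<Phi> (x0, x0) \<le> \<Phi> (x, y)" by (rule \<Phi>max[OF x0C x0C])
    then have 1: "(1 - \<theta>) * (U1 x0 - \<phi> x0) + \<theta> * (U2 x0 - \<phi> x0) - L * \<mu> \<le> \<Phi> (x, y)" using \<mu> by (simp add: \<Phi>_def)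
    have "\<bar>(U2 y - U2 x) - (\<phi> y - \<phi> x)\<bar> \<le> (L1 + B) * d"
      using Ulip(2)[OF yc xc] B(2)[OF y x] by (simp add: d_def norm_minus_commute distrib_right abs_le_iff)
    moreover have "0 \<le> (L1 + B) * d" using LB by (simp add: d_def)
    ultimately have 2: "\<theta> * ((U2 y - U2 x) - (\<phi> y - \<phi> x)) \<le> 1 * ((L1 + B) * d)"
      using \<theta> by (intro order_trans[OF mult_left_mono mult_right_mono]) (auto simp: abs_le_iff)
    have 3: "((1 - \<theta>) * U1 x + \<theta> * U2 x) - \<phi> x \<le> ((1 - \<theta>) * U1 x0 + \<theta> * U2 x0) - \<phi> x0" using max xc by blast
    have 4: "L * \<mu> \<le> L * z" using zd L0 by simp
    have 5: "norm (x - x0) ^ 2 = ((1 - \<theta>) * U1 x + \<theta> * U2 x - \<phi> x) + \<theta> * ((U2 y - U2 x) - (\<phi> y - \<phi> x)) - L * z - \<Phi> (x, y)"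
      unfolding val by (simp add: algebra_simps)
    have 6: "(1 - \<theta>) * (U1 x0 - \<phi> x0) + \<theta> * (U2 x0 - \<phi> x0) = ((1 - \<theta>) * U1 x0 + \<theta> * U2 x0) - \<phi> x0"
      by (simp add: algebra_simps)
    have "norm (x - x0) ^ 2 \<le> (L1 + B) * d" using 1 2 3 4 5 6 by linarith
    also have "\<dots> \<le> (L1 + B) * (4 * \<mu>)" using d3 \<mu> LB by (intro mult_left_mono) auto
    also have "\<dots> < b\<^sup>2" using \<mu>b2 b zero_less_power[of b 2] by linarith
    finally show ?thesis using b by (intro power2_less_imp_less[of _ b]) auto
  qed
  have d_b: "d < b / 4" using d3 \<mu>b by linarith
  have yx0: "norm (y - x0) \<le> d + norm (x - x0)"
    using norm_triangle_ineq[of "y - x" "x - x0"] by (simp add: d_def norm_minus_commute)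
  have x\<epsilon>: "norm (x - x0) < \<epsilon>" "norm (x - x0) < s / 2" using xb b by linarith+
  have y\<epsilon>: "norm (y - x0) < \<epsilon>" using yx0 d_b xb b \<epsilon> by linarith
  define q where "q = L *\<^sub>R ((1 / z) *\<^sub>R (x - y))"
  have q: "norm q \<le> L"
  proof -
    have "norm q = L * (d / z)" using z0 L0 by (simp add: q_def d_def)
    also have "\<dots> \<le> L * 1" using zd z0 L0 by (intro mult_left_mono) auto
    finally show ?thesis by simp
  qed
  have sqlip: "\<bar>L * sqrt (\<mu>\<^sup>2 + norm (a - w) ^ 2) - L * sqrt (\<mu>\<^sup>2 + norm (a' - w) ^ 2)\<bar> \<le> L * norm (a - a')" for a a' w :: 'a
  proof -
    have "\<bar>L * sqrt (\<mu>\<^sup>2 + norm (a - w) ^ 2) - L * sqrt (\<mu>\<^sup>2 + norm (a' - w) ^ 2)\<bar>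
      = L * \<bar>sqrt (\<mu>\<^sup>2 + norm (a - w) ^ 2) - sqrt (\<mu>\<^sup>2 + norm (a' - w) ^ 2)\<bar>"
      using L0 by (simp add: abs_mult flip: right_diff_distrib)
    also have "\<dots> \<le> L * norm ((a - w) - (a' - w))" using L0 by (intro mult_left_mono sqrt_sum_sq_lipschitz \<mu>) simp
    finally show ?thesis by simp
  qed
  have t1: "1 / (1 - \<theta>) > 0" and t2: "1 / \<theta> > 0" using \<theta> by auto
  define \<phi>1 where "\<phi>1 = (\<lambda>a. \<phi> a + (1 / (1 - \<theta>)) * (norm (a - x0) ^ 2 + L * sqrt (\<mu>\<^sup>2 + norm (a - y) ^ 2)))"
  define D\<phi>1 where "D\<phi>1 = (\<lambda>a. D\<phi> a + (1 / (1 - \<theta>)) *\<^sub>R (2 *\<^sub>R (a - x0) + L *\<^sub>R ((1 / sqrt (\<mu>\<^sup>2 + norm (a - y) ^ 2)) *\<^sub>R (a - y))))"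
  have C1: "C1_with_gradient cl \<phi>1 D\<phi>1"
    unfolding \<phi>1_def D\<phi>1_def
    by (intro C1_with_gradient_add C1_with_gradient_cmult C1_with_gradient_sqrt C1_with_gradient_dist_sq \<mu> \<phi>)
  define \<phi>2 where "\<phi>2 = (\<lambda>a. \<phi> a + (1 / \<theta>) * (L * sqrt (\<mu>\<^sup>2 + norm (a - x) ^ 2)))"
  define D\<phi>2 where "D\<phi>2 = (\<lambda>a. D\<phi> a + (1 / \<theta>) *\<^sub>R (L *\<^sub>R ((1 / sqrt (\<mu>\<^sup>2 + norm (a - x) ^ 2)) *\<^sub>R (a - x))))"
  have C2: "C1_with_gradient cl \<phi>2 D\<phi>2"
    unfolding \<phi>2_def D\<phi>2_def
    by (intro C1_with_gradient_add C1_with_gradient_cmult C1_with_gradient_sqrt \<mu> \<phi>)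
  have D1: "D\<phi>1 x = D\<phi> x + (1 / (1 - \<theta>)) *\<^sub>R (2 *\<^sub>R (x - x0) + q)"
    by (simp add: D\<phi>1_def q_def z_def d_def)
  have D2: "D\<phi>2 y = D\<phi> y + (1 / \<theta>) *\<^sub>R (- q)"
  proof -
    have "L *\<^sub>R ((1 / z) *\<^sub>R (y - x)) = - q" unfolding q_def by (metis minus_diff_eq scaleR_minus_right)
    then show ?thesis by (simp only: D\<phi>2_def z_def d_def norm_minus_commute[of y x])
  qed
  have yb: "norm (y - x0) < s / 2" using yx0 d_b xb b by linarith
  have mem: "w \<in> ?C" if "dist w a < s / 2" "norm (a - x0) < s / 2" for w a
    using that dist_triangle[of x0 w a] by (simp add: dist_norm norm_minus_commute)
  have M1: "U1 a - \<phi>1 a \<le> U1 x - \<phi>1 x" if a: "dist a x < s / 2" for a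
  proof -
    have "\<Phi> (a, y) \<le> \<Phi> (x, y)" by (rule \<Phi>max[OF mem[OF a x\<epsilon>(2)] y])
    then have "(1 - \<theta>) * (U1 a - \<phi> a) - (norm (a - x0) ^ 2 + L * sqrt (\<mu>\<^sup>2 + norm (a - y) ^ 2))
      \<le> (1 - \<theta>) * (U1 x - \<phi> x) - (norm (x - x0) ^ 2 + L * sqrt (\<mu>\<^sup>2 + norm (x - y) ^ 2))" by (simp add: \<Phi>_def)
    moreover have "(1 - \<theta>) * (U1 w - \<phi>1 w) = (1 - \<theta>) * (U1 w - \<phi> w) - (norm (w - x0) ^ 2 + L * sqrt (\<mu>\<^sup>2 + norm (w - y) ^ 2))" for w
      using \<theta> by (simp add: \<phi>1_def field_simps)
    ultimately have "(1 - \<theta>) * (U1 a - \<phi>1 a) \<le> (1 - \<theta>) * (U1 x - \<phi>1 x)" by simp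
    then show ?thesis using \<theta> by simp
  qed
  have M2: "U2 a - \<phi>2 a \<le> U2 y - \<phi>2 y" if a: "dist a y < s / 2" for a
  proof -
    have "\<Phi> (x, a) \<le> \<Phi> (x, y)" by (rule \<Phi>max[OF x mem[OF a yb]])
    then have "\<theta> * (U2 a - \<phi> a) - L * sqrt (\<mu>\<^sup>2 + norm (a - x) ^ 2) \<le> \<theta> * (U2 y - \<phi> y) - L * sqrt (\<mu>\<^sup>2 + norm (y - x) ^ 2)"
      by (simp add: \<Phi>_def norm_minus_commute[of x])
    moreover have "\<theta> * (U2 w - \<phi>2 w) = \<theta> * (U2 w - \<phi> w) - L * sqrt (\<mu>\<^sup>2 + norm (w - x) ^ 2)" for w
      using \<theta> by (simp add: \<phi>2_def field_simps)
    ultimately have "\<theta> * (U2 a - \<phi>2 a) \<le> \<theta> * (U2 y - \<phi>2 y)" by simp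
    then show ?thesis using \<theta> by simp
  qed
  have K1: "\<bar>\<phi>1 a - \<phi>1 a'\<bar> \<le> (B + (1 / (1 - \<theta>)) * (2 * s + L)) * norm (a - a')" if "a \<in> ?C" "a' \<in> ?C" for a a'
  proof -
    let ?X = "norm (a - x0) ^ 2 - norm (a' - x0) ^ 2" and ?Y = "L * sqrt (\<mu>\<^sup>2 + norm (a - y) ^ 2) - L * sqrt (\<mu>\<^sup>2 + norm (a' - y) ^ 2)"
    have "\<bar>?X + ?Y\<bar> \<le> (2 * s + L) * norm (a - a')"
      using dist_sq_lipschitz[OF that] sqlip[of a y a'] by (simp add: distrib_right abs_le_iff)
    then have "1 / (1 - \<theta>) * \<bar>?X + ?Y\<bar> \<le> 1 / (1 - \<theta>) * ((2 * s + L) * norm (a - a'))" using t1 by (intro mult_left_mono) auto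
    moreover have "\<phi>1 a - \<phi>1 a' = (\<phi> a - \<phi> a') + 1 / (1 - \<theta>) * (?X + ?Y)" unfolding \<phi>1_def by (simp add: algebra_simps)
    moreover have "\<bar>1 / (1 - \<theta>) * (?X + ?Y)\<bar> = 1 / (1 - \<theta>) * \<bar>?X + ?Y\<bar>" using t1 by (simp only: abs_mult abs_of_pos)
    moreover have "(B + (1 / (1 - \<theta>)) * (2 * s + L)) * norm (a - a') = B * norm (a - a') + 1 / (1 - \<theta>) * ((2 * s + L) * norm (a - a'))"
      by (simp add: algebra_simps)
    ultimately show ?thesis using B(2)[OF that] by linarith
  qed
  have K2: "\<bar>\<phi>2 a - \<phi>2 a'\<bar> \<le> (B + (1 / \<theta>) * L) * norm (a - a')" if "a \<in> ?C" "a' \<in> ?C" for a a'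
  proof -
    let ?Y = "L * sqrt (\<mu>\<^sup>2 + norm (a - x) ^ 2) - L * sqrt (\<mu>\<^sup>2 + norm (a' - x) ^ 2)"
    have "1 / \<theta> * \<bar>?Y\<bar> \<le> 1 / \<theta> * (L * norm (a - a'))" using t2 sqlip[of a x a'] by (intro mult_left_mono) auto
    moreover have "\<phi>2 a - \<phi>2 a' = (\<phi> a - \<phi> a') + 1 / \<theta> * ?Y" unfolding \<phi>2_def by (simp add: algebra_simps)
    moreover have "\<bar>1 / \<theta> * ?Y\<bar> = 1 / \<theta> * \<bar>?Y\<bar>" using t2 by (simp only: abs_mult abs_of_pos)
    moreover have "(B + (1 / \<theta>) * L) * norm (a - a') = B * norm (a - a') + 1 / \<theta> * (L * norm (a - a'))"
      by (simp add: algebra_simps)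
    ultimately show ?thesis using B(2)[OF that] by linarith
  qed
  obtain R1 where R1: "\<And>y. y \<in> cl \<Longrightarrow> \<bar>U1 y\<bar> \<le> R1" using continuous_on_cl_bounded[OF U1c] by blast
  obtain R2 where R2: "\<And>y. y \<in> cl \<Longrightarrow> \<bar>U2 y\<bar> \<le> R2" using continuous_on_cl_bounded[OF U2c] by blast
  have x\<Omega>: "x \<in> \<Omega>" "y \<in> \<Omega>" using x y s(3) by auto
  have ineq: "H x (U1 x) (D\<phi> x + (1 / (1 - \<theta>)) *\<^sub>R (2 *\<^sub>R (x - x0) + q)) \<le>
        c1 + (B + (1 / (1 - \<theta>)) * (2 * s + L)) * (near_const * \<delta> powr (1 - \<sigma>)) + nonlocal_op \<Omega> \<nu> (- ball 0 \<delta>) U1 x"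
      "H y (U2 y) (D\<phi> y + (1 / \<theta>) *\<^sub>R (- q)) \<le>
        c2 + (B + (1 / \<theta>) * L) * (near_const * \<delta> powr (1 - \<sigma>)) + nonlocal_op \<Omega> \<nu> (- ball 0 \<delta>) U2 y"
    if \<delta>: "0 < \<delta>" "\<delta> < s / 2" for \<delta>
  proof -
    have \<delta>1: "\<delta> < 1" using \<delta> s by linarith
    have "visc_E \<Omega> \<nu> H \<delta> U1 \<phi>1 D\<phi>1 x \<le> c1"
      by (rule sub_at_local[OF sub(1)[OF x\<Omega>(1)] xc C1 M1 _ \<delta>]) (use R1 in \<open>auto simp: abs_le_iff\<close>)
    moreover have "\<bar>nonlocal_op \<Omega> \<nu> (ball 0 \<delta>) \<phi>1 x\<bar> \<le> (B + (1 / (1 - \<theta>)) * (2 * s + L)) * (near_const * \<delta> powr (1 - \<sigma>))"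
      by (rule near_bound_lipschitz_ball[OF xc \<delta>(1) \<delta>1 \<delta>(2) x\<epsilon>(2) _ K1]) (use B t1 s L0 in auto)
    ultimately show "H x (U1 x) (D\<phi> x + (1 / (1 - \<theta>)) *\<^sub>R (2 *\<^sub>R (x - x0) + q)) \<le>
        c1 + (B + (1 / (1 - \<theta>)) * (2 * s + L)) * (near_const * \<delta> powr (1 - \<sigma>)) + nonlocal_op \<Omega> \<nu> (- ball 0 \<delta>) U1 x"
      unfolding visc_E_def D1 by linarith
    have "visc_E \<Omega> \<nu> H \<delta> U2 \<phi>2 D\<phi>2 y \<le> c2"
      by (rule sub_at_local[OF sub(2)[OF x\<Omega>(2)] yc C2 M2 _ \<delta>]) (use R2 in \<open>auto simp: abs_le_iff\<close>)
    moreover have "\<bar>nonlocal_op \<Omega> \<nu> (ball 0 \<delta>) \<phi>2 y\<bar> \<le> (B + (1 / \<theta>) * L) * (near_const * \<delta> powr (1 - \<sigma>))"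
      by (rule near_bound_lipschitz_ball[OF yc \<delta>(1) \<delta>1 \<delta>(2) yb _ K2]) (use B t2 L0 in auto)
    ultimately show "H y (U2 y) (D\<phi> y + (1 / \<theta>) *\<^sub>R (- q)) \<le>
        c2 + (B + (1 / \<theta>) * L) * (near_const * \<delta> powr (1 - \<sigma>)) + nonlocal_op \<Omega> \<nu> (- ball 0 \<delta>) U2 y"
      unfolding visc_E_def D2 by linarith
  qed
  show ?thesis
    using xc yc x\<epsilon>(1) y\<epsilon> q ineq by (intro exI[of _ x] exI[of _ y] exI[of _ q]) simp
qed

text \<open>In the limit the slopes \<open>p1\<close> and \<open>p2\<close> average to the gradient
  of \<phi>, so joint convexity of \<open>H\<close> in value and slope bounds the Hamiltonian of the
  combination, while the far terms combine linearly.\<close>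

lemma sub_at_convex_combination:
  assumes L1: "L1 > 0" "L1-lipschitz_on cl U1" "L1-lipschitz_on cl U2"
    and sub: "\<And>x. x \<in> \<Omega> \<Longrightarrow> sub_at c1 U1 x" "\<And>x. x \<in> \<Omega> \<Longrightarrow> sub_at c2 U2 x"
    and \<theta>: "0 < \<theta>" "\<theta> < 1" and conv: "\<And>x. x \<in> cl \<Longrightarrow> convex_on UNIV (\<lambda>(r, p). H x r p)"
    and x0: "x0 \<in> \<Omega>"
  shows "sub_at ((1 - \<theta>) * c1 + \<theta> * c2) (\<lambda>x. (1 - \<theta>) * U1 x + \<theta> * U2 x) x0"
proof (rule sub_at_limitI[OF x0])
  let ?u = "\<lambda>x. (1 - \<theta>) * U1 x + \<theta> * U2 x"
  have U1c: "continuous_on cl U1" and U2c: "continuous_on cl U2"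
    using L1 lipschitz_on_continuous_on by blast+
  then show "continuous_on cl ?u" by (intro continuous_intros)
  have x0c: "x0 \<in> cl" using x0 \<Omega>_cl by blast
  fix \<phi> D\<phi>
  assume \<phi>: "C1_with_gradient cl \<phi> D\<phi>" and max: "\<forall>y\<in>cl. ?u y - \<phi> y \<le> ?u x0 - \<phi> x0"
  obtain s0 where s0: "s0 > 0" "cball x0 s0 \<subseteq> \<Omega>" using open_\<Omega> x0 open_contains_cball by blast
  define s where "s = min s0 1"
  have s: "0 < s" "s \<le> 1" "cball x0 s \<subseteq> \<Omega>" using s0 by (auto simp: s_def)
  have "C1_with_gradient (cball x0 s) \<phi> D\<phi>" using C1_with_gradient_subset[OF \<phi>] s(3) \<Omega>_cl by (meson subset_trans)
  from C1_with_gradient_lipschitz_compact[OF this convex_cball compact_cball]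
  obtain B where B: "B \<ge> 1" "\<And>a b. a \<in> cball x0 s \<Longrightarrow> b \<in> cball x0 s \<Longrightarrow> \<bar>\<phi> a - \<phi> b\<bar> \<le> B * norm (a - b)" by blast
  define L where "L = 2 * (L1 + B + 2)"
  define K1 where "K1 = B + (1 / (1 - \<theta>)) * (2 * s + L)"
  define K2 where "K2 = B + (1 / \<theta>) * L"
  define Rel where "Rel = (\<lambda>\<epsilon> x y q. x \<in> cl \<and> y \<in> cl \<and> norm (x - x0) < \<epsilon> \<and> norm (y - x0) < \<epsilon> \<and> norm q \<le> L \<and>
    (\<forall>\<delta>. 0 < \<delta> \<and> \<delta> < s / 2 \<longrightarrow>
      H x (U1 x) (D\<phi> x + (1 / (1 - \<theta>)) *\<^sub>R (2 *\<^sub>R (x - x0) + q)) \<le>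
        c1 + K1 * (near_const * \<delta> powr (1 - \<sigma>)) + nonlocal_op \<Omega> \<nu> (- ball 0 \<delta>) U1 x \<and>
      H y (U2 y) (D\<phi> y + (1 / \<theta>) *\<^sub>R (- q)) \<le>
        c2 + K2 * (near_const * \<delta> powr (1 - \<sigma>)) + nonlocal_op \<Omega> \<nu> (- ball 0 \<delta>) U2 y))"
  have ex: "\<exists>x y q. Rel (inverse (real (Suc n))) x y q" for n
    unfolding Rel_def K1_def K2_def
    by (rule convex_combination_approx[OF L1 sub \<theta> s \<phi> max B L_def]) simp_all
  have "\<forall>n. \<exists>z. Rel (inverse (real (Suc n))) (fst z) (fst (snd z)) (snd (snd z))"
  proof
    fix n
    obtain x y q where "Rel (inverse (real (Suc n))) x y q" using ex by blast
    then show "\<exists>z. Rel (inverse (real (Suc n))) (fst z) (fst (snd z)) (snd (snd z))"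
      by (intro exI[of _ "(x, y, q)"]) simp
  qed
  from choice[OF this] obtain Z where Z: "\<And>n. Rel (inverse (real (Suc n))) (fst (Z n)) (fst (snd (Z n))) (snd (snd (Z n)))" by blast
  define X Y Q where "X = (\<lambda>n. fst (Z n))" and "Y = (\<lambda>n. fst (snd (Z n)))" and "Q = (\<lambda>n. snd (snd (Z n)))"
  have XY: "Rel (inverse (real (Suc n))) (X n) (Y n) (Q n)" for n
    using Z by (simp add: X_def Y_def Q_def)
  have S: "\<And>n. X n \<in> cl" "\<And>n. Y n \<in> cl" "\<And>n. norm (X n - x0) < inverse (real (Suc n))"
    "\<And>n. norm (Y n - x0) < inverse (real (Suc n))" "\<And>n. norm (Q n) \<le> L"
    "\<And>n \<delta>. 0 < \<delta> \<Longrightarrow> \<delta> < s / 2 \<Longrightarrow> H (X n) (U1 (X n)) (D\<phi> (X n) + (1 / (1 - \<theta>)) *\<^sub>R (2 *\<^sub>R (X n - x0) + Q n)) \<le>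
        c1 + K1 * (near_const * \<delta> powr (1 - \<sigma>)) + nonlocal_op \<Omega> \<nu> (- ball 0 \<delta>) U1 (X n)"
    "\<And>n \<delta>. 0 < \<delta> \<Longrightarrow> \<delta> < s / 2 \<Longrightarrow> H (Y n) (U2 (Y n)) (D\<phi> (Y n) + (1 / \<theta>) *\<^sub>R (- Q n)) \<le>
        c2 + K2 * (near_const * \<delta> powr (1 - \<sigma>)) + nonlocal_op \<Omega> \<nu> (- ball 0 \<delta>) U2 (Y n)"
    using XY unfolding Rel_def by simp_all
  have X: "X \<longlonglongrightarrow> x0" and Y: "Y \<longlonglongrightarrow> x0" using S(3,4) by (auto intro!: tendsto_zero_inverse_Suc simp: dist_norm)
  have "\<forall>n. Q n \<in> cball 0 L" using S(5) by simp
  then have "\<exists>l\<in>cball 0 L. \<exists>r. strict_mono r \<and> (Q \<circ> r) \<longlonglongrightarrow> l"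
    using compact_cball[of "0::'a" L] unfolding compact_def by simp
  then obtain q \<tau> where \<tau>: "strict_mono \<tau>" "(Q \<circ> \<tau>) \<longlonglongrightarrow> q" by blast
  have sub': "(\<lambda>n. f (\<tau> n)) \<longlonglongrightarrow> l" if "f \<longlonglongrightarrow> l" for f :: "nat \<Rightarrow> 'b::topological_space" and l
    using LIMSEQ_subseq_LIMSEQ[OF that \<tau>(1)] by (simp add: o_def)
  have Q: "(\<lambda>n. Q (\<tau> n)) \<longlonglongrightarrow> q" using \<tau>(2) by (simp add: o_def)
  have Dc: "continuous_on cl D\<phi>" using \<phi> unfolding C1_with_gradient_def by blast
  have cont: "(\<lambda>n. f (X (\<tau> n))) \<longlonglongrightarrow> f x0" "(\<lambda>n. f (Y (\<tau> n))) \<longlonglongrightarrow> f x0" if "continuous_on cl f"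
    for f :: "'a \<Rightarrow> 'b::topological_space"
    using continuous_on_tendsto_compose[OF that sub'[OF X] x0c] continuous_on_tendsto_compose[OF that sub'[OF Y] x0c] S(1,2) by simp_all
  define p1 where "p1 = D\<phi> x0 + (1 / (1 - \<theta>)) *\<^sub>R q"
  define p2 where "p2 = D\<phi> x0 + (1 / \<theta>) *\<^sub>R (- q)"
  have "(\<lambda>n. D\<phi> (X (\<tau> n)) + (1 / (1 - \<theta>)) *\<^sub>R (2 *\<^sub>R (X (\<tau> n) - x0) + Q (\<tau> n))) \<longlonglongrightarrow> D\<phi> x0 + (1 / (1 - \<theta>)) *\<^sub>R (2 *\<^sub>R (x0 - x0) + q)"
    by (intro tendsto_intros cont Dc Q sub'[OF X])
  then have P1: "(\<lambda>n. D\<phi> (X (\<tau> n)) + (1 / (1 - \<theta>)) *\<^sub>R (2 *\<^sub>R (X (\<tau> n) - x0) + Q (\<tau> n))) \<longlonglongrightarrow> p1" by (simp add: p1_def)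
  have P2: "(\<lambda>n. D\<phi> (Y (\<tau> n)) + (1 / \<theta>) *\<^sub>R (- Q (\<tau> n))) \<longlonglongrightarrow> p2"
    unfolding p2_def by (intro tendsto_intros cont Dc Q)
  have HX: "(\<lambda>n. H (X (\<tau> n)) (U1 (X (\<tau> n))) (D\<phi> (X (\<tau> n)) + (1 / (1 - \<theta>)) *\<^sub>R (2 *\<^sub>R (X (\<tau> n) - x0) + Q (\<tau> n)))) \<longlonglongrightarrow> H x0 (U1 x0) p1"
    by (rule H_tendsto[OF S(1) x0c sub'[OF X] cont(1)[OF U1c] P1])
  have HY: "(\<lambda>n. H (Y (\<tau> n)) (U2 (Y (\<tau> n))) (D\<phi> (Y (\<tau> n)) + (1 / \<theta>) *\<^sub>R (- Q (\<tau> n)))) \<longlonglongrightarrow> H x0 (U2 x0) p2"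
    by (rule H_tendsto[OF S(2) x0c sub'[OF Y] cont(2)[OF U2c] P2])
  have Dcomb: "(1 - \<theta>) *\<^sub>R p1 + \<theta> *\<^sub>R p2 = D\<phi> x0"
    using \<theta> by (simp add: p1_def p2_def algebra_simps)
  have "H x0 (?u x0) (D\<phi> x0) \<le> ((1 - \<theta>) * c1 + \<theta> * c2) + ((1 - \<theta>) * K1 + \<theta> * K2) * (near_const * \<delta> powr (1 - \<sigma>))
      + nonlocal_op \<Omega> \<nu> (- ball 0 \<delta>) ?u x0" if \<delta>: "0 < \<delta>" "\<delta> < s / 2" for \<delta>
  proof -
    let ?k = "near_const * \<delta> powr (1 - \<sigma>)"
    let ?I = "nonlocal_op \<Omega> \<nu> (- ball 0 \<delta>)"
    have a: "H x0 (U1 x0) p1 \<le> c1 + K1 * ?k + ?I U1 x0"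
    proof (rule LIMSEQ_le[OF HX])
      show "(\<lambda>n. c1 + K1 * ?k + ?I U1 (X (\<tau> n))) \<longlonglongrightarrow> c1 + K1 * ?k + ?I U1 x0"
        by (intro tendsto_intros nonlocal_far_tendsto[OF S(1) x0c sub'[OF X] \<delta>(1) U1c])
    qed (use S(6)[OF \<delta>] in blast)
    have b: "H x0 (U2 x0) p2 \<le> c2 + K2 * ?k + ?I U2 x0"
    proof (rule LIMSEQ_le[OF HY])
      show "(\<lambda>n. c2 + K2 * ?k + ?I U2 (Y (\<tau> n))) \<longlonglongrightarrow> c2 + K2 * ?k + ?I U2 x0"
        by (intro tendsto_intros nonlocal_far_tendsto[OF S(2) x0c sub'[OF Y] \<delta>(1) U2c])
    qed (use S(7)[OF \<delta>] in blast)
    have "H x0 (?u x0) (D\<phi> x0) \<le> (1 - \<theta>) * H x0 (U1 x0) p1 + \<theta> * H x0 (U2 x0) p2"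
    proof -
      have "(\<lambda>(r, p). H x0 r p) ((1 - \<theta>) *\<^sub>R (U1 x0, p1) + \<theta> *\<^sub>R (U2 x0, p2))
        \<le> (1 - \<theta>) * (\<lambda>(r, p). H x0 r p) (U1 x0, p1) + \<theta> * (\<lambda>(r, p). H x0 r p) (U2 x0, p2)"
        using \<theta> by (intro convex_onD[OF conv[OF x0c]]) auto
      then show ?thesis by (simp add: Dcomb)
    qed
    also have "\<dots> \<le> (1 - \<theta>) * (c1 + K1 * ?k + ?I U1 x0) + \<theta> * (c2 + K2 * ?k + ?I U2 x0)"
      using a b \<theta> by (intro add_mono mult_left_mono) auto
    also have "(1 - \<theta>) * (c1 + K1 * ?k + ?I U1 x0) + \<theta> * (c2 + K2 * ?k + ?I U2 x0)
      = ((1 - \<theta>) * c1 + \<theta> * c2) + ((1 - \<theta>) * K1 + \<theta> * K2) * ?k + ((1 - \<theta>) * ?I U1 x0 + \<theta> * ?I U2 x0)"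
      by (simp add: algebra_simps)
    also have "(1 - \<theta>) * ?I U1 x0 + \<theta> * ?I U2 x0 = ?I ?u x0"
    proof -
      obtain R1 where R1: "\<And>y. y \<in> cl \<Longrightarrow> \<bar>U1 y\<bar> \<le> R1" using continuous_on_cl_bounded[OF U1c] by blast
      obtain R2 where R2: "\<And>y. y \<in> cl \<Longrightarrow> \<bar>U2 y\<bar> \<le> R2" using continuous_on_cl_bounded[OF U2c] by blast
      have i1: "set_integrable (\<nu> x0) (- ball 0 \<delta>) (\<lambda>z. (1 - \<theta>) * jump U1 x0 z)"
        by (intro set_integrable_mult_right impI far_jump_integrable[OF x0c \<delta>(1) continuous_on_cl_measurable[OF U1c] R1]) auto
      have i2: "set_integrable (\<nu> x0) (- ball 0 \<delta>) (\<lambda>z. \<theta> * jump U2 x0 z)"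
        by (intro set_integrable_mult_right impI far_jump_integrable[OF x0c \<delta>(1) continuous_on_cl_measurable[OF U2c] R2]) auto
      have "?I ?u x0 = (LINT z:- ball 0 \<delta>|\<nu> x0. (1 - \<theta>) * jump U1 x0 z + \<theta> * jump U2 x0 z)"
        unfolding nonlocal_far_eq set_lebesgue_integral_def
        by (intro Bochner_Integration.integral_cong) (auto simp: algebra_simps)
      also have "\<dots> = (LINT z:- ball 0 \<delta>|\<nu> x0. (1 - \<theta>) * jump U1 x0 z) + (LINT z:- ball 0 \<delta>|\<nu> x0. \<theta> * jump U2 x0 z)"
        by (rule set_integral_add(2)[OF i1 i2])
      also have "\<dots> = (1 - \<theta>) * ?I U1 x0 + \<theta> * ?I U2 x0" unfolding nonlocal_far_eq by simp
      finally show ?thesis by simp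
    qed
    finally show ?thesis .
  qed
  then show "\<exists>K. \<exists>r>0. \<forall>\<delta>. 0 < \<delta> \<and> \<delta> < r \<longrightarrow> H x0 (?u x0) (D\<phi> x0) \<le> ((1 - \<theta>) * c1 + \<theta> * c2)
      + K * (near_const * \<delta> powr (1 - \<sigma>)) + nonlocal_op \<Omega> \<nu> (- ball 0 \<delta>) ?u x0"
    using s(1) by (intro exI[of _ "(1 - \<theta>) * K1 + \<theta> * K2"] exI[of _ "s / 2"]) auto
qed

end

section \<open>Perron's method\<close>


context nonlocal_dirichlet
begin

text \<open>Here the data are respected pointwise. By \<open>subsolution_extension\<close> every
  bounded subsolution agrees on \<Omega> with such a function.\<close>

definition cont_sub :: "('a \<Rightarrow> real) \<Rightarrow> bool" where
  "cont_sub w \<longleftrightarrow> continuous_on cl w \<and> (\<forall>x\<in>\<Omega>. sub_at 0 w x) \<and> (\<forall>x\<in>frontier \<Omega>. w x \<le> g x)"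

lemma cont_sub_subs:
  assumes "cont_sub w" "\<And>y. y \<in> cl \<Longrightarrow> \<bar>w y\<bar> \<le> R"
  shows "w \<in> subs R"
  using assms continuous_on_imp_usc_on unfolding cont_sub_def subs_def by blast

lemma equi_lipschitz_cont_sub:
  assumes R: "R > 0"
  obtains A where "A > 0" "\<And>w. cont_sub w \<Longrightarrow> (\<And>y. y \<in> cl \<Longrightarrow> \<bar>w y\<bar> \<le> R) \<Longrightarrow> A-lipschitz_on cl w"
proof -
  obtain A where A: "A \<ge> 0" "\<And>u x y. u \<in> subs R \<Longrightarrow> x \<in> \<Omega> \<Longrightarrow> y \<in> \<Omega> \<Longrightarrow> \<bar>u x - u y\<bar> \<le> A * norm (x - y)"
    using equi_lipschitz[OF R] by blast
  show ?thesis
  proof (rule that[of "A + 1"])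
    fix w assume w: "cont_sub w" "\<And>y. y \<in> cl \<Longrightarrow> \<bar>w y\<bar> \<le> R"
    have ws: "w \<in> subs R" by (rule cont_sub_subs[OF w])
    show "(A + 1)-lipschitz_on cl w"
    proof (rule lipschitz_on_closure)
      show "(A + 1)-lipschitz_on \<Omega> w"
      proof (rule lipschitz_onI)
        fix x y assume "x \<in> \<Omega>" "y \<in> \<Omega>"
        then have "\<bar>w x - w y\<bar> \<le> A * norm (x - y)" by (rule A(2)[OF ws])
        also have "\<dots> \<le> (A + 1) * norm (x - y)" by (intro mult_right_mono) auto
        finally show "dist (w x) (w y) \<le> (A + 1) * dist x y" by (simp add: dist_norm)
      qed (use A in simp)
      show "continuous_on cl w" using w(1) unfolding cont_sub_def by blast
    qed
  qed (use A in simp)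
qed

lemma cont_sub_lipschitz:
  assumes "cont_sub w"
  obtains L where "L > 0" "L-lipschitz_on cl w"
proof -
  obtain R where R: "R > 0" "\<And>y. y \<in> cl \<Longrightarrow> \<bar>w y\<bar> \<le> R"
    using continuous_on_cl_bounded assms unfolding cont_sub_def by blast
  obtain A where A: "A > 0" "\<And>w. cont_sub w \<Longrightarrow> (\<And>y. y \<in> cl \<Longrightarrow> \<bar>w y\<bar> \<le> R) \<Longrightarrow> A-lipschitz_on cl w"
    using equi_lipschitz_cont_sub[OF R(1)] by blast
  show ?thesis by (rule that[OF A(1) A(2)[OF assms R(2)]])
qed

lemma cont_sub_visc_subsolution: "cont_sub w \<Longrightarrow> visc_subsolution \<Omega> \<nu> H g 0 w"
  unfolding cont_sub_def visc_subsolution_def sub_at_def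
  by (auto intro: continuous_on_imp_usc_on simp: min_le_iff_disj)

text \<open>Members of \<open>F\<close> that nearly attain \<open>u x0\<close> have their own
  contact points, which converge to \<open>x0\<close> once the contact of \<open>u\<close> is made
  strict. The inequalities at these points pass to the limit.\<close>

lemma sub_at_Sup:
  assumes F: "\<And>w. w \<in> F \<Longrightarrow> continuous_on cl w" "\<And>w x. w \<in> F \<Longrightarrow> x \<in> \<Omega> \<Longrightarrow> sub_at 0 w x"
    and R: "\<And>w y. w \<in> F \<Longrightarrow> y \<in> cl \<Longrightarrow> \<bar>w y\<bar> \<le> R"
    and u: "continuous_on cl u" and le: "\<And>w y. w \<in> F \<Longrightarrow> y \<in> cl \<Longrightarrow> w y \<le> u y"
    and x0: "x0 \<in> \<Omega>" and approx: "\<And>e. e > 0 \<Longrightarrow> \<exists>w\<in>F. u x0 - e < w x0"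
  shows "sub_at 0 u x0"
proof (rule sub_at_limitI[OF x0 u])
  have x0c: "x0 \<in> cl" using x0 \<Omega>_cl by blast
  fix \<phi> D\<phi>
  assume \<phi>: "C1_with_gradient cl \<phi> D\<phi>" and max: "\<forall>y\<in>cl. u y - \<phi> y \<le> u x0 - \<phi> x0"
  obtain s where s: "s > 0" "cball x0 s \<subseteq> \<Omega>" using open_\<Omega> x0 open_contains_cball by blast
  \<comment> \<open>The quadratic term makes the contact at \<open>x0\<close> strict without
    changing the gradient there, so maximisers of \<open>w - \<psi>\<close> for nearly optimal
    \<open>w\<close> cannot stay away from \<open>x0\<close>.\<close>
  define \<psi> where "\<psi> = (\<lambda>x. \<phi> x + norm (x - x0) ^ 2)"
  define D\<psi> where "D\<psi> = (\<lambda>x. D\<phi> x + 2 *\<^sub>R (x - x0))"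
  have \<psi>: "C1_with_gradient cl \<psi> D\<psi>"
    unfolding \<psi>_def D\<psi>_def by (intro C1_with_gradient_add \<phi> C1_with_gradient_dist_sq)
  have "C1_with_gradient (cball x0 s) \<psi> D\<psi>" using C1_with_gradient_subset[OF \<psi>] s(2) \<Omega>_cl by (meson subset_trans)
  from C1_with_gradient_lipschitz_compact[OF this convex_cball compact_cball]
  obtain B where B: "B \<ge> 1" "\<And>a b. a \<in> cball x0 s \<Longrightarrow> b \<in> cball x0 s \<Longrightarrow> \<bar>\<psi> a - \<psi> b\<bar> \<le> B * norm (a - b)" by blast
  have cl_ne: "cl \<noteq> {}" using \<Omega>_nonempty by simp
  have "\<forall>n. \<exists>z. fst z \<in> F \<and> snd z \<in> cl \<and> norm (snd z - x0) ^ 2 \<le> inverse (real (Suc n)) \<and>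
      u (snd z) - inverse (real (Suc n)) \<le> fst z (snd z) \<and> (\<forall>y\<in>cl. fst z y - \<psi> y \<le> fst z (snd z) - \<psi> (snd z))"
  proof
    fix n
    let ?e = "inverse (real (Suc n))"
    obtain w where w: "w \<in> F" "u x0 - ?e < w x0" using approx[of ?e] by auto
    have "continuous_on cl (\<lambda>y. w y - \<psi> y)"
      by (intro continuous_intros F(1)[OF w(1)] C1_with_gradient_continuous_on[OF \<psi>])
    from continuous_attains_sup[OF compact_cl cl_ne this]
    obtain x where x: "x \<in> cl" "\<forall>y\<in>cl. w y - \<psi> y \<le> w x - \<psi> x" by blast
    have 1: "w x0 - \<psi> x0 \<le> w x - \<psi> x" using x x0c by blast
    have 2: "u x - \<phi> x \<le> u x0 - \<phi> x0" using max x by blast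
    have 3: "w x \<le> u x" by (rule le[OF w(1) x(1)])
    have 4: "0 \<le> norm (x - x0) ^ 2" by simp
    have 5: "\<psi> x0 = \<phi> x0" "\<psi> x = \<phi> x + norm (x - x0) ^ 2" by (simp_all add: \<psi>_def)
    have "norm (x - x0) ^ 2 \<le> ?e" "u x - ?e \<le> w x" using 1 2 3 4 5 w(2) by linarith+
    then show "\<exists>z. fst z \<in> F \<and> snd z \<in> cl \<and> norm (snd z - x0) ^ 2 \<le> ?e \<and>
      u (snd z) - ?e \<le> fst z (snd z) \<and> (\<forall>y\<in>cl. fst z y - \<psi> y \<le> fst z (snd z) - \<psi> (snd z))"
      using w x by (intro exI[of _ "(w, x)"]) simp
  qed
  from choice[OF this] obtain Z where Z: "\<And>n. fst (Z n) \<in> F \<and> snd (Z n) \<in> cl \<and> norm (snd (Z n) - x0) ^ 2 \<le> inverse (real (Suc n)) \<and>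
      u (snd (Z n)) - inverse (real (Suc n)) \<le> fst (Z n) (snd (Z n)) \<and> (\<forall>y\<in>cl. fst (Z n) y - \<psi> y \<le> fst (Z n) (snd (Z n)) - \<psi> (snd (Z n)))"
    by blast
  define W X where "W = (\<lambda>n. fst (Z n))" and "X = (\<lambda>n. snd (Z n))"
  have W: "W n \<in> F" and Xc: "X n \<in> cl" and Xsq: "norm (X n - x0) ^ 2 \<le> inverse (real (Suc n))"
    and Wlow: "u (X n) - inverse (real (Suc n)) \<le> W n (X n)" and Wmax: "\<forall>y\<in>cl. W n y - \<psi> y \<le> W n (X n) - \<psi> (X n)" for n
    using Z[of n] by (simp_all add: W_def X_def)
  have "(\<lambda>n. norm (X n - x0) ^ 2) \<longlonglongrightarrow> 0"
    by (rule tendsto_sandwich[OF _ _ tendsto_const LIMSEQ_inverse_real_of_nat]) (use Xsq in auto)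
  then have "(\<lambda>n. sqrt (norm (X n - x0) ^ 2)) \<longlonglongrightarrow> sqrt 0" by (rule tendsto_real_sqrt)
  then have nX: "(\<lambda>n. norm (X n - x0)) \<longlonglongrightarrow> 0" by simp
  then have X: "X \<longlonglongrightarrow> x0" using tendsto_norm_zero_iff LIM_zero_cancel by blast
  have uX: "(\<lambda>n. u (X n)) \<longlonglongrightarrow> u x0" using continuous_on_tendsto_compose[OF u X x0c] Xc by simp
  have WX: "(\<lambda>n. W n (X n)) \<longlonglongrightarrow> u x0"
  proof (rule tendsto_sandwich)
    show "(\<lambda>n. u (X n) - inverse (real (Suc n))) \<longlonglongrightarrow> u x0"
      using tendsto_diff[OF uX LIMSEQ_inverse_real_of_nat] by simp
    show "(\<lambda>n. u (X n)) \<longlonglongrightarrow> u x0" by (rule uX)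
  qed (use Wlow le[OF W Xc] in auto)
  have Dc: "continuous_on cl D\<psi>" using \<psi> unfolding C1_with_gradient_def by blast
  have DX: "(\<lambda>n. D\<psi> (X n)) \<longlonglongrightarrow> D\<phi> x0"
    using continuous_on_tendsto_compose[OF Dc X x0c] Xc by (simp add: D\<psi>_def)
  have HX: "(\<lambda>n. H (X n) (W n (X n)) (D\<psi> (X n))) \<longlonglongrightarrow> H x0 (u x0) (D\<phi> x0)"
    by (rule H_tendsto[OF Xc x0c X WX DX])
  obtain Ru where Ru: "\<And>y. y \<in> cl \<Longrightarrow> \<bar>u y\<bar> \<le> Ru" using continuous_on_cl_bounded[OF u] by blast
  have "H x0 (u x0) (D\<phi> x0) \<le> 0 + B * (near_const * \<delta> powr (1 - \<sigma>)) + nonlocal_op \<Omega> \<nu> (- ball 0 \<delta>) u x0"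
    if \<delta>: "0 < \<delta>" "\<delta> < min (s / 2) 1" for \<delta>
  proof -
    let ?k = "near_const * \<delta> powr (1 - \<sigma>)"
    \<comment> \<open>Only the landing value \<open>W n (X n + z)\<close> is raised to
      \<open>u\<close>; the base value stays. This bounds the far term from above and has a limit
      although the functions \<open>W n\<close> need not converge away from their contact
      points.\<close>
    let ?J = "\<lambda>n. LINT z:- ball 0 \<delta>|\<nu> (X n). indicat_real cl (X n + z) * (u (X n + z) - W n (X n))"
    have lim: "(\<lambda>n. B * ?k + ?J n) \<longlonglongrightarrow> B * ?k + nonlocal_op \<Omega> \<nu> (- ball 0 \<delta>) u x0"
      unfolding nonlocal_far_eq[of \<delta> u x0]
      by (intro tendsto_intros far_limit_jump[OF Xc x0c X \<delta>(1) continuous_on_cl_measurable[OF u] Ru _ WX]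
        continuous_on_subset[OF u \<Omega>_cl])
    have "\<forall>\<^sub>F n in sequentially. norm (X n - x0) < s / 2" using order_tendstoD(2)[OF nX, of "s / 2"] s(1) by simp
    then have "\<forall>\<^sub>F n in sequentially. H (X n) (W n (X n)) (D\<psi> (X n)) \<le> B * ?k + ?J n"
    proof eventually_elim
      case (elim n)
      have "norm (X n - x0) \<le> s" using elim s(1) by linarith
      then have "X n \<in> cball x0 s" by (metis dist_commute dist_norm mem_cball)
      then have X\<Omega>: "X n \<in> \<Omega>" using s by blast
      have "visc_E \<Omega> \<nu> H \<delta> (W n) \<psi> D\<psi> (X n) \<le> 0"
        using F(2)[OF W X\<Omega>] \<psi> Wmax \<delta>(1) unfolding sub_at_def by blast
      moreover have "\<bar>nonlocal_op \<Omega> \<nu> (ball 0 \<delta>) \<psi> (X n)\<bar> \<le> B * ?k"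
        by (rule near_bound_lipschitz_ball[OF Xc \<delta>(1) _ _ elim _ B(2)]) (use \<delta> B in auto)
      moreover have "nonlocal_op \<Omega> \<nu> (- ball 0 \<delta>) (W n) (X n) \<le> ?J n"
        unfolding nonlocal_far_eq
      proof (rule set_integral_mono)
        show "set_integrable (\<nu> (X n)) (- ball 0 \<delta>) (\<lambda>z. jump (W n) (X n) z)"
          by (rule far_jump_integrable[OF Xc \<delta>(1) continuous_on_cl_measurable[OF F(1)[OF W]] R[OF W]])
        show "set_integrable (\<nu> (X n)) (- ball 0 \<delta>) (\<lambda>z. indicat_real cl (X n + z) * (u (X n + z) - W n (X n)))"
          by (rule far_jump_integrable[OF Xc \<delta>(1) continuous_on_cl_measurable[OF u] Ru])
        show "jump (W n) (X n) z \<le> indicat_real cl (X n + z) * (u (X n + z) - W n (X n))" for z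
          using le[OF W, of "X n + z" n] by (auto simp: indicator_def)
      qed
      ultimately show ?case unfolding visc_E_def by linarith
    qed
    then have "H x0 (u x0) (D\<phi> x0) \<le> B * ?k + nonlocal_op \<Omega> \<nu> (- ball 0 \<delta>) u x0"
      by (rule tendsto_le[OF _ lim HX, rotated]) simp
    then show ?thesis by simp
  qed
  then show "\<exists>K. \<exists>r>0. \<forall>\<delta>. 0 < \<delta> \<and> \<delta> < r \<longrightarrow> H x0 (u x0) (D\<phi> x0) \<le>
        0 + K * (near_const * \<delta> powr (1 - \<sigma>)) + nonlocal_op \<Omega> \<nu> (- ball 0 \<delta>) u x0"
    using s(1) by (intro exI[of _ B] exI[of _ "min (s / 2) 1"]) auto
qed

lemma C1_min_gradient_eq:
  assumes f: "C1_with_gradient cl f Df" and h: "C1_with_gradient cl h Dh" and x: "x \<in> \<Omega>"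
    and min: "\<And>y. y \<in> cl \<Longrightarrow> f x - h x \<le> f y - h y"
  shows "Df x = Dh x"
proof -
  have d: "(k has_derivative (\<lambda>v. Dk x \<bullet> v)) (at x)" if "C1_with_gradient cl k Dk" for k Dk
  proof -
    have "C1_with_gradient \<Omega> k Dk" using C1_with_gradient_subset[OF that \<Omega>_cl] .
    then have "(k has_derivative (\<lambda>v. Dk x \<bullet> v)) (at x within \<Omega>)" using x unfolding C1_with_gradient_def by blast
    then show ?thesis using at_within_open[OF x open_\<Omega>] by simp
  qed
  have "((\<lambda>y. f y - h y) has_derivative (\<lambda>v. Df x \<bullet> v - Dh x \<bullet> v)) (at x)"
    by (intro has_derivative_diff d f h)
  then have "(\<lambda>v. Df x \<bullet> v - Dh x \<bullet> v) = (\<lambda>v. 0)"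
    using min \<Omega>_cl by (intro differential_zero_maxmin[OF x open_\<Omega>]) auto
  then have "Df x \<bullet> (Df x - Dh x) - Dh x \<bullet> (Df x - Dh x) = 0" by meson
  then have "(Df x - Dh x) \<bullet> (Df x - Dh x) = 0" by (simp add: inner_diff_left)
  then show ?thesis by simp
qed

lemma nonlocal_near_eq:
  "nonlocal_op \<Omega> \<nu> (ball 0 \<delta>) u x = (LINT z:ball 0 \<delta>|\<nu> x. indicat_real cl (x + z) * (u (x + z) - u x))"
  unfolding nonlocal_op_def set_lebesgue_integral_def
  by (rule Bochner_Integration.integral_cong) (auto simp: jump_set_def indicator_def)

lemma nonlocal_near_add_cmult:
  assumes x: "x \<in> cl" and \<phi>: "C1_with_gradient cl \<phi> D\<phi>" and \<psi>: "C1_with_gradient cl \<psi> D\<psi>"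
  shows "nonlocal_op \<Omega> \<nu> (ball 0 \<delta>) (\<lambda>y. \<phi> y + k + t * \<psi> y) x
    = nonlocal_op \<Omega> \<nu> (ball 0 \<delta>) \<phi> x + t * nonlocal_op \<Omega> \<nu> (ball 0 \<delta>) \<psi> x"
proof -
  have i: "set_integrable (\<nu> x) (ball 0 \<delta>) (\<lambda>z. jump f x z)" if "C1_with_gradient cl f Df" for f Df
    unfolding set_integrable_def
    using C1_jump_integrable[OF x that] x by (intro integrable_mult_indicator) auto
  have "nonlocal_op \<Omega> \<nu> (ball 0 \<delta>) (\<lambda>y. \<phi> y + k + t * \<psi> y) x = (LINT z:ball 0 \<delta>|\<nu> x. jump \<phi> x z + t * jump \<psi> x z)"
    unfolding nonlocal_near_eq set_lebesgue_integral_def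
    by (intro Bochner_Integration.integral_cong) (auto simp: algebra_simps)
  also have "\<dots> = (LINT z:ball 0 \<delta>|\<nu> x. jump \<phi> x z) + (LINT z:ball 0 \<delta>|\<nu> x. t * jump \<psi> x z)"
    by (intro set_integral_add(2) i[OF \<phi>] set_integrable_mult_right impI i[OF \<psi>])
  finally show ?thesis unfolding nonlocal_near_eq by simp
qed

lemma nonlocal_near_tendsto:
  assumes x: "\<And>n. x n \<in> cl" "x0 \<in> cl" "x \<longlonglongrightarrow> x0" and \<phi>: "C1_with_gradient cl \<phi> D\<phi>"
  shows "(\<lambda>n. nonlocal_op \<Omega> \<nu> (ball 0 \<delta>) \<phi> (x n)) \<longlonglongrightarrow> nonlocal_op \<Omega> \<nu> (ball 0 \<delta>) \<phi> x0"
proof -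
  have c: "continuous_on cl \<phi>" using C1_with_gradient_continuous_on[OF \<phi>] .
  have 1: "\<phi> \<in> borel_measurable (restrict_space borel cl)" by (rule continuous_on_cl_measurable[OF c])
  have 2: "bounded (\<phi> ` cl)" using compact_continuous_image[OF c compact_cl] compact_imp_bounded by blast
  have 3: "C1_on (ball x0 1 \<inter> cl) \<phi>"
    using C1_with_gradient_subset[OF \<phi>] unfolding C1_on_def by (meson inf_le2)
  have 4: "ball 0 \<delta> \<in> sets (borel :: 'a measure)" by simp
  have cont: "continuous_on (ball x0 1 \<inter> cl) (\<lambda>y. nonlocal_op \<Omega> \<nu> (ball 0 \<delta>) \<phi> y)"
    using M0 x(2) 1 2 3 4 unfolding M0_def M0_2_def by (meson zero_less_one)
  have "\<forall>\<^sub>F n in sequentially. x n \<in> ball x0 1 \<inter> cl"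
    using topological_tendstoD[OF x(3) open_ball, of x0 1] x(1) by (auto elim: eventually_mono)
  then show ?thesis using continuous_on_tendsto_compose[OF cont x(3)] x(2) by simp
qed

text \<open>Where the supersolution inequality fails strictly, the test function from below,
  slightly raised and bent down, is itself a strict subsolution near \<open>x0\<close>. Its maximum
  with \<open>u\<close> is a larger member of the Perron class.\<close>

lemma cont_sub_bump:
  assumes u: "cont_sub u" and x0: "x0 \<in> cl" and \<phi>: "C1_with_gradient cl \<phi> D\<phi>"
    and min: "\<And>y. y \<in> cl \<Longrightarrow> u x0 - \<phi> x0 \<le> u y - \<phi> y" and \<delta>: "\<delta> > 0"
    and E: "visc_E \<Omega> \<nu> H \<delta> u \<phi> D\<phi> x0 < 0" and bc: "x0 \<in> frontier \<Omega> \<Longrightarrow> u x0 < g x0"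
  shows "\<exists>w. cont_sub w \<and> (\<forall>x\<in>cl. u x \<le> w x) \<and> u x0 < w x0"
proof -
  have uc: "continuous_on cl u" and usub: "\<And>x. x \<in> \<Omega> \<Longrightarrow> sub_at 0 u x" and ug: "\<And>x. x \<in> frontier \<Omega> \<Longrightarrow> u x \<le> g x"
    using u unfolding cont_sub_def by auto
  obtain Ru where Ru: "\<And>y. y \<in> cl \<Longrightarrow> \<bar>u y\<bar> \<le> Ru" using continuous_on_cl_bounded[OF uc] by blast
  define \<rho> where "\<rho> = (\<lambda>n. inverse (real (Suc n)))"
  have \<rho>: "\<rho> n > 0" for n by (simp add: \<rho>_def)
  have \<rho>lim: "\<rho> \<longlonglongrightarrow> 0" unfolding \<rho>_def by (rule LIMSEQ_inverse_real_of_nat)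
  \<comment> \<open>The lifted function can exceed \<open>u\<close> only where
    \<open>\<rho> n * norm (x - x0) ^ 2 < k n\<close>, that is, within distance
    \<open>\<rho> n\<close> of \<open>x0\<close>.\<close>
  define k where "k = (\<lambda>n. \<rho> n ^ 3)"
  have k: "k n > 0" for n using \<rho> by (simp add: k_def)
  have klim: "k \<longlonglongrightarrow> 0" unfolding k_def using tendsto_power[OF \<rho>lim, of 3] by simp
  define \<Phi> where "\<Phi> = (\<lambda>n x. \<phi> x + (u x0 - \<phi> x0 + k n) + (- \<rho> n) * norm (x - x0) ^ 2)"
  define D\<Phi> where "D\<Phi> = (\<lambda>n x. D\<phi> x + 0 + (- \<rho> n) *\<^sub>R (2 *\<^sub>R (x - x0)))"
  have \<Phi>: "C1_with_gradient cl (\<Phi> n) (D\<Phi> n)" for n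
    unfolding \<Phi>_def D\<Phi>_def
    by (intro C1_with_gradient_add C1_with_gradient_cmult C1_with_gradient_dist_sq C1_with_gradient_const \<phi>)
  have \<Phi>le: "\<Phi> n x \<le> u x + k n - \<rho> n * norm (x - x0) ^ 2" if "x \<in> cl" for n x
    using min[OF that] by (simp add: \<Phi>_def)
  have \<Phi>le': "\<Phi> n x \<le> u x + k n" if "x \<in> cl" for n x
    using \<Phi>le[OF that, of n] mult_nonneg_nonneg[OF less_imp_le[OF \<rho>[of n]] zero_le_power2[of "norm (x - x0)"]] by linarith
  \<comment> \<open>An upper bound for \<open>visc_E\<close> of the raised function where it differs
    from \<open>u\<close>. The term with \<open>k n\<close> pays for long jumps, which start from
    \<open>\<Phi> n\<close> but may land on the lower function \<open>u\<close>.\<close>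
  define V where "V = (\<lambda>n x. - nonlocal_op \<Omega> \<nu> (ball 0 \<delta>) (\<Phi> n) x - nonlocal_op \<Omega> \<nu> (- ball 0 \<delta>) u x
    + k n * (far_const * \<delta> powr (- \<sigma>)) + H x (\<Phi> n x) (D\<Phi> n x))"
  \<comment> \<open>Points violating this for every \<open>n\<close> would converge to
    \<open>x0\<close>, where the strict inequalities for the operator and, on the boundary, for the
    data survive the limit.\<close>
  have "\<exists>n. \<forall>x\<in>cl. u x < \<Phi> n x \<longrightarrow> (x \<in> frontier \<Omega> \<longrightarrow> \<Phi> n x \<le> g x) \<and> (x \<in> \<Omega> \<longrightarrow> V n x \<le> 0)"
  proof (rule ccontr)
    assume "\<not> ?thesis"
    then have "\<forall>n. \<exists>x. x \<in> cl \<and> u x < \<Phi> n x \<and> ((x \<in> frontier \<Omega> \<and> g x < \<Phi> n x) \<or> (x \<in> \<Omega> \<and> V n x > 0))"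
      by (auto simp: not_le) 
    from choice[OF this] obtain X where X: "\<And>n. X n \<in> cl \<and> u (X n) < \<Phi> n (X n) \<and>
      ((X n \<in> frontier \<Omega> \<and> g (X n) < \<Phi> n (X n)) \<or> (X n \<in> \<Omega> \<and> V n (X n) > 0))" by blast
    then have Xc: "X n \<in> cl" for n by blast
    have Xd: "norm (X n - x0) < \<rho> n" for n
    proof -
      have "\<rho> n * norm (X n - x0) ^ 2 < k n" using \<Phi>le[OF Xc[of n], of n] X[of n] by linarith
      also have "k n = \<rho> n * \<rho> n ^ 2" by (simp add: k_def power2_eq_square power3_eq_cube)
      finally have "norm (X n - x0) ^ 2 < \<rho> n ^ 2" using \<rho>[of n] by simp
      then show ?thesis using \<rho>[of n] by (intro power2_less_imp_less[of _ "\<rho> n"]) auto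
    qed
    have Xlim: "X \<longlonglongrightarrow> x0"
      using Xd unfolding \<rho>_def by (intro tendsto_zero_inverse_Suc) (simp add: dist_norm)
    have nXlim: "(\<lambda>n. norm (X n - x0)) \<longlonglongrightarrow> 0" using tendsto_norm[OF tendsto_diff[OF Xlim tendsto_const[of x0]]] by simp
    have \<phi>X: "(\<lambda>n. \<phi> (X n)) \<longlonglongrightarrow> \<phi> x0"
      using continuous_on_tendsto_compose[OF C1_with_gradient_continuous_on[OF \<phi>] Xlim x0] Xc by simp
    have "(\<lambda>n. \<phi> (X n) + (u x0 - \<phi> x0 + k n) + (- \<rho> n) * norm (X n - x0) ^ 2) \<longlonglongrightarrow> \<phi> x0 + (u x0 - \<phi> x0 + 0) + (- 0) * 0 ^ 2"
      by (intro tendsto_intros \<phi>X klim \<rho>lim nXlim)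
    then have \<Phi>X: "(\<lambda>n. \<Phi> n (X n)) \<longlonglongrightarrow> u x0" by (simp add: \<Phi>_def)
    have Dc: "continuous_on cl D\<phi>" using \<phi> unfolding C1_with_gradient_def by blast
    have D\<phi>X: "(\<lambda>n. D\<phi> (X n)) \<longlonglongrightarrow> D\<phi> x0" using continuous_on_tendsto_compose[OF Dc Xlim x0] Xc by simp
    have "(\<lambda>n. D\<phi> (X n) + 0 + (- \<rho> n) *\<^sub>R (2 *\<^sub>R (X n - x0))) \<longlonglongrightarrow> D\<phi> x0 + 0 + (- 0) *\<^sub>R (2 *\<^sub>R (x0 - x0))"
      by (intro tendsto_intros D\<phi>X \<rho>lim Xlim)
    then have D\<Phi>X: "(\<lambda>n. D\<Phi> n (X n)) \<longlonglongrightarrow> D\<phi> x0" by (simp add: D\<Phi>_def)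
    have HX: "(\<lambda>n. H (X n) (\<Phi> n (X n)) (D\<Phi> n (X n))) \<longlonglongrightarrow> H x0 (u x0) (D\<phi> x0)"
      by (rule H_tendsto[OF Xc x0 Xlim \<Phi>X D\<Phi>X])
    have "(\<lambda>n. nonlocal_op \<Omega> \<nu> (ball 0 \<delta>) \<phi> (X n) + (- \<rho> n) * nonlocal_op \<Omega> \<nu> (ball 0 \<delta>) (\<lambda>x. norm (x - x0) ^ 2) (X n))
      \<longlonglongrightarrow> nonlocal_op \<Omega> \<nu> (ball 0 \<delta>) \<phi> x0 + (- 0) * nonlocal_op \<Omega> \<nu> (ball 0 \<delta>) (\<lambda>x. norm (x - x0) ^ 2) x0"
      by (intro tendsto_intros \<rho>lim nonlocal_near_tendsto[OF Xc x0 Xlim \<phi>] nonlocal_near_tendsto[OF Xc x0 Xlim C1_with_gradient_dist_sq])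
    then have IX: "(\<lambda>n. nonlocal_op \<Omega> \<nu> (ball 0 \<delta>) (\<Phi> n) (X n)) \<longlonglongrightarrow> nonlocal_op \<Omega> \<nu> (ball 0 \<delta>) \<phi> x0"
      unfolding \<Phi>_def nonlocal_near_add_cmult[OF Xc \<phi> C1_with_gradient_dist_sq] by simp
    have "(\<lambda>n. V n (X n)) \<longlonglongrightarrow> - nonlocal_op \<Omega> \<nu> (ball 0 \<delta>) \<phi> x0 - nonlocal_op \<Omega> \<nu> (- ball 0 \<delta>) u x0
        + 0 * (far_const * \<delta> powr (- \<sigma>)) + H x0 (u x0) (D\<phi> x0)"
      unfolding V_def by (intro tendsto_intros IX HX klim nonlocal_far_tendsto[OF Xc x0 Xlim \<delta> uc])
    then have VX: "(\<lambda>n. V n (X n)) \<longlonglongrightarrow> visc_E \<Omega> \<nu> H \<delta> u \<phi> D\<phi> x0" by (simp add: visc_E_def)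
    have ev1: "\<forall>\<^sub>F n in sequentially. V n (X n) < 0" using order_tendstoD(2)[OF VX E] .
    have ev2: "\<forall>\<^sub>F n in sequentially. \<not> (X n \<in> frontier \<Omega> \<and> g (X n) < \<Phi> n (X n))"
    proof (cases "x0 \<in> \<Omega>")
      case True
      then have "\<forall>\<^sub>F n in sequentially. X n \<in> \<Omega>" using Xlim open_\<Omega> topological_tendstoD by blast
      then show ?thesis by eventually_elim (simp add: frontier_cl)
    next
      case False
      then have xf: "x0 \<in> frontier \<Omega>" using x0 by (simp add: frontier_cl)
      obtain a where a: "u x0 < a" "a < g x0" using dense[OF bc[OF xf]] by blast
      have "\<forall>\<^sub>F y in at x0 within frontier \<Omega>. a < g y"
        using g xf a(2) unfolding continuous_on_def by (auto simp: order_tendsto_iff)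
      then obtain d where d: "d > 0" "\<And>y. y \<in> frontier \<Omega> \<Longrightarrow> dist y x0 < d \<Longrightarrow> a < g y"
        using a(2) unfolding eventually_at by metis
      have "\<forall>\<^sub>F n in sequentially. dist (X n) x0 < d" using Xlim d(1) tendstoD by blast
      moreover have "\<forall>\<^sub>F n in sequentially. \<Phi> n (X n) < a" using order_tendstoD(2)[OF \<Phi>X a(1)] .
      ultimately show ?thesis by eventually_elim (use d(2) in fastforce)
    qed
    from ev1 ev2 have "\<forall>\<^sub>F n::nat in sequentially. False"
    proof eventually_elim
      case (elim n)
      then show ?case using X[of n] by linarith
    qed
    then show False by simp
  qed
  then obtain n where n: "\<And>x. x \<in> cl \<Longrightarrow> u x < \<Phi> n x \<Longrightarrow> x \<in> frontier \<Omega> \<Longrightarrow> \<Phi> n x \<le> g x"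
    "\<And>x. x \<in> cl \<Longrightarrow> u x < \<Phi> n x \<Longrightarrow> x \<in> \<Omega> \<Longrightarrow> V n x \<le> 0" by blast
  define w where "w = (\<lambda>x. max (u x) (\<Phi> n x))"
  have wc: "continuous_on cl w"
    unfolding w_def by (intro continuous_intros uc C1_with_gradient_continuous_on[OF \<Phi>])
  obtain Rw where Rw: "\<And>y. y \<in> cl \<Longrightarrow> \<bar>w y\<bar> \<le> Rw" using continuous_on_cl_bounded[OF wc] by blast
  have "sub_at 0 w x" if x: "x \<in> \<Omega>" for x
    unfolding sub_at_def
  proof (intro allI impI)
    fix \<psi> D\<psi> and d :: real
    assume \<psi>: "C1_with_gradient cl \<psi> D\<psi>" and max: "\<forall>y\<in>cl. w y - \<psi> y \<le> w x - \<psi> x" and d: "d > 0"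
    have xc: "x \<in> cl" using x \<Omega>_cl by blast
    have um: "u \<in> borel_measurable (restrict_space borel cl)" and wm: "w \<in> borel_measurable (restrict_space borel cl)"
      using continuous_on_cl_measurable uc wc by blast+
    have wdiff: "w y - w x \<le> \<psi> y - \<psi> x" if "y \<in> cl" for y using max that by fastforce
    show "visc_E \<Omega> \<nu> H d w \<psi> D\<psi> x \<le> 0"
    proof (cases "u x < \<Phi> n x")
      case False
      then have wx: "w x = u x" by (simp add: w_def)
      have uw: "u y \<le> w y" for y by (simp add: w_def)
      have "\<forall>y\<in>cl. u y - \<psi> y \<le> u x - \<psi> x" using max uw wx by (smt (verit))
      then have "visc_E \<Omega> \<nu> H d u \<psi> D\<psi> x \<le> 0" using usub[OF x] \<psi> d unfolding sub_at_def by blast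
      moreover have "nonlocal_op \<Omega> \<nu> (ball 0 d) \<psi> x + nonlocal_op \<Omega> \<nu> (- ball 0 d) u x
        \<le> nonlocal_op \<Omega> \<nu> (ball 0 d) \<psi> x + nonlocal_op \<Omega> \<nu> (- ball 0 d) w x + 0 * (far_const * d powr (- \<sigma>))"
        by (rule nonlocal_split_mono[OF xc \<psi> \<psi> d d um Ru wm Rw]) (use uw wx in auto)
      ultimately show ?thesis unfolding visc_E_def wx by simp
    next
      case True
      then have wx: "w x = \<Phi> n x" by (simp add: w_def)
      have grad: "D\<psi> x = D\<Phi> n x"
      proof (rule C1_min_gradient_eq[OF \<psi> \<Phi> x])
        fix y assume y: "y \<in> cl"
        have "\<Phi> n y \<le> w y" by (simp add: w_def)
        then show "\<psi> x - \<Phi> n x \<le> \<psi> y - \<Phi> n y" using wdiff[OF y] wx by linarith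
      qed
      have "nonlocal_op \<Omega> \<nu> (ball 0 \<delta>) (\<Phi> n) x + nonlocal_op \<Omega> \<nu> (- ball 0 \<delta>) u x
        \<le> nonlocal_op \<Omega> \<nu> (ball 0 d) \<psi> x + nonlocal_op \<Omega> \<nu> (- ball 0 d) w x + k n * (far_const * \<delta> powr (- \<sigma>))"
      proof (rule nonlocal_split_mono[OF xc \<Phi> \<psi> \<delta> d um Ru wm Rw less_imp_le[OF k]])
        fix z assume z: "x + z \<in> cl"
        \<comment> \<open>At such points \<open>w\<close> equals \<open>\<Phi> n\<close>, which is
          at most \<open>k n\<close> above \<open>u\<close>; this is the defect allowed for long
          jumps.\<close>
        have "\<Phi> n (x + z) - \<Phi> n x \<le> w (x + z) - w x" using wx by (simp add: w_def)
        moreover have "u (x + z) - u x \<le> w (x + z) - w x + k n"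
          using wx \<Phi>le'[OF xc, of n] by (simp add: w_def)
        ultimately show "(if norm z < \<delta> then \<Phi> n (x + z) - \<Phi> n x else u (x + z) - u x)
          \<le> (if norm z < d then \<psi> (x + z) - \<psi> x else w (x + z) - w x) + (if norm z < \<delta> then 0 else k n)"
          using wdiff[OF z] by auto
      qed
      moreover have "V n x \<le> 0" by (rule n(2)[OF xc True x])
      ultimately show ?thesis unfolding visc_E_def V_def wx grad by linarith
    qed
  qed
  moreover have "w x \<le> g x" if "x \<in> frontier \<Omega>" for x
    using n(1)[of x] ug[OF that] that by (cases "u x < \<Phi> n x") (auto simp: w_def frontier_cl)
  ultimately have "cont_sub w" using wc unfolding cont_sub_def by blast
  moreover have "u x0 < w x0" using k[of n] by (simp add: w_def \<Phi>_def)
  ultimately show ?thesis by (intro exI[of _ w]) (auto simp: w_def)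
qed

text \<open>All competitors above \<open>w0\<close> share a bound and hence a Lipschitz constant, so
  their supremum is continuous and belongs to the class itself. Its maximality then contradicts
  \<open>cont_sub_bump\<close> wherever the supersolution property fails.\<close>

lemma perron:
  assumes w0: "cont_sub w0" and B: "\<And>w x. cont_sub w \<Longrightarrow> x \<in> cl \<Longrightarrow> w x \<le> B"
  obtains u where "continuous_on cl u" "visc_solution \<Omega> \<nu> H g 0 u"
proof -
  define F where "F = {w. cont_sub w \<and> (\<forall>x\<in>cl. w0 x \<le> w x)}"
  have w0F: "w0 \<in> F" using w0 by (simp add: F_def)
  obtain R0 where R0: "R0 > 0" "\<And>y. y \<in> cl \<Longrightarrow> \<bar>w0 y\<bar> \<le> R0"
    using continuous_on_cl_bounded w0 unfolding cont_sub_def by blast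
  define R where "R = R0 + \<bar>B\<bar>"
  have Rpos: "R > 0" using R0(1) by (simp add: R_def)
  have FR: "\<bar>w y\<bar> \<le> R" if "w \<in> F" "y \<in> cl" for w y
  proof -
    have "w0 y \<le> w y" "w y \<le> B" using that B unfolding F_def by auto
    then show ?thesis using R0(2)[OF that(2)] unfolding R_def by linarith
  qed
  obtain A where A: "A > 0" "\<And>w. cont_sub w \<Longrightarrow> (\<And>y. y \<in> cl \<Longrightarrow> \<bar>w y\<bar> \<le> R) \<Longrightarrow> A-lipschitz_on cl w"
    using equi_lipschitz_cont_sub[OF Rpos] by blast
  have Flip: "A-lipschitz_on cl w" if "w \<in> F" for w
    using that FR[OF that] by (intro A(2)) (auto simp: F_def)
  define u where "u = (\<lambda>x. SUP w\<in>F. w x)"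
  have bdd: "bdd_above ((\<lambda>w. w x) ` F)" if "x \<in> cl" for x
    using FR that by (intro bdd_aboveI2[of _ _ R]) (auto simp: abs_le_iff)
  have ule: "w x \<le> u x" if "w \<in> F" "x \<in> cl" for w x
    unfolding u_def by (rule cSUP_upper[OF that(1) bdd[OF that(2)]])
  have uleast: "u x \<le> c" if "\<And>w. w \<in> F \<Longrightarrow> w x \<le> c" for x c
    unfolding u_def using w0F that by (intro cSUP_least) auto
  have half: "u x \<le> u y + A * dist x y" if "x \<in> cl" "y \<in> cl" for x y
  proof (rule uleast)
    fix w assume w: "w \<in> F"
    have "\<bar>w x - w y\<bar> \<le> A * dist x y" using lipschitz_onD[OF Flip[OF w] that] by (simp add: dist_real_def)
    then show "w x \<le> u y + A * dist x y" using ule[OF w that(2)] by linarith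
  qed
  have "A-lipschitz_on cl u"
  proof (rule lipschitz_onI)
    show "dist (u x) (u y) \<le> A * dist x y" if "x \<in> cl" "y \<in> cl" for x y
      using half[OF that] half[OF that(2,1)] by (simp add: dist_real_def dist_commute abs_le_iff)
  qed (use A in simp)
  then have uc: "continuous_on cl u" by (rule lipschitz_on_continuous_on)
  have "sub_at 0 u x" if x: "x \<in> \<Omega>" for x
  proof (rule sub_at_Sup[where F=F and R=R])
    show "\<exists>w\<in>F. u x - e < w x" if "e > 0" for e
    proof (rule ccontr)
      assume "\<not> ?thesis"
      then have "u x \<le> u x - e" by (intro uleast) force
      then show False using that by simp
    qed
  qed (use FR uc ule x in \<open>simp_all add: F_def cont_sub_def\<close>)
  moreover have "u x \<le> g x" if "x \<in> frontier \<Omega>" for x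
    using that by (intro uleast) (auto simp: F_def cont_sub_def)
  ultimately have cu: "cont_sub u" using uc unfolding cont_sub_def by blast
  \<comment> \<open>At a boundary point a violation means that the equation and the data inequality
    fail together, which is what \<open>cont_sub_bump\<close> needs there.\<close>
  have no_bump: "\<not> (visc_E \<Omega> \<nu> H \<delta> u \<phi> D\<phi> x0 < 0 \<and> (x0 \<in> frontier \<Omega> \<longrightarrow> u x0 < g x0))"
    if "x0 \<in> cl" "C1_with_gradient cl \<phi> D\<phi>" "\<forall>y\<in>cl. u x0 - \<phi> x0 \<le> u y - \<phi> y" "\<delta> > 0" for x0 \<phi> D\<phi> \<delta>
  proof
    assume *: "visc_E \<Omega> \<nu> H \<delta> u \<phi> D\<phi> x0 < 0 \<and> (x0 \<in> frontier \<Omega> \<longrightarrow> u x0 < g x0)"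
    have "\<exists>w. cont_sub w \<and> (\<forall>x\<in>cl. u x \<le> w x) \<and> u x0 < w x0"
      by (rule cont_sub_bump[OF cu that(1,2) _ that(4)]) (use * that(3) in auto)
    then obtain w where w: "cont_sub w" "\<forall>x\<in>cl. u x \<le> w x" "u x0 < w x0" by blast
    then have "w \<in> F" using ule[OF w0F] unfolding F_def by force
    then show False using ule[OF _ that(1)] w(3) by force
  qed
  have "visc_supersolution \<Omega> \<nu> H g 0 u"
    unfolding visc_supersolution_def
  proof (intro conjI allI impI ballI continuous_on_imp_lsc_on[OF uc])
    fix \<phi> D\<phi> x0 and \<delta> :: real
    assume a: "C1_with_gradient cl \<phi> D\<phi>" "x0 \<in> cl" "\<forall>y\<in>cl. u x0 - \<phi> x0 \<le> u y - \<phi> y" "\<delta> > 0"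
    show "0 \<le> visc_E \<Omega> \<nu> H \<delta> u \<phi> D\<phi> x0 - 0" if "x0 \<in> \<Omega>"
      using no_bump[OF a(2,1,3,4)] that by (auto simp: frontier_cl)
    show "0 \<le> max (visc_E \<Omega> \<nu> H \<delta> u \<phi> D\<phi> x0 - 0) (u x0 - g x0)" if "x0 \<in> frontier \<Omega>"
      using no_bump[OF a(2,1,3,4)] that by (auto simp: le_max_iff_disj)
  qed
  then have "visc_solution \<Omega> \<nu> H g 0 u"
    using cont_sub_visc_subsolution[OF cu] unfolding visc_solution_def by blast
  with uc show ?thesis by (rule that)
qed

end

section \<open>Barriers and conclusion\<close>


context nonlocal_dirichlet
begin

text \<open>A test function touching \<open>v\<close> from below in \<Omega> has the gradient of
  \<open>v\<close> and smaller increments, so the classical inequality for \<open>v\<close> implies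
  the viscosity one. On the boundary, lying above the data is enough.\<close>

lemma C1_supersolution:
  assumes v: "C1_with_gradient cl v Dv" and g_le: "\<And>x. x \<in> frontier \<Omega> \<Longrightarrow> g x \<le> v x"
    and super: "\<And>x \<delta>. x \<in> \<Omega> \<Longrightarrow> \<delta> > 0 \<Longrightarrow>
      nonlocal_op \<Omega> \<nu> (ball 0 \<delta>) v x + nonlocal_op \<Omega> \<nu> (- ball 0 \<delta>) v x \<le> H x (v x) (Dv x)"
  shows "visc_supersolution \<Omega> \<nu> H g 0 v"
  unfolding visc_supersolution_def
proof (intro conjI allI impI ballI)
  have vc: "continuous_on cl v" by (rule C1_with_gradient_continuous_on[OF v])
  then show "lsc_on cl v" by (rule continuous_on_imp_lsc_on)
  obtain R where R: "\<And>y. y \<in> cl \<Longrightarrow> \<bar>v y\<bar> \<le> R" using continuous_on_cl_bounded[OF vc] by blast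
  have vm: "v \<in> borel_measurable (restrict_space borel cl)" by (rule continuous_on_cl_measurable[OF vc])
  fix \<psi> D\<psi> x0 and \<delta> :: real
  assume \<psi>: "C1_with_gradient cl \<psi> D\<psi>" and x0: "x0 \<in> cl" and min: "\<forall>y\<in>cl. v x0 - \<psi> x0 \<le> v y - \<psi> y" and \<delta>: "\<delta> > 0"
  show "0 \<le> max (visc_E \<Omega> \<nu> H \<delta> v \<psi> D\<psi> x0 - 0) (v x0 - g x0)" if "x0 \<in> frontier \<Omega>"
    using g_le[OF that] by (simp add: le_max_iff_disj)
  show "0 \<le> visc_E \<Omega> \<nu> H \<delta> v \<psi> D\<psi> x0 - 0" if x: "x0 \<in> \<Omega>"
  proof -
    have "Dv x0 = D\<psi> x0" using min by (intro C1_min_gradient_eq[OF v \<psi> x]) auto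
    moreover have "nonlocal_op \<Omega> \<nu> (ball 0 \<delta>) \<psi> x0 + nonlocal_op \<Omega> \<nu> (- ball 0 \<delta>) v x0
      \<le> nonlocal_op \<Omega> \<nu> (ball 0 \<delta>) v x0 + nonlocal_op \<Omega> \<nu> (- ball 0 \<delta>) v x0 + 0 * (far_const * \<delta> powr (- \<sigma>))"
    proof (rule nonlocal_split_mono[OF x0 \<psi> v \<delta> \<delta> vm R vm R])
      fix z assume "x0 + z \<in> cl"
      then have "\<psi> (x0 + z) - \<psi> x0 \<le> v (x0 + z) - v x0" using min by fastforce
      then show "(if norm z < \<delta> then \<psi> (x0 + z) - \<psi> x0 else v (x0 + z) - v x0)
        \<le> (if norm z < \<delta> then v (x0 + z) - v x0 else v (x0 + z) - v x0) + (if norm z < \<delta> then 0 else 0)" by simp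
    qed simp_all
    ultimately show ?thesis using super[OF x \<delta>] unfolding visc_E_def by simp
  qed
qed

lemma bounded_boundary_data:
  obtains G where "G \<ge> 0" "\<And>x. x \<in> frontier \<Omega> \<Longrightarrow> \<bar>g x\<bar> \<le> G"
proof -
  have "compact (frontier \<Omega>)" using bounded_\<Omega> by (rule compact_frontier_bounded)
  then have "bounded (g ` frontier \<Omega>)" using compact_continuous_image[OF g] compact_imp_bounded by blast
  then obtain G where "\<And>x. x \<in> frontier \<Omega> \<Longrightarrow> \<bar>g x\<bar> \<le> G" unfolding bounded_iff by auto
  then show ?thesis using that[of "\<bar>G\<bar>"] by fastforce
qed

lemma H_zero_bounded:
  obtains h where "h \<ge> 0" "\<And>x. x \<in> cl \<Longrightarrow> \<bar>H x 0 0\<bar> \<le> h"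
proof -
  have "continuous_on cl (\<lambda>x. case (x, 0, 0) of (x, r, p) \<Rightarrow> H x r p)"
    by (rule continuous_on_compose2[OF H]) (auto intro!: continuous_intros)
  then have "continuous_on cl (\<lambda>x. H x 0 0)" by simp
  then obtain R where "R > 0" "\<And>y. y \<in> cl \<Longrightarrow> \<bar>H y 0 0\<bar> \<le> R" using continuous_on_cl_bounded by blast
  then show ?thesis using that[of R] by simp
qed

lemma nonlocal_op_const [simp]: "nonlocal_op \<Omega> \<nu> D (\<lambda>x. c) y = 0"
  by (simp add: nonlocal_op_def set_lebesgue_integral_def)

section \<open>Case (i): constant barriers and comparison\<close>

context
  fixes lam0 :: real
  assumes lam0: "lam0 > 0" "\<And>R. R > 0 \<Longrightarrow> lam R \<ge> lam0"
begin

lemma H_strict_mono: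
  assumes x: "x \<in> cl" and rs: "r \<le> s"
  shows "H x r p + lam0 * (s - r) \<le> H x s p"
proof -
  define R where "R = \<bar>r\<bar> + \<bar>s\<bar> + 1"
  have R: "R > 0" "\<bar>r\<bar> \<le> R" "\<bar>s\<bar> \<le> R" by (auto simp: R_def)
  then have "H x s p - H x r p \<ge> lam R * (s - r)" using H1 x rs unfolding H1_def by blast
  moreover have "lam R * (s - r) \<ge> lam0 * (s - r)" using lam0(2)[OF R(1)] rs by (intro mult_right_mono) auto
  ultimately show ?thesis by linarith
qed

lemma constant_barriers:
  obtains C where "cont_sub (\<lambda>x. - C)" "visc_supersolution \<Omega> \<nu> H g 0 (\<lambda>x. C)"
proof -
  obtain G where G: "G \<ge> 0" "\<And>x. x \<in> frontier \<Omega> \<Longrightarrow> \<bar>g x\<bar> \<le> G" using bounded_boundary_data by blast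
  obtain h where h: "h \<ge> 0" "\<And>x. x \<in> cl \<Longrightarrow> \<bar>H x 0 0\<bar> \<le> h" using H_zero_bounded by blast
  \<comment> \<open>\<open>G\<close> dominates the data, and \<open>lam0 * C \<ge> h\<close> lets
    the monotonicity of \<open>H\<close> in the value outweigh \<open>H x 0 0\<close>.\<close>
  define C where "C = G + h / lam0"
  have C: "C \<ge> G" "C \<ge> 0" using G h lam0 by (auto simp: C_def)
  have lC: "lam0 * C \<ge> h" using G lam0 by (simp add: C_def distrib_left)
  have Hm: "H x (- C) 0 \<le> 0" and Hp: "H x C 0 \<ge> 0" if "x \<in> cl" for x
    using H_strict_mono[OF that, of "- C" 0 0] H_strict_mono[OF that, of 0 C 0] C h(2)[OF that] lC by (auto simp: abs_le_iff)
  have "sub_at 0 (\<lambda>x. - C) x" if x: "x \<in> \<Omega>" for x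
  proof (rule sub_at_limitI[OF x])
    have xc: "x \<in> cl" using x \<Omega>_cl by blast
    fix \<phi> D\<phi> assume \<phi>: "C1_with_gradient cl \<phi> D\<phi>" and max: "\<forall>y\<in>cl. - C - \<phi> y \<le> - C - \<phi> x"
    have "D\<phi> x = 0" by (rule C1_min_gradient_eq[OF \<phi> C1_with_gradient_const x]) (use max in auto)
    then show "\<exists>K. \<exists>r>0. \<forall>\<delta>. 0 < \<delta> \<and> \<delta> < r \<longrightarrow> H x (- C) (D\<phi> x) \<le>
        0 + K * (near_const * \<delta> powr (1 - \<sigma>)) + nonlocal_op \<Omega> \<nu> (- ball 0 \<delta>) (\<lambda>x. - C) x"
      using Hm[OF xc] by (intro exI[of _ 0] exI[of _ 1]) simp
  qed simp
  moreover have "- C \<le> g x" "g x \<le> C" if "x \<in> frontier \<Omega>" for x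
    using G(2)[OF that] C(1) by auto
  ultimately have "cont_sub (\<lambda>x. - C)" unfolding cont_sub_def by simp
  moreover have "visc_supersolution \<Omega> \<nu> H g 0 (\<lambda>x. C)"
    by (rule C1_supersolution[OF C1_with_gradient_const]) (use \<open>\<And>x. x \<in> frontier \<Omega> \<Longrightarrow> g x \<le> C\<close> Hp \<Omega>_cl in auto)
  ultimately show ?thesis by (rule that)
qed

lemma comparison_proper:
  assumes U: "L-lipschitz_on cl U" "L > 0" and sub: "cont_sub U"
    and v: "visc_supersolution \<Omega> \<nu> H g 0 v" and bd: "bounded (v ` cl)" and w: "w \<in> cl"
  shows "U w \<le> v w"
proof (rule field_le_epsilon)
  fix k :: real assume k: "k > 0"
  have "U w - k \<le> v w"
  proof (rule strict_comparison[of L "\<lambda>x. U x - k" "lam0 * k"])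
    show "L-lipschitz_on cl (\<lambda>x. U x - k)" using U(1) by (auto simp: lipschitz_on_def dist_real_def)
    show "sub_at (- (lam0 * k)) (\<lambda>x. U x - k) x" if x: "x \<in> \<Omega>" for x
      unfolding sub_at_def
    proof (intro allI impI)
      fix \<phi> D\<phi> and \<delta> :: real
      assume \<phi>: "C1_with_gradient cl \<phi> D\<phi>" and max: "\<forall>y\<in>cl. U y - k - \<phi> y \<le> U x - k - \<phi> x" and \<delta>: "\<delta> > 0"
      have xc: "x \<in> cl" using x \<Omega>_cl by blast
      have "\<forall>y\<in>cl. U y - \<phi> y \<le> U x - \<phi> x"
      proof
        fix y assume "y \<in> cl"
        then have "U y - k - \<phi> y \<le> U x - k - \<phi> x" using max by blast
        then show "U y - \<phi> y \<le> U x - \<phi> x" by linarith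
      qed
      then have "visc_E \<Omega> \<nu> H \<delta> U \<phi> D\<phi> x \<le> 0" using sub x \<phi> \<delta> unfolding cont_sub_def sub_at_def by blast
      moreover have "nonlocal_op \<Omega> \<nu> (- ball 0 \<delta>) (\<lambda>x. U x - k) x = nonlocal_op \<Omega> \<nu> (- ball 0 \<delta>) U x"
        by (simp add: nonlocal_op_def)
      moreover have "H x (U x - k) (D\<phi> x) + lam0 * (U x - (U x - k)) \<le> H x (U x) (D\<phi> x)"
        using k by (intro H_strict_mono xc) simp
      ultimately show "visc_E \<Omega> \<nu> H \<delta> (\<lambda>x. U x - k) \<phi> D\<phi> x \<le> - (lam0 * k)" unfolding visc_E_def by simp
    qed
    show "U x - k \<le> g x" if "x \<in> frontier \<Omega>" for x using sub that k unfolding cont_sub_def by force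
  qed (use U lam0 k v bd w in simp_all)
  then show "U w \<le> v w + k" by linarith
qed

end

section \<open>Case (ii): exponential barrier and comparison\<close>

context
  assumes conv: "\<And>x. x \<in> cl \<Longrightarrow> convex_on UNIV (\<lambda>(r, p). H x r p)"
begin

text \<open>Coercivity makes \<open>H x 0\<close> exceed \<open>h + 1\<close> on the sphere of
  radius \<rho>, while it is at most \<open>h\<close> at the origin. Along each ray a convex
  function keeps at least this slope, which gives linear growth even if
  \<open>m < 1\<close>.\<close>

lemma H_linear_growth:
  obtains \<rho> where "\<rho> > 0" "\<And>x p. x \<in> cl \<Longrightarrow> \<rho> \<le> norm p \<Longrightarrow> norm p / \<rho> \<le> H x 0 p"
proof -
  obtain h where h: "h \<ge> 0" "\<And>x. x \<in> cl \<Longrightarrow> \<bar>H x 0 0\<bar> \<le> h" using H_zero_bounded by blast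
  obtain c where c: "c > 0" "\<And>R. R > 0 \<Longrightarrow> \<exists>C\<ge>0. \<forall>x\<in>cl. \<forall>p r. \<bar>r\<bar> \<le> R \<longrightarrow> H x r p \<ge> c * norm p powr m - C"
    using coercive by blast
  obtain C where C: "\<And>x p r. x \<in> cl \<Longrightarrow> \<bar>r\<bar> \<le> 1 \<Longrightarrow> H x r p \<ge> c * norm p powr m - C"
    using c(2)[of 1] by auto
  have "\<forall>\<^sub>F k in at_top. (h + C + 1) + 0 * k powr 0 < c * k powr m"
    using \<sigma> m c by (intro powr_dominates) auto
  then have "\<forall>\<^sub>F k in at_top. (h + C + 1) + 0 * k powr 0 < c * k powr m \<and> k > 0"
    using eventually_gt_at_top eventually_conj by blast
  from eventually_happens'[OF _ this] obtain \<rho> where \<rho>: "h + C + 1 < c * \<rho> powr m" "\<rho> > 0" by auto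
  show ?thesis
  proof (rule that[OF \<rho>(2)])
    fix x p :: 'a assume x: "x \<in> cl" and p: "\<rho> \<le> norm p"
    define t where "t = \<rho> / norm p"
    have np: "norm p > 0" using p \<rho> by linarith
    have t: "0 < t" "t \<le> 1" using p \<rho> np by (auto simp: t_def)
    have "norm (t *\<^sub>R p) = \<rho>" using np \<rho> by (simp add: t_def)
    then have "h + 1 \<le> H x 0 (t *\<^sub>R p)" using C[OF x, of 0 "t *\<^sub>R p"] \<rho>(1) by simp
    also have "\<dots> \<le> (1 - t) * H x 0 0 + t * H x 0 p"
    proof -
      have "(\<lambda>(r, p). H x r p) ((1 - t) *\<^sub>R (0, 0) + t *\<^sub>R (0, p))
        \<le> (1 - t) * (\<lambda>(r, p). H x r p) (0, 0) + t * (\<lambda>(r, p). H x r p) (0, p)"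
        using t by (intro convex_onD[OF conv[OF x]]) auto
      then show ?thesis by simp
    qed
    also have "(1 - t) * H x 0 0 \<le> 1 * h"
      using h x t by (intro order_trans[OF mult_left_mono[of "H x 0 0" h "1 - t"] mult_right_mono]) (auto simp: abs_le_iff)
    finally have "1 \<le> t * H x 0 p" by simp
    then show "norm p / \<rho> \<le> H x 0 p" using np \<rho>(2) by (simp add: t_def field_simps)
  qed
qed

text \<open>For the steep concave function \<open>b - exp (L e \<bullet> x + c)\<close> the nonlocal term is of order
  \<open>L powr \<sigma>\<close> times the exponential, while convexity and coercivity make \<open>H\<close> at least of order
  \<open>L\<close> times it.\<close>

lemma exponential_supersolution:
  obtains v where "continuous_on cl v" "visc_supersolution \<Omega> \<nu> H g 0 v"
proof -
  obtain G where G: "G \<ge> 0" "\<And>x. x \<in> frontier \<Omega> \<Longrightarrow> \<bar>g x\<bar> \<le> G" using bounded_boundary_data by blast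
  obtain \<rho> where \<rho>: "\<rho> > 0" "\<And>x p. x \<in> cl \<Longrightarrow> \<rho> \<le> norm p \<Longrightarrow> norm p / \<rho> \<le> H x 0 p"
    using H_linear_growth by blast
  obtain e :: 'a where e: "norm e = 1" using vector_choose_size[of 1] by auto
  \<comment> \<open>Possible because \<open>\<sigma> < 1\<close>: the nonlocal cost of order
    \<open>k powr \<sigma>\<close> loses against the linear gain \<open>k / \<rho>\<close>.\<close>
  have "\<forall>\<^sub>F k in at_top. 0 + (near_const + far_const) * k powr \<sigma> < 1 / \<rho> * k powr 1"
    using \<sigma> \<rho> by (intro powr_dominates) auto
  then have "\<forall>\<^sub>F k in at_top. 0 + (near_const + far_const) * k powr \<sigma> < 1 / \<rho> * k powr 1 \<and> k > max 1 \<rho>"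
    using eventually_gt_at_top eventually_conj by blast
  from eventually_happens'[OF _ this] obtain L
    where L: "(near_const + far_const) * L powr \<sigma> < L / \<rho>" "L > 1" "L > \<rho>" by auto
  obtain D where D: "\<And>x. x \<in> cl \<Longrightarrow> norm x \<le> D"
    using compact_imp_bounded[OF compact_cl] unfolding bounded_iff by auto
  \<comment> \<open>The shift \<open>L * D\<close> makes the exponent nonnegative on the closure, so
    \<open>a x \<ge> 1\<close> and the gradient of the barrier has norm at least
    \<open>L > \<rho>\<close>.\<close>
  define a where "a = (\<lambda>x. exp (L * (e \<bullet> x) + L * D))"
  have ex: "\<bar>e \<bullet> x\<bar> \<le> D" if "x \<in> cl" for x
    using Cauchy_Schwarz_ineq2[of e x] e D[OF that] by simp
  have a1: "1 \<le> a x" and a2: "a x \<le> exp (2 * L * D)" if x: "x \<in> cl" for x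
  proof -
    have "- D \<le> e \<bullet> x" "e \<bullet> x \<le> D" using ex[OF x] by linarith+
    then have "L * (- D) \<le> L * (e \<bullet> x)" "L * (e \<bullet> x) \<le> L * D"
      using L by (simp_all only: mult_left_mono less_imp_le[OF order.strict_trans[OF zero_less_one L(2)]])
    then have "0 \<le> L * (e \<bullet> x) + L * D" "L * (e \<bullet> x) + L * D \<le> 2 * L * D" by linarith+
    then show "1 \<le> a x" "a x \<le> exp (2 * L * D)" unfolding a_def by (simp_all only: one_le_exp_iff exp_le_cancel_iff)
  qed
  \<comment> \<open>The constant makes \<open>v \<ge> G \<ge> 0\<close>: the data are dominated, and
    \<open>H x (v x)\<close> can be compared with \<open>H x 0\<close>, where the linear growth is
    known.\<close>
  define v where "v = (\<lambda>x. (G + exp (2 * L * D)) - a x)"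
  define Dv where "Dv = (\<lambda>x. - (L * a x) *\<^sub>R e)"
  have v: "C1_with_gradient cl v Dv"
    unfolding C1_with_gradient_def
  proof (intro conjI ballI)
    show "(v has_derivative (\<lambda>h. Dv x \<bullet> h)) (at x within cl)" for x
      unfolding v_def Dv_def a_def by (auto intro!: derivative_eq_intros simp: algebra_simps)
    show "continuous_on cl Dv" unfolding Dv_def a_def by (intro continuous_intros)
  qed
  have vc: "continuous_on cl v" by (rule C1_with_gradient_continuous_on[OF v])
  obtain R where R: "\<And>y. y \<in> cl \<Longrightarrow> \<bar>v y\<bar> \<le> R" using continuous_on_cl_bounded[OF vc] by blast
  have vm: "v \<in> borel_measurable (restrict_space borel cl)" by (rule continuous_on_cl_measurable[OF vc])
  have vG: "G \<le> v x" if "x \<in> cl" for x using a2[OF that] by (simp add: v_def)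
  have "visc_supersolution \<Omega> \<nu> H g 0 v"
  proof (rule C1_supersolution[OF v])
    show "g x \<le> v x" if "x \<in> frontier \<Omega>" for x
      using G(2)[OF that] vG[of x] that by (auto simp: frontier_cl)
    fix x \<delta> assume x: "x \<in> \<Omega>" and \<delta>: "(\<delta>::real) > 0"
    have xc: "x \<in> cl" using x \<Omega>_cl by blast
    define l where "l = (\<lambda>y. (- (L * a x)) * (e \<bullet> y))"
    have l: "C1_with_gradient cl l (\<lambda>y. (- (L * a x)) *\<^sub>R e)"
      unfolding C1_with_gradient_def l_def by (auto intro!: derivative_eq_intros continuous_intros)
    define d where "d = 1 / L"
    have d: "0 < d" "d < 1" using L by (auto simp: d_def)
    have La: "0 \<le> L * a x" using L a1[OF xc] by simp
    \<comment> \<open>By concavity short jumps gain at most what the tangent \<open>l\<close> does;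
      long jumps gain at most \<open>a x\<close>. At the radius \<open>1 / L\<close> both contribute
      order \<open>L powr \<sigma> * a x\<close>.\<close>
    have jump_le: "v (x + z) - v x \<le> l (x + z) - l x" "v (x + z) - v x \<le> a x" for z
    proof -
      have eq: "v (x + z) - v x = a x * (1 - exp (L * (e \<bullet> z)))"
        by (simp add: v_def a_def inner_add_right algebra_simps flip: exp_add)
      have "1 - exp (L * (e \<bullet> z)) \<le> - (L * (e \<bullet> z))" using exp_ge_add_one_self[of "L * (e \<bullet> z)"] by linarith
      then have "a x * (1 - exp (L * (e \<bullet> z))) \<le> a x * - (L * (e \<bullet> z))" by (intro mult_left_mono) (simp_all add: a_def)
      then show "v (x + z) - v x \<le> l (x + z) - l x" unfolding eq by (simp add: l_def inner_add_right algebra_simps)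
      have "a x * (1 - exp (L * (e \<bullet> z))) \<le> a x * 1" by (intro mult_left_mono) (simp_all add: a_def)
      then show "v (x + z) - v x \<le> a x" unfolding eq by simp
    qed
    have "nonlocal_op \<Omega> \<nu> (ball 0 \<delta>) v x + nonlocal_op \<Omega> \<nu> (- ball 0 \<delta>) v x
      \<le> nonlocal_op \<Omega> \<nu> (ball 0 d) v x + nonlocal_op \<Omega> \<nu> (- ball 0 d) v x + 0 * (far_const * \<delta> powr (- \<sigma>))"
      by (rule nonlocal_split_mono[OF xc v v \<delta> d(1) vm R vm R]) auto
    moreover have "nonlocal_op \<Omega> \<nu> (ball 0 d) v x + nonlocal_op \<Omega> \<nu> (- ball 0 d) v x
      \<le> nonlocal_op \<Omega> \<nu> (ball 0 d) l x + nonlocal_op \<Omega> \<nu> (- ball 0 d) (\<lambda>_. 0) x + a x * (far_const * d powr (- \<sigma>))"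
      by (rule nonlocal_split_mono[OF xc v l d(1) d(1) vm R, of _ 0]) (use jump_le a1[OF xc] in auto)
    moreover have "\<bar>nonlocal_op \<Omega> \<nu> (ball 0 d) l x\<bar> \<le> (L * a x) * (near_const * d powr (1 - \<sigma>))"
    proof (rule near_bound[OF xc d La])
      fix z :: 'a
      have "\<bar>l (x + z) - l x\<bar> = (L * a x) * \<bar>e \<bullet> z\<bar>"
      proof -
        have "l (x + z) - l x = - ((L * a x) * (e \<bullet> z))" by (simp add: l_def inner_add_right algebra_simps)
        then show ?thesis by (simp only: abs_minus_cancel abs_mult[of "L * a x"] abs_of_nonneg[OF La])
      qed
      also have "\<dots> \<le> (L * a x) * norm z" using Cauchy_Schwarz_ineq2[of e z] e La by (intro mult_left_mono) auto
      finally show "\<bar>l (x + z) - l x\<bar> \<le> (L * a x) * norm z" .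
    qed
    moreover have "d powr (- \<sigma>) = L powr \<sigma>" "L * d powr (1 - \<sigma>) = L powr \<sigma>"
    proof -
      show 1: "d powr (- \<sigma>) = L powr \<sigma>" using L by (simp add: d_def powr_divide powr_minus_divide)
      have "d powr (1 - \<sigma>) = d * d powr (- \<sigma>)" using d powr_mult_base[of d "- \<sigma>"] by simp
      then show "L * d powr (1 - \<sigma>) = L powr \<sigma>" using L unfolding 1 by (simp add: d_def)
    qed
    moreover have "(L * a x) * (near_const * d powr (1 - \<sigma>)) = a x * (near_const * (L * d powr (1 - \<sigma>)))"
      "a x * ((near_const + far_const) * L powr \<sigma>) = a x * (near_const * L powr \<sigma>) + a x * (far_const * L powr \<sigma>)"
      by (simp_all add: algebra_simps)
    ultimately have "nonlocal_op \<Omega> \<nu> (ball 0 \<delta>) v x + nonlocal_op \<Omega> \<nu> (- ball 0 \<delta>) v x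
      \<le> a x * ((near_const + far_const) * L powr \<sigma>)"
      by simp
    also have "\<dots> \<le> a x * (L / \<rho>)" using L(1) a1[OF xc] by (intro mult_left_mono) auto
    also have "\<dots> = norm (Dv x) / \<rho>" using e L a1[OF xc] by (simp add: Dv_def)
    also have "\<dots> \<le> H x 0 (Dv x)"
    proof (rule \<rho>(2)[OF xc])
      have "norm (Dv x) = L * a x" using e La by (simp add: Dv_def)
      moreover have "L * 1 \<le> L * a x" using a1[OF xc] L by (intro mult_left_mono) auto
      ultimately show "\<rho> \<le> norm (Dv x)" using L(3) by linarith
    qed
    also have "\<dots> \<le> H x (v x) (Dv x)" using vG[OF xc] G(1) by (intro H_mono xc) simp
    finally show "nonlocal_op \<Omega> \<nu> (ball 0 \<delta>) v x + nonlocal_op \<Omega> \<nu> (- ball 0 \<delta>) v x \<le> H x (v x) (Dv x)" .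
  qed
  with vc show ?thesis by (rule that)
qed

lemma comparison_convex:
  assumes W: "L'-lipschitz_on cl W" "\<And>x. x \<in> \<Omega> \<Longrightarrow> sub_at (- \<eta>) W x" "\<eta> > 0" "\<And>x. x \<in> frontier \<Omega> \<Longrightarrow> W x \<le> g x"
    and U: "L-lipschitz_on cl U" "L > 0" and sub: "cont_sub U"
    and v: "visc_supersolution \<Omega> \<nu> H g 0 v" and bd: "bounded (v ` cl)" and w: "w \<in> cl"
  shows "U w \<le> v w"
proof -
  define L1 where "L1 = max L L'"
  have L1: "L1 > 0" "L1-lipschitz_on cl U" "L1-lipschitz_on cl W"
    using U W(1) by (auto simp: L1_def intro: lipschitz_on_mono)
  \<comment> \<open>The combination inherits the margin \<open>\<theta> * \<eta>\<close> from
    \<open>W\<close>, so strict comparison applies for each \<theta>; letting \<theta> tend to 0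
    recovers \<open>U\<close>.\<close>
  have comb: "(1 - \<theta>) * U w + \<theta> * W w \<le> v w" if \<theta>: "0 < \<theta>" "\<theta> < 1" for \<theta>
  proof (rule strict_comparison[of L1 "\<lambda>x. (1 - \<theta>) * U x + \<theta> * W x" "\<theta> * \<eta>"])
    show "L1-lipschitz_on cl (\<lambda>x. (1 - \<theta>) * U x + \<theta> * W x)"
    proof (rule lipschitz_onI)
      fix x y assume xy: "x \<in> cl" "y \<in> cl"
      have "\<bar>U x - U y\<bar> \<le> L1 * dist x y" "\<bar>W x - W y\<bar> \<le> L1 * dist x y"
        using lipschitz_onD[OF L1(2) xy] lipschitz_onD[OF L1(3) xy] by (simp_all add: dist_real_def)
      then have "(1 - \<theta>) * \<bar>U x - U y\<bar> + \<theta> * \<bar>W x - W y\<bar> \<le> (1 - \<theta>) * (L1 * dist x y) + \<theta> * (L1 * dist x y)"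
        using \<theta> by (intro add_mono mult_left_mono) auto
      moreover have "\<bar>((1 - \<theta>) * U x + \<theta> * W x) - ((1 - \<theta>) * U y + \<theta> * W y)\<bar> \<le> (1 - \<theta>) * \<bar>U x - U y\<bar> + \<theta> * \<bar>W x - W y\<bar>"
      proof -
        have "((1 - \<theta>) * U x + \<theta> * W x) - ((1 - \<theta>) * U y + \<theta> * W y) = (1 - \<theta>) * (U x - U y) + \<theta> * (W x - W y)"
          by (simp add: algebra_simps)
        then show ?thesis using abs_triangle_ineq[of "(1 - \<theta>) * (U x - U y)" "\<theta> * (W x - W y)"] \<theta> by (simp add: abs_mult)
      qed
      ultimately show "dist ((1 - \<theta>) * U x + \<theta> * W x) ((1 - \<theta>) * U y + \<theta> * W y) \<le> L1 * dist x y"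
        by (simp add: dist_real_def algebra_simps)
    qed (use L1 in simp)
    show "sub_at (- (\<theta> * \<eta>)) (\<lambda>x. (1 - \<theta>) * U x + \<theta> * W x) x" if "x \<in> \<Omega>" for x
    proof -
      have "sub_at ((1 - \<theta>) * 0 + \<theta> * (- \<eta>)) (\<lambda>x. (1 - \<theta>) * U x + \<theta> * W x) x"
        by (rule sub_at_convex_combination[OF L1 _ W(2) \<theta> conv that]) (use sub in \<open>auto simp: cont_sub_def\<close>)
      then show ?thesis by simp
    qed
    show "(1 - \<theta>) * U x + \<theta> * W x \<le> g x" if "x \<in> frontier \<Omega>" for x
    proof -
      have "(1 - \<theta>) * U x + \<theta> * W x \<le> (1 - \<theta>) * g x + \<theta> * g x"
        using sub that W(4)[OF that] \<theta> unfolding cont_sub_def by (intro add_mono mult_left_mono) auto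
      then show ?thesis by (simp add: algebra_simps)
    qed
  qed (use L1 \<theta> W(3) v bd w in simp_all)
  have "(\<lambda>n. (1 - inverse (real (Suc n))) * U w + inverse (real (Suc n)) * W w) \<longlonglongrightarrow> (1 - 0) * U w + 0 * W w"
    by (intro tendsto_intros LIMSEQ_inverse_real_of_nat)
  moreover have "\<forall>\<^sub>F n::nat in sequentially. (1 - inverse (real (Suc n))) * U w + inverse (real (Suc n)) * W w \<le> v w"
    using eventually_ge_at_top[of "1::nat"]
  proof eventually_elim
    case (elim n)
    have "inverse (real (Suc n)) < 1" using elim by (simp add: inverse_eq_divide)
    then show ?case by (intro comb) auto
  qed
  ultimately have "(1 - 0) * U w + 0 * W w \<le> v w" by (intro tendsto_upperbound) auto
  then show ?thesis by simp
qed

end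

section \<open>From comparison of Lipschitz subsolutions to well-posedness\<close>

text \<open>Shared by both cases. Comparison extends to all bounded subsolutions because each agrees
  on \<Omega> with a Lipschitz one, whose boundary values are the limits superior in question. The
  upper barrier bounds the Perron class from above.\<close>

lemma well_posed_if_comparison:
  assumes comp: "\<And>L U v w. L-lipschitz_on cl U \<Longrightarrow> L > 0 \<Longrightarrow> cont_sub U \<Longrightarrow>
      visc_supersolution \<Omega> \<nu> H g 0 v \<Longrightarrow> bounded (v ` cl) \<Longrightarrow> w \<in> cl \<Longrightarrow> U w \<le> v w"
    and w0: "cont_sub w0" and v0: "continuous_on cl v0" "visc_supersolution \<Omega> \<nu> H g 0 v0"
  shows "(\<forall>u v. bounded (u ` closure \<Omega>) \<and> bounded (v ` closure \<Omega>) \<and>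
            visc_subsolution \<Omega> \<nu> H g 0 u \<and> visc_supersolution \<Omega> \<nu> H g 0 v \<longrightarrow>
            (\<forall>x\<in>\<Omega>. u x \<le> v x) \<and>
            (\<forall>x\<in>closure \<Omega>. interior_limsup_ext \<Omega> u x \<le> ereal (v x))) \<and>
         (\<exists>u. continuous_on (closure \<Omega>) u \<and> visc_solution \<Omega> \<nu> H g 0 u \<and>
            (\<forall>w. continuous_on (closure \<Omega>) w \<and> visc_solution \<Omega> \<nu> H g 0 w \<longrightarrow>
               (\<forall>x\<in>closure \<Omega>. w x = u x)))"
proof (intro conjI)
  have main: "(\<forall>x\<in>\<Omega>. u x \<le> v x) \<and> (\<forall>x\<in>cl. interior_limsup_ext \<Omega> u x \<le> ereal (v x))"
    if bu: "bounded (u ` cl)" and bv: "bounded (v ` cl)" and u: "visc_subsolution \<Omega> \<nu> H g 0 u"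
      and v: "visc_supersolution \<Omega> \<nu> H g 0 v" for u v
  proof -
    obtain U L where U: "L > 0" "L-lipschitz_on cl U" "\<And>x. x \<in> \<Omega> \<Longrightarrow> U x = u x"
      "\<And>x. x \<in> \<Omega> \<Longrightarrow> sub_at 0 U x" "\<And>x. x \<in> frontier \<Omega> \<Longrightarrow> U x \<le> g x"
      by (rule subsolution_extension[OF u order_refl bu]) (rule that)
    have Uc: "continuous_on cl U" using lipschitz_on_continuous_on[OF U(2)] .
    have "cont_sub U" unfolding cont_sub_def using Uc U by blast
    then have le: "U x \<le> v x" if "x \<in> cl" for x by (rule comp[OF U(2,1) _ v bv that])
    \<comment> \<open>At a boundary point \<open>u\<close> and \<open>U\<close> agree nearby in
      \<Omega>, so the limit from inside exists and equals \<open>U x\<close>.\<close>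
    have "interior_limsup_ext \<Omega> u x = ereal (U x)" if x: "x \<in> cl" for x
    proof (cases "x \<in> \<Omega>")
      case False
      have ne: "at x within \<Omega> \<noteq> bot"
        using x False by (simp add: trivial_limit_within islimpt_in_closure)
      have "(U \<longlongrightarrow> U x) (at x within \<Omega>)"
        using Uc x unfolding continuous_on_def by (meson \<Omega>_cl tendsto_within_subset)
      then have "((\<lambda>y. ereal (U y)) \<longlongrightarrow> ereal (U x)) (at x within \<Omega>)" by (simp add: tendsto_ereal)
      moreover have "\<forall>\<^sub>F y in at x within \<Omega>. ereal (U y) = ereal (u y)"
        using U(3) by (simp add: eventually_at_filter)
      ultimately have "((\<lambda>y. ereal (u y)) \<longlongrightarrow> ereal (U x)) (at x within \<Omega>)"
        by (rule Lim_transform_eventually)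
      then have "Limsup (at x within \<Omega>) (\<lambda>y. ereal (u y)) = ereal (U x)" by (rule lim_imp_Limsup[OF ne])
      then show ?thesis using False by (simp add: interior_limsup_ext_def)
    qed (simp add: interior_limsup_ext_def U(3))
    then show ?thesis using le U(3) \<Omega>_cl by (metis ereal_less_eq(3) subsetD)
  qed
  then show "\<forall>u v. bounded (u ` closure \<Omega>) \<and> bounded (v ` closure \<Omega>) \<and>
            visc_subsolution \<Omega> \<nu> H g 0 u \<and> visc_supersolution \<Omega> \<nu> H g 0 v \<longrightarrow>
            (\<forall>x\<in>\<Omega>. u x \<le> v x) \<and> (\<forall>x\<in>closure \<Omega>. interior_limsup_ext \<Omega> u x \<le> ereal (v x))" by blast
  obtain B where B: "\<And>y. y \<in> cl \<Longrightarrow> \<bar>v0 y\<bar> \<le> B" using continuous_on_cl_bounded[OF v0(1)] by blast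
  have bc: "bounded (f ` cl)" if "continuous_on cl f" for f :: "'a \<Rightarrow> real"
    using compact_continuous_image[OF that compact_cl] compact_imp_bounded by blast
  have "w x \<le> B" if w: "cont_sub w" and x: "x \<in> cl" for w x
  proof -
    obtain L where "L > 0" "L-lipschitz_on cl w" using cont_sub_lipschitz[OF w] by blast
    then have "w x \<le> v0 x" using w x v0 bc by (intro comp) auto
    then show ?thesis using B[OF x] by linarith
  qed
  then obtain u where u: "continuous_on cl u" "visc_solution \<Omega> \<nu> H g 0 u" using perron[OF w0] by metis
  \<comment> \<open>Comparison in both directions gives equality in \<Omega> only. Solutions need
    not attain the data, so the boundary values are identified by continuity from inside.\<close>
  have "w x = u x" if w: "continuous_on cl w" "visc_solution \<Omega> \<nu> H g 0 w" and x: "x \<in> cl" for w x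
  proof -
    have eq: "w y = u y" if "y \<in> \<Omega>" for y
      using main[OF bc[OF w(1)] bc[OF u(1)]] main[OF bc[OF u(1)] bc[OF w(1)]] w(2) u(2) that
      unfolding visc_solution_def by (meson order_antisym)
    obtain s where s: "\<And>n. s n \<in> \<Omega>" "s \<longlonglongrightarrow> x" using x unfolding closure_sequential by blast
    have sc: "s n \<in> cl" for n using s(1) \<Omega>_cl by blast
    have "(\<lambda>n. w (s n)) \<longlonglongrightarrow> w x" "(\<lambda>n. u (s n)) \<longlonglongrightarrow> u x"
      using continuous_on_tendsto_compose[OF w(1) s(2) x] continuous_on_tendsto_compose[OF u(1) s(2) x] sc by simp_all
    then show ?thesis using eq[OF s(1)] LIMSEQ_unique by simp
  qed
  then show "\<exists>u. continuous_on (closure \<Omega>) u \<and> visc_solution \<Omega> \<nu> H g 0 u \<and>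
            (\<forall>w. continuous_on (closure \<Omega>) w \<and> visc_solution \<Omega> \<nu> H g 0 w \<longrightarrow> (\<forall>x\<in>closure \<Omega>. w x = u x))"
    using u by blast
qed

end

theorem proposition4p9:
  fixes \<Omega> :: "'a::euclidean_space set"
    and \<nu> :: "'a \<Rightarrow> 'a measure"
    and \<sigma> m :: real
    and g :: "'a \<Rightarrow> real"
    and H :: "'a \<Rightarrow> real \<Rightarrow> 'a \<Rightarrow> real"
    and lam :: "real \<Rightarrow> real"
  assumes "bounded_C1_domain \<Omega>"
    and "\<And>x. x \<in> closure \<Omega> \<Longrightarrow> regular_off_origin (\<nu> x)"
    and "0 < \<sigma>" and "\<sigma> < 1"
    and "M0 \<Omega> \<nu>" and "M1 \<Omega> \<nu> \<sigma>" and "M2 \<Omega> \<nu> \<sigma>" and "M3 \<Omega> \<nu> \<sigma>"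
    and "continuous_on (frontier \<Omega>) g"
    and "continuous_on (closure \<Omega> \<times> UNIV \<times> UNIV) (\<lambda>(x, r, p). H x r p)"
    and "H1 \<Omega> H lam"
    and "m > \<sigma>" and "H2 \<Omega> H m"
    and "(\<exists>lam0>0. \<forall>R>0. lam R \<ge> lam0) \<or>
         ((\<forall>x\<in>closure \<Omega>. convex_on UNIV (\<lambda>(r, p). H x r p)) \<and>
          (\<exists>w. bounded (w ` closure \<Omega>) \<and> strict_visc_subsolution \<Omega> \<nu> H g w))"
  shows "(\<forall>u v. bounded (u ` closure \<Omega>) \<and> bounded (v ` closure \<Omega>) \<and>
            visc_subsolution \<Omega> \<nu> H g 0 u \<and> visc_supersolution \<Omega> \<nu> H g 0 v \<longrightarrow>
            (\<forall>x\<in>\<Omega>. u x \<le> v x) \<and>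
            (\<forall>x\<in>closure \<Omega>. interior_limsup_ext \<Omega> u x \<le> ereal (v x))) \<and>
         (\<exists>u. continuous_on (closure \<Omega>) u \<and> visc_solution \<Omega> \<nu> H g 0 u \<and>
            (\<forall>w. continuous_on (closure \<Omega>) w \<and> visc_solution \<Omega> \<nu> H g 0 w \<longrightarrow>
               (\<forall>x\<in>closure \<Omega>. w x = u x)))"
proof -
  interpret nonlocal_dirichlet \<Omega> \<nu> \<sigma> m g H lam
    using assms(1-13) by unfold_locales
  show ?thesis
    using assms(14)
  proof
    assume "\<exists>lam0>0. \<forall>R>0. lam R \<ge> lam0"
    then obtain lam0 where lam0: "lam0 > 0" "\<And>R. R > 0 \<Longrightarrow> lam R \<ge> lam0" by blast
    obtain C where "cont_sub (\<lambda>x. - C)" "visc_supersolution \<Omega> \<nu> H g 0 (\<lambda>x. C)"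
      by (rule constant_barriers[OF lam0(1)]) (rule lam0(2), assumption, rule that)
    show ?thesis
    proof (rule well_posed_if_comparison)
      show "U w \<le> v w" if "L-lipschitz_on (closure \<Omega>) U" "L > 0" "cont_sub U"
        "visc_supersolution \<Omega> \<nu> H g 0 v" "bounded (v ` closure \<Omega>)" "w \<in> closure \<Omega>" for L U v w
        by (rule comparison_proper[OF lam0(1) _ that]) (rule lam0(2))
      show "continuous_on (closure \<Omega>) (\<lambda>x. C)" by (rule continuous_on_const)
    qed fact+
  next
    assume "(\<forall>x\<in>closure \<Omega>. convex_on UNIV (\<lambda>(r, p). H x r p)) \<and>
      (\<exists>w. bounded (w ` closure \<Omega>) \<and> strict_visc_subsolution \<Omega> \<nu> H g w)"
    then obtain w \<eta> where conv: "\<And>x. x \<in> closure \<Omega> \<Longrightarrow> convex_on UNIV (\<lambda>(r, p). H x r p)"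
      and w: "bounded (w ` closure \<Omega>)" "visc_subsolution \<Omega> \<nu> H g (- \<eta>) w" and \<eta>: "\<eta> > 0"
      unfolding strict_visc_subsolution_def by blast
    have \<eta>0: "- \<eta> \<le> 0" using \<eta> by simp
    obtain W L where W: "L > 0" "L-lipschitz_on (closure \<Omega>) W" "\<And>x. x \<in> \<Omega> \<Longrightarrow> W x = w x"
      "\<And>x. x \<in> \<Omega> \<Longrightarrow> sub_at (- \<eta>) W x" "\<And>x. x \<in> frontier \<Omega> \<Longrightarrow> W x \<le> g x"
      by (rule subsolution_extension[OF w(2) \<eta>0 w(1)]) (rule that)
    \<comment> \<open>The strict subsolution serves twice: as the lower barrier of Perron's method
      and as the source of strictness in the comparison.\<close>
    have W': "cont_sub W"
      unfolding cont_sub_def using lipschitz_on_continuous_on[OF W(2)] W(5) sub_at_mono[OF W(4) \<eta>0] by blast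
    obtain v where "continuous_on (closure \<Omega>) v" "visc_supersolution \<Omega> \<nu> H g 0 v"
      using exponential_supersolution[OF conv] by blast
    show ?thesis
    proof (rule well_posed_if_comparison)
      show "U w \<le> v w" if "L-lipschitz_on (closure \<Omega>) U" "L > 0" "cont_sub U"
        "visc_supersolution \<Omega> \<nu> H g 0 v" "bounded (v ` closure \<Omega>)" "w \<in> closure \<Omega>" for L U v w
        by (rule comparison_convex[OF conv W(2) W(4) \<eta> W(5) that])
    qed fact+
  qed
qed

end
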